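(* Let $n\geq 1$ and let $m_0,\dots,m_n\geq 2$ be integers such that $$\sum_{\substack{0\leq i\leq n\\ i\neq j}}\frac{1}{m_i(m_i+1)}\geq 1$$ for some $j\in\{0,\dots,n\}$. For a positive integer $N$ let $R(N)$ be the number of $(x_0,\dots,x_n)\in\mathbb{N}^{n+1}$ (positive integers) with $N=x_0^{m_0}+\dots+x_n^{m_n}$. Then there exists $\eta>0$ such that $$R(N)=\frac{\prod_{i=0}^n\Gamma(1+\frac{1}{m_i})}{\Gamma(\sum_{i=0}^n\frac{1}{m_i})}\,\mathfrak{S}(N)\,N^{\sum_{i=0}^n\frac{1}{m_i}-1}+O\left(N^{\sum_{i=0}^n\frac{1}{m_i}-1-\eta}\right),$$ the implied constant depending only on $n$ and $m_0,\dots,m_n$.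
   Context: Here $\Gamma(\cdot)$ is the Gamma function, $e(x)=\exp(2\pi i x)$, and $$\mathfrak{S}(N)=\sum_{q=1}^\infty\frac{1}{q^{n+1}}\sum_{\substack{0\leq a<q\\ \gcd(a,q)=1}}e\left(-\frac{aN}{q}\right)\prod_{j=0}^n\sum_{0\leq k<q}e\left(\frac{a k^{m_j}}{q}\right).$$ *)

theory Defs
  imports "HOL-Analysis.Analysis" "HOL-Library.FuncSet"
begin

definition unit_exp :: "real \<Rightarrow> complex" where
  "unit_exp x = exp (2 * of_real pi * \<i> * of_real x)"

text \<open>Exponents are given by a function \<open>m\<close>, of which only \<open>m 0, \<dots>, m n\<close> matter.\<close>

definition singular_term :: "nat \<Rightarrow> (nat \<Rightarrow> nat) \<Rightarrow> nat \<Rightarrow> nat \<Rightarrow> complex" where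
  "singular_term n m N q =
     1 / of_nat q ^ (n + 1) *
     (\<Sum>a | a < q \<and> gcd a q = 1.
        unit_exp (- (real a * real N / real q)) *
        (\<Prod>j\<le>n. \<Sum>k<q. unit_exp (real a * real k ^ m j / real q)))"

text \<open>The shift by \<open>Suc\<close> makes the series start at \<open>q = 1\<close>.\<close>

definition singular_series :: "nat \<Rightarrow> (nat \<Rightarrow> nat) \<Rightarrow> nat \<Rightarrow> complex" where
  "singular_series n m N = (\<Sum>q. singular_term n m N (Suc q))"

text \<open>Tuples are extensional functions on \<open>{..n}\<close>, so that each is counted once. The set is
  finite for exponents \<open>m i \<ge> 1\<close>.\<close>

definition rep_count :: "nat \<Rightarrow> (nat \<Rightarrow> nat) \<Rightarrow> nat \<Rightarrow> nat" where
  "rep_count n m N = card {x \<in> {..n} \<rightarrow>\<^sub>E {1..}. N = (\<Sum>i\<le>n. x i ^ m i)}"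

end

theory Submission
  imports Defs "HOL-Number_Theory.Cong" "HOL-Computational_Algebra.Computational_Algebra" "HOL-Real_Asymp.Real_Asymp"
begin

text \<open>Circle method. For the minor arcs, one factor \<open>x ^ m j\<close> is estimated by Weyl's inequality
  and the remaining ones are distributed by Hoelder's inequality with weights proportional to
  \<open>1 / (m i * (m i + 1))\<close>; the hypothesis says that the mean values at the exponents \<open>m i * (m i + 1)\<close>
  then suffice. These come from Vinogradov's mean value theorem at the critical exponent, which is proved
  through \<open>\<ell>\<^sup>2\<close> decoupling for the moment curve following Guo, Li, Yung and Zorin-Kranich, with the real
  intervals replaced by residue classes modulo powers of a fixed prime \<open>p > k\<close>.

  The integral over the circle is replaced by an average over the fractions \<open>r / Q\<close>, where \<open>Q\<close> is a large
  multiple of \<open>N\<close>. On the major arcs the generating functions are compared with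
  \<open>\<Sum>t\<le>N. wcoef (1 / m) t * unit_exp (\<beta> * t)\<close>, where \<open>wcoef a\<close> are the coefficients of \<open>(1 - z)\<close> to the
  power \<open>- a\<close>. These convolve exactly, so the singular integral is computed as a single coefficient.
  Since \<open>\<Sum>i\<le>n. 1 / m i > 3\<close>, trivial bounds are enough off the centre of a major arc. The same mean values,
  read at fractions with small denominators, bound the moments of complete exponential sums and
  give the convergence of the singular series.\<close>

section \<open>Additive characters and Hoelder inequalities\<close>

text \<open>The hypothesis leaves no slack: Hoelder's inequality for the factors other than
  \<open>j\<close> saves one power of \<open>N\<close> over the trivial bound, but only up to an
  arbitrarily small loss. Weyl's inequality for the factor \<open>j\<close> has a fixed saving,
  however small, and this pays for the loss. That is why one index stays out of the sum in the
  hypothesis. The same balance makes the singular series converge absolutely.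

  Residue classes make every localisation exact: classes are nested or disjoint, restricting to one
  produces no tails, and different classes modulo \<open>p\<close> are automatically transversal,
  since their representatives differ by a unit modulo powers of \<open>p\<close>. The prime exceeds
  \<open>k\<close> so that all integers from 1 to \<open>k\<close> can be inverted.

  Averages over \<open>r / Q\<close> turn Parseval and coefficient extraction into finite
  identities; \<open>Q\<close> is so large that the congruences modulo \<open>Q\<close> that occur
  are equalities.\<close>

lemma unit_exp_add: "unit_exp (x + y) = unit_exp x * unit_exp y"
  by (simp add: unit_exp_def ring_distribs exp_add)

lemma norm_unit_exp [simp]: "norm (unit_exp x) = 1"
  by (simp add: unit_exp_def)

lemma unit_exp_of_int [simp]: "unit_exp (of_int k) = 1"
proof -
  have "unit_exp (of_int k) = exp (2 * of_int k * pi * \<i>)"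
    by (simp add: unit_exp_def mult_ac)
  then show ?thesis
    by (metis exp_integer_2pi Ints_of_int)
qed

lemma unit_exp_0 [simp]: "unit_exp 0 = 1"
  by (simp add: unit_exp_def)

lemma unit_exp_minus: "unit_exp (- x) = cnj (unit_exp x)"
  by (simp add: unit_exp_def exp_cnj)

lemma unit_exp_power: "unit_exp x ^ n = unit_exp (of_nat n * x)"
  by (induction n) (simp_all add: unit_exp_add ring_distribs)

lemma unit_exp_cong:
  assumes "x - y \<in> \<int>"
  shows "unit_exp x = unit_exp y"
proof -
  obtain k where "x = of_int k + y"
    using assms by (metis Ints_cases diff_add_cancel)
  then show ?thesis by (simp add: unit_exp_add)
qed

lemma unit_exp_eq_1_iff: "unit_exp x = 1 \<longleftrightarrow> x \<in> \<int>"
proof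
  assume "unit_exp x = 1"
  then obtain n :: int where "2 * pi * x = of_int (2 * n) * pi"
    by (auto simp: unit_exp_def exp_eq_1)
  then have "x = of_int n" by simp
  then show "x \<in> \<int>" by simp
qed (auto elim!: Ints_cases)

lemma sum_unit_exp:
  fixes Q :: nat and c :: int
  assumes "Q > 0"
  shows "(\<Sum>r<Q. unit_exp (of_nat r * of_int c / of_nat Q)) = (if int Q dvd c then of_nat Q else 0)"
proof -
  let ?z = "unit_exp (of_int c / of_nat Q)"
  have *: "unit_exp (of_nat r * of_int c / of_nat Q) = ?z ^ r" for r
    by (simp add: unit_exp_power)
  have 1: "?z = 1 \<longleftrightarrow> int Q dvd c"
  proof -
    have "(of_int c / of_nat Q :: real) \<in> \<int> \<longleftrightarrow> int Q dvd c"
    proof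
      assume "(of_int c / of_nat Q :: real) \<in> \<int>"
      then obtain k where "(of_int c / of_nat Q :: real) = of_int k" by (auto elim: Ints_cases)
      then have "of_int c = (of_int (k * int Q) :: real)" using assms by (simp add: field_simps)
      then have "c = k * int Q" by (simp only: of_int_eq_iff)
      then show "int Q dvd c" by simp
    next
      assume "int Q dvd c"
      then show "(of_int c / of_nat Q :: real) \<in> \<int>" using assms by (auto elim!: dvdE)
    qed
    then show ?thesis by (simp add: unit_exp_eq_1_iff)
  qed
  have 2: "?z ^ Q = 1"
    using assms by (simp add: unit_exp_power)
  show ?thesis
  proof (cases "?z = 1")
    case True
    then show ?thesis using 1 by (simp add: *)
  next
    case False
    then show ?thesis using 1 2 by (simp add: * sum_gp_strict)
  qed
qed

section \<open>Inequalities of Hoelder and Minkowski for finite sums\<close>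

lemma weighted_AM_GM:
  fixes u w :: "'i \<Rightarrow> real"
  assumes "finite I" "(\<Sum>i\<in>I. w i) = 1" "\<And>i. i \<in> I \<Longrightarrow> w i \<ge> 0" "\<And>i. i \<in> I \<Longrightarrow> u i > 0"
  shows "(\<Prod>i\<in>I. u i powr w i) \<le> (\<Sum>i\<in>I. w i * u i)"
proof -
  have ne: "I \<noteq> {}" using assms(2) by auto
  have "exp (\<Sum>i\<in>I. w i *\<^sub>R ln (u i)) \<le> (\<Sum>i\<in>I. w i * exp (ln (u i)))"
    using assms ne by (intro convex_on_sum[OF _ _ exp_convex]) auto
  also have "\<dots> = (\<Sum>i\<in>I. w i * u i)"
    using assms(4) by (intro sum.cong) auto
  also have "exp (\<Sum>i\<in>I. w i *\<^sub>R ln (u i)) = (\<Prod>i\<in>I. u i powr w i)"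
  proof -
    have "exp (w i * ln (u i)) = u i powr w i" if "i \<in> I" for i
      using assms(4)[OF that] by (simp add: powr_def)
    then show ?thesis using assms(1) by (simp add: exp_sum)
  qed
  finally show ?thesis .
qed

text \<open>Dividing each \<open>f i\<close> by its sum reduces the claim to functions of sum 1, for
  which the weighted mean inequality holds at each point and can be added up. A function of sum 0
  cannot be normalised, but it makes the left side vanish.\<close>

lemma Hoelder_sum_prod:
  fixes f :: "'i \<Rightarrow> 'x \<Rightarrow> real" and w :: "'i \<Rightarrow> real"
  assumes "finite I" "finite X" "(\<Sum>i\<in>I. w i) = 1" "\<And>i. i \<in> I \<Longrightarrow> w i > 0"
    and nonneg: "\<And>i x. i \<in> I \<Longrightarrow> x \<in> X \<Longrightarrow> f i x \<ge> 0"
  shows "(\<Sum>x\<in>X. \<Prod>i\<in>I. f i x powr w i) \<le> (\<Prod>i\<in>I. (\<Sum>x\<in>X. f i x) powr w i)"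
proof (cases "\<exists>i\<in>I. (\<Sum>x\<in>X. f i x) = 0")
  case True
  then obtain i where i: "i \<in> I" "(\<Sum>x\<in>X. f i x) = 0" by auto
  then have "\<And>x. x \<in> X \<Longrightarrow> f i x = 0"
    using nonneg assms(2) by (simp add: sum_nonneg_eq_0_iff)
  then have "(\<Prod>i\<in>I. f i x powr w i) = 0" if "x \<in> X" for x
    using i that assms(1) by (intro prod_zero) auto
  then have "(\<Sum>x\<in>X. \<Prod>i\<in>I. f i x powr w i) = 0" by simp
  also have "\<dots> \<le> (\<Prod>i\<in>I. (\<Sum>x\<in>X. f i x) powr w i)"
    by (intro prod_nonneg) auto
  finally show ?thesis .
next
  case False
  define S where "S i = (\<Sum>x\<in>X. f i x)" for i
  have S: "S i > 0" if "i \<in> I" for i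
    using False that nonneg by (metis S_def less_le sum_nonneg)
  have AG: "(\<Prod>i\<in>I. (f i x / S i) powr w i) \<le> (\<Sum>i\<in>I. w i * (f i x / S i))" if x: "x \<in> X" for x
  proof (cases "\<exists>i\<in>I. f i x = 0")
    case True
    then have "(\<Prod>i\<in>I. (f i x / S i) powr w i) = 0"
      using assms(1) by (intro prod_zero) auto
    also have "\<dots> \<le> (\<Sum>i\<in>I. w i * (f i x / S i))"
      using x nonneg S assms(4) by (intro sum_nonneg mult_nonneg_nonneg divide_nonneg_nonneg) (auto intro: less_imp_le)
    finally show ?thesis .
  next
    case False
    then show ?thesis
      using x nonneg S assms by (intro weighted_AM_GM divide_pos_pos) (auto simp: less_le)
  qed
  have "(\<Sum>x\<in>X. \<Prod>i\<in>I. f i x powr w i) = (\<Sum>x\<in>X. (\<Prod>i\<in>I. S i powr w i) * (\<Prod>i\<in>I. (f i x / S i) powr w i))"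
  proof (intro sum.cong refl)
    fix x assume x: "x \<in> X"
    have "f i x powr w i = S i powr w i * (f i x / S i) powr w i" if "i \<in> I" for i
      using S[OF that] nonneg[OF that x] by (simp add: powr_divide)
    then show "(\<Prod>i\<in>I. f i x powr w i) = (\<Prod>i\<in>I. S i powr w i) * (\<Prod>i\<in>I. (f i x / S i) powr w i)"
      by (simp add: prod.distrib[symmetric])
  qed
  also have "\<dots> \<le> (\<Sum>x\<in>X. (\<Prod>i\<in>I. S i powr w i) * (\<Sum>i\<in>I. w i * (f i x / S i)))"
    by (intro sum_mono mult_left_mono AG prod_nonneg) auto
  also have "\<dots> = (\<Prod>i\<in>I. S i powr w i) * (\<Sum>i\<in>I. w i * (\<Sum>x\<in>X. f i x / S i))"
    unfolding sum_distrib_left[symmetric] by (subst sum.swap) (simp add: sum_distrib_left)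
  also have "(\<Sum>i\<in>I. w i * (\<Sum>x\<in>X. f i x / S i)) = (\<Sum>i\<in>I. w i)"
    using S by (intro sum.cong refl) (force simp: S_def sum_divide_distrib[symmetric])
  finally show ?thesis by (simp add: S_def assms(3))
qed

lemma Hoelder_sum:
  fixes f g :: "'x \<Rightarrow> real"
  assumes "finite X" "0 < t" "t < 1" "\<And>x. x \<in> X \<Longrightarrow> f x \<ge> 0" "\<And>x. x \<in> X \<Longrightarrow> g x \<ge> 0"
  shows "(\<Sum>x\<in>X. f x powr t * g x powr (1 - t)) \<le> (\<Sum>x\<in>X. f x) powr t * (\<Sum>x\<in>X. g x) powr (1 - t)"
  using Hoelder_sum_prod[of "UNIV :: bool set" X "\<lambda>b. if b then t else 1 - t" "\<lambda>b. if b then f else g"] assms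
  by (auto simp: UNIV_bool mult.commute)

text \<open>The triangle inequality for the weighted norm of exponent \<open>r\<close>, raised to
  the power \<open>r\<close>. With \<open>n j\<close> the norm of \<open>A j\<close> and
  \<open>T\<close> the total of these norms, it is convexity of the \<open>r\<close>-th power at the
  points \<open>A j x / n j\<close> with weights \<open>n j / T\<close>.\<close>

lemma Minkowski_sum:
  fixes A :: "'j \<Rightarrow> 'x \<Rightarrow> real" and w :: "'x \<Rightarrow> real" and r :: nat
  assumes "finite X" "finite J" "r > 0"
    and w: "\<And>x. x \<in> X \<Longrightarrow> w x \<ge> 0" and A: "\<And>j x. j \<in> J \<Longrightarrow> x \<in> X \<Longrightarrow> A j x \<ge> 0"
  shows "(\<Sum>x\<in>X. w x * (\<Sum>j\<in>J. A j x) ^ r) \<le> (\<Sum>j\<in>J. (\<Sum>x\<in>X. w x * A j x ^ r) powr (1 / r)) ^ r"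
proof -
  define n where "n j = (\<Sum>x\<in>X. w x * A j x ^ r) powr (1 / r)" for j
  have sum_nn: "(\<Sum>x\<in>X. w x * A j x ^ r) \<ge> 0" if "j \<in> J" for j
    using that by (intro sum_nonneg mult_nonneg_nonneg w zero_le_power A)
  have n_pow: "n j ^ r = (\<Sum>x\<in>X. w x * A j x ^ r)" if "j \<in> J" for j
    using sum_nn[OF that] assms(3) unfolding n_def by (cases "(\<Sum>x\<in>X. w x * A j x ^ r) = 0")
     (auto simp: powr_realpow[symmetric] powr_powr)
  have n_nn: "n j \<ge> 0" for j by (simp add: n_def)
  define K where "K = {j\<in>J. n j > 0}"
  define T where "T = (\<Sum>j\<in>K. n j)"
  have K: "finite K" "K \<subseteq> J" using assms(2) by (auto simp: K_def)
  have TJ: "T = (\<Sum>j\<in>J. n j)"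
    unfolding T_def using K assms(2) n_nn by (intro sum.mono_neutral_left) (auto simp: K_def less_le)
  have zero: "w x * (\<Sum>j\<in>J. A j x) ^ r = w x * (\<Sum>j\<in>K. A j x) ^ r" if x: "x \<in> X" for x
  proof (cases "w x = 0")
    case False
    have "A j x = 0" if j: "j \<in> J - K" for j
    proof -
      have "n j = 0" using j n_nn[of j] by (auto simp: K_def)
      then have "(\<Sum>x\<in>X. w x * A j x ^ r) = 0" using n_pow[of j] j assms(3) by (simp add: power_0_left)
      then have "w x * A j x ^ r = 0"
        using x j assms(1) by (subst (asm) sum_nonneg_eq_0_iff) (auto intro!: mult_nonneg_nonneg zero_le_power w A)
      then show ?thesis using False by auto
    qed
    then have "(\<Sum>j\<in>J. A j x) = (\<Sum>j\<in>K. A j x)"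
      using K assms(2) by (intro sum.mono_neutral_right) auto
    then show ?thesis by simp
  qed simp
  have "(\<Sum>x\<in>X. w x * (\<Sum>j\<in>K. A j x) ^ r) \<le> T ^ r"
  proof (cases "K = {}")
    case True
    then show ?thesis using assms(3) by (simp add: T_def power_0_left)
  next
    case False
    have T: "T > 0" unfolding T_def using K False by (intro sum_pos) (auto simp: K_def)
    have cv: "(\<Sum>j\<in>K. A j x) ^ r \<le> T ^ r * (\<Sum>j\<in>K. (n j / T) * (A j x / n j) ^ r)" if x: "x \<in> X" for x
    proof -
      have "(\<Sum>j\<in>K. (n j / T) *\<^sub>R (A j x / n j)) ^ r \<le> (\<Sum>j\<in>K. (n j / T) * (A j x / n j) ^ r)"
      proof (rule convex_on_sum[where C = "{0..}" and f = "\<lambda>y. y ^ r"])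
        show "convex_on {0..} (\<lambda>y::real. y ^ r)"
        proof (rule convex_onI)
          fix t x y :: real
          assume t: "0 < t" "t < 1" and xy: "x \<in> {0..}" "y \<in> {0..}"
          show "((1 - t) *\<^sub>R x + t *\<^sub>R y) ^ r \<le> (1 - t) * x ^ r + t * y ^ r"
          proof (induction r)
            case (Suc r)
            have "((1 - t) *\<^sub>R x + t *\<^sub>R y) ^ Suc r \<le> ((1 - t) *\<^sub>R x + t *\<^sub>R y) * ((1 - t) * x ^ r + t * y ^ r)"
              using Suc t xy by (simp add: mult_left_mono)
            also have "\<dots> = (1 - t) * x ^ Suc r + t * y ^ Suc r - t * (1 - t) * ((x - y) * (x ^ r - y ^ r))"
              by (simp add: algebra_simps)
            also have "\<dots> \<le> (1 - t) * x ^ Suc r + t * y ^ Suc r"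
            proof -
              have "(x - y) * (x ^ r - y ^ r) \<ge> 0"
              proof (cases "x \<le> y")
                case True
                then show ?thesis using xy power_mono[of x y r] by (intro mult_nonpos_nonpos) auto
              next
                case False
                then show ?thesis using xy power_mono[of y x r] by (intro mult_nonneg_nonneg) auto
              qed
              then show ?thesis using t by simp
            qed
            finally show ?case .
          qed simp
        qed (simp add: convex_real_interval)
        show "(\<Sum>j\<in>K. n j / T) = 1" using T by (simp add: T_def sum_divide_distrib[symmetric])
      qed (use K False T x A n_nn in \<open>auto simp: K_def intro!: divide_nonneg_nonneg\<close>)
      also have "(\<Sum>j\<in>K. (n j / T) *\<^sub>R (A j x / n j)) = (\<Sum>j\<in>K. A j x) / T"
        unfolding sum_divide_distrib by (intro sum.cong) (auto simp: K_def)
      finally have "((\<Sum>j\<in>K. A j x) / T) ^ r \<le> (\<Sum>j\<in>K. (n j / T) * (A j x / n j) ^ r)" .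
      then show ?thesis using T by (simp add: power_divide field_simps)
    qed
    have "(\<Sum>x\<in>X. w x * (\<Sum>j\<in>K. A j x) ^ r) \<le> (\<Sum>x\<in>X. w x * (T ^ r * (\<Sum>j\<in>K. (n j / T) * (A j x / n j) ^ r)))"
      by (intro sum_mono mult_left_mono cv w)
    also have "\<dots> = T ^ r * (\<Sum>j\<in>K. (n j / T) * ((\<Sum>x\<in>X. w x * A j x ^ r) / n j ^ r))"
      unfolding sum_distrib_left sum_divide_distrib
      by (subst sum.swap) (intro sum.cong refl, simp add: power_divide)
    also have "(\<Sum>j\<in>K. (n j / T) * ((\<Sum>x\<in>X. w x * A j x ^ r) / n j ^ r)) = (\<Sum>j\<in>K. n j / T)"
    proof (intro sum.cong refl)
      fix j assume "j \<in> K"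
      then have "n j > 0" "(\<Sum>x\<in>X. w x * A j x ^ r) = n j ^ r" using n_pow by (auto simp: K_def)
      then show "n j / T * ((\<Sum>x\<in>X. w x * A j x ^ r) / n j ^ r) = n j / T" by simp
    qed
    also have "\<dots> = 1" using T by (simp add: T_def sum_divide_distrib[symmetric])
    finally show ?thesis by simp
  qed
  then show ?thesis by (simp add: sum.cong[OF refl zero] TJ n_def)
qed

section \<open>Decoupling for the moment curve over residue classes\<close>

text \<open>The \<open>p\<close>-adic counterpart of \<open>\<ell>\<^sup>2\<close> decoupling at the critical exponent \<open>l * (l + 1) = 2 * tri l\<close>: the
  frequencies \<open>n\<close> are split into residue classes modulo \<open>p ^ N\<close>, and physical space is the group of
  coefficient vectors modulo \<open>p ^ (l * N)\<close>.\<close>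

definition tri :: "nat \<Rightarrow> nat" where "tri l = l * (l + 1) div 2"

definition grid :: "nat \<Rightarrow> nat \<Rightarrow> (nat \<Rightarrow> int) set" where
  "grid l q = {1..l} \<rightarrow>\<^sub>E {0..<int q}"

definition mphase :: "nat \<Rightarrow> (nat \<Rightarrow> int) \<Rightarrow> int \<Rightarrow> int" where
  "mphase l x n = (\<Sum>j=1..l. x j * n ^ j)"

text \<open>With P = 2 * tri l, the usual inequality bounds the P-norm of the sum by the root of the
  sum of squared P-norms over the classes. Here it is raised to the power P: 1 / tri l is 2 / P, tri
  l is P / 2, and \<open>D\<close> is the P-th power of the usual constant. Arbitrary coefficients
  \<open>g\<close> are essential, since the transfer below applies the inequality with coefficients
  that vary from point to point.\<close>

definition decoupling :: "nat \<Rightarrow> nat \<Rightarrow> nat \<Rightarrow> real \<Rightarrow> bool" where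
  "decoupling p l N D \<longleftrightarrow> (\<forall>(A :: int set) (g :: int \<Rightarrow> complex). finite A \<longrightarrow>
     (\<Sum>x\<in>grid l (p ^ (l * N)). norm (\<Sum>n\<in>A. g n * unit_exp (of_int (mphase l x n) / of_nat (p ^ (l * N)))) ^ (2 * tri l))
     \<le> D * (\<Sum>c\<in>{0..<int p ^ N}. (\<Sum>x\<in>grid l (p ^ (l * N)).
         norm (\<Sum>n | n \<in> A \<and> n mod int p ^ N = c. g n * unit_exp (of_int (mphase l x n) / of_nat (p ^ (l * N)))) ^ (2 * tri l))
           powr (1 / tri l)) ^ tri l)"

lemma tri_Suc: "tri (Suc l) = tri l + Suc l"
  by (simp add: tri_def)

lemma two_tri: "2 * tri l = l * (l + 1)"
  by (simp add: tri_def)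

lemma tri_0 [simp]: "tri 0 = 0"
  by (simp add: tri_def)

lemma tri_mono: "l \<le> k \<Longrightarrow> tri l \<le> tri k"
  unfolding tri_def by (intro div_le_mono mult_mono) auto

lemma tri_pos [simp]: "0 < tri l \<longleftrightarrow> 0 < l"
  by (cases l) (auto simp: tri_Suc)

lemma finite_grid [simp]: "finite (grid l q)"
  by (auto simp: grid_def intro: finite_PiE)

lemma card_grid: "card (grid l q) = q ^ l"
  by (simp add: grid_def card_PiE)

lemma power_powr_inverse:
  fixes x :: real
  assumes "x \<ge> 0" "r > (0::nat)"
  shows "(x powr (1 / r)) ^ r = x"
  using assms by (cases "x = 0") (auto simp: powr_realpow[symmetric] powr_powr)

text \<open>Translations that multiply each \<open>G i\<close> by a character of a moment curve of degree \<open>l\<close> can be averaged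
  over, which reduces the claim to decoupling in degree \<open>l\<close>.\<close>

lemma decoupling_transfer:
  fixes G :: "'i \<Rightarrow> 'x \<Rightarrow> complex" and w :: "'x \<Rightarrow> real" and z :: "'i \<Rightarrow> int"
  assumes dec: "decoupling p l N D" and D: "D \<ge> 0" and l: "l > 0" and p: "p > 0"
    and fin: "finite X" "finite A"
    and bij: "\<And>s. s \<in> grid l (p ^ (l * N)) \<Longrightarrow> bij_betw (\<tau> s) X X"
    and w0: "\<And>x. x \<in> X \<Longrightarrow> w x \<ge> 0"
    and w: "\<And>s x. s \<in> grid l (p ^ (l * N)) \<Longrightarrow> x \<in> X \<Longrightarrow> w (\<tau> s x) = w x"
    and G: "\<And>s x. s \<in> grid l (p ^ (l * N)) \<Longrightarrow> x \<in> X \<Longrightarrow> \<exists>\<theta>. norm \<theta> = 1 \<and>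
      (\<forall>i\<in>A. G i (\<tau> s x) = \<theta> * (G i x * unit_exp (of_int (mphase l s (z i)) / of_nat (p ^ (l * N)))))"
  shows "(\<Sum>x\<in>X. w x * norm (\<Sum>i\<in>A. G i x) ^ (2 * tri l))
    \<le> D * (\<Sum>c\<in>{0..<int p ^ N}. (\<Sum>x\<in>X. w x * norm (\<Sum>i | i \<in> A \<and> z i mod int p ^ N = c. G i x) ^ (2 * tri l))
        powr (1 / tri l)) ^ tri l"
proof -
  define S where "S = grid l (p ^ (l * N))"
  define t where "t = tri l"
  define e where "e s n = unit_exp (of_int (mphase l s n) / of_nat (p ^ (l * N)))" for s n
  define K where "K B x = (\<Sum>s\<in>S. norm (\<Sum>i\<in>B. G i x * e s (z i)) ^ (2 * t))" for B x
  define C where "C c = {i \<in> A. z i mod int p ^ N = c}" for c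
  have t: "t > 0" using l by (simp add: t_def)
  have S: "finite S" "card S > 0" using p by (auto simp: S_def card_grid)
  have K0: "K B x \<ge> 0" for B x by (auto simp: K_def intro: sum_nonneg)
  \<comment> \<open>Each translation permutes \<open>X\<close> and preserves the weight, so
    averaging over \<open>s\<close> changes nothing, and the common unimodular factor disappears in
    the norm.\<close>
  have avg: "real (card S) * (\<Sum>x\<in>X. w x * norm (\<Sum>i\<in>B. G i x) ^ (2 * t)) = (\<Sum>x\<in>X. w x * K B x)"
    if B: "B \<subseteq> A" for B
  proof -
    have "real (card S) * (\<Sum>x\<in>X. w x * norm (\<Sum>i\<in>B. G i x) ^ (2 * t))
        = (\<Sum>s\<in>S. \<Sum>x\<in>X. w x * norm (\<Sum>i\<in>B. G i x) ^ (2 * t))" by simp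
    also have "\<dots> = (\<Sum>s\<in>S. \<Sum>x\<in>X. w (\<tau> s x) * norm (\<Sum>i\<in>B. G i (\<tau> s x)) ^ (2 * t))"
      by (intro sum.cong refl sum.reindex_bij_betw[symmetric] bij) (simp add: S_def)
    also have "\<dots> = (\<Sum>s\<in>S. \<Sum>x\<in>X. w x * norm (\<Sum>i\<in>B. G i x * e s (z i)) ^ (2 * t))"
    proof (intro sum.cong refl)
      fix s x assume sx: "s \<in> S" "x \<in> X"
      obtain \<theta> where \<theta>: "norm \<theta> = 1" "\<forall>i\<in>A. G i (\<tau> s x) = \<theta> * (G i x * e s (z i))"
        using G[of s x] sx unfolding S_def e_def by blast
      have "(\<Sum>i\<in>B. G i (\<tau> s x)) = \<theta> * (\<Sum>i\<in>B. G i x * e s (z i))"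
        unfolding sum_distrib_left using \<theta>(2) B by (intro sum.cong) auto
      then show "w (\<tau> s x) * norm (\<Sum>i\<in>B. G i (\<tau> s x)) ^ (2 * t) = w x * norm (\<Sum>i\<in>B. G i x * e s (z i)) ^ (2 * t)"
        using w sx \<theta>(1) by (simp add: S_def norm_mult)
    qed
    also have "\<dots> = (\<Sum>x\<in>X. w x * K B x)"
      by (subst sum.swap) (simp add: K_def sum_distrib_left)
    finally show ?thesis .
  qed
  \<comment> \<open>At a fixed point \<open>x\<close> the average over \<open>s\<close> is a moment
    for the curve of degree \<open>l\<close>. Indices with equal value of \<open>z\<close> merge
    into one coefficient \<open>h\<close>.\<close>
  have main: "K A x \<le> D * (\<Sum>c\<in>{0..<int p ^ N}. K (C c) x powr (1 / t)) ^ t" for x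
  proof -
    define h where "h n = (\<Sum>i | i \<in> A \<and> z i = n. G i x)" for n
    have grp: "(\<Sum>n | n \<in> z ` A \<and> P n. h n * e s n) = (\<Sum>i | i \<in> A \<and> P (z i). G i x * e s (z i))" for P s
    proof -
      have "(\<Sum>i | i \<in> A \<and> P (z i). G i x * e s (z i))
          = (\<Sum>n\<in>z ` {i. i \<in> A \<and> P (z i)}. \<Sum>i\<in>{i. i \<in> {i. i \<in> A \<and> P (z i)} \<and> z i = n}. G i x * e s (z i))"
        using fin by (intro sum.image_gen) auto
      also have "\<dots> = (\<Sum>n\<in>{n. n \<in> z ` A \<and> P n}. h n * e s n)"
        unfolding h_def sum_distrib_right
        by (intro sum.cong) (auto intro!: sum.cong)
      finally show ?thesis by simp
    qed
    have "K A x = (\<Sum>s\<in>S. norm (\<Sum>n\<in>z ` A. h n * e s n) ^ (2 * t))"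
      unfolding K_def using grp[where P = "\<lambda>_. True"] by simp
    also have "\<dots> \<le> D * (\<Sum>c\<in>{0..<int p ^ N}. (\<Sum>s\<in>S. norm (\<Sum>n | n \<in> z ` A \<and> n mod int p ^ N = c. h n * e s n) ^ (2 * t))
        powr (1 / t)) ^ t"
      using dec fin unfolding decoupling_def S_def e_def t_def by blast
    also have "\<dots> = D * (\<Sum>c\<in>{0..<int p ^ N}. K (C c) x powr (1 / t)) ^ t"
      unfolding K_def C_def grp[where P = "\<lambda>n. n mod int p ^ N = _"] ..
    finally show ?thesis .
  qed
  have "real (card S) * (\<Sum>x\<in>X. w x * norm (\<Sum>i\<in>A. G i x) ^ (2 * t)) = (\<Sum>x\<in>X. w x * K A x)"
    by (rule avg) simp
  also have "\<dots> \<le> (\<Sum>x\<in>X. w x * (D * (\<Sum>c\<in>{0..<int p ^ N}. K (C c) x powr (1 / t)) ^ t))"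
    by (intro sum_mono mult_left_mono main w0)
  also have "\<dots> = D * (\<Sum>x\<in>X. w x * (\<Sum>c\<in>{0..<int p ^ N}. K (C c) x powr (1 / t)) ^ t)"
    by (simp add: sum_distrib_left mult_ac)
  \<comment> \<open>Minkowski with exponent \<open>t\<close> moves the sum over \<open>x\<close>
    inside the sum over classes. The exponent is at least 1 because the moments have order at least
    2.\<close>
  also have "\<dots> \<le> D * (\<Sum>c\<in>{0..<int p ^ N}. (\<Sum>x\<in>X. w x * (K (C c) x powr (1 / t)) ^ t) powr (1 / t)) ^ t"
    using D t fin w0 by (intro mult_left_mono Minkowski_sum) auto
  also have "\<dots> = D * (\<Sum>c\<in>{0..<int p ^ N}. (\<Sum>x\<in>X. w x * K (C c) x) powr (1 / t)) ^ t"
    using K0 t by (simp add: power_powr_inverse)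
  also have "\<dots> = D * (\<Sum>c\<in>{0..<int p ^ N}. (real (card S) * (\<Sum>x\<in>X. w x * norm (\<Sum>i\<in>C c. G i x) ^ (2 * t))) powr (1 / t)) ^ t"
    by (subst avg) (auto simp: C_def)
  also have "\<dots> = D * (real (card S) powr (1 / t) * (\<Sum>c\<in>{0..<int p ^ N}. (\<Sum>x\<in>X. w x * norm (\<Sum>i\<in>C c. G i x) ^ (2 * t)) powr (1 / t))) ^ t"
    by (simp only: powr_mult sum_distrib_left[of "real (card S) powr (1 / t)"])
  also have "\<dots> = real (card S) * (D * (\<Sum>c\<in>{0..<int p ^ N}. (\<Sum>x\<in>X. w x * norm (\<Sum>i\<in>C c. G i x) ^ (2 * t)) powr (1 / t)) ^ t)"
    using t by (simp add: power_mult_distrib power_powr_inverse)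
  finally show ?thesis
    using S unfolding C_def t_def by (simp add: mult_le_cancel_left)
qed

definition children :: "nat \<Rightarrow> nat \<Rightarrow> int \<Rightarrow> nat \<Rightarrow> int set" where
  "children p a c b = {d \<in> {0..<int p ^ b}. d mod int p ^ a = c}"

lemma finite_children [simp]: "finite (children p a c b)"
  unfolding children_def by (rule finite_subset[of _ "{0..<int p ^ b}"]) auto

lemma int_div_less:
  fixes a b d :: int
  assumes "d < a * b" "a > 0"
  shows "d div a < b"
proof -
  have "a * (d div a) \<le> d" using assms(2) by (metis div_mult_mod_eq mult.commute le_add_same_cancel1 pos_mod_sign)
  then have "a * (d div a) < a * b" using assms(1) by simp
  then show ?thesis using assms(2) by simp
qed

text \<open>Expansion in base \<open>p\<close>: a subclass of \<xi> modulo
  \<open>p ^ (r + M)\<close> is given by its next \<open>M\<close> digits.\<close>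

lemma children_image:
  assumes "p > 0" "\<xi> \<in> {0..<int p ^ r}"
  shows "bij_betw (\<lambda>c. \<xi> + int p ^ r * c) {0..<int p ^ M} (children p r \<xi> (r + M))"
proof -
  have pp: "int p ^ r > 0" "int p ^ M > 0" using assms by auto
  show ?thesis
  proof (rule bij_betwI[where g = "\<lambda>d. d div int p ^ r"])
    show "(\<lambda>c. \<xi> + int p ^ r * c) \<in> {0..<int p ^ M} \<rightarrow> children p r \<xi> (r + M)"
    proof
      fix c assume c: "c \<in> {0..<int p ^ M}"
      then have "c + 1 \<le> int p ^ M" by auto
      then have "int p ^ r * (c + 1) \<le> int p ^ r * int p ^ M" using pp by (intro mult_left_mono) auto
      then have "\<xi> + int p ^ r * c < int p ^ (r + M)"
        using assms(2) by (simp add: power_add ring_distribs)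
      then show "\<xi> + int p ^ r * c \<in> children p r \<xi> (r + M)"
        using assms(2) c pp by (auto simp: children_def mod_pos_pos_trivial)
    qed
    show "(\<lambda>d. d div int p ^ r) \<in> children p r \<xi> (r + M) \<rightarrow> {0..<int p ^ M}"
    proof
      fix d assume d: "d \<in> children p r \<xi> (r + M)"
      then have "d < int p ^ r * int p ^ M" "0 \<le> d" by (auto simp: children_def power_add)
      then show "d div int p ^ r \<in> {0..<int p ^ M}"
        using pp by (auto simp: pos_imp_zdiv_nonneg_iff intro: int_div_less)
    qed
  qed (use assms pp in \<open>auto simp: children_def div_pos_pos_trivial\<close>)
qed

section \<open>Translations on the group of coefficient vectors\<close>

locale moment_sum =
  fixes p k N :: nat and A :: "int set" and g :: "int \<Rightarrow> complex"
  assumes p: "prime p" and k: "k \<ge> 1" and fin: "finite A"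
begin

definition "q = p ^ (k * N)"

definition summand :: "int \<Rightarrow> (nat \<Rightarrow> int) \<Rightarrow> complex" where
  "summand n x = g n * unit_exp (of_int (mphase k x n) / of_nat q)"

definition F :: "nat \<Rightarrow> int \<Rightarrow> (nat \<Rightarrow> int) \<Rightarrow> complex" where
  "F a c x = (\<Sum>n | n \<in> A \<and> n mod int p ^ a = c. summand n x)"

definition shift :: "(nat \<Rightarrow> int) \<Rightarrow> (nat \<Rightarrow> int) \<Rightarrow> nat \<Rightarrow> int" where
  "shift u x = (\<lambda>j\<in>{1..k}. (x j + u j) mod int q)"

abbreviation "X \<equiv> grid k q"

lemma p_pos: "p > 0" using p by (simp add: prime_gt_0_nat)

lemma q_pos: "q > 0" using p_pos by (simp add: q_def)

lemma shift_shift: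
  assumes "x \<in> X" "\<And>j. v j = - u j"
  shows "shift v (shift u x) = x"
proof
  fix j
  show "shift v (shift u x) j = x j"
  proof (cases "j \<in> {1..k}")
    case True
    then have "x j \<in> {0..<int q}" using assms(1) by (auto simp: grid_def PiE_def)
    then show ?thesis using True assms(2) by (simp add: shift_def mod_diff_left_eq)
  next
    case False
    then show ?thesis using assms(1) by (auto simp: shift_def grid_def PiE_def extensional_def)
  qed
qed

lemma bij_shift: "bij_betw (shift u) X X"
proof (rule bij_betwI[where g = "shift (\<lambda>j. - u j)"])
  have "shift u x \<in> X" for u x
    using q_pos by (auto simp: shift_def grid_def)
  then show "shift u \<in> X \<rightarrow> X" "shift (\<lambda>j. - u j) \<in> X \<rightarrow> X" by auto
qed (auto intro!: shift_shift)

lemma summand_shift: "summand n (shift u x) = unit_exp (of_int (mphase k u n) / of_nat q) * summand n x"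
proof -
  have "[mphase k (shift u x) n = mphase k x n + mphase k u n] (mod int q)"
  proof -
    have "[mphase k (shift u x) n = (\<Sum>j=1..k. (x j + u j) * n ^ j)] (mod int q)"
      unfolding mphase_def by (intro cong_sum cong_mult cong_refl) (auto simp: shift_def cong_def)
    then show ?thesis by (simp add: mphase_def ring_distribs sum.distrib)
  qed
  then obtain h where h: "mphase k (shift u x) n = mphase k x n + mphase k u n + int q * h"
    by (metis cong_iff_lin cong_sym)
  have "unit_exp (of_int (mphase k (shift u x) n) / of_nat q)
      = unit_exp (of_int (mphase k x n) / of_nat q + of_int (mphase k u n) / of_nat q)"
    using q_pos by (intro unit_exp_cong) (simp add: h field_simps)
  then show ?thesis by (simp add: summand_def unit_exp_add)
qed

text \<open>On the class of \<xi> write n = \<xi> + p^r z. A translation along \<open>Y j\<close> is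
  scaled by \<open>s j * p ^ (k * N - l * r' + r * (l - j))\<close>; the factor p^(r j) contained in
  (n - \<xi>)^j completes p^(r (l - j)) to p^(r l), so the phase changes by
  \<open>s j * z ^ j / p ^ (l * M)\<close>, up to an integer and a term independent of n. The
  translations thus act through the characters of a moment curve of degree \<open>l\<close> in the
  variable z, and decoupling in that degree transfers.\<close>

lemma step_general:
  assumes dec: "decoupling p l M D" and D: "D \<ge> 0" and l: "l \<ge> 1" and r': "r' = r + M" and lr': "l * r' \<le> k * N"
    and \<xi>: "\<xi> \<in> {0..<int p ^ r}"
    and Y: "\<And>j n. j \<in> {1..l} \<Longrightarrow> n mod int p ^ r = \<xi> \<Longrightarrow> [mphase k (Y j) n = c j + (n - \<xi>) ^ j] (mod int p ^ (l * r'))"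
    and w0: "\<And>x. x \<in> X \<Longrightarrow> w x \<ge> 0"
    and w: "\<And>s x. x \<in> X \<Longrightarrow> w (shift (\<lambda>i. int p ^ (k * N - l * r') * (\<Sum>j=1..l. s j * int p ^ (r * (l - j)) * Y j i)) x) = w x"
  shows "(\<Sum>x\<in>X. w x * norm (F r \<xi> x) ^ (2 * tri l)) \<le>
     D * (\<Sum>d\<in>children p r \<xi> r'. (\<Sum>x\<in>X. w x * norm (F r' d x) ^ (2 * tri l)) powr (1 / tri l)) ^ tri l"
proof -
  define u where "u s = (\<lambda>i. int p ^ (k * N - l * r') * (\<Sum>j=1..l. s j * int p ^ (r * (l - j)) * Y j i))" for s
  define z where "z n = n div int p ^ r" for n
  define B where "B = {n \<in> A. n mod int p ^ r = \<xi>}"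
  have pp: "int p ^ i > 0" "real p ^ i > 0" for i using p_pos by auto
  have zn: "n - \<xi> = int p ^ r * z n" if "n \<in> B" for n
    using that by (auto simp: B_def z_def minus_mod_eq_mult_div)
  have phase: "\<exists>\<theta>. norm \<theta> = 1 \<and> (\<forall>n\<in>B. summand n (shift (u s) x) =
        \<theta> * (summand n x * unit_exp (of_int (mphase l s (z n)) / of_nat (p ^ (l * M)))))" for s x
  proof (intro exI conjI ballI)
    let ?\<theta> = "unit_exp ((\<Sum>j=1..l. s j * int p ^ (r * (l - j)) * c j) / of_nat (p ^ (l * r')))"
    show "norm ?\<theta> = 1" by simp
    fix n assume n: "n \<in> B"
    have "\<exists>h. \<forall>j\<in>{1..l}. mphase k (Y j) n = c j + (n - \<xi>) ^ j + int p ^ (l * r') * h j"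
    proof (rule bchoice, rule ballI)
      fix j assume j: "j \<in> {1..l}"
      have "[mphase k (Y j) n = c j + (n - \<xi>) ^ j] (mod int p ^ (l * r'))"
        using Y[OF j] n by (simp add: B_def)
      then show "\<exists>h. mphase k (Y j) n = c j + (n - \<xi>) ^ j + int p ^ (l * r') * h"
        by (metis cong_iff_lin cong_sym)
    qed
    then obtain h where h: "\<And>j. j \<in> {1..l} \<Longrightarrow> mphase k (Y j) n = c j + (n - \<xi>) ^ j + int p ^ (l * r') * h j"
      by blast
    have "mphase k (u s) n = int p ^ (k * N - l * r') * (\<Sum>j=1..l. s j * int p ^ (r * (l - j)) * mphase k (Y j) n)"
      unfolding mphase_def u_def sum_distrib_left sum_distrib_right
      by (subst sum.swap) (simp add: mult_ac)
    also have "(\<Sum>j=1..l. s j * int p ^ (r * (l - j)) * mphase k (Y j) n)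
       = (\<Sum>j=1..l. s j * int p ^ (r * (l - j)) * c j) + int p ^ (r * l) * mphase l s (z n)
         + int p ^ (l * r') * (\<Sum>j=1..l. s j * int p ^ (r * (l - j)) * h j)"
      unfolding mphase_def[of l] sum_distrib_left sum.distrib[symmetric]
    proof (intro sum.cong refl)
      fix j assume j: "j \<in> {1..l}"
      have "r * l = r * (l - j) + r * j"
        using j by (metis atLeastAtMost_iff le_add_diff_inverse2 distrib_left)
      then have "int p ^ (r * l) = int p ^ (r * (l - j)) * (int p ^ r) ^ j"
        by (simp add: power_add power_mult)
      then show "s j * int p ^ (r * (l - j)) * mphase k (Y j) n =
         s j * int p ^ (r * (l - j)) * c j + int p ^ (r * l) * (s j * z n ^ j) + int p ^ (l * r') * (s j * int p ^ (r * (l - j)) * h j)"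
        using h[OF j] zn[OF n] by (simp add: power_mult_distrib algebra_simps)
    qed
    finally have E: "mphase k (u s) n = int p ^ (k * N - l * r') * ((\<Sum>j=1..l. s j * int p ^ (r * (l - j)) * c j) + int p ^ (r * l) * mphase l s (z n)
         + int p ^ (l * r') * (\<Sum>j=1..l. s j * int p ^ (r * (l - j)) * h j))" .
    have q: "real q = real p ^ (k * N - l * r') * real p ^ (l * r')"
      using lr' by (simp add: q_def flip: power_add)
    have lr: "real p ^ (l * r') = real p ^ (r * l) * real p ^ (l * M)"
      by (simp add: r' algebra_simps power_add)
    have "unit_exp (of_int (mphase k (u s) n) / of_nat q)
      = unit_exp ((\<Sum>j=1..l. s j * int p ^ (r * (l - j)) * c j) / of_nat (p ^ (l * r')) + of_int (mphase l s (z n)) / of_nat (p ^ (l * M)))"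
    proof (rule unit_exp_cong)
      let ?a = "real_of_int (\<Sum>j=1..l. s j * int p ^ (r * (l - j)) * c j)"
      let ?b = "real_of_int (\<Sum>j=1..l. s j * int p ^ (r * (l - j)) * h j)"
      let ?m = "real_of_int (mphase l s (z n))"
      have "of_int (mphase k (u s) n) / real q = (?a + real p ^ (r * l) * ?m + real p ^ (l * r') * ?b) / real p ^ (l * r')"
        unfolding q E using p_pos by simp
      also have "\<dots> = ?a / real p ^ (l * r') + ?m / real p ^ (l * M) + ?b"
        using p_pos by (simp add: add_divide_distrib) (simp add: lr)
      finally have E2: "of_int (mphase k (u s) n) / real q - (?a / of_nat (p ^ (l * r')) + ?m / of_nat (p ^ (l * M))) = ?b"
        by simp
      show "of_int (mphase k (u s) n) / real q - (?a / of_nat (p ^ (l * r')) + ?m / of_nat (p ^ (l * M))) \<in> \<int>"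
        unfolding E2 by (rule Ints_of_int)
    qed
    then show "summand n (shift (u s) x) = ?\<theta> * (summand n x * unit_exp (of_int (mphase l s (z n)) / of_nat (p ^ (l * M))))"
      by (simp add: summand_shift unit_exp_add mult_ac)
  qed
  have "(\<Sum>x\<in>X. w x * norm (\<Sum>n\<in>B. summand n x) ^ (2 * tri l)) \<le>
     D * (\<Sum>c\<in>{0..<int p ^ M}. (\<Sum>x\<in>X. w x * norm (\<Sum>n | n \<in> B \<and> z n mod int p ^ M = c. summand n x) ^ (2 * tri l)) powr (1 / tri l)) ^ tri l"
    by (rule decoupling_transfer[OF dec D, where \<tau> = "\<lambda>s. shift (u s)"])
      (use l p_pos fin bij_shift w0 w phase in \<open>auto simp: B_def u_def\<close>)
  also have "(\<Sum>c\<in>{0..<int p ^ M}. (\<Sum>x\<in>X. w x * norm (\<Sum>n | n \<in> B \<and> z n mod int p ^ M = c. summand n x) ^ (2 * tri l)) powr (1 / tri l))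
     = (\<Sum>c\<in>{0..<int p ^ M}. (\<Sum>x\<in>X. w x * norm (F r' (\<xi> + int p ^ r * c) x) ^ (2 * tri l)) powr (1 / tri l))"
  proof (intro sum.cong refl)
    fix c assume c: "c \<in> {0..<int p ^ M}"
    have "{n. n \<in> B \<and> z n mod int p ^ M = c} = {n. n \<in> A \<and> n mod int p ^ r' = \<xi> + int p ^ r * c}"
    proof -
      have md: "n mod int p ^ r' = int p ^ r * (n div int p ^ r mod int p ^ M) + n mod int p ^ r" for n
        unfolding r' power_add using pp[of M] by (intro zmod_zmult2_eq) auto
      have "n mod int p ^ r' = \<xi> + int p ^ r * c \<longleftrightarrow> n mod int p ^ r = \<xi> \<and> z n mod int p ^ M = c" for n
      proof
        assume a: "n mod int p ^ r' = \<xi> + int p ^ r * c"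
        have "n mod int p ^ r' mod int p ^ r = n mod int p ^ r"
          unfolding r' by (simp add: mod_mod_cancel power_add)
        then have "n mod int p ^ r = \<xi>" using a \<xi> by (simp add: mod_pos_pos_trivial)
        moreover have "int p ^ r * (n div int p ^ r mod int p ^ M) = int p ^ r * c"
          using a md[of n] calculation by simp
        ultimately show "n mod int p ^ r = \<xi> \<and> z n mod int p ^ M = c"
          using pp[of r] p_pos by (auto simp: z_def)
      qed (auto simp: md z_def)
      then show ?thesis by (auto simp: B_def)
    qed
    then show "(\<Sum>x\<in>X. w x * norm (\<Sum>n | n \<in> B \<and> z n mod int p ^ M = c. summand n x) ^ (2 * tri l)) powr (1 / tri l)
       = (\<Sum>x\<in>X. w x * norm (F r' (\<xi> + int p ^ r * c) x) ^ (2 * tri l)) powr (1 / tri l)"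
      by (simp add: F_def)
  qed
  also have "\<dots> = (\<Sum>d\<in>children p r \<xi> r'. (\<Sum>x\<in>X. w x * norm (F r' d x) ^ (2 * tri l)) powr (1 / tri l))"
    unfolding r' by (rule sum.reindex_bij_betw[OF children_image[OF p_pos \<xi>]])
  finally show ?thesis by (simp add: F_def B_def)
qed

end

lemma sum_power_le_power_sum:
  fixes y :: "'a \<Rightarrow> real"
  assumes "finite S" "n \<ge> 1" "\<And>i. i \<in> S \<Longrightarrow> y i \<ge> 0"
  shows "(\<Sum>i\<in>S. y i ^ n) \<le> (\<Sum>i\<in>S. y i) ^ n"
proof -
  obtain n' where n: "n = Suc n'" using assms(2) by (cases n) auto
  have "(\<Sum>i\<in>S. y i ^ n) \<le> (\<Sum>i\<in>S. y i * (\<Sum>i\<in>S. y i) ^ n')"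
  proof (rule sum_mono)
    fix i assume i: "i \<in> S"
    have "y i \<le> (\<Sum>i\<in>S. y i)" using assms i by (intro member_le_sum) auto
    then show "y i ^ n \<le> y i * (\<Sum>i\<in>S. y i) ^ n'"
      using assms(3)[OF i] by (simp add: n mult_left_mono power_mono)
  qed
  then show ?thesis by (simp add: n sum_distrib_right)
qed

lemma power_sum_le:
  fixes y :: "'a \<Rightarrow> real"
  assumes "finite S" "real (card S) \<le> K" "n \<ge> 1" "\<And>i. i \<in> S \<Longrightarrow> y i \<ge> 0"
  shows "(\<Sum>i\<in>S. y i) ^ n \<le> K ^ n * (\<Sum>i\<in>S. y i ^ n)"
proof (cases "S = {}")
  case True
  then show ?thesis using assms(3) by (simp add: power_0_left)
next
  case False
  define M where "M = Max (y ` S)"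
  obtain i where i: "i \<in> S" "y i = M"
  proof -
    have "M \<in> y ` S" unfolding M_def using False assms(1) by (intro Max_in) auto
    then show ?thesis using that by auto
  qed
  have M0: "M \<ge> 0" using i assms(4) by auto
  have "(\<Sum>i\<in>S. y i) \<le> (\<Sum>i\<in>S. M)" using assms(1) by (intro sum_mono) (auto simp: M_def)
  also have "\<dots> \<le> K * M" using assms(2) M0 by (simp add: mult_right_mono)
  finally have "(\<Sum>i\<in>S. y i) ^ n \<le> (K * M) ^ n" using assms(4) by (intro power_mono sum_nonneg) auto
  also have "\<dots> = K ^ n * y i ^ n" using i by (simp add: power_mult_distrib)
  also have "\<dots> \<le> K ^ n * (\<Sum>i\<in>S. y i ^ n)"
    using assms i by (intro mult_left_mono member_le_sum) (auto intro: order_trans[OF _ assms(2)])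
  finally show ?thesis .
qed

section \<open>Polynomial congruences and local coordinates on the moment curve\<close>

lemma coeff_mult_cong:
  fixes f f' g g' :: "int poly"
  assumes "\<And>i. i < l \<Longrightarrow> [coeff f i = coeff f' i] (mod P)" "\<And>i. i < l \<Longrightarrow> [coeff g i = coeff g' i] (mod P)" "i < l"
  shows "[coeff (f * g) i = coeff (f' * g') i] (mod P)"
  unfolding coeff_mult using assms by (intro cong_sum cong_mult) auto

lemma pcompose_power: "pcompose (f ^ n) h = pcompose f h ^ n" for f h :: "'a :: comm_ring_1 poly"
  by (induction n) (simp_all add: pcompose_mult pcompose_1)

text \<open>Since \<open>y\<close> is a unit modulo \<open>P\<close>, the polynomial
  \<open>[:y, 1:]\<close> can be inverted up to order \<open>l\<close>, and \<open>m\<close> such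
  inversions solve the equation.\<close>

lemma unit_power_poly_solve:
  fixes y P :: int and g :: "int poly"
  assumes "coprime y P"
  shows "\<exists>R :: int poly. \<forall>i<l. [coeff ([:y, 1:] ^ m * R) i = coeff g i] (mod P)"
proof (induction m)
  case 0
  then show ?case by (intro exI[of _ g]) simp
next
  case (Suc m)
  then obtain R :: "int poly" where R: "\<And>i. i < l \<Longrightarrow> [coeff ([:y, 1:] ^ m * R) i = coeff g i] (mod P)" by auto
  obtain u where u: "[y * u = 1] (mod P)" using cong_solve_coprime_int[OF assms] by auto
  \<comment> \<open>Truncated geometric series of 1 / (y + w) = u / (1 + u w), where u is inverse to
    y.\<close>
  define U :: "int poly" where "U = (\<Sum>i<l. monom (u * (- u) ^ i) i)"
  have cU: "coeff U i = (if i < l then u * (- u) ^ i else 0)" for i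
    by (simp add: U_def coeff_sum)
  have yU: "[coeff ([:y, 1:] * U) i = coeff 1 i] (mod P)" if i: "i < l" for i
  proof (cases i)
    case 0
    then show ?thesis using u i by (simp add: cU)
  next
    case (Suc i')
    have "coeff ([:y, 1:] * U) i = y * (u * (- u) ^ i) + u * (- u) ^ i'"
      using i by (simp add: Suc cU)
    also have "\<dots> = - (y * u - 1) * (u * (- u) ^ i')"
      by (simp add: Suc algebra_simps)
    finally have "coeff ([:y, 1:] * U) i = - (y * u - 1) * (u * (- u) ^ i')" .
    then have "P dvd coeff ([:y, 1:] * U) i"
      using u by (metis cong_iff_dvd_diff dvd_minus_iff dvd_mult2)
    then show ?thesis by (simp add: Suc cong_0_iff)
  qed
  show ?case
  proof (intro exI[of _ "U * R"] allI impI)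
    fix i assume i: "i < l"
    have eq: "[:y, 1:] ^ Suc m * (U * R) = ([:y, 1:] * U) * ([:y, 1:] ^ m * R)" by (simp only: power_Suc mult_ac)
    have "[coeff (([:y, 1:] * U) * ([:y, 1:] ^ m * R)) i = coeff (1 * g) i] (mod P)"
      by (rule coeff_mult_cong[where l = l]) (use yU R i in auto)
    then show "[coeff ([:y, 1:] ^ Suc m * (U * R)) i = coeff g i] (mod P)" by (simp only: eq mult_1_left)
  qed
qed

text \<open>The truncation of \<open>w\<^sup>j\<close> at order \<open>l\<close> around \<open>y\<close> is found by solving for its derivative,
  which only requires inverting a power of \<open>x\<close>, and integrating.\<close>

lemma moment_curve_local_coordinates:
  fixes y :: int
  assumes p: "prime p" "k < p" and l: "1 \<le> l" "l \<le> k" and j: "j \<in> {1..l}" and y: "\<not> int p dvd y"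
  shows "\<exists>(V :: nat \<Rightarrow> int) c h. \<forall>w. [(\<Sum>i=1..l. V i * (y + w) ^ (k - l + i)) = c + w ^ j + w ^ (l + 1) * h w] (mod int p ^ B)"
proof -
  define P where "P = int p ^ B"
  define m where "m = k - l"
  have cop: "coprime (int i) P" if "0 < i" "i < p" for i
    unfolding P_def using that p(1)
    by (metis coprime_commute coprime_power_left_iff nat_dvd_not_less of_nat_dvd_iff prime_imp_coprime prime_nat_int_transfer)
  have copy: "coprime y P"
    unfolding P_def using y p(1)
    by (metis coprime_commute coprime_power_left_iff prime_imp_coprime prime_nat_int_transfer)
  \<comment> \<open>The wanted combination of the powers x^(m + 1), ..., x^(m + l) has a derivative
    of the form x^m R(x) with R of degree below \<open>l\<close>. Expanding at x = y + w and
    requiring j w^(j - 1) up to order \<open>l\<close> gives this equation for R.\<close>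
  obtain R1 :: "int poly" where R1: "\<And>i. i < l \<Longrightarrow> [coeff ([:y, 1:] ^ m * R1) i = coeff (monom (int j) (j - 1)) i] (mod P)"
    using unit_power_poly_solve[OF copy] by blast
  define R0 where "R0 = poly_cutoff l R1"
  define R where "R = pcompose R0 [:- y, 1:]"
  have degR0: "degree R0 \<le> l - 1"
    by (rule degree_le) (use l in \<open>auto simp: R0_def coeff_poly_cutoff\<close>)
  then have degR: "degree R \<le> l - 1"
    by (simp add: R_def degree_pcompose)
  have R0: "[coeff ([:y, 1:] ^ m * R0) i = coeff (monom (int j) (j - 1)) i] (mod P)" if "i < l" for i
  proof -
    have "[coeff ([:y, 1:] ^ m * R0) i = coeff ([:y, 1:] ^ m * R1) i] (mod P)"
      by (rule coeff_mult_cong[where l = l]) (use that in \<open>auto simp: R0_def coeff_poly_cutoff\<close>)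
    then show ?thesis using R1[OF that] cong_trans by blast
  qed
  \<comment> \<open>Integration divides by the exponents m + i. They are at most k, hence units
    modulo \<open>P\<close>.\<close>
  have "\<exists>v. \<forall>i\<in>{1..l}. [int (m + i) * v i = 1] (mod P)"
  proof (rule bchoice, rule ballI)
    fix i assume "i \<in> {1..l}"
    then have "coprime (int (m + i)) P" using l p(2) by (intro cop) (auto simp: m_def)
    then show "\<exists>v. [int (m + i) * v = 1] (mod P)" by (rule cong_solve_coprime_int)
  qed
  then obtain v where v: "\<And>i. i \<in> {1..l} \<Longrightarrow> [int (m + i) * v i = 1] (mod P)" by blast
  define V where "V i = v i * coeff R (i - 1)" for i
  define Q where "Q = (\<Sum>i=1..l. monom (V i) (m + i))"
  define Qy where "Qy = pcompose Q [:y, 1:]"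
  have "[:P:] dvd pderiv Q - monom 1 m * R"
    unfolding const_poly_dvd_iff
  proof
    fix i
    have Rsum: "monom 1 m * R = (\<Sum>i=1..l. monom (coeff R (i - 1)) (m + i - 1))"
    proof -
      have "R = (\<Sum>i\<le>l - 1. monom (coeff R i) i)"
        using poly_as_sum_of_monoms'[OF degR] by simp
      then have "monom 1 m * R = (\<Sum>i\<le>l - 1. monom (coeff R i) (m + i))"
        by (metis (no_types, lifting) mult_1 mult_monom sum.cong sum_distrib_left)
      also have "\<dots> = (\<Sum>i=1..l. monom (coeff R (i - 1)) (m + i - 1))"
        by (rule sum.reindex_bij_witness[of _ "\<lambda>i. i - 1" Suc]) (use l in auto)
      finally show ?thesis .
    qed
    have "pderiv Q - monom 1 m * R = (\<Sum>i=1..l. monom ((int (m + i) * v i - 1) * coeff R (i - 1)) (m + i - 1))"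
      unfolding Rsum Q_def higher_pderiv_sum[of 1, simplified] sum_subtractf[symmetric]
      by (intro sum.cong refl) (simp add: pderiv_monom V_def diff_monom[symmetric] algebra_simps)
    also have "P dvd coeff \<dots> i"
      unfolding coeff_sum using v by (intro dvd_sum) (auto simp: cong_iff_dvd_diff)
    finally show "P dvd coeff (pderiv Q - monom 1 m * R) i" .
  qed
  then obtain H where "pderiv Q - monom 1 m * R = [:P:] * H" by (elim dvdE)
  then have H: "pderiv Q = monom 1 m * R + [:P:] * H" by (simp only: diff_eq_eq add.commute)
  have "pderiv Qy = pcompose (pderiv Q) [:y, 1:]"
    by (simp add: Qy_def pderiv_pcompose pderiv_pCons)
  also have "\<dots> = [:y, 1:] ^ m * R0 + [:P:] * pcompose H [:y, 1:]"
  proof -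
    have "pcompose (monom 1 m) [:y, 1:] = [:y, 1:] ^ m"
      by (simp add: monom_altdef pcompose_power pcompose_pCons)
    moreover have "pcompose R [:y, 1:] = R0"
      by (simp add: R_def pcompose_assoc[symmetric] pcompose_pCons)
    ultimately show ?thesis unfolding H by (simp add: pcompose_add pcompose_mult pcompose_smult)
  qed
  finally have eQ: "pderiv Qy = [:y, 1:] ^ m * R0 + [:P:] * pcompose H [:y, 1:]" .
  have dQ: "[coeff (pderiv Qy) i = coeff (monom (int j) (j - 1)) i] (mod P)" if "i < l" for i
  proof -
    have "coeff (pderiv Qy) i = coeff ([:y, 1:] ^ m * R0) i + P * coeff (pcompose H [:y, 1:]) i"
      unfolding eQ coeff_add by simp
    then show ?thesis using R0[OF that] by (simp only: cong_def mod_mult_self2)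
  qed
  have cQ: "[coeff Qy i = (if i = j then 1 else 0)] (mod P)" if i: "i \<in> {1..l}" for i
  proof -
    have "[int i * coeff Qy i = int i * (if i = j then 1 else 0)] (mod P)"
      using dQ[of "i - 1"] i j by (cases i; cases j) (auto simp: coeff_pderiv)
    moreover have "coprime (int i) P" using i l p(2) by (intro cop) auto
    ultimately show ?thesis by (simp only: cong_mult_lcancel)
  qed
  have ev: "poly Qy w = (\<Sum>i=1..l. V i * (y + w) ^ (k - l + i))" for w
    by (simp add: Qy_def poly_pcompose Q_def poly_sum poly_monom m_def)
  define hh where "hh w = poly (poly_shift (l + 1) Qy) w" for w
  have split: "poly Qy w = coeff Qy 0 + (\<Sum>i=1..l. coeff Qy i * w ^ i) + w ^ (l + 1) * hh w" for w
  proof -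
    have "Qy = poly_cutoff (l + 1) Qy + monom 1 (l + 1) * poly_shift (l + 1) Qy"
      by (rule poly_eqI) (auto simp: coeff_poly_cutoff coeff_poly_shift coeff_monom_mult)
    then have "poly Qy w = poly (poly_cutoff (l + 1) Qy) w + w ^ (l + 1) * hh w"
      by (metis hh_def mult_1 poly_add poly_monom poly_mult)
    also have "poly (poly_cutoff (l + 1) Qy) w = (\<Sum>i\<le>l. coeff Qy i * w ^ i)"
    proof -
      have "degree (poly_cutoff (l + 1) Qy) \<le> l" by (rule degree_le) (auto simp: coeff_poly_cutoff)
      then have "poly_cutoff (l + 1) Qy = (\<Sum>i\<le>l. monom (coeff Qy i) i)"
        using poly_as_sum_of_monoms'[of "poly_cutoff (l + 1) Qy" l] by (auto simp: coeff_poly_cutoff intro!: sum.cong)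
      then show ?thesis by (simp add: poly_sum poly_monom)
    qed
    also have "\<dots> = coeff Qy 0 + (\<Sum>i=1..l. coeff Qy i * w ^ i)"
      by (simp add: sum.atMost_shift atLeast0AtMost[symmetric] sum.atLeast_Suc_atMost)
    finally show ?thesis .
  qed
  have "[(\<Sum>i=1..l. V i * (y + w) ^ (k - l + i)) = coeff Qy 0 + w ^ j + w ^ (l + 1) * hh w] (mod P)" for w
  proof -
    have "[(\<Sum>i=1..l. coeff Qy i * w ^ i) = (\<Sum>i=1..l. (if i = j then 1 else 0) * w ^ i)] (mod P)"
      by (intro cong_sum cong_mult cQ cong_refl)
    also have "(\<Sum>i=1..l. (if i = j then 1 else 0) * w ^ i) = w ^ j"
      using j by (simp add: if_distrib[of "\<lambda>x. x * _"] cong: if_cong)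
    finally show ?thesis
      unfolding ev[symmetric] split by (intro cong_add cong_refl)
  qed
  then show ?thesis unfolding P_def by blast
qed

text \<open>These are the directions in coefficient space that recentre the curve at \<eta>. The
  constant is subtracted because \<open>mphase\<close> has no term of degree 0.\<close>

lemma mphase_shifted_power:
  assumes "j \<le> k"
  shows "\<exists>Y. \<forall>n. mphase k Y n = (n - \<eta>) ^ j - (- \<eta>) ^ j"
proof (intro exI allI)
  fix n
  let ?Y = "\<lambda>i. if i \<le> j then int (j choose i) * (- \<eta>) ^ (j - i) else 0"
  have "(n - \<eta>) ^ j = (\<Sum>i\<le>j. of_nat (j choose i) * n ^ i * (- \<eta>) ^ (j - i))"
    using binomial_ring[of n "- \<eta>" j] by simp
  also have "\<dots> = (- \<eta>) ^ j + (\<Sum>i=1..j. of_nat (j choose i) * n ^ i * (- \<eta>) ^ (j - i))"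
    by (simp add: atLeast0AtMost[symmetric] sum.atLeast_Suc_atMost)
  also have "(\<Sum>i=1..j. of_nat (j choose i) * n ^ i * (- \<eta>) ^ (j - i)) = mphase k ?Y n"
    unfolding mphase_def using assms by (intro sum.mono_neutral_cong_left) auto
  finally show "mphase k ?Y n = (n - \<eta>) ^ j - (- \<eta>) ^ j" by simp
qed

lemma sum_children:
  fixes f :: "int \<Rightarrow> real"
  assumes "p > 0" "a \<le> b" "b \<le> c"
  shows "(\<Sum>d\<in>children p a \<xi> b. \<Sum>e\<in>children p b d c. f e) = (\<Sum>e\<in>children p a \<xi> c. f e)"
proof -
  have mm: "e mod int p ^ b mod int p ^ a = e mod int p ^ a" for e :: int
    using assms(2) by (simp add: mod_mod_cancel le_imp_power_dvd)
  have "(\<Sum>d\<in>children p a \<xi> b. sum f {e \<in> children p a \<xi> c. e mod int p ^ b = d}) = (\<Sum>e\<in>children p a \<xi> c. f e)"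
    by (rule sum.group[OF finite_children finite_children]) (use assms mm in \<open>auto simp: children_def\<close>)
  moreover have "{e \<in> children p a \<xi> c. e mod int p ^ b = d} = children p b d c" if "d \<in> children p a \<xi> b" for d
    using that mm by (auto simp: children_def)
  ultimately show ?thesis by simp
qed

lemma children_mem:
  assumes "d \<in> children p a \<xi> b" "1 \<le> a"
  shows "d \<in> {0..<int p ^ b}" "int p dvd d - \<xi>"
proof -
  show "d \<in> {0..<int p ^ b}" using assms by (simp add: children_def)
  have "int p ^ a dvd d - \<xi>" using assms by (auto simp: children_def mod_eq_dvd_iff[symmetric])
  then show "int p dvd d - \<xi>" using assms(2) by (meson dvd_power dvd_trans order.strict_trans2 zero_less_one)
qed

lemma decoupling_mono:
  assumes "decoupling p l N D" "D \<le> D'"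
  shows "decoupling p l N D'"
proof -
  have "D * y ^ tri l \<le> D' * y ^ tri l" if "y \<ge> 0" for y
    using assms(2) that by (intro mult_right_mono) auto
  then show ?thesis
    using assms(1) unfolding decoupling_def by (meson order_trans powr_ge_zero sum_nonneg)
qed

section \<open>Rescaling, and the use of transversality\<close>

context moment_sum
begin

text \<open>\<open>bil l a b K\<close> is the bilinear estimate of the iteration: it concerns the part of the moment in which
  a class modulo \<open>p ^ a\<close> carries the critical exponent of degree \<open>l\<close> and a class modulo \<open>p ^ b\<close>,
  transversal to it, carries the rest.\<close>

definition mix :: "nat \<Rightarrow> nat \<Rightarrow> int \<Rightarrow> nat \<Rightarrow> int \<Rightarrow> real" where
  "mix l a \<xi> b \<eta> = (\<Sum>x\<in>X. norm (F a \<xi> x) ^ (2 * tri l) * norm (F b \<eta> x) ^ (2 * (tri k - tri l)))"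

text \<open>The sum over the finest classes from the right-hand side of decoupling, before the outer
  power is taken. In this form it is additive over subclasses, so the iteration can change scale
  without loss.\<close>

definition nrm :: "nat \<Rightarrow> int \<Rightarrow> real" where
  "nrm a \<xi> = (\<Sum>d\<in>children p a \<xi> N. (\<Sum>x\<in>X. norm (F N d x) ^ (2 * tri k)) powr (1 / tri k))"

definition bil :: "nat \<Rightarrow> nat \<Rightarrow> nat \<Rightarrow> real \<Rightarrow> bool" where
  "bil l a b K \<longleftrightarrow> (\<forall>\<xi>\<in>{0..<int p ^ a}. \<forall>\<eta>\<in>{0..<int p ^ b}. \<not> int p dvd \<xi> - \<eta> \<longrightarrow>
     mix l a \<xi> b \<eta> \<le> K * (nrm a \<xi> ^ tri l * nrm b \<eta> ^ (tri k - tri l)))"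

lemma mix_nonneg: "mix l a \<xi> b \<eta> \<ge> 0"
  by (auto simp: mix_def intro!: sum_nonneg)

lemma nrm_nonneg: "nrm a \<xi> \<ge> 0"
  by (auto simp: nrm_def intro!: sum_nonneg)

lemma nrm_children: "a \<le> b \<Longrightarrow> b \<le> N \<Longrightarrow> (\<Sum>d\<in>children p a \<xi> b. nrm b d) = nrm a \<xi>"
  unfolding nrm_def using p_pos by (intro sum_children) auto

text \<open>Affine invariance: recentring at \<xi> and removing the factor p^r turns a class modulo
  p^r into the full problem at scale \<open>M\<close>. All degrees up to \<open>k\<close> are
  available, so the required congruences hold as identities.\<close>

lemma rescale:
  assumes "decoupling p k M D" "D \<ge> 0" "r' = r + M" "r' \<le> N" "\<xi> \<in> {0..<int p ^ r}"
  shows "(\<Sum>x\<in>X. norm (F r \<xi> x) ^ (2 * tri k)) \<le>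
     D * (\<Sum>d\<in>children p r \<xi> r'. (\<Sum>x\<in>X. norm (F r' d x) ^ (2 * tri k)) powr (1 / tri k)) ^ tri k"
proof -
  have "\<exists>Y. \<forall>j\<in>{1..k}. \<forall>n. mphase k (Y j) n = (n - \<xi>) ^ j - (- \<xi>) ^ j"
    by (rule bchoice) (auto intro: mphase_shifted_power)
  then obtain Y where Y: "\<And>j n. j \<in> {1..k} \<Longrightarrow> mphase k (Y j) n = (n - \<xi>) ^ j - (- \<xi>) ^ j" by blast
  have "(\<Sum>x\<in>X. 1 * norm (F r \<xi> x) ^ (2 * tri k)) \<le>
     D * (\<Sum>d\<in>children p r \<xi> r'. (\<Sum>x\<in>X. 1 * norm (F r' d x) ^ (2 * tri k)) powr (1 / tri k)) ^ tri k"
    by (rule step_general[OF assms(1) assms(2) k assms(3) _ assms(5), where c = "\<lambda>j. - ((- \<xi>) ^ j)" and Y = Y and w = "\<lambda>_. 1"])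
       (use assms Y in auto)
  then show ?thesis by simp
qed

lemma rescale_nrm:
  assumes "decoupling p k (N - r) D" "D \<ge> 0" "r \<le> N" "\<xi> \<in> {0..<int p ^ r}"
  shows "(\<Sum>x\<in>X. norm (F r \<xi> x) ^ (2 * tri k)) \<le> D * nrm r \<xi> ^ tri k"
  unfolding nrm_def using assms by (intro rescale) auto

text \<open>The translations use only the powers (n - \<eta>)^(k - l + i) with i >= 1. On the class
  of \<eta> these are divisible by p^(b (k - l + 1)), so by the bound of \<open>l * r'\<close> by (k
  - l + 1) b the function \<open>F b \<eta>\<close> only acquires a unimodular constant and its norm
  may serve as a weight. On the class of \<xi>, where \<xi> - \<eta> is prime to p, local
  coordinates combine the same powers to (n - \<xi>)^j plus terms of order l + 1, and these vanish
  because \<open>l * r'\<close> is at most (l + 1) r. Each scale condition protects one of the two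
  classes.\<close>

lemma step_lower_degree:
  assumes dec: "decoupling p l M D" and D: "D \<ge> 0" and l: "1 \<le> l" "l \<le> k" and kp: "k < p"
    and r': "r' = r + M" "l * r' \<le> (l + 1) * r" "l * r' \<le> (k - l + 1) * b" "b \<le> N"
    and \<xi>: "\<xi> \<in> {0..<int p ^ r}" and \<eta>: "\<eta> \<in> {0..<int p ^ b}" and sep: "\<not> int p dvd \<xi> - \<eta>"
  shows "mix l r \<xi> b \<eta> \<le> D * (\<Sum>d\<in>children p r \<xi> r'. mix l r' d b \<eta> powr (1 / tri l)) ^ tri l"
proof -
  define m where "m = k - l"
  have "\<exists>V. \<forall>j\<in>{1..l}. \<exists>c h. \<forall>w. [(\<Sum>i=1..l. V j i * (\<xi> - \<eta> + w) ^ (m + i)) = c + w ^ j + w ^ (l + 1) * h w] (mod int p ^ (l * r'))"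
    unfolding m_def by (rule bchoice) (use moment_curve_local_coordinates[OF p kp l _ sep] in blast)
  then obtain V where V: "\<forall>j\<in>{1..l}. \<exists>c h. \<forall>w. [(\<Sum>i=1..l. V j i * (\<xi> - \<eta> + w) ^ (m + i)) = c + w ^ j + w ^ (l + 1) * h w] (mod int p ^ (l * r'))"
    by blast
  then have "\<exists>c. \<forall>j\<in>{1..l}. \<exists>h. \<forall>w. [(\<Sum>i=1..l. V j i * (\<xi> - \<eta> + w) ^ (m + i)) = c j + w ^ j + w ^ (l + 1) * h w] (mod int p ^ (l * r'))"
    by (rule bchoice)
  then obtain c where c: "\<forall>j\<in>{1..l}. \<exists>h. \<forall>w. [(\<Sum>i=1..l. V j i * (\<xi> - \<eta> + w) ^ (m + i)) = c j + w ^ j + w ^ (l + 1) * h w] (mod int p ^ (l * r'))"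
    by (rule exE)
  from bchoice[OF c] obtain h where h: "\<forall>j\<in>{1..l}. \<forall>w. [(\<Sum>i=1..l. V j i * (\<xi> - \<eta> + w) ^ (m + i)) = c j + w ^ j + w ^ (l + 1) * h j w] (mod int p ^ (l * r'))"
    by (rule exE)
  then have ch: "[(\<Sum>i=1..l. V j i * (\<xi> - \<eta> + w) ^ (m + i)) = c j + w ^ j + w ^ (l + 1) * h j w] (mod int p ^ (l * r'))"
    if "j \<in> {1..l}" for j w
    using that by blast
  have "\<exists>Z. \<forall>i\<in>{1..l}. \<forall>n. mphase k (Z i) n = (n - \<eta>) ^ (m + i) - (- \<eta>) ^ (m + i)"
    by (rule bchoice) (use l in \<open>auto simp: m_def intro!: mphase_shifted_power\<close>)
  then obtain Z where Z: "\<And>i n. i \<in> {1..l} \<Longrightarrow> mphase k (Z i) n = (n - \<eta>) ^ (m + i) - (- \<eta>) ^ (m + i)" by blast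
  define Y where "Y j i' = (\<Sum>i=1..l. V j i * Z i i')" for j i'
  define c0 where "c0 j = (\<Sum>i=1..l. V j i * (- \<eta>) ^ (m + i))" for j
  have Y: "mphase k (Y j) n = (\<Sum>i=1..l. V j i * (n - \<eta>) ^ (m + i)) - c0 j" for j n
  proof -
    have "mphase k (Y j) n = (\<Sum>i=1..l. V j i * mphase k (Z i) n)"
      unfolding mphase_def Y_def sum_distrib_left sum_distrib_right by (subst sum.swap) (simp add: mult_ac)
    also have "\<dots> = (\<Sum>i=1..l. V j i * (n - \<eta>) ^ (m + i) - V j i * (- \<eta>) ^ (m + i))"
      by (intro sum.cong refl) (simp add: Z algebra_simps)
    finally show ?thesis by (simp add: sum_subtractf c0_def)
  qed
  have lr: "l * r' \<le> k * N"
  proof -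
    have "l * r' \<le> (k - l + 1) * b" by fact
    also have "\<dots> \<le> k * N" using l r'(4) by (intro mult_mono) auto
    finally show ?thesis .
  qed
  have Ycong: "[mphase k (Y j) n = (c j - c0 j) + (n - \<xi>) ^ j] (mod int p ^ (l * r'))"
    if j: "j \<in> {1..l}" and n: "n mod int p ^ r = \<xi>" for j n
  proof -
    have dv: "int p ^ r dvd n - \<xi>" using n by (metis dvd_minus_mod)
    have "int p ^ (l * r') dvd (n - \<xi>) ^ (l + 1)"
    proof -
      have "int p ^ (r * (l + 1)) dvd (n - \<xi>) ^ (l + 1)"
        using dv by (simp only: power_mult dvd_power_same)
      moreover have "int p ^ (l * r') dvd int p ^ (r * (l + 1))"
        using r'(2) by (intro le_imp_power_dvd) (simp add: mult.commute)
      ultimately show ?thesis by (rule dvd_trans[rotated])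
    qed
    then have z: "[(n - \<xi>) ^ (l + 1) * h j (n - \<xi>) = 0] (mod int p ^ (l * r'))" by (simp add: cong_0_iff)
    have "[(\<Sum>i=1..l. V j i * (\<xi> - \<eta> + (n - \<xi>)) ^ (m + i)) = c j + (n - \<xi>) ^ j + 0] (mod int p ^ (l * r'))"
      using ch[OF j, of "n - \<xi>"] z by (meson cong_add cong_refl cong_trans)
    then have "[(\<Sum>i=1..l. V j i * (n - \<eta>) ^ (m + i)) - c0 j = c j + (n - \<xi>) ^ j - c0 j] (mod int p ^ (l * r'))"
      by (intro cong_diff cong_refl) simp
    then show ?thesis by (simp add: Y algebra_simps)
  qed
  have inv: "norm (F b \<eta> (shift (\<lambda>i. int p ^ (k * N - l * r') * (\<Sum>j=1..l. s j * int p ^ (r * (l - j)) * Y j i)) x)) = norm (F b \<eta> x)" for s x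
  proof -
    define u where "u = (\<lambda>i. int p ^ (k * N - l * r') * (\<Sum>j=1..l. s j * int p ^ (r * (l - j)) * Y j i))"
    define e0 where "e0 = - (int p ^ (k * N - l * r')) * (\<Sum>j=1..l. s j * int p ^ (r * (l - j)) * c0 j)"
    have ph: "unit_exp (of_int (mphase k u n) / of_nat q) = unit_exp (of_int e0 / of_nat q)" if n: "n mod int p ^ b = \<eta>" for n
    proof (rule unit_exp_cong)
      have "mphase k u n = int p ^ (k * N - l * r') * (\<Sum>j=1..l. s j * int p ^ (r * (l - j)) * mphase k (Y j) n)"
        unfolding mphase_def u_def sum_distrib_left sum_distrib_right
        by (subst sum.swap) (simp add: mult_ac)
      also have "\<dots> = e0 + int p ^ (k * N - l * r') * (\<Sum>j=1..l. s j * int p ^ (r * (l - j)) * (\<Sum>i=1..l. V j i * (n - \<eta>) ^ (m + i)))"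
        by (simp add: Y e0_def algebra_simps sum_subtractf)
      finally have E: "mphase k u n - e0 = int p ^ (k * N - l * r') * (\<Sum>j=1..l. s j * int p ^ (r * (l - j)) * (\<Sum>i=1..l. V j i * (n - \<eta>) ^ (m + i)))"
        by simp
      have "int p ^ (l * r') dvd (n - \<eta>) ^ (m + i)" if "i \<in> {1..l}" for i
      proof -
        have "int p ^ b dvd n - \<eta>" using n by (metis dvd_minus_mod)
        then have "int p ^ (b * (m + i)) dvd (n - \<eta>) ^ (m + i)" by (simp only: power_mult dvd_power_same)
        moreover have "int p ^ (l * r') dvd int p ^ (b * (m + i))"
        proof (intro le_imp_power_dvd)
          have "l * r' \<le> (m + 1) * b" using r'(3) by (simp add: m_def)
          also have "\<dots> \<le> (m + i) * b" using that by (intro mult_right_mono) auto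
          finally show "l * r' \<le> b * (m + i)" by (simp add: mult.commute)
        qed
        ultimately show ?thesis by (rule dvd_trans[rotated])
      qed
      then have "int p ^ (k * N - l * r') * int p ^ (l * r') dvd mphase k u n - e0"
        unfolding E by (intro mult_dvd_mono dvd_refl dvd_sum dvd_mult) auto
      then have "int q dvd mphase k u n - e0" using lr by (simp add: q_def flip: power_add)
      then obtain h where "mphase k u n - e0 = int q * h" by (elim dvdE)
      then have "of_int (mphase k u n) / real q - of_int e0 / real q = of_int h"
        using q_pos by (simp add: diff_divide_distrib[symmetric] flip: of_int_diff)
      then show "of_int (mphase k u n) / real q - of_int e0 / real q \<in> \<int>" by simp
    qed
    have "F b \<eta> (shift u x) = unit_exp (of_int e0 / of_nat q) * F b \<eta> x"
      unfolding F_def sum_distrib_left by (intro sum.cong refl) (simp add: summand_shift ph)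
    then show ?thesis by (simp add: norm_mult u_def)
  qed
  have "(\<Sum>x\<in>X. norm (F b \<eta> x) ^ (2 * (tri k - tri l)) * norm (F r \<xi> x) ^ (2 * tri l)) \<le>
     D * (\<Sum>d\<in>children p r \<xi> r'. (\<Sum>x\<in>X. norm (F b \<eta> x) ^ (2 * (tri k - tri l)) * norm (F r' d x) ^ (2 * tri l)) powr (1 / tri l)) ^ tri l"
    by (rule step_general[OF dec D l(1) r'(1) lr \<xi> Ycong]) (simp_all only: inv, simp_all)
  then show ?thesis by (simp add: mix_def mult.commute)
qed

end

section \<open>The bilinear iteration\<close>

lemma tri_eq_0_iff [simp]: "tri l = 0 \<longleftrightarrow> l = 0"
  by (cases l) (auto simp: tri_Suc)

lemma powr_inverse_power:
  fixes x :: real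
  assumes "x \<ge> 0" "r > (0::nat)"
  shows "(x ^ r) powr (1 / r) = x"
  using assms by (cases "x = 0") (auto simp: powr_powr power_0_left simp flip: powr_realpow)

lemma real_tri: "real (tri l) = real l * (real l + 1) / 2"
proof -
  have "real (2 * tri l) = real (l * (l + 1))" by (simp only: two_tri)
  then show ?thesis by (simp add: field_simps)
qed

text \<open>Exponents for Hoelder's inequality between degree \<open>k - l\<close> with the two
  classes exchanged and degree \<open>l - 1\<close>. The first identity determines t; the second
  follows because both exponents of a mixed moment add up to \<open>tri k\<close>.\<close>

lemma tri_interpolation:
  assumes "1 \<le> l" "l < k" "t = 1 / (real k - real l + 1)"
  shows "real (tri l) = t * real (tri k - tri (k - l)) + (1 - t) * real (tri (l - 1))"
    and "real (tri k - tri l) = t * real (tri (k - l)) + (1 - t) * real (tri k - tri (l - 1))"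
proof -
  have d: "real (tri k - tri i) = real (tri k) - real (tri i)" if "i \<le> k" for i
    using tri_mono[OF that] by simp
  have D: "real k - real l + 1 > 0" using assms by simp
  have t: "1 - t = (real k - real l) / (real k - real l + 1)" using D assms(3) by (simp add: field_simps)
  have r: "real (k - l) = real k - real l" "real (l - 1) = real l - 1" using assms by auto
  have e1: "real (tri k - tri (k - l)) = real l * (2 * real k - real l + 1) / 2"
    using assms by (simp add: d real_tri r field_simps)
  show A: "real (tri l) = t * real (tri k - tri (k - l)) + (1 - t) * real (tri (l - 1))"
  proof -
    have "real (tri l) * (real k - real l + 1) = real l * (2 * real k - real l + 1) / 2 + (real k - real l) * real (tri (l - 1))"
      unfolding real_tri r by (simp add: field_simps)
    then have "real (tri l) = (real l * (2 * real k - real l + 1) / 2 + (real k - real l) * real (tri (l - 1))) / (real k - real l + 1)"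
      using D by (simp only: eq_divide_eq) simp
    then show ?thesis unfolding e1 t unfolding assms(3) by (simp add: add_divide_distrib)
  qed
  have "real (tri k - tri l) = real (tri k) - real (tri l)" using assms by (simp add: d)
  also have "\<dots> = t * (real (tri k) - real (tri k - tri (k - l))) + (1 - t) * (real (tri k) - real (tri (l - 1)))"
    unfolding A by (simp add: algebra_simps)
  also have "\<dots> = t * real (tri (k - l)) + (1 - t) * real (tri k - tri (l - 1))"
    using assms by (simp add: d)
  finally show "real (tri k - tri l) = t * real (tri (k - l)) + (1 - t) * real (tri k - tri (l - 1))" .
qed

lemma power_interpolation:
  fixes x y :: real
  assumes l: "1 \<le> l" "l < k" and t: "t = 1 / (real k - real l + 1)" and x: "x \<ge> 0" and y: "y \<ge> 0"
  shows "(y ^ tri (k - l) * x ^ (tri k - tri (k - l))) powr t * (x ^ tri (l - 1) * y ^ (tri k - tri (l - 1))) powr (1 - t)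
    = x ^ tri l * y ^ (tri k - tri l)"
proof -
  have lt: "tri i < tri k" if "i < k" for i
    using tri_mono[of "Suc i" k] that by (simp add: tri_Suc)
  show ?thesis
  proof (cases "x = 0 \<or> y = 0")
    case True
    have "tri (k - l) < tri k" "tri l < tri k" "tri l > 0" "tri (k - l) > 0" using l by (auto intro!: lt)
    then show ?thesis using True by (auto simp: power_0_left)
  next
    case False
    then have "x > 0" "y > 0" using x y by auto
    then have "(y ^ tri (k - l) * x ^ (tri k - tri (k - l))) powr t * (x ^ tri (l - 1) * y ^ (tri k - tri (l - 1))) powr (1 - t)
       = x powr (t * real (tri k - tri (k - l)) + (1 - t) * real (tri (l - 1))) * y powr (t * real (tri (k - l)) + (1 - t) * real (tri k - tri (l - 1)))"
      by (simp add: powr_realpow[symmetric] powr_mult powr_powr powr_add mult_ac del: of_nat_diff)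
    also have "\<dots> = x ^ tri l * y ^ (tri k - tri l)"
      unfolding tri_interpolation[OF l t, symmetric] using \<open>x > 0\<close> \<open>y > 0\<close> by (simp add: powr_realpow)
    finally show ?thesis .
  qed
qed

definition decoupling_exponents :: "nat \<Rightarrow> nat \<Rightarrow> real set" where
  "decoupling_exponents p l = {e. e > 0 \<and> (\<exists>C\<ge>1. \<forall>N. decoupling p l N (C * real p powr (e * real N)))}"

text \<open>A single step in degree \<open>l\<close> can only enlarge the scale \<open>a\<close> by
  the factor 1 + 1 / l, so it is iterated. Each use costs the decoupling constant \<open>C\<close>.
  Decoupling is invoked with exponent e / 2, and the other half of \<open>e\<close> absorbs
  \<open>C\<close> if the step is long enough; only the last step pays \<open>C\<close>
  itself.\<close>

lemma multi_step:
  assumes pr: "prime p" "k < p" and l: "1 \<le> l" "l \<le> k"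
    and IH: "\<forall>e>0. e \<in> decoupling_exponents p l" and e: "e > 0"
  shows "\<exists>C\<ge>1. \<exists>r0\<ge>1. \<forall>N A g a a' b \<xi> \<eta>. moment_sum p k A \<longrightarrow> r0 \<le> a \<longrightarrow> a \<le> a' \<longrightarrow> l * a' \<le> (k - l + 1) * b \<longrightarrow> b \<le> N \<longrightarrow>
     \<xi> \<in> {0..<int p ^ a} \<longrightarrow> \<eta> \<in> {0..<int p ^ b} \<longrightarrow> \<not> int p dvd \<xi> - \<eta> \<longrightarrow>
     moment_sum.mix p k N A g l a \<xi> b \<eta> \<le> C * real p powr (e * (real a' - real a)) *
        (\<Sum>d\<in>children p a \<xi> a'. moment_sum.mix p k N A g l a' d b \<eta> powr (1 / tri l)) ^ tri l"
proof -
  obtain C where C: "C \<ge> 1" "\<And>N. decoupling p l N (C * real p powr (e / 2 * real N))"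
    using IH[rule_format, of "e / 2"] e by (auto simp: decoupling_exponents_def)
  have p1: "real p > 1" using pr(1) prime_gt_1_nat by simp
  define R where "R = nat \<lceil>ln C / (ln (real p) * (e / 2))\<rceil> + 1"
  have R: "C \<le> real p powr (e / 2 * real M)" if M: "M \<ge> R" for M
  proof -
    have "ln C / (ln (real p) * (e / 2)) \<le> real M" using M unfolding R_def by linarith
    then have "ln C \<le> e / 2 * real M * ln (real p)" using p1 e by (simp add: field_simps)
    then have "exp (ln C) \<le> exp (e / 2 * real M * ln (real p))" by (simp only: exp_le_cancel_iff)
    then show ?thesis using C(1) p1 by (simp add: powr_def)
  qed
  \<comment> \<open>From this scale on, the step length a div l is at least \<open>R\<close>, the
    length that absorbs the constant.\<close>
  define r0 where "r0 = l * R"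
  have r0: "r0 \<ge> 1" using l by (simp add: r0_def R_def)
  have main: "moment_sum.mix p k N A g l a \<xi> b \<eta> \<le> C * real p powr (e * (real a' - real a)) *
        (\<Sum>d\<in>children p a \<xi> a'. moment_sum.mix p k N A g l a' d b \<eta> powr (1 / tri l)) ^ tri l"
    if ms: "moment_sum p k A" and a: "r0 \<le> a" "a \<le> a'" and b: "l * a' \<le> (k - l + 1) * b" "b \<le> N"
      and \<xi>: "\<xi> \<in> {0..<int p ^ a}" and \<eta>: "\<eta> \<in> {0..<int p ^ b}" and sep: "\<not> int p dvd \<xi> - \<eta>"
    for N A g a a' b \<xi> \<eta>
    using a \<xi> sep
  proof (induction "a' - a" arbitrary: a \<xi> rule: less_induct)
    case less
    interpret moment_sum p k N A g by fact
    show ?case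
    proof (cases "l * a' \<le> (l + 1) * a")
      case True
      have "mix l a \<xi> b \<eta> \<le> C * real p powr (e / 2 * real (a' - a)) * (\<Sum>d\<in>children p a \<xi> a'. mix l a' d b \<eta> powr (1 / tri l)) ^ tri l"
        by (rule step_lower_degree[OF C(2)]) (use l pr less.prems b True C(1) \<eta> in auto)
      also have "\<dots> \<le> C * real p powr (e * (real a' - real a)) * (\<Sum>d\<in>children p a \<xi> a'. mix l a' d b \<eta> powr (1 / tri l)) ^ tri l"
        using less.prems(2) e C(1) p1 by (intro mult_right_mono mult_left_mono powr_mono zero_le_power sum_nonneg) auto
      finally show ?thesis .
    next
      case False
      \<comment> \<open>The longest step permitted by l * (a + M) <= (l + 1) * a.\<close>
      define M where "M = a div l"
      define r where "r = a + M"
      have M: "M \<ge> R" unfolding M_def using less.prems(1) l by (simp add: r0_def less_eq_div_iff_mult_less_eq mult.commute)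
      have lM: "l * M \<le> a" by (simp add: M_def)
      have ra': "r \<le> a'"
      proof -
        have "l * r \<le> (l + 1) * a" using lM by (simp add: r_def algebra_simps)
        then have "l * r \<le> l * a'" using False by linarith
        then show ?thesis using l by simp
      qed
      have "M \<ge> 1" using M by (simp add: R_def)
      have K1: "C * real p powr (e / 2 * real M) \<le> real p powr (e * (real r - real a))"
      proof -
        have "C * real p powr (e / 2 * real M) \<le> real p powr (e / 2 * real M) * real p powr (e / 2 * real M)"
          using R[OF M] by (intro mult_right_mono) auto
        also have "\<dots> = real p powr (e * (real r - real a))" by (simp add: powr_add[symmetric] r_def field_simps)
        finally show ?thesis .
      qed
      define K2 where "K2 = C * real p powr (e * (real a' - real r))"
      have K20: "K2 \<ge> 0" using C(1) by (simp add: K2_def)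
      have IH': "mix l r d b \<eta> \<le> K2 * (\<Sum>d'\<in>children p r d a'. mix l a' d' b \<eta> powr (1 / tri l)) ^ tri l"
        if d: "d \<in> children p a \<xi> r" for d
        unfolding K2_def
      proof (rule less.hyps)
        show "a' - r < a' - a" using \<open>M \<ge> 1\<close> ra' by (simp add: r_def)
        show "r0 \<le> r" using less.prems(1) by (simp add: r_def)
        show "d \<in> {0..<int p ^ r}" using children_mem[OF d] less.prems(1) r0 by auto
        have "int p dvd d - \<xi>" using children_mem[OF d] less.prems(1) r0 by auto
        then show "\<not> int p dvd d - \<eta>" using less.prems(4)
          by (metis (no_types, opaque_lifting) add_diff_cancel_left diff_add_cancel diff_diff_eq2 dvd_diff)
      qed (use ra' in auto)
      have "mix l a \<xi> b \<eta> \<le> C * real p powr (e / 2 * real M) * (\<Sum>d\<in>children p a \<xi> r. mix l r d b \<eta> powr (1 / tri l)) ^ tri l"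
      proof (rule step_lower_degree[OF C(2)])
        have "l * r \<le> l * a'" using ra' by simp
        then show "l * r \<le> (k - l + 1) * b" using b(1) by linarith
      qed (use l pr less.prems b C(1) \<eta> lM in \<open>auto simp: r_def algebra_simps\<close>)
      also have "\<dots> \<le> real p powr (e * (real r - real a)) * (\<Sum>d\<in>children p a \<xi> r. mix l r d b \<eta> powr (1 / tri l)) ^ tri l"
        using K1 by (intro mult_right_mono zero_le_power sum_nonneg) auto
      also have "(\<Sum>d\<in>children p a \<xi> r. mix l r d b \<eta> powr (1 / tri l)) ^ tri l
        \<le> (\<Sum>d\<in>children p a \<xi> r. K2 powr (1 / tri l) * (\<Sum>d'\<in>children p r d a'. mix l a' d' b \<eta> powr (1 / tri l))) ^ tri l"
      proof (intro power_mono sum_mono sum_nonneg)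
        fix d assume d: "d \<in> children p a \<xi> r"
        have "mix l r d b \<eta> powr (1 / tri l) \<le> (K2 * (\<Sum>d'\<in>children p r d a'. mix l a' d' b \<eta> powr (1 / tri l)) ^ tri l) powr (1 / tri l)"
          using IH'[OF d] by (intro powr_mono2) (auto simp: mix_nonneg)
        also have "\<dots> = K2 powr (1 / tri l) * (\<Sum>d'\<in>children p r d a'. mix l a' d' b \<eta> powr (1 / tri l))"
        proof -
          have "(\<Sum>d'\<in>children p r d a'. mix l a' d' b \<eta> powr (1 / tri l)) \<ge> 0" by (intro sum_nonneg) auto
          then show ?thesis using l by (simp add: powr_mult powr_inverse_power)
        qed
        finally show "mix l r d b \<eta> powr (1 / tri l) \<le> K2 powr (1 / tri l) * (\<Sum>d'\<in>children p r d a'. mix l a' d' b \<eta> powr (1 / tri l))" .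
      qed auto
      also have "\<dots> = K2 * (\<Sum>d\<in>children p a \<xi> r. \<Sum>d'\<in>children p r d a'. mix l a' d' b \<eta> powr (1 / tri l)) ^ tri l"
        unfolding sum_distrib_left[symmetric] power_mult_distrib using K20 l by (simp add: power_powr_inverse)
      also have "(\<Sum>d\<in>children p a \<xi> r. \<Sum>d'\<in>children p r d a'. mix l a' d' b \<eta> powr (1 / tri l)) = (\<Sum>d\<in>children p a \<xi> a'. mix l a' d b \<eta> powr (1 / tri l))"
        using ra' p_pos by (intro sum_children) (auto simp: r_def)
      also have "real p powr (e * (real r - real a)) * (K2 * (\<Sum>d\<in>children p a \<xi> a'. mix l a' d b \<eta> powr (1 / tri l)) ^ tri l)
         = C * real p powr (e * (real a' - real a)) * (\<Sum>d\<in>children p a \<xi> a'. mix l a' d b \<eta> powr (1 / tri l)) ^ tri l"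
      proof -
        have "e * (real a' - real a) = e * (real r - real a) + e * (real a' - real r)" by (simp add: algebra_simps)
        then show ?thesis by (simp add: K2_def powr_add)
      qed
      finally show ?thesis by (simp add: mult_left_mono)
    qed
  qed
  show ?thesis by (rule exI[of _ C], intro conjI C(1) exI[of _ r0] r0 allI impI, rule main)
qed

context moment_sum
begin

text \<open>Exchanging the two classes in the first factor keeps both degrees, \<open>k - l\<close>
  and \<open>l - 1\<close>, below \<open>k\<close>, which is the range covered by the bilinear
  estimates.\<close>

lemma mix_interpolation:
  assumes l: "1 \<le> l" "l < k" and t: "t = 1 / (real k - real l + 1)"
  shows "mix l a \<xi> b \<eta> \<le> mix (k - l) b \<eta> a \<xi> powr t * mix (l - 1) a \<xi> b \<eta> powr (1 - t)"
proof -
  have "0 < t" "t < 1" using l t by auto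
  have "mix l a \<xi> b \<eta> = (\<Sum>x\<in>X. (norm (F b \<eta> x) ^ (2 * tri (k - l)) * norm (F a \<xi> x) ^ (2 * (tri k - tri (k - l)))) powr t *
     (norm (F a \<xi> x) ^ (2 * tri (l - 1)) * norm (F b \<eta> x) ^ (2 * (tri k - tri (l - 1)))) powr (1 - t))"
    unfolding mix_def power_mult by (intro sum.cong refl power_interpolation[OF l t, symmetric]) auto
  also have "\<dots> \<le> mix (k - l) b \<eta> a \<xi> powr t * mix (l - 1) a \<xi> b \<eta> powr (1 - t)"
    unfolding mix_def by (intro Hoelder_sum) (use \<open>0 < t\<close> \<open>t < 1\<close> in auto)
  finally show ?thesis .
qed

text \<open>The class modulo p^a is first refined to scale \<open>a'\<close>, then every refined
  mixed moment is interpolated. The powers of \<open>nrm\<close> recombine by the same exponent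
  identity, so after taking the root of order \<open>tri l\<close> the bound is linear in
  \<open>nrm a' d\<close>, and summing over subclasses is an equality.\<close>

lemma bil_step:
  assumes l: "1 \<le> l" "l < k" and t: "t = 1 / (real k - real l + 1)"
    and aa': "1 \<le> a" "a \<le> a'" "a' \<le> N"
    and ms: "\<And>\<xi> \<eta>. \<xi> \<in> {0..<int p ^ a} \<Longrightarrow> \<eta> \<in> {0..<int p ^ b} \<Longrightarrow> \<not> int p dvd \<xi> - \<eta> \<Longrightarrow>
       mix l a \<xi> b \<eta> \<le> L * (\<Sum>d\<in>children p a \<xi> a'. mix l a' d b \<eta> powr (1 / tri l)) ^ tri l"
    and L: "L \<ge> 0" and b1: "bil (k - l) b a' K1" "K1 \<ge> 0" and b2: "bil (l - 1) a' b K2" "K2 \<ge> 0"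
  shows "bil l a b (L * (K1 powr t * K2 powr (1 - t)))"
  unfolding bil_def
proof (intro ballI impI)
  fix \<xi> \<eta> assume \<xi>: "\<xi> \<in> {0..<int p ^ a}" and \<eta>: "\<eta> \<in> {0..<int p ^ b}" and sep: "\<not> int p dvd \<xi> - \<eta>"
  have "0 < t" "t < 1" using l t by auto
  define K where "K = K1 powr t * K2 powr (1 - t) * nrm b \<eta> ^ (tri k - tri l)"
  have K0: "K \<ge> 0" by (simp add: K_def nrm_nonneg)
  have *: "mix l a' d b \<eta> powr (1 / tri l) \<le> K powr (1 / tri l) * nrm a' d" if d: "d \<in> children p a \<xi> a'" for d
  proof -
    have dm: "d \<in> {0..<int p ^ a'}" "int p dvd d - \<xi>" using children_mem[OF d aa'(1)] by auto
    have sep1: "\<not> int p dvd d - \<eta>" using dm(2) sep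
      by (metis (no_types, opaque_lifting) add_diff_cancel_left diff_add_cancel diff_diff_eq2 dvd_diff)
    then have sep2: "\<not> int p dvd \<eta> - d" by (metis dvd_minus_iff minus_diff_eq)
    have "mix l a' d b \<eta> \<le> mix (k - l) b \<eta> a' d powr t * mix (l - 1) a' d b \<eta> powr (1 - t)"
      by (rule mix_interpolation[OF l t])
    also have "\<dots> \<le> (K1 * (nrm b \<eta> ^ tri (k - l) * nrm a' d ^ (tri k - tri (k - l)))) powr t *
        (K2 * (nrm a' d ^ tri (l - 1) * nrm b \<eta> ^ (tri k - tri (l - 1)))) powr (1 - t)"
      using b1(1) b2(1) dm(1) \<eta> sep1 sep2 \<open>0 < t\<close> \<open>t < 1\<close> unfolding bil_def
      by (intro mult_mono powr_mono2) (auto simp: mix_nonneg)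
    also have "\<dots> = K1 powr t * K2 powr (1 - t) * ((nrm b \<eta> ^ tri (k - l) * nrm a' d ^ (tri k - tri (k - l))) powr t *
        (nrm a' d ^ tri (l - 1) * nrm b \<eta> ^ (tri k - tri (l - 1))) powr (1 - t))"
      by (simp only: powr_mult[of K1] powr_mult[of K2] mult_ac)
    also have "\<dots> = K * nrm a' d ^ tri l"
      by (subst power_interpolation[OF l t]) (auto simp: nrm_nonneg K_def)
    finally have "mix l a' d b \<eta> powr (1 / tri l) \<le> (K * nrm a' d ^ tri l) powr (1 / tri l)"
      by (intro powr_mono2) (auto simp: mix_nonneg)
    also have "\<dots> = K powr (1 / tri l) * nrm a' d"
      using l nrm_nonneg[of a' d] by (simp add: powr_mult powr_inverse_power)
    finally show ?thesis .
  qed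
  have "mix l a \<xi> b \<eta> \<le> L * (\<Sum>d\<in>children p a \<xi> a'. mix l a' d b \<eta> powr (1 / tri l)) ^ tri l"
    by (rule ms[OF \<xi> \<eta> sep])
  also have "\<dots> \<le> L * (\<Sum>d\<in>children p a \<xi> a'. K powr (1 / tri l) * nrm a' d) ^ tri l"
    by (intro mult_left_mono power_mono sum_mono * sum_nonneg L) auto
  also have "\<dots> = L * (K * nrm a \<xi> ^ tri l)"
    unfolding sum_distrib_left[symmetric] nrm_children[OF aa'(2,3)] power_mult_distrib
    using K0 l by (simp add: power_powr_inverse)
  finally show "mix l a \<xi> b \<eta> \<le> L * (K1 powr t * K2 powr (1 - t)) * (nrm a \<xi> ^ tri l * nrm b \<eta> ^ (tri k - tri l))"
    by (simp add: K_def mult_ac)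
qed

text \<open>In degree 0 only the class modulo p^b remains, and rescaling it leaves decoupling at
  scale \<open>N - b\<close>. This is the source of all gain in the iteration.\<close>

lemma bil_zero:
  assumes "decoupling p k (N - b) D" "D \<ge> 0" "b \<le> N"
  shows "bil 0 a b D"
  unfolding bil_def mix_def using rescale_nrm[OF assms] by simp

text \<open>Hoelder's inequality between the two pure moments, each rescaled. Nothing is gained, in
  agreement with the initial value 0 of \<open>gain\<close> for l > 0.\<close>

lemma bil_trivial:
  assumes "decoupling p k (N - a) D" "decoupling p k (N - b) D" "D \<ge> 0" "a \<le> N" "b \<le> N" "1 \<le> l" "l < k"
  shows "bil l a b D"
  unfolding bil_def
proof (intro ballI impI)
  fix \<xi> \<eta> assume \<xi>: "\<xi> \<in> {0..<int p ^ a}" and \<eta>: "\<eta> \<in> {0..<int p ^ b}"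
  define t where "t = real (tri l) / real (tri k)"
  have lt: "tri l < tri k" using tri_mono[of "Suc l" k] assms by (simp add: tri_Suc)
  have l0: "tri l > 0" using assms by simp
  have t: "0 < t" "t < 1" using lt l0 assms(7) by (auto simp: t_def divide_simps)
  have t1: "real (tri k) * t = real (tri l)" "real (tri k) * (1 - t) = real (tri k - tri l)"
    using lt by (auto simp: t_def field_simps)
  have pw: "(x ^ tri k) powr t * (y ^ tri k) powr (1 - t) = x ^ tri l * y ^ (tri k - tri l)" if "x \<ge> 0" "y \<ge> 0" for x y :: real
  proof (cases "x = 0 \<or> y = 0")
    case True
    then show ?thesis using lt l0 assms(7) by (auto simp: power_0_left)
  next
    case False
    then have "(x ^ tri k) powr t * (y ^ tri k) powr (1 - t) = x powr (real (tri k) * t) * y powr (real (tri k) * (1 - t))"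
      using that by (simp add: powr_powr flip: powr_realpow)
    then show ?thesis using False that unfolding t1 by (simp add: powr_realpow)
  qed
  have "mix l a \<xi> b \<eta> = (\<Sum>x\<in>X. (norm (F a \<xi> x) ^ (2 * tri k)) powr t * (norm (F b \<eta> x) ^ (2 * tri k)) powr (1 - t))"
    unfolding mix_def power_mult by (simp add: pw)
  also have "\<dots> \<le> (\<Sum>x\<in>X. norm (F a \<xi> x) ^ (2 * tri k)) powr t * (\<Sum>x\<in>X. norm (F b \<eta> x) ^ (2 * tri k)) powr (1 - t)"
    using t by (intro Hoelder_sum) auto
  also have "\<dots> \<le> (D * nrm a \<xi> ^ tri k) powr t * (D * nrm b \<eta> ^ tri k) powr (1 - t)"
    using t rescale_nrm[OF assms(1,3,4) \<xi>] rescale_nrm[OF assms(2,3,5) \<eta>]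
    by (intro mult_mono powr_mono2) (auto intro!: sum_nonneg)
  also have "\<dots> = (D powr t * D powr (1 - t)) * ((nrm a \<xi> ^ tri k) powr t * (nrm b \<eta> ^ tri k) powr (1 - t))"
    by (simp only: powr_mult[of D] mult_ac)
  also have "D powr t * D powr (1 - t) = D" using assms(3) by (simp flip: powr_add)
  finally show "mix l a \<xi> b \<eta> \<le> D * (nrm a \<xi> ^ tri l * nrm b \<eta> ^ (tri k - tri l))"
    by (simp add: pw nrm_nonneg)
qed

lemma bil_mono: "bil l a b K \<Longrightarrow> K \<le> K' \<Longrightarrow> bil l a b K'"
  unfolding bil_def by (meson mult_nonneg_nonneg mult_right_mono nrm_nonneg order_trans zero_le_power)

end

text \<open>Starting from decoupling with exponent \<open>e\<close>, the iteration improves the trivial bilinear estimate at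
  the scale \<open>b\<close> by \<open>p\<close> to the power \<open>- e * gain k t l * b\<close> after \<open>t\<close> rounds. The recursion is that of
  \<open>mix_interpolation\<close>; the sum over \<open>l\<close> is unbounded in \<open>t\<close>, so no \<open>e > 0\<close> can be optimal.\<close>

fun gain :: "nat \<Rightarrow> nat \<Rightarrow> nat \<Rightarrow> real" where
  "gain k 0 l = (if l = 0 then 1 else 0)"
| "gain k (Suc t) l = (if l = 0 then 1 else
     gain k t (k - l) / real l + (real k - real l) / (real k - real l + 1) * gain k t (l - 1))"

lemma gain_0 [simp]: "gain k t 0 = 1"
  by (cases t) auto

text \<open>One round sends \<open>gain k t m\<close> to the indices k - m and m + 1 with weights 1
  / (k - m) and (k - m - 1) / (k - m). These add up to 1, and the second is 0 at m = k - 1, so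
  nothing is lost there. The total therefore changes only by the inflow (k - 1) / k from index
  0.\<close>

lemma sum_gain:
  assumes "k \<ge> 1"
  shows "(\<Sum>l=1..k - 1. gain k t l) = real t * (real k - 1) / real k"
proof (induction t)
  case (Suc t)
  define h where "h m = (real k - real m - 1) / (real k - real m) * gain k t m" for m
  have "(\<Sum>l=1..k - 1. gain k (Suc t) l) = (\<Sum>l=1..k - 1. gain k t (k - l) / real l) + (\<Sum>l=1..k - 1. h (l - 1))"
    unfolding sum.distrib[symmetric] by (intro sum.cong refl) (auto simp: h_def of_nat_diff)
  also have "(\<Sum>l=1..k - 1. gain k t (k - l) / real l) = (\<Sum>m=1..k - 1. gain k t m / (real k - real m))"
    by (rule sum.reindex_bij_witness[of _ "\<lambda>m. k - m" "\<lambda>l. k - l"]) (auto simp: of_nat_diff)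
  also have "(\<Sum>l=1..k - 1. h (l - 1)) = (\<Sum>m<k - 1. h m)"
    by (rule sum.reindex_bij_witness[of _ Suc "\<lambda>l. l - 1"]) auto
  also have "\<dots> = (\<Sum>m\<le>k - 1. h m)"
  proof -
    have "(\<Sum>m\<le>k - 1. h m) = (\<Sum>m<k - 1. h m) + h (k - 1)"
      by (simp only: lessThan_Suc_atMost[symmetric] sum.lessThan_Suc)
    then show ?thesis using assms by (simp add: h_def of_nat_diff)
  qed
  also have "\<dots> = h 0 + (\<Sum>m=1..k - 1. h m)"
    by (simp add: atLeast0AtMost[symmetric] sum.atLeast_Suc_atMost)
  also have "(\<Sum>m=1..k - 1. gain k t m / (real k - real m)) + (h 0 + (\<Sum>m=1..k - 1. h m)) = h 0 + (\<Sum>m=1..k - 1. gain k t m)"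
  proof -
    have "gain k t m / (real k - real m) + h m = gain k t m" if "m \<in> {1..k - 1}" for m
    proof -
      have "g / d + (d - 1) / d * g = g" if "d > 0" for d g :: real
        using that by (simp add: field_simps)
      moreover have "real k - real m > 0" using that assms by auto
      ultimately show ?thesis by (simp only: h_def)
    qed
    then show ?thesis by (simp add: sum.distrib[symmetric])
  qed
  finally show ?case using assms Suc by (simp add: h_def field_simps)
qed auto

text \<open>The side conditions keep the scales usable. Divisibility of b by
  \<open>fact k ^ t\<close> makes the next scale (k - l + 1) b / l an integer that is still
  divisible by the preceding power. The condition \<open>k ^ Suc t * b \<le> N\<close> keeps all
  later scales below \<open>N\<close>, since one round enlarges b at most by the factor k.\<close>

lemma bil_iteration:
  assumes pr: "prime p" "k < p" and k2: "k \<ge> 2"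
    and IHl: "\<forall>l e. 1 \<le> l \<longrightarrow> l < k \<longrightarrow> e > 0 \<longrightarrow> e \<in> decoupling_exponents p l"
    and E: "E \<ge> 0" and C0: "C0 \<ge> 1" and dec: "\<And>M. decoupling p k M (C0 * real p powr (E * real M))"
  shows "e > 0 \<Longrightarrow> \<exists>C\<ge>1. \<exists>r0\<ge>1. \<forall>N A g. moment_sum p k A \<longrightarrow> (\<forall>l a b. l < k \<longrightarrow> fact k ^ t dvd b \<longrightarrow> r0 \<le> a \<longrightarrow> r0 \<le> b \<longrightarrow>
     l * a \<le> (k - l + 1) * b \<longrightarrow> k ^ Suc t * b \<le> N \<longrightarrow>
     moment_sum.bil p k N A g l a b (C * real p powr (E * real N - E * gain k t l * real b + e * real b)))"
proof (induction t arbitrary: e)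
  case 0
  have p1: "real p > 1" using pr(1) prime_gt_1_nat by simp
  show ?case
  proof (intro exI[of _ C0] exI[of _ 1] conjI allI impI C0)
    fix N A g l a b
    assume ms: "moment_sum p k A" and l: "l < k" and ab: "1 \<le> a" "1 \<le> b" and lab: "l * a \<le> (k - l + 1) * b" and N: "k ^ Suc 0 * b \<le> N"
    interpret moment_sum p k N A g by fact
    have "1 * b \<le> k * b" using k2 by (intro mult_right_mono) auto
    also have "\<dots> \<le> N" using N by simp
    finally have bN: "b \<le> N" by simp
    show "bil l a b (C0 * real p powr (E * real N - E * gain k 0 l * real b + e * real b))"
    proof (cases "l = 0")
      case True
      have "bil l a b (C0 * real p powr (E * real (N - b)))"
        unfolding True by (rule bil_zero[OF dec]) (use C0 bN in auto)
      then show ?thesis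
        by (rule bil_mono) (use True 0 C0 p1 bN in \<open>auto intro!: mult_left_mono powr_mono simp: of_nat_diff algebra_simps\<close>)
    next
      case False
      have "a \<le> l * a" using False by simp
      also have "\<dots> \<le> (k - l + 1) * b" by fact
      also have "\<dots> \<le> k * b" using False l by (intro mult_right_mono) auto
      finally have aN: "a \<le> N" using N by simp
      have d: "decoupling p k (N - c) (C0 * real p powr (E * real N))" for c
        by (rule decoupling_mono[OF dec]) (use C0 E p1 in \<open>auto intro!: mult_left_mono powr_mono\<close>)
      have "bil l a b (C0 * real p powr (E * real N))"
        by (rule bil_trivial[OF d d]) (use C0 False l aN bN in auto)
      then show ?thesis
        by (rule bil_mono) (use False 0 C0 p1 in \<open>auto intro!: mult_left_mono powr_mono\<close>)
    qed
  qed simp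
next
  case (Suc t)
  have p1: "real p > 1" using pr(1) prime_gt_1_nat by simp
  \<comment> \<open>A round loses e1 times a' for the refinement, and e1 times b / l and at most b
    through the two bilinear bounds. As a' is at most k * b, this is at most e1 * (k + 2) *
    b.\<close>
  define e1 where "e1 = e / (real k + 2)"
  have e1: "e1 > 0" "e1 * (real k + 2) = e" using Suc.prems by (auto simp: e1_def)
  obtain C2 r2 where C2: "C2 \<ge> 1" and r2: "r2 \<ge> 1" and bil2: "\<forall>N A g. moment_sum p k A \<longrightarrow> (\<forall>l a b. l < k \<longrightarrow> fact k ^ t dvd b \<longrightarrow> r2 \<le> a \<longrightarrow> r2 \<le> b \<longrightarrow>
     l * a \<le> (k - l + 1) * b \<longrightarrow> k ^ Suc t * b \<le> N \<longrightarrow>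
     moment_sum.bil p k N A g l a b (C2 * real p powr (E * real N - E * gain k t l * real b + e1 * real b)))"
    using Suc.IH[OF e1(1)] by (elim exE conjE) (rule that)
  have "\<forall>l\<in>{1..<k}. \<exists>cr. fst cr \<ge> 1 \<and> snd cr \<ge> 1 \<and> (\<forall>N A g a a' b \<xi> \<eta>. moment_sum p k A \<longrightarrow> snd cr \<le> a \<longrightarrow> a \<le> a' \<longrightarrow> l * a' \<le> (k - l + 1) * b \<longrightarrow> b \<le> N \<longrightarrow>
     \<xi> \<in> {0..<int p ^ a} \<longrightarrow> \<eta> \<in> {0..<int p ^ b} \<longrightarrow> \<not> int p dvd \<xi> - \<eta> \<longrightarrow>
     moment_sum.mix p k N A g l a \<xi> b \<eta> \<le> fst cr * real p powr (e1 * (real a' - real a)) *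
        (\<Sum>d\<in>children p a \<xi> a'. moment_sum.mix p k N A g l a' d b \<eta> powr (1 / tri l)) ^ tri l)" (is "\<forall>l\<in>_. \<exists>cr. ?P l cr")
  proof
    fix l assume l: "l \<in> {1..<k}"
    then have l': "1 \<le> l" "l \<le> k" "l < k" by auto
    have IH': "\<forall>e>0. e \<in> decoupling_exponents p l" using IHl l'(1,3) by blast
    from multi_step[OF pr l'(1,2) IH' e1(1)] show "\<exists>cr. ?P l cr"
    proof (elim exE conjE, goal_cases)
      case (1 C r0)
      show ?case by (rule exI[of _ "(C, r0)"], unfold fst_conv snd_conv) (intro conjI 1(1) 1(2), rule 1(3))
    qed
  qed
  then have "\<exists>cr. \<forall>l\<in>{1..<k}. ?P l (cr l)" by (rule bchoice)
  then obtain cr where cr: "\<forall>l\<in>{1..<k}. ?P l (cr l)" by (rule exE)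
  have cr1: "fst (cr l) \<ge> 1" if "l \<in> {1..<k}" for l
    by (rule bspec[OF cr that, THEN conjunct1])
  note cr3 = bspec[OF cr, THEN conjunct2, THEN conjunct2, rule_format]
  define C where "C = (1 + (\<Sum>l\<in>{1..<k}. fst (cr l))) * C2 * C0"
  define r0 where "r0 = r2 + (\<Sum>l\<in>{1..<k}. snd (cr l))"
  have S0: "(\<Sum>l\<in>{1..<k}. fst (cr l)) \<ge> 0" using cr1 by (intro sum_nonneg) (auto intro: order_trans[OF zero_le_one])
  have crl: "fst (cr l) * C2 \<le> C" "snd (cr l) \<le> r0" if "l \<in> {1..<k}" for l
  proof -
    have "fst (cr l) \<le> (\<Sum>l\<in>{1..<k}. fst (cr l))"
      using that cr1 by (intro member_le_sum) (auto intro: order_trans[OF zero_le_one])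
    then have "fst (cr l) * C2 \<le> (1 + (\<Sum>l\<in>{1..<k}. fst (cr l))) * C2" using C2 by (intro mult_right_mono) auto
    also have "\<dots> \<le> (1 + (\<Sum>l\<in>{1..<k}. fst (cr l))) * C2 * C0"
    proof -
      have "0 \<le> (1 + (\<Sum>l\<in>{1..<k}. fst (cr l))) * C2" using C2 S0 by (intro mult_nonneg_nonneg) auto
      from mult_left_mono[OF C0 this] show ?thesis by (simp only: mult_1_right)
    qed
    finally show "fst (cr l) * C2 \<le> C" by (simp add: C_def)
    have "snd (cr l) \<le> (\<Sum>l\<in>{1..<k}. snd (cr l))"
      using that by (intro member_le_sum) auto
    then show "snd (cr l) \<le> r0" by (simp add: r0_def)
  qed
  have CC0: "C \<ge> C0"
  proof -
    have "1 * 1 * C0 \<le> C" unfolding C_def using C0 C2 S0 by (intro mult_mono) auto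
    then show ?thesis by simp
  qed
  show ?case
  proof (intro exI[of _ C] exI[of _ r0] conjI allI impI)
    show "1 \<le> C" "1 \<le> r0" using CC0 C0 r2 by (auto simp: r0_def)
    fix N A g l a b
    assume ms: "moment_sum p k A" and l: "l < k" and fb: "fact k ^ Suc t dvd b" and ab: "r0 \<le> a" "r0 \<le> b"
      and lab: "l * a \<le> (k - l + 1) * b" and N: "k ^ Suc (Suc t) * b \<le> N"
    interpret moment_sum p k N A g by fact
    have kk: "1 \<le> k ^ i" for i using k2 by simp
    have kle: "y \<le> N" if "k ^ i * y \<le> N" for i y
      using that mult_right_mono[OF kk[of i], of y] by linarith
    have bN: "b \<le> N" by (rule kle[OF N])
    show "bil l a b (C * real p powr (E * real N - E * gain k (Suc t) l * real b + e * real b))"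
    proof (cases "l = 0")
      case True
      have "bil l a b (C0 * real p powr (E * real (N - b)))"
        unfolding True by (rule bil_zero[OF dec]) (use C0 bN in auto)
      then show ?thesis
        by (rule bil_mono) (use True Suc.prems C0 CC0 p1 bN in \<open>auto intro!: mult_mono powr_mono simp: of_nat_diff algebra_simps\<close>)
    next
      case False
      then have l1: "1 \<le> l" by simp
      have "l dvd (fact k :: nat)" using l1 l by (simp add: dvd_fact)
      then obtain f where f: "fact k = l * f" by (elim dvdE)
      have "l dvd b" using \<open>l dvd fact k\<close> fb by (metis dvd_mult2 dvd_trans power_Suc)
      then obtain b1 where b1: "b = l * b1" by (elim dvdE)
      \<comment> \<open>The largest scale allowed by l * a' <= (k - l + 1) * b, attained with
        equality.\<close>
      define a' where "a' = (k - l + 1) * b1"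
      have fb1: "fact k ^ t dvd b1"
      proof -
        have "l * (f * fact k ^ t) dvd l * b1" using fb by (simp add: b1 f mult.assoc)
        then have "f * fact k ^ t dvd b1" using l1 by simp
        then show ?thesis by (rule dvd_mult_right)
      qed
      have aa': "a \<le> a'"
      proof -
        have "l * a \<le> l * a'" using lab by (simp add: a'_def b1 algebra_simps)
        then show ?thesis using l1 by simp
      qed
      have b1b: "b1 \<le> b" using l1 by (simp add: b1)
      have a'kb: "a' \<le> k * b"
        unfolding a'_def using l1 l b1b by (intro mult_mono) auto
      have Na': "k ^ Suc t * a' \<le> N"
      proof -
        have "k ^ Suc t * a' \<le> k ^ Suc t * (k * b)" using a'kb by (intro mult_left_mono) auto
        also have "\<dots> = k ^ Suc (Suc t) * b" by simp
        also note N
        finally show ?thesis .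
      qed
      have a'N: "a' \<le> N" by (rule kle[OF Na'])
      have Nb: "k ^ Suc t * b \<le> N"
      proof -
        have "k ^ Suc t * b \<le> k ^ Suc (Suc t) * b" using k2 by (intro mult_right_mono power_increasing) auto
        also note N
        finally show ?thesis .
      qed
      have lk: "l \<in> {1..<k}" using l l1 by simp
      have rr: "r2 \<le> r0" by (simp add: r0_def)
      define \<tau> where "\<tau> = 1 / (real k - real l + 1)"
      have \<tau>: "0 < \<tau>" "\<tau> < 1" using l by (auto simp: \<tau>_def)
      \<comment> \<open>The exchanged moment gains in proportion to \<open>a'\<close>, but enters
        with Hoelder weight \<tau>. The product is b / l, which explains the coefficient 1 / l in
        the recursion of \<open>gain\<close>.\<close>
      have \<tau>a': "\<tau> * real a' = real b1"
      proof -
        have kl: "real (k - l + 1) = real k - real l + 1" using l by (simp add: of_nat_diff)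
        have a'r: "real a' = (real k - real l + 1) * real b1" by (simp only: a'_def of_nat_mult kl)
        have gen: "1 / D * (D * x) = x" if "D > 0" for D x :: real using that by simp
        have "1 / (real k - real l + 1) * ((real k - real l + 1) * real b1) = real b1" using l by (intro gen) simp
        then show ?thesis by (simp only: \<tau>_def a'r)
      qed
      define K1 where "K1 = C2 * real p powr (E * real N - E * gain k t (k - l) * real a' + e1 * real a')"
      define K2 where "K2 = C2 * real p powr (E * real N - E * gain k t (l - 1) * real b + e1 * real b)"
      define L where "L = fst (cr l) * real p powr (e1 * (real a' - real a))"
      have bA: "bil (k - l) b a' K1" unfolding K1_def
      proof (rule bil2[rule_format, OF ms])
        show "fact k ^ t dvd a'" unfolding a'_def by (rule dvd_mult[OF fb1])
        have "(k - l) * b = (k - l) * l * b1" by (simp only: b1 mult_ac)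
        also have "\<dots> \<le> (k - l + 1) * (l + 1) * b1" by (intro mult_right_mono mult_mono) auto
        also have "\<dots> = (l + 1) * a'" by (simp only: a'_def mult_ac)
        finally show "(k - l) * b \<le> (k - (k - l) + 1) * a'" using l by simp
      qed (use l l1 ab aa' rr Na' in auto)
      have bB: "bil (l - 1) a' b K2" unfolding K2_def
      proof (rule bil2[rule_format, OF ms])
        show "fact k ^ t dvd b" by (rule dvd_trans[OF le_imp_power_dvd fb]) simp
        have "(l - 1) * a' = (l - 1) * (k - l + 1) * b1" by (simp only: a'_def mult_ac)
        also have "\<dots> \<le> l * (k - (l - 1) + 1) * b1" by (intro mult_right_mono mult_mono) auto
        also have "\<dots> = (k - (l - 1) + 1) * b" by (simp only: b1 mult_ac)
        finally show "(l - 1) * a' \<le> (k - (l - 1) + 1) * b" .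
      qed (use l l1 ab aa' rr Nb in auto)
      have "bil l a b (L * (K1 powr \<tau> * K2 powr (1 - \<tau>)))"
      proof (rule bil_step[OF l1 l \<tau>_def _ aa' a'N _ _ bA _ bB])
        show "1 \<le> a" using ab r2 rr by linarith
        fix \<xi> \<eta> assume A: "\<xi> \<in> {0..<int p ^ a}" "\<eta> \<in> {0..<int p ^ b}" "\<not> int p dvd \<xi> - \<eta>"
        have "snd (cr l) \<le> a" using crl(2)[OF lk] ab by simp
        moreover have "l * a' \<le> (k - l + 1) * b" by (simp add: a'_def b1 algebra_simps)
        ultimately show "mix l a \<xi> b \<eta> \<le> L * (\<Sum>d\<in>children p a \<xi> a'. mix l a' d b \<eta> powr (1 / tri l)) ^ tri l"
          unfolding L_def by (intro cr3[OF lk ms] aa' bN A)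
      next
        show "0 \<le> L" using cr1[OF lk] unfolding L_def by simp
      qed (use C2 in \<open>auto simp: K1_def K2_def\<close>)
      then show ?thesis
      proof (rule bil_mono)
        have gen: "(c * P powr x0) * ((C2 * P powr x1) powr \<tau> * (C2 * P powr x2) powr (1 - \<tau>)) =
           c * (C2 powr \<tau> * C2 powr (1 - \<tau>)) * P powr (x0 + x1 * \<tau> + x2 * (1 - \<tau>))" for c P x0 x1 x2
          by (simp only: powr_mult powr_powr powr_add mult_ac)
        have "L * (K1 powr \<tau> * K2 powr (1 - \<tau>)) = fst (cr l) * (C2 powr \<tau> * C2 powr (1 - \<tau>)) *
          real p powr (e1 * (real a' - real a) + (E * real N - E * gain k t (k - l) * real a' + e1 * real a') * \<tau>
             + (E * real N - E * gain k t (l - 1) * real b + e1 * real b) * (1 - \<tau>))"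
          unfolding L_def K1_def K2_def by (rule gen)
        also have "C2 powr \<tau> * C2 powr (1 - \<tau>) = C2" using C2 by (simp flip: powr_add)
        also have "e1 * (real a' - real a) + (E * real N - E * gain k t (k - l) * real a' + e1 * real a') * \<tau>
             + (E * real N - E * gain k t (l - 1) * real b + e1 * real b) * (1 - \<tau>)
           = E * real N - E * (gain k t (k - l) * (\<tau> * real a') + (1 - \<tau>) * gain k t (l - 1) * real b) + e1 * (real a' - real a + \<tau> * real a' + (1 - \<tau>) * real b)"
          by (simp add: algebra_simps)
        also have "gain k t (k - l) * (\<tau> * real a') + (1 - \<tau>) * gain k t (l - 1) * real b = gain k (Suc t) l * real b"
        proof -
          have D: "(real k - real l) / (real k - real l + 1) = 1 - \<tau>" using l by (simp add: \<tau>_def field_simps)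
          have G: "gain k (Suc t) l = gain k t (k - l) / real l + (1 - \<tau>) * gain k t (l - 1)"
            using l1 by (simp only: gain.simps D) simp
          have B: "real b = real l * real b1" by (simp only: b1 of_nat_mult)
          have gen: "g1 * y + c * g2 * (x * y) = (g1 / x + c * g2) * (x * y)" if "x > 0" for g1 g2 x y c :: real
            using that by (simp add: field_simps)
          show ?thesis unfolding \<tau>a' G B by (rule gen) (use l1 in simp)
        qed
        also have "fst (cr l) * C2 * real p powr (E * real N - E * (gain k (Suc t) l * real b) + e1 * (real a' - real a + \<tau> * real a' + (1 - \<tau>) * real b))
           \<le> C * real p powr (E * real N - E * gain k (Suc t) l * real b + e * real b)"
        proof (intro mult_mono crl(1)[OF lk] powr_mono)
          have "real a' \<le> real k * real b" using a'kb by (simp flip: of_nat_mult)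
          moreover have "(1 - \<tau>) * real b \<le> 1 * real b" using \<tau> by (intro mult_right_mono) auto
          moreover have "real b1 \<le> real b" using b1b by simp
          ultimately have "real a' - real a + \<tau> * real a' + (1 - \<tau>) * real b \<le> real k * real b + real b + 1 * real b"
            unfolding \<tau>a' by linarith
          then have "e1 * (real a' - real a + \<tau> * real a' + (1 - \<tau>) * real b) \<le> e1 * ((real k + 2) * real b)"
            using e1(1) by (intro mult_left_mono) (auto simp: algebra_simps)
          also have "\<dots> = e * real b" using e1(2) by (simp add: mult.assoc[symmetric])
          finally show "E * real N - E * (gain k (Suc t) l * real b) + e1 * (real a' - real a + \<tau> * real a' + (1 - \<tau>) * real b)
            \<le> E * real N - E * gain k (Suc t) l * real b + e * real b" by (simp add: mult.assoc del: gain.simps)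
        qed (use p1 CC0 C0 in auto)
        finally show "L * (K1 powr \<tau> * K2 powr (1 - \<tau>)) \<le> C * real p powr (E * real N - E * gain k (Suc t) l * real b + e * real b)" .
      qed
    qed
  qed
qed

section \<open>Reduction from linear to bilinear estimates\<close>

lemma broad_narrow_pointwise:
  fixes y :: "'i \<Rightarrow> real"
  assumes "finite I" "real (card I) \<le> K" "K \<ge> 1" "\<And>i. i \<in> I \<Longrightarrow> y i \<ge> 0" "0 < th" "th \<le> 1" "n = s + s'" "n \<ge> 1"
  shows "(\<Sum>i\<in>I. y i) ^ n \<le> (1 + th) ^ n * (\<Sum>i\<in>I. y i ^ n) + (K\<^sup>2 / th) ^ n * (\<Sum>i\<in>I. \<Sum>j\<in>I - {i}. y i ^ s * y j ^ s')"
proof (cases "I = {}")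
  case True
  then show ?thesis using assms(8) by (simp add: power_0_left)
next
  case False
  define M where "M = Max (y ` I)"
  have "M \<in> y ` I" unfolding M_def using False assms(1) by (intro Max_in) auto
  then obtain i where i: "i \<in> I" "y i = M" by auto
  have M: "y j \<le> M" if "j \<in> I" for j using that assms(1) by (simp add: M_def)
  have M0: "M \<ge> 0" using i assms(4) by auto
  have S1: "(\<Sum>i\<in>I. y i ^ n) \<ge> M ^ n"
    using i assms member_le_sum[of i I "\<lambda>i. y i ^ n"] by simp
  have S2: "(\<Sum>i\<in>I. \<Sum>j\<in>I - {i}. y i ^ s * y j ^ s') \<ge> 0"
    using assms(4) by (intro sum_nonneg mult_nonneg_nonneg zero_le_power) auto
  show ?thesis
  proof (cases "\<forall>j\<in>I - {i}. y j \<le> th / K * M")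
    \<comment> \<open>Narrow case: all other terms together are at most \<open>th\<close> times the
      largest one.\<close>
    case True
    have "(\<Sum>i\<in>I. y i) = M + (\<Sum>j\<in>I - {i}. y j)" using i assms(1) by (simp add: sum.remove)
    also have "(\<Sum>j\<in>I - {i}. y j) \<le> (\<Sum>j\<in>I - {i}. th / K * M)" using True by (intro sum_mono) auto
    also have "\<dots> \<le> (\<Sum>j\<in>I. th / K * M)" using assms M0 by (intro sum_mono2) auto
    also have "\<dots> = real (card I) * (th / K * M)" by simp
    also have "\<dots> \<le> K * (th / K * M)" using assms(2,3,5) M0 by (intro mult_right_mono) auto
    finally have "(\<Sum>i\<in>I. y i) \<le> (1 + th) * M" using assms(3) by (simp add: algebra_simps)
    then have "(\<Sum>i\<in>I. y i) ^ n \<le> ((1 + th) * M) ^ n" using assms(4) by (intro power_mono sum_nonneg) auto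
    also have "\<dots> \<le> (1 + th) ^ n * (\<Sum>i\<in>I. y i ^ n)"
      using S1 assms(5) by (simp add: power_mult_distrib mult_left_mono)
    also have "\<dots> \<le> \<dots> + (K\<^sup>2 / th) ^ n * (\<Sum>i\<in>I. \<Sum>j\<in>I - {i}. y i ^ s * y j ^ s')"
      using S2 assms by simp
    finally show ?thesis .
  next
    \<comment> \<open>Broad case: a second term is comparable to the maximum, so the product of the
      two controls the whole sum.\<close>
    case False
    then obtain j where j: "j \<in> I - {i}" "y j > th / K * M" by force
    have Mj: "M \<le> K / th * y j" using j(2) assms(3,5) by (simp add: field_simps)
    have "(\<Sum>i\<in>I. y i) \<le> (\<Sum>i\<in>I. M)" by (intro sum_mono M)
    also have "\<dots> \<le> K * M" using assms(2) M0 by (simp add: mult_right_mono)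
    finally have "(\<Sum>i\<in>I. y i) ^ n \<le> (K * M) ^ n" using assms(4) by (intro power_mono sum_nonneg) auto
    also have "\<dots> = K ^ n * (M ^ s * M ^ s')" by (simp add: assms(7) power_mult_distrib power_add)
    also have "\<dots> \<le> K ^ n * (M ^ s * (K / th * y j) ^ s')"
      using assms(3) M0 Mj by (intro mult_left_mono power_mono) auto
    also have "\<dots> = K ^ n * (K / th) ^ s' * (y i ^ s * y j ^ s')" by (simp only: i power_mult_distrib mult_ac)
    also have "\<dots> \<le> K ^ n * (K / th) ^ n * (y i ^ s * y j ^ s')"
    proof (intro mult_right_mono mult_left_mono power_increasing)
      show "1 \<le> K / th" using assms(3,5,6) by (simp add: field_simps)
    qed (use assms j i in auto)
    also have "K ^ n * (K / th) ^ n = (K\<^sup>2 / th) ^ n" by (simp add: power_mult_distrib[symmetric] power2_eq_square)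
    also have "(K\<^sup>2 / th) ^ n * (y i ^ s * y j ^ s') \<le> (K\<^sup>2 / th) ^ n * (\<Sum>i\<in>I. \<Sum>j\<in>I - {i}. y i ^ s * y j ^ s')"
    proof (intro mult_left_mono)
      have "y i ^ s * y j ^ s' \<le> (\<Sum>j\<in>I - {i}. y i ^ s * y j ^ s')"
        using j assms i by (intro member_le_sum[of j "I - {i}" "\<lambda>j. y i ^ s * y j ^ s'"]) auto
      also have "\<dots> \<le> (\<Sum>i\<in>I. \<Sum>j\<in>I - {i}. y i ^ s * y j ^ s')"
        using i assms by (intro member_le_sum[of i I "\<lambda>i. \<Sum>j\<in>I - {i}. y i ^ s * y j ^ s'"] sum_nonneg) auto
      finally show "y i ^ s * y j ^ s' \<le> (\<Sum>i\<in>I. \<Sum>j\<in>I - {i}. y i ^ s * y j ^ s')" .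
    qed (use assms in auto)
    also have "\<dots> \<le> (1 + th) ^ n * (\<Sum>i\<in>I. y i ^ n) + \<dots>"
      using S1 M0 assms(5) by (simp add: order_trans[OF _ S1])
    finally show ?thesis .
  qed
qed

context moment_sum
begin

lemma F_children:
  assumes "a \<le> b"
  shows "F a c x = (\<Sum>d\<in>children p a c b. F b d x)"
proof -
  have mm: "e mod int p ^ b mod int p ^ a = e mod int p ^ a" for e :: int
    using assms by (simp add: mod_mod_cancel le_imp_power_dvd)
  have "(\<Sum>d\<in>children p a c b. sum (\<lambda>n. summand n x) {n \<in> {n. n \<in> A \<and> n mod int p ^ a = c}. n mod int p ^ b = d})
      = (\<Sum>n\<in>{n. n \<in> A \<and> n mod int p ^ a = c}. summand n x)"
    by (rule sum.group[OF _ finite_children]) (use fin p_pos mm in \<open>auto simp: children_def\<close>)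
  moreover have "{n \<in> {n. n \<in> A \<and> n mod int p ^ a = c}. n mod int p ^ b = d} = {n. n \<in> A \<and> n mod int p ^ b = d}" if "d \<in> children p a c b" for d
    using that mm by (auto simp: children_def)
  ultimately show ?thesis by (simp add: F_def)
qed

lemma card_children_le: "real (card (children p a c b)) \<le> real p ^ b"
proof -
  have "card (children p a c b) \<le> card {0..<int p ^ b}"
    by (intro card_mono) (auto simp: children_def)
  also have "\<dots> = p ^ b" by (simp flip: of_nat_power)
  finally show ?thesis by (simp flip: of_nat_power)
qed

lemma nrm_mono: "a \<le> b \<Longrightarrow> b \<le> N \<Longrightarrow> d \<in> children p a c b \<Longrightarrow> nrm b d \<le> nrm a c"
  unfolding nrm_children[of a b c, symmetric] by (intro member_le_sum nrm_nonneg finite_children)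

lemma F_power_le:
  assumes "a \<le> b" "n \<ge> 1"
  shows "norm (F a c x) ^ n \<le> (real p ^ b) ^ n * (\<Sum>d\<in>children p a c b. norm (F b d x) ^ n)"
proof -
  have "norm (F a c x) \<le> (\<Sum>d\<in>children p a c b. norm (F b d x))"
    unfolding F_children[OF assms(1)] by (rule norm_sum)
  then have "norm (F a c x) ^ n \<le> (\<Sum>d\<in>children p a c b. norm (F b d x)) ^ n" by (intro power_mono) auto
  also have "\<dots> \<le> (real p ^ b) ^ n * (\<Sum>d\<in>children p a c b. norm (F b d x) ^ n)"
    by (intro power_sum_le card_children_le assms) auto
  finally show ?thesis .
qed

text \<open>The sum is split modulo p. A dominating class is rescaled, at the cost of a factor close
  to 1 and with decoupling at scale \<open>N - 1\<close>. Two comparable classes are distinct modulo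
  p, hence transversal; they are split crudely into classes modulo p^a and p^b, with a loss that
  depends only on a + b, and the bilinear bound applies to every pair.\<close>

lemma broad_narrow:
  assumes l: "1 \<le> l" "l < k" and ab: "1 \<le> a" "1 \<le> b" "a \<le> N" "b \<le> N" and K: "bil l a b K" "K \<ge> 0"
    and dec: "decoupling p k (N - 1) D" "D \<ge> 0" and th: "0 < th" "th \<le> 1"
  shows "(\<Sum>x\<in>X. norm (F 0 0 x) ^ (2 * tri k)) \<le> ((1 + th) ^ (2 * tri k) * D +
    ((real p)\<^sup>2 / th) ^ (2 * tri k) * ((real p)\<^sup>2 * (real p ^ (a + b)) ^ (2 * tri k) * K)) * nrm 0 0 ^ tri k"
proof -
  define I where "I = children p 0 0 1"
  define s where "s = 2 * tri l"
  define s' where "s' = 2 * (tri k - tri l)"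
  define n where "n = 2 * tri k"
  have lt: "tri l < tri k" using tri_mono[of "Suc l" k] l by (simp add: tri_Suc)
  have n: "n = s + s'" "n \<ge> 1" "s \<ge> 1" "s' \<ge> 1" using lt l tri_pos[of l] by (auto simp: n_def s_def s'_def simp del: tri_pos tri_eq_0_iff)
  have p1: "real p \<ge> 1" using p_pos by simp
  have cI: "real (card I) \<le> real p" using card_children_le[of 0 0 1] by (simp add: I_def)
  have I: "finite I" "i \<in> I \<Longrightarrow> i \<in> {0..<int p ^ 1}" for i by (auto simp: I_def children_def)
  have nI: "nrm 1 i \<le> nrm 0 0" if "i \<in> I" for i using that ab by (intro nrm_mono) (auto simp: I_def)
  have pw: "norm (F 0 0 x) ^ n \<le> (1 + th) ^ n * (\<Sum>i\<in>I. norm (F 1 i x) ^ n) +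
     ((real p)\<^sup>2 / th) ^ n * (\<Sum>i\<in>I. \<Sum>j\<in>I - {i}. norm (F 1 i x) ^ s * norm (F 1 j x) ^ s')" for x
  proof -
    have "norm (F 0 0 x) \<le> (\<Sum>i\<in>I. norm (F 1 i x))"
      unfolding I_def F_children[of 0 1 0 x, simplified] by (simp add: norm_sum)
    then have "norm (F 0 0 x) ^ n \<le> (\<Sum>i\<in>I. norm (F 1 i x)) ^ n" by (intro power_mono) auto
    also have "\<dots> \<le> (1 + th) ^ n * (\<Sum>i\<in>I. norm (F 1 i x) ^ n) +
     ((real p)\<^sup>2 / th) ^ n * (\<Sum>i\<in>I. \<Sum>j\<in>I - {i}. norm (F 1 i x) ^ s * norm (F 1 j x) ^ s')"
      by (rule broad_narrow_pointwise) (use I cI p1 th n in auto)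
    finally show ?thesis .
  qed
  have narrow: "(\<Sum>i\<in>I. \<Sum>x\<in>X. norm (F 1 i x) ^ n) \<le> D * nrm 0 0 ^ tri k"
  proof -
    have "(\<Sum>i\<in>I. \<Sum>x\<in>X. norm (F 1 i x) ^ n) \<le> (\<Sum>i\<in>I. D * nrm 1 i ^ tri k)"
      unfolding n_def using dec ab I by (intro sum_mono rescale_nrm) auto
    also have "\<dots> = D * (\<Sum>i\<in>I. nrm 1 i ^ tri k)" by (simp add: sum_distrib_left)
    also have "\<dots> \<le> D * (\<Sum>i\<in>I. nrm 1 i) ^ tri k"
      using dec lt I by (intro mult_left_mono sum_power_le_power_sum) (auto simp: nrm_nonneg)
    also have "(\<Sum>i\<in>I. nrm 1 i) = nrm 0 0" unfolding I_def using ab by (intro nrm_children) auto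
    finally show ?thesis .
  qed
  have broad: "(\<Sum>x\<in>X. norm (F 1 i x) ^ s * norm (F 1 j x) ^ s') \<le> (real p ^ (a + b)) ^ n * K * nrm 0 0 ^ tri k"
    if ij: "i \<in> I" "j \<in> I" "i \<noteq> j" for i j
  proof -
    have mx: "mix l a d b e \<le> K * (nrm a d ^ tri l * nrm b e ^ (tri k - tri l))"
      if d: "d \<in> children p 1 i a" and e: "e \<in> children p 1 j b" for d e
    proof -
      have "\<not> int p dvd d - e" using d e ij(3) by (auto simp: children_def mod_eq_dvd_iff[symmetric])
      then show ?thesis using K(1) children_mem(1)[OF d] children_mem(1)[OF e] unfolding bil_def by auto
    qed
    have "(\<Sum>d\<in>children p 1 i a. \<Sum>e\<in>children p 1 j b. mix l a d b e) \<le> (\<Sum>d\<in>children p 1 i a. \<Sum>e\<in>children p 1 j b. K * (nrm a d ^ tri l * nrm b e ^ (tri k - tri l)))"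
      by (intro sum_mono mx)
    also have "(\<Sum>d\<in>children p 1 i a. \<Sum>e\<in>children p 1 j b. K * (nrm a d ^ tri l * nrm b e ^ (tri k - tri l)))
      = K * ((\<Sum>d\<in>children p 1 i a. nrm a d ^ tri l) * (\<Sum>e\<in>children p 1 j b. nrm b e ^ (tri k - tri l)))"
      by (simp only: sum_product) (simp only: sum_distrib_left)
    also have "\<dots> \<le> K * (nrm 0 0 ^ tri l * nrm 0 0 ^ (tri k - tri l))"
    proof (intro mult_left_mono mult_mono K(2))
      have "(\<Sum>d\<in>children p 1 i a. nrm a d ^ tri l) \<le> (\<Sum>d\<in>children p 1 i a. nrm a d) ^ tri l"
        using l by (intro sum_power_le_power_sum) (auto simp: nrm_nonneg Suc_leI)
      also have "\<dots> \<le> nrm 0 0 ^ tri l"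
        using nI[OF ij(1)] ab by (subst nrm_children) (auto intro!: power_mono nrm_nonneg)
      finally show "(\<Sum>d\<in>children p 1 i a. nrm a d ^ tri l) \<le> nrm 0 0 ^ tri l" .
      have "(\<Sum>e\<in>children p 1 j b. nrm b e ^ (tri k - tri l)) \<le> (\<Sum>e\<in>children p 1 j b. nrm b e) ^ (tri k - tri l)"
        using lt by (intro sum_power_le_power_sum) (auto simp: nrm_nonneg Suc_leI)
      also have "\<dots> \<le> nrm 0 0 ^ (tri k - tri l)"
        using nI[OF ij(2)] ab by (subst nrm_children) (auto intro!: power_mono nrm_nonneg)
      finally show "(\<Sum>e\<in>children p 1 j b. nrm b e ^ (tri k - tri l)) \<le> nrm 0 0 ^ (tri k - tri l)" .
    qed (auto intro!: sum_nonneg simp: nrm_nonneg)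
    also have "nrm 0 0 ^ tri l * nrm 0 0 ^ (tri k - tri l) = nrm 0 0 ^ tri k"
      using lt by (simp flip: power_add)
    finally have inner: "(\<Sum>d\<in>children p 1 i a. \<Sum>e\<in>children p 1 j b. mix l a d b e) \<le> K * nrm 0 0 ^ tri k" .
    have "(\<Sum>x\<in>X. norm (F 1 i x) ^ s * norm (F 1 j x) ^ s') \<le>
       (\<Sum>x\<in>X. ((real p ^ a) ^ s * (\<Sum>d\<in>children p 1 i a. norm (F a d x) ^ s)) * ((real p ^ b) ^ s' * (\<Sum>e\<in>children p 1 j b. norm (F b e x) ^ s')))"
      using ab n by (intro sum_mono mult_mono F_power_le) (auto intro!: mult_nonneg_nonneg sum_nonneg)
    also have "\<dots> = (\<Sum>x\<in>X. (real p ^ a) ^ s * (real p ^ b) ^ s' * (\<Sum>d\<in>children p 1 i a. \<Sum>e\<in>children p 1 j b. norm (F a d x) ^ s * norm (F b e x) ^ s'))"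
      by (intro sum.cong refl) (simp add: sum_product mult_ac)
    also have "\<dots> = (real p ^ a) ^ s * (real p ^ b) ^ s' * (\<Sum>d\<in>children p 1 i a. \<Sum>e\<in>children p 1 j b. mix l a d b e)"
    proof -
      have "(\<Sum>x\<in>X. \<Sum>d\<in>children p 1 i a. \<Sum>e\<in>children p 1 j b. norm (F a d x) ^ s * norm (F b e x) ^ s')
        = (\<Sum>d\<in>children p 1 i a. \<Sum>x\<in>X. \<Sum>e\<in>children p 1 j b. norm (F a d x) ^ s * norm (F b e x) ^ s')" by (rule sum.swap)
      also have "\<dots> = (\<Sum>d\<in>children p 1 i a. \<Sum>e\<in>children p 1 j b. mix l a d b e)"
        unfolding mix_def s_def s'_def by (intro sum.cong refl sum.swap)
      finally show ?thesis by (simp add: sum_distrib_left[symmetric])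
    qed
    also have "\<dots> \<le> (real p ^ a) ^ s * (real p ^ b) ^ s' * (K * nrm 0 0 ^ tri k)"
      by (intro mult_left_mono inner) auto
    also have "\<dots> \<le> (real p ^ (a + b)) ^ n * (K * nrm 0 0 ^ tri k)"
    proof (intro mult_right_mono)
      have "(real p ^ a) ^ s * (real p ^ b) ^ s' \<le> (real p ^ (a + b)) ^ s * (real p ^ (a + b)) ^ s'"
        using p1 by (intro mult_mono power_mono power_increasing) auto
      then show "(real p ^ a) ^ s * (real p ^ b) ^ s' \<le> (real p ^ (a + b)) ^ n" by (simp add: n(1) flip: power_add)
    qed (use K in \<open>auto simp: nrm_nonneg\<close>)
    finally show ?thesis by (simp add: mult_ac)
  qed
  have broad2: "(\<Sum>i\<in>I. \<Sum>j\<in>I - {i}. \<Sum>x\<in>X. norm (F 1 i x) ^ s * norm (F 1 j x) ^ s') \<le> (real p)\<^sup>2 * (real p ^ (a + b)) ^ n * K * nrm 0 0 ^ tri k"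
  proof -
    let ?T = "(real p ^ (a + b)) ^ n * K * nrm 0 0 ^ tri k"
    have T0: "?T \<ge> 0" using K by (simp add: nrm_nonneg)
    have "(\<Sum>i\<in>I. \<Sum>j\<in>I - {i}. \<Sum>x\<in>X. norm (F 1 i x) ^ s * norm (F 1 j x) ^ s') \<le> (\<Sum>i\<in>I. \<Sum>j\<in>I - {i}. ?T)"
      by (intro sum_mono broad) auto
    also have "\<dots> \<le> (\<Sum>i\<in>I. \<Sum>j\<in>I. ?T)" using T0 I by (intro sum_mono sum_mono2) auto
    also have "\<dots> = real (card I) * real (card I) * ?T" by simp
    also have "\<dots> \<le> real p * real p * ?T" using cI T0 by (intro mult_right_mono mult_mono) auto
    finally show ?thesis by (simp add: power2_eq_square mult_ac)
  qed
  have "(\<Sum>x\<in>X. norm (F 0 0 x) ^ n) \<le> (\<Sum>x\<in>X. (1 + th) ^ n * (\<Sum>i\<in>I. norm (F 1 i x) ^ n) +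
     ((real p)\<^sup>2 / th) ^ n * (\<Sum>i\<in>I. \<Sum>j\<in>I - {i}. norm (F 1 i x) ^ s * norm (F 1 j x) ^ s'))"
    by (intro sum_mono pw)
  also have "\<dots> = (1 + th) ^ n * (\<Sum>i\<in>I. \<Sum>x\<in>X. norm (F 1 i x) ^ n) +
     ((real p)\<^sup>2 / th) ^ n * (\<Sum>i\<in>I. \<Sum>j\<in>I - {i}. \<Sum>x\<in>X. norm (F 1 i x) ^ s * norm (F 1 j x) ^ s')"
  proof -
    have "(\<Sum>x\<in>X. \<Sum>i\<in>I. norm (F 1 i x) ^ n) = (\<Sum>i\<in>I. \<Sum>x\<in>X. norm (F 1 i x) ^ n)" by (rule sum.swap)
    moreover have "(\<Sum>x\<in>X. \<Sum>i\<in>I. \<Sum>j\<in>I - {i}. norm (F 1 i x) ^ s * norm (F 1 j x) ^ s')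
      = (\<Sum>i\<in>I. \<Sum>j\<in>I - {i}. \<Sum>x\<in>X. norm (F 1 i x) ^ s * norm (F 1 j x) ^ s')"
      by (subst sum.swap) (intro sum.cong refl sum.swap)
    ultimately show ?thesis by (simp add: sum.distrib sum_distrib_left[symmetric])
  qed
  also have "\<dots> \<le> (1 + th) ^ n * (D * nrm 0 0 ^ tri k) + ((real p)\<^sup>2 / th) ^ n * ((real p)\<^sup>2 * (real p ^ (a + b)) ^ n * K * nrm 0 0 ^ tri k)"
    using th by (intro add_mono mult_left_mono narrow broad2) auto
  finally show ?thesis by (simp add: n_def algebra_simps)
qed

text \<open>Crude, but it shows that some exponent is admissible, so that an infimum of exponents
  can be formed.\<close>

lemma trivial_bound: "(\<Sum>x\<in>X. norm (F 0 0 x) ^ (2 * tri k)) \<le> (real p ^ N) ^ (2 * tri k) * nrm 0 0 ^ tri k"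
proof -
  have t: "tri k \<ge> 1" using k by (simp add: Suc_leI)
  have "(\<Sum>x\<in>X. norm (F 0 0 x) ^ (2 * tri k)) \<le> (\<Sum>x\<in>X. (real p ^ N) ^ (2 * tri k) * (\<Sum>d\<in>children p 0 0 N. norm (F N d x) ^ (2 * tri k)))"
    using t by (intro sum_mono F_power_le) auto
  also have "\<dots> = (real p ^ N) ^ (2 * tri k) * (\<Sum>d\<in>children p 0 0 N. ((\<Sum>x\<in>X. norm (F N d x) ^ (2 * tri k)) powr (1 / tri k)) ^ tri k)"
  proof -
    have "(\<Sum>x\<in>X. \<Sum>d\<in>children p 0 0 N. norm (F N d x) ^ (2 * tri k)) = (\<Sum>d\<in>children p 0 0 N. \<Sum>x\<in>X. norm (F N d x) ^ (2 * tri k))"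
      by (rule sum.swap)
    then show ?thesis using t k by (simp add: sum_distrib_left[symmetric] power_powr_inverse sum_nonneg)
  qed
  also have "\<dots> \<le> (real p ^ N) ^ (2 * tri k) * nrm 0 0 ^ tri k"
    unfolding nrm_def using t by (intro mult_left_mono sum_power_le_power_sum) auto
  finally show ?thesis .
qed

end

section \<open>Orthogonality relations and decoupling in degree 1\<close>

lemma sum_norm_square_expand:
  fixes c :: "'i \<Rightarrow> complex" and E :: "'x \<Rightarrow> 'i \<Rightarrow> complex"
  shows "complex_of_real (\<Sum>x\<in>X. (norm (\<Sum>i\<in>I. c i * E x i))\<^sup>2) = (\<Sum>i\<in>I. \<Sum>j\<in>I. c i * cnj (c j) * (\<Sum>x\<in>X. E x i * cnj (E x j)))"
proof -
  have "complex_of_real (\<Sum>x\<in>X. (norm (\<Sum>i\<in>I. c i * E x i))\<^sup>2) = (\<Sum>x\<in>X. \<Sum>i\<in>I. \<Sum>j\<in>I. c i * cnj (c j) * (E x i * cnj (E x j)))"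
    unfolding of_real_sum by (intro sum.cong refl) (simp add: complex_norm_square sum_product mult_ac del: of_real_power)
  also have "\<dots> = (\<Sum>i\<in>I. \<Sum>x\<in>X. \<Sum>j\<in>I. c i * cnj (c j) * (E x i * cnj (E x j)))" by (rule sum.swap)
  also have "\<dots> = (\<Sum>i\<in>I. \<Sum>j\<in>I. \<Sum>x\<in>X. c i * cnj (c j) * (E x i * cnj (E x j)))" by (intro sum.cong refl sum.swap)
  finally show ?thesis by (simp add: sum_distrib_left)
qed

lemma unit_exp_diff: "unit_exp (x - y) = unit_exp x * cnj (unit_exp y)"
  using unit_exp_add[of x "- y"] by (simp add: unit_exp_minus)

lemma unit_exp_sum: "unit_exp (\<Sum>i\<in>I. f i) = (\<Prod>i\<in>I. unit_exp (f i))"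
  by (induction I rule: infinite_finite_induct) (simp_all add: unit_exp_add)

lemma Parseval_unit_exp:
  fixes c :: "'i \<Rightarrow> complex" and v :: "'i \<Rightarrow> int"
  assumes "Q > 0"
  shows "complex_of_real (\<Sum>r<Q. (norm (\<Sum>i\<in>I. c i * unit_exp (real r * of_int (v i) / real Q)))\<^sup>2)
    = of_nat Q * (\<Sum>i\<in>I. \<Sum>j\<in>I. if int Q dvd v i - v j then c i * cnj (c j) else 0)"
proof -
  have K: "(\<Sum>r<Q. unit_exp (real r * of_int (v i) / real Q) * cnj (unit_exp (real r * of_int (v j) / real Q)))
     = (if int Q dvd v i - v j then of_nat Q else 0)" for i j
    unfolding sum_unit_exp[OF assms, symmetric]
    by (intro sum.cong refl) (simp flip: unit_exp_diff add: diff_divide_distrib[symmetric] right_diff_distrib)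
  show ?thesis
    unfolding sum_norm_square_expand K by (simp add: sum_distrib_left if_distrib mult_ac cong: if_cong)
qed

lemma Parseval_grid:
  fixes c :: "'i \<Rightarrow> complex" and v :: "'i \<Rightarrow> nat \<Rightarrow> int"
  assumes "Q > 0"
  shows "complex_of_real (\<Sum>x\<in>grid l Q. (norm (\<Sum>i\<in>I. c i * unit_exp (of_int (\<Sum>n=1..l. x n * v i n) / real Q)))\<^sup>2)
    = of_nat Q ^ l * (\<Sum>i\<in>I. \<Sum>j\<in>I. if \<forall>n\<in>{1..l}. int Q dvd v i n - v j n then c i * cnj (c j) else 0)"
proof -
  have one: "(\<Sum>y\<in>{0..<int Q}. unit_exp (of_int (y * w) / real Q)) = (if int Q dvd w then of_nat Q else 0)" for w
    unfolding sum_unit_exp[OF assms, symmetric]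
    by (rule sum.reindex_bij_witness[of _ int nat]) auto
  have K: "(\<Sum>x\<in>grid l Q. unit_exp (of_int (\<Sum>n=1..l. x n * v i n) / real Q) * cnj (unit_exp (of_int (\<Sum>n=1..l. x n * v j n) / real Q)))
     = (if \<forall>n\<in>{1..l}. int Q dvd v i n - v j n then of_nat Q ^ l else 0)" for i j
  proof -
    have "(\<Sum>x\<in>grid l Q. unit_exp (of_int (\<Sum>n=1..l. x n * v i n) / real Q) * cnj (unit_exp (of_int (\<Sum>n=1..l. x n * v j n) / real Q)))
       = (\<Sum>x\<in>grid l Q. \<Prod>n=1..l. unit_exp (of_int (x n * (v i n - v j n)) / real Q))"
      unfolding unit_exp_sum[symmetric] unit_exp_diff[symmetric]
      by (intro sum.cong refl arg_cong[of _ _ unit_exp])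
        (simp add: diff_divide_distrib[symmetric] sum_divide_distrib[symmetric] sum_subtractf right_diff_distrib)
    also have "\<dots> = (\<Prod>n=1..l. \<Sum>y\<in>{0..<int Q}. unit_exp (of_int (y * (v i n - v j n)) / real Q))"
      unfolding grid_def by (rule prod_sum_PiE[symmetric]) auto
    also have "\<dots> = (\<Prod>n=1..l. if int Q dvd v i n - v j n then of_nat Q else 0)" by (simp only: one)
    also have "\<dots> = (if \<forall>n\<in>{1..l}. int Q dvd v i n - v j n then of_nat Q ^ l else 0)"
      by (auto intro!: prod_zero)
    finally show ?thesis .
  qed
  show ?thesis
    unfolding sum_norm_square_expand K by (simp add: sum_distrib_left if_distrib mult_ac cong: if_cong)
qed

lemma decouplingI:
  assumes "prime p" "k \<ge> 1"
    and "\<And>A g. finite A \<Longrightarrow> (\<Sum>x\<in>grid k (p ^ (k * N)). norm (moment_sum.F p k N A g 0 0 x) ^ (2 * tri k)) \<le> D * moment_sum.nrm p k N A g 0 0 ^ tri k"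
  shows "decoupling p k N D"
  unfolding decoupling_def
proof (intro allI impI)
  fix A :: "int set" and g :: "int \<Rightarrow> complex" assume fin: "finite A"
  interpret moment_sum p k N A g using assms(1,2) fin by unfold_locales
  have "children p 0 0 N = {0..<int p ^ N}" by (auto simp: children_def)
  then show "(\<Sum>x\<in>grid k (p ^ (k * N)). norm (\<Sum>n\<in>A. g n * unit_exp (of_int (mphase k x n) / of_nat (p ^ (k * N)))) ^ (2 * tri k))
     \<le> D * (\<Sum>c\<in>{0..<int p ^ N}. (\<Sum>x\<in>grid k (p ^ (k * N)).
         norm (\<Sum>n | n \<in> A \<and> n mod int p ^ N = c. g n * unit_exp (of_int (mphase k x n) / of_nat (p ^ (k * N)))) ^ (2 * tri k))
           powr (1 / tri k)) ^ tri k"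
    using assms(3)[OF fin, of g] by (simp add: F_def nrm_def summand_def q_def)
qed

text \<open>In degree 1 the moment is of second order, and frequencies in different classes modulo
  p^N are orthogonal, so the contributions of the classes add up exactly. This starts the induction
  on the degree.\<close>

lemma decoupling_one:
  assumes "p > 0"
  shows "decoupling p 1 N 1"
  unfolding decoupling_def
proof (intro allI impI)
  fix A :: "int set" and g :: "int \<Rightarrow> complex" assume fin: "finite A"
  define Q where "Q = p ^ N"
  have Q: "Q > 0" using assms by (simp add: Q_def)
  define S where "S B = (\<Sum>x\<in>grid 1 Q. (norm (\<Sum>n\<in>B. g n * unit_exp (of_int (mphase 1 x n) / real Q)))\<^sup>2)" for B
  define C where "C c = {n. n \<in> A \<and> n mod int Q = c}" for c
  have S: "complex_of_real (S B) = of_nat Q * (\<Sum>n\<in>B. \<Sum>m\<in>B. if int Q dvd n - m then g n * cnj (g m) else 0)" for B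
    unfolding S_def using Parseval_grid[OF Q, where l = 1 and I = B and c = g and v = "\<lambda>n j. n ^ j"] by (simp add: mphase_def)
  have "complex_of_real (S A) = of_nat Q * (\<Sum>c\<in>{0..<int Q}. \<Sum>n\<in>C c. \<Sum>m\<in>A. if int Q dvd n - m then g n * cnj (g m) else 0)"
    unfolding S C_def using Q fin by (subst sum.group) auto
  also have "\<dots> = of_nat Q * (\<Sum>c\<in>{0..<int Q}. \<Sum>n\<in>C c. \<Sum>m\<in>C c. if int Q dvd n - m then g n * cnj (g m) else 0)"
  proof -
    have "(\<Sum>m\<in>A. if int Q dvd n - m then g n * cnj (g m) else 0) = (\<Sum>m\<in>C c. if int Q dvd n - m then g n * cnj (g m) else 0)"
      if "n \<in> C c" for n c
      using that fin by (intro sum.mono_neutral_right) (auto simp: C_def mod_eq_dvd_iff[symmetric])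
    then show ?thesis by simp
  qed
  also have "\<dots> = complex_of_real (\<Sum>c\<in>{0..<int Q}. S (C c))"
    by (simp add: S sum_distrib_left)
  finally have "S A = (\<Sum>c\<in>{0..<int Q}. S (C c))" by (simp only: of_real_eq_iff)
  moreover have "S B \<ge> 0" for B by (auto simp: S_def intro: sum_nonneg)
  moreover have "tri 1 = 1" by (simp add: tri_def)
  ultimately show "(\<Sum>x\<in>grid 1 (p ^ (1 * N)). norm (\<Sum>n\<in>A. g n * unit_exp (of_int (mphase 1 x n) / of_nat (p ^ (1 * N)))) ^ (2 * tri 1))
     \<le> 1 * (\<Sum>c\<in>{0..<int p ^ N}. (\<Sum>x\<in>grid 1 (p ^ (1 * N)).
         norm (\<Sum>n | n \<in> A \<and> n mod int p ^ N = c. g n * unit_exp (of_int (mphase 1 x n) / of_nat (p ^ (1 * N)))) ^ (2 * tri 1))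
           powr (1 / tri 1)) ^ tri 1"
    by (simp add: S_def C_def Q_def)
qed

section \<open>The infimum of the admissible exponents\<close>

lemma decoupling_exponents_upward:
  assumes "e \<in> decoupling_exponents p k" "e \<le> e'" "p > 1"
  shows "e' \<in> decoupling_exponents p k"
proof -
  obtain C where C: "C \<ge> 1" "\<And>N. decoupling p k N (C * real p powr (e * real N))" and "e > 0"
    using assms(1) by (auto simp: decoupling_exponents_def)
  have "decoupling p k N (C * real p powr (e' * real N))" for N
    by (rule decoupling_mono[OF C(2)]) (use C(1) assms in \<open>auto intro!: mult_left_mono powr_mono mult_right_mono\<close>)
  then show ?thesis using C(1) \<open>e > 0\<close> assms(2) by (auto simp: decoupling_exponents_def)
qed

lemma decoupling_exponents_nonempty:
  assumes "prime p" "k \<ge> 1"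
  shows "real (2 * tri k) \<in> decoupling_exponents p k"
proof -
  have p1: "real p > 1" using assms(1) prime_gt_1_nat by simp
  have "decoupling p k N (1 * real p powr (real (2 * tri k) * real N))" for N
  proof (rule decouplingI[OF assms])
    fix A :: "int set" and g :: "int \<Rightarrow> complex" assume "finite A"
    then interpret moment_sum p k N A g using assms by unfold_locales
    have "real p powr (real (2 * tri k) * real N) = (real p ^ N) ^ (2 * tri k)"
      using p1 by (simp add: power_mult[symmetric] mult.commute powr_realpow flip: of_nat_mult)
    then show "(\<Sum>x\<in>grid k (p ^ (k * N)). norm (F 0 0 x) ^ (2 * tri k)) \<le> 1 * real p powr (real (2 * tri k) * real N) * nrm 0 0 ^ tri k"
      using trivial_bound by (simp add: q_def)
  qed
  then show ?thesis using assms by (auto simp: decoupling_exponents_def intro!: exI[of _ 1])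
qed

text \<open>The bilinear bound is used with a = r0 fixed and b about N / k^(t + 1). As exponents of
  p, splitting to scale b loses 2 * tri k * b, the gain is at least (2 * tri k + 2) * b, and the
  error of the iteration is taken as b. A factor p^b is saved, which in terms of N is the exponent 1
  / k^(t + 1).\<close>

lemma decoupling_recursion:
  assumes pr: "prime p" "k < p" and k2: "k \<ge> 2" and IHl: "\<forall>l e. 1 \<le> l \<longrightarrow> l < k \<longrightarrow> e > 0 \<longrightarrow> e \<in> decoupling_exponents p l"
    and E: "E \<ge> 0" and C0: "C0 \<ge> 1" and dec: "\<And>M. decoupling p k M (C0 * real p powr (E * real M))"
    and l: "1 \<le> l" "l < k" and g: "E * gain k t l \<ge> real (2 * tri k) + 2" and th: "0 < th" "th \<le> 1"
  shows "\<exists>B>0. \<exists>N1\<ge>1. \<forall>N D. N \<ge> N1 \<longrightarrow> D \<ge> 0 \<longrightarrow> decoupling p k (N - 1) D \<longrightarrow>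
     decoupling p k N ((1 + th) ^ (2 * tri k) * D + B * real p powr ((E - 1 / real (k ^ Suc t)) * real N))"
proof -
  have p1: "real p > 1" using pr(1) prime_gt_1_nat by simp
  obtain C1 r0 where C1: "C1 \<ge> 1" and r0: "r0 \<ge> 1" and bil: "\<forall>N A g. moment_sum p k A \<longrightarrow> (\<forall>l a b. l < k \<longrightarrow> fact k ^ t dvd b \<longrightarrow> r0 \<le> a \<longrightarrow> r0 \<le> b \<longrightarrow>
     l * a \<le> (k - l + 1) * b \<longrightarrow> k ^ Suc t * b \<le> N \<longrightarrow>
     moment_sum.bil p k N A g l a b (C1 * real p powr (E * real N - E * gain k t l * real b + 1 * real b)))"
    using bil_iteration[where t = t, OF pr k2 IHl E C0 dec zero_less_one] by (elim exE conjE) (rule that)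
  define P where "P = 2 * tri k"
  define Z :: nat where "Z = fact k ^ t"
  define W where "W = k ^ Suc t"
  have Z: "Z \<ge> 1" by (simp add: Z_def Suc_le_eq)
  have W: "W \<ge> 1" using k2 by (simp add: W_def Suc_le_eq)
  define B where "B = ((real p)\<^sup>2 / th) ^ P * (real p)\<^sup>2 * (real p ^ r0) ^ P * C1 * real p powr real Z"
  have B: "B > 0" using p1 th C1 by (simp add: B_def)
  define N1 where "N1 = W * (Z + l * r0)"
  have N1: "N1 \<ge> 1" using W Z l r0 by (simp add: N1_def)
  have main: "decoupling p k N ((1 + th) ^ P * D + B * real p powr ((E - 1 / real W) * real N))"
    if N: "N \<ge> N1" and D: "D \<ge> 0" "decoupling p k (N - 1) D" for N D
  proof -
    \<comment> \<open>The largest multiple of (k!)^t that satisfies k^(t + 1) * b <= N.\<close>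
    define b where "b = Z * (N div (Z * W))"
    have Wb: "W * b \<le> N" by (simp add: b_def mult_ac) (metis mult.assoc mult.commute div_times_less_eq_dividend)
    have bl: "N < W * b + Z * W"
    proof -
      have "N = Z * W * (N div (Z * W)) + N mod (Z * W)" by simp
      also have "\<dots> < Z * W * (N div (Z * W)) + Z * W" using Z W by (intro add_strict_left_mono mod_less_divisor) simp
      finally show ?thesis by (simp add: b_def mult_ac)
    qed
    have br: "real b \<ge> real N / real W - real Z"
    proof -
      have "real N \<le> real W * (real b + real Z)" using bl by (simp add: algebra_simps flip: of_nat_mult of_nat_add)
      then have "real N / real W \<le> real b + real Z" using W by (simp add: field_simps)
      then show ?thesis by simp
    qed
    have lb: "l * r0 \<le> b"
    proof -
      have "W * (Z + l * r0) \<le> N" using N by (simp only: N1_def)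
      also have "N < W * b + Z * W" by (rule bl)
      also have "\<dots> = W * (b + Z)" by (simp only: distrib_left mult.commute)
      finally have "W * (Z + l * r0) < W * (b + Z)" .
      then have "Z + l * r0 < b + Z" using W by (metis mult_less_cancel1)
      then show ?thesis by simp
    qed
    have r0b: "r0 \<le> b" using lb l by (metis le_trans mult_le_mono1 mult_1)
    have bN: "b \<le> N" using Wb W by (metis le_trans mult_le_mono1 mult_1)
    define K where "K = C1 * real p powr (E * real N - E * gain k t l * real b + 1 * real b)"
    show ?thesis
    proof (rule decoupling_mono[OF decouplingI[OF pr(1)]])
      show "1 \<le> k" using k2 by simp
      fix A :: "int set" and g :: "int \<Rightarrow> complex" assume fin: "finite A"
      interpret moment_sum p k N A g using pr(1) k2 fin by unfold_locales auto
      have ms: "moment_sum p k A" using pr(1) k2 fin by unfold_locales auto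
      have BL: "bil l r0 b K" unfolding K_def
      proof (rule bil[rule_format, OF ms l(2)])
        show "fact k ^ t dvd b" by (simp add: b_def Z_def)
        have "l * r0 \<le> 1 * b" using lb by simp
        also have "\<dots> \<le> (k - l + 1) * b" by (intro mult_right_mono) auto
        finally show "l * r0 \<le> (k - l + 1) * b" .
      qed (use r0b Wb in \<open>auto simp: W_def\<close>)
      show "(\<Sum>x\<in>grid k (p ^ (k * N)). norm (F 0 0 x) ^ (2 * tri k)) \<le> ((1 + th) ^ P * D +
          ((real p)\<^sup>2 / th) ^ P * ((real p)\<^sup>2 * (real p ^ (r0 + b)) ^ P * K)) * nrm 0 0 ^ tri k"
        unfolding q_def[symmetric] P_def
        by (rule broad_narrow[OF l r0 _ _ bN BL _ D(2,1) th]) (use r0 r0b bN C1 in \<open>auto simp: K_def\<close>)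
    next
      have "((real p)\<^sup>2 / th) ^ P * ((real p)\<^sup>2 * (real p ^ (r0 + b)) ^ P * K)
        = ((real p)\<^sup>2 / th) ^ P * (real p)\<^sup>2 * (real p ^ r0) ^ P * C1 * (real p powr (real P * real b) * real p powr (E * real N - E * gain k t l * real b + 1 * real b))"
      proof -
        have "real p powr (real P * real b) = (real p ^ b) ^ P"
          using p1 by (simp add: power_mult[symmetric] mult.commute powr_realpow flip: of_nat_mult)
        then show ?thesis by (simp add: K_def power_add power_mult_distrib mult_ac)
      qed
      also have "\<dots> \<le> ((real p)\<^sup>2 / th) ^ P * (real p)\<^sup>2 * (real p ^ r0) ^ P * C1 * (real p powr real Z * real p powr ((E - 1 / real W) * real N))"
        unfolding powr_add[symmetric]
      proof (intro mult_left_mono powr_mono)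
        have "(real P + 2) * real b \<le> E * gain k t l * real b" using g by (intro mult_right_mono) (auto simp: P_def)
        then have "real P * real b + (E * real N - E * gain k t l * real b + 1 * real b) \<le> E * real N - real b"
          by (simp add: algebra_simps)
        also have "\<dots> \<le> E * real N - (real N / real W - real Z)" using br by simp
        finally show "real P * real b + (E * real N - E * gain k t l * real b + 1 * real b) \<le> real Z + (E - 1 / real W) * real N"
          by (simp add: algebra_simps)
      qed (use p1 th C1 in auto)
      also have "\<dots> = B * real p powr ((E - 1 / real W) * real N)" by (simp add: B_def)
      finally show "(1 + th) ^ P * D + ((real p)\<^sup>2 / th) ^ P * ((real p)\<^sup>2 * (real p ^ (r0 + b)) ^ P * K)
         \<le> (1 + th) ^ P * D + B * real p powr ((E - 1 / real W) * real N)" by simp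
    qed
  qed
  show ?thesis
    by (rule exI[of _ B], intro conjI B exI[of _ N1] N1 allI impI) (use main in \<open>simp add: P_def W_def\<close>)
qed

text \<open>With \<open>th\<close> small, passing from N - 1 to N multiplies the old bound by at
  most p^(E' / 2), less than the permitted growth p^E'. Relative to that growth the broad terms are
  summed with ratio \<rho> < 1, so the constant B / (1 - \<rho>) carries the induction.\<close>

lemma decoupling_exponent_improve:
  assumes pr: "prime p" "k < p" and k2: "k \<ge> 2" and IHl: "\<forall>l e. 1 \<le> l \<longrightarrow> l < k \<longrightarrow> e > 0 \<longrightarrow> e \<in> decoupling_exponents p l"
    and E: "E \<in> decoupling_exponents p k" and l: "1 \<le> l" "l < k" and g: "E * gain k t l \<ge> real (2 * tri k) + 2"
    and E': "E' > 0" "E' < E" "E - 1 / real (k ^ Suc t) \<le> E'"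
  shows "E' \<in> decoupling_exponents p k"
proof -
  have p1: "real p > 1" using pr(1) prime_gt_1_nat by simp
  obtain C0 where C0: "C0 \<ge> 1" "\<And>M. decoupling p k M (C0 * real p powr (E * real M))" and E0: "E > 0"
    using E by (auto simp: decoupling_exponents_def)
  define P where "P = 2 * tri k"
  have P: "P > 0" using k2 by (simp add: P_def)
  define th where "th = min 1 (real p powr (E' / (2 * real P)) - 1)"
  have "real p powr (E' / (2 * real P)) > 1" using p1 E'(1) P by simp
  then have th: "0 < th" "th \<le> 1" by (auto simp: th_def)
  have thP: "(1 + th) ^ P \<le> real p powr (E' / 2)"
  proof -
    have "(1 + th) ^ P \<le> (real p powr (E' / (2 * real P))) ^ P" using th by (intro power_mono) (auto simp: th_def)
    also have "\<dots> = real p powr (E' / 2)" using P p1 by (simp add: powr_powr flip: powr_realpow)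
    finally show ?thesis .
  qed
  obtain B N1 where B: "B > 0" and N1: "N1 \<ge> 1" and rec: "\<forall>N D. N \<ge> N1 \<longrightarrow> D \<ge> 0 \<longrightarrow> decoupling p k (N - 1) D \<longrightarrow>
     decoupling p k N ((1 + th) ^ (2 * tri k) * D + B * real p powr ((E - 1 / real (k ^ Suc t)) * real N))"
    using decoupling_recursion[OF pr k2 IHl less_imp_le[OF E0] C0 l g th] by (elim exE conjE) (rule that)
  note rec = rec[folded P_def]
  define \<rho> where "\<rho> = real p powr (- E' / 2)"
  have \<rho>: "\<rho> < 1" "\<rho> > 0" unfolding \<rho>_def using p1 E'(1) by (auto intro!: powr_less_one)
  define C where "C = C0 * real p powr (E * real N1) + B / (1 - \<rho>)"
  have C1: "C0 * real p powr (E * real N1) \<le> C" "B / (1 - \<rho>) \<le> C" using B \<rho> C0(1) by (auto simp: C_def)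
  have "1 * 1 \<le> C0 * real p powr (E * real N1)" using C0(1) p1 E0 by (intro mult_mono) (auto intro: ge_one_powr_ge_zero)
  then have C: "C \<ge> 1" using C1 by simp
  have "decoupling p k N (C * real p powr (E' * real N))" for N
  proof (induction N)
    case 0
    show ?case by (rule decoupling_mono[OF C0(2)[of 0]]) (use C1 C0 p1 E0 in \<open>auto intro!: order_trans[OF _ C1(1)] simp: mult_le_cancel_left1 ge_one_powr_ge_zero\<close>)
  next
    case (Suc N)
    show ?case
    proof (cases "Suc N \<ge> N1")
      case False
      have "C0 * real p powr (E * real (Suc N)) \<le> C0 * real p powr (E * real N1)"
        using False C0(1) p1 E0 by (intro mult_left_mono powr_mono) auto
      also have "\<dots> \<le> C * 1" using C1 by simp
      also have "\<dots> \<le> C * real p powr (E' * real (Suc N))"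
        using C p1 E'(1) by (intro mult_left_mono ge_one_powr_ge_zero) auto
      finally show ?thesis by (rule decoupling_mono[OF C0(2)])
    next
      case True
      have "decoupling p k (Suc N) ((1 + th) ^ P * (C * real p powr (E' * real N)) + B * real p powr ((E - 1 / real (k ^ Suc t)) * real (Suc N)))"
        using Suc True C by (intro rec[rule_format]) auto
      moreover have "(1 + th) ^ P * (C * real p powr (E' * real N)) + B * real p powr ((E - 1 / real (k ^ Suc t)) * real (Suc N)) \<le> C * real p powr (E' * real (Suc N))"
      proof -
        define y where "y = real p powr (E' * real (Suc N))"
        have "(1 + th) ^ P * (C * real p powr (E' * real N)) \<le> real p powr (E' / 2) * (C * real p powr (E' * real N))"
          using thP C by (intro mult_right_mono) auto
        also have "\<dots> = C * (real p powr (E' / 2) * real p powr (E' * real N))" by (simp only: mult_ac)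
        also have "real p powr (E' / 2) * real p powr (E' * real N) = y * \<rho>"
          unfolding y_def \<rho>_def powr_add[symmetric] by (simp add: algebra_simps)
        finally have 1: "(1 + th) ^ P * (C * real p powr (E' * real N)) \<le> C * (y * \<rho>)" .
        have "B * real p powr ((E - 1 / real (k ^ Suc t)) * real (Suc N)) \<le> B * y"
          unfolding y_def using B p1 E'(3) by (intro mult_left_mono powr_mono mult_right_mono) auto
        moreover have "B * y \<le> C * (1 - \<rho>) * y"
        proof (intro mult_right_mono)
          show "B \<le> C * (1 - \<rho>)" using C1(2) \<rho> by (simp add: divide_le_eq)
        qed (simp add: y_def)
        ultimately have 2: "B * real p powr ((E - 1 / real (k ^ Suc t)) * real (Suc N)) \<le> C * (1 - \<rho>) * y" by simp
        show ?thesis using add_mono[OF 1 2] unfolding y_def[symmetric] by (simp add: algebra_simps)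
      qed
      ultimately show ?thesis by (rule decoupling_mono)
    qed
  qed
  then show ?thesis using C E'(1) by (auto simp: decoupling_exponents_def)
qed

theorem decoupling_all_exponents:
  assumes "prime p"
  shows "1 \<le> k \<Longrightarrow> k < p \<Longrightarrow> e > 0 \<Longrightarrow> e \<in> decoupling_exponents p k"
proof (induction k arbitrary: e rule: less_induct)
  case (less k)
  have p1: "p > 1" using assms prime_gt_1_nat by simp
  show ?case
  proof (cases "k = 1")
    case True
    have "decoupling p 1 N (1 * real p powr (e * real N))" for N
      by (rule decoupling_mono[OF decoupling_one]) (use p1 less.prems in \<open>auto intro!: ge_one_powr_ge_zero\<close>)
    then show ?thesis using less.prems True by (auto simp: decoupling_exponents_def intro!: exI[of _ 1])
  next
    case False
    then have k2: "k \<ge> 2" using less.prems by simp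
    define S where "S = decoupling_exponents p k"
    have S: "S \<noteq> {}" unfolding S_def using decoupling_exponents_nonempty[OF assms less.prems(1)] by blast
    have Sb: "bdd_below S" by (rule bdd_belowI[of _ 0]) (auto simp: S_def decoupling_exponents_def)
    define E0 where "E0 = Inf S"
    have E0: "E0 \<ge> 0" unfolding E0_def by (rule cInf_greatest[OF S]) (auto simp: S_def decoupling_exponents_def)
    have "E0 = 0"
    proof (rule ccontr)
      assume "E0 \<noteq> 0"
      then have E0: "E0 > 0" using E0 by simp
      \<comment> \<open>The gain required at exponent E0 to outweigh the crude losses. The gains at
        1, ..., k - 1 average to t / k, so one of them reaches T as soon as t >= k * T.\<close>
      define T where "T = (real (2 * tri k) + 2) / E0"
      have T: "T > 0" using E0 by (simp add: T_def)
      define t where "t = nat \<lceil>real k * T\<rceil>"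
      have tT: "real t \<ge> real k * T" unfolding t_def by linarith
      have "\<exists>l\<in>{1..k - 1}. gain k t l \<ge> T"
      proof (rule ccontr)
        assume "\<not> ?thesis"
        then have "(\<Sum>l=1..k - 1. gain k t l) < (\<Sum>l=1..k - 1. T)" using k2 by (intro sum_strict_mono) (auto simp: not_le)
        also have "\<dots> = (real k - 1) * T" using k2 by (simp add: of_nat_diff)
        also have "\<dots> \<le> real t * (real k - 1) / real k"
        proof -
          have "(real k - 1) * (real k * T) \<le> (real k - 1) * real t" using tT k2 by (intro mult_left_mono) auto
          then show ?thesis using k2 by (simp add: field_simps)
        qed
        also have "\<dots> = (\<Sum>l=1..k - 1. gain k t l)" using sum_gain[of k t] k2 by simp
        finally show False by simp
      qed
      then obtain l where l: "l \<in> {1..k - 1}" "gain k t l \<ge> T" by auto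
      \<comment> \<open>An exponent less than \<kappa> / 2 above the infimum is lowered by \<kappa>
        / 2 and so drops below it. The bound of \<kappa> by E0 keeps the new exponent
        positive.\<close>
      define \<kappa> where "\<kappa> = min E0 (1 / real (k ^ Suc t))"
      have \<kappa>: "\<kappa> > 0" "\<kappa> \<le> E0" "\<kappa> \<le> 1 / real (k ^ Suc t)" using E0 k2 by (auto simp: \<kappa>_def)
      obtain E where E: "E \<in> S" "E < E0 + \<kappa> / 2"
        using cInf_lessD[OF S, of "E0 + \<kappa> / 2"] \<kappa>(1) unfolding E0_def by auto
      have EE0: "E \<ge> E0" unfolding E0_def by (rule cInf_lower[OF E(1) Sb])
      have "E - \<kappa> / 2 \<in> decoupling_exponents p k"
      proof (rule decoupling_exponent_improve[where E = E and l = l and t = t])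
        have "real (2 * tri k) + 2 = E0 * T" using E0 by (simp add: T_def)
        also have "\<dots> \<le> E * gain k t l" using EE0 E0 l T by (intro mult_mono) auto
        finally show "real (2 * tri k) + 2 \<le> E * gain k t l" .
        show "E - 1 / real (k ^ Suc t) \<le> E - \<kappa> / 2" using \<kappa> by linarith
        show "0 < E - \<kappa> / 2" using \<kappa> EE0 by linarith
      qed (use less assms k2 E l \<kappa> in \<open>auto simp: S_def\<close>)
      then have "E0 \<le> E - \<kappa> / 2" unfolding E0_def S_def[symmetric] by (intro cInf_lower Sb)
      then show False using E(2) by simp
    qed
    then obtain E where "E \<in> S" "E < e" using cInf_lessD[OF S, of e] less.prems by (auto simp: E0_def)
    then show ?thesis unfolding S_def using p1 by (auto intro: decoupling_exponents_upward)
  qed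
qed

section \<open>Mean values\<close>

text \<open>Cauchy-Schwarz: \<open>h\<close> splits a fibre of \<open>f\<close> into at most
  \<open>card B\<close> groups, and the square of the sum of the group sizes is at most
  \<open>card B\<close> times the sum of their squares.\<close>

lemma card_fibre_pairs_le:
  fixes f :: "'u \<Rightarrow> 'a" and h :: "'u \<Rightarrow> 'b"
  assumes T: "finite T" and B: "finite B" "h ` T \<subseteq> B"
  shows "real (card {(u, u'). u \<in> T \<and> u' \<in> T \<and> f u = f u'})
    \<le> real (card B) * real (card {(u, u'). u \<in> T \<and> u' \<in> T \<and> f u = f u' \<and> h u = h u'})"
proof -
  define a where "a w v = card {u \<in> T. f u = w \<and> h u = v}" for w v
  have 1: "card {(u, u'). u \<in> T \<and> u' \<in> T \<and> f u = f u'} = (\<Sum>w\<in>f ` T. (\<Sum>v\<in>B. a w v)\<^sup>2)"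
  proof -
    have "{(u, u'). u \<in> T \<and> u' \<in> T \<and> f u = f u'} = (\<Union>w\<in>f ` T. {u \<in> T. f u = w} \<times> {u \<in> T. f u = w})" by auto
    also have "card \<dots> = (\<Sum>w\<in>f ` T. card ({u \<in> T. f u = w} \<times> {u \<in> T. f u = w}))"
      using T by (intro card_UN_disjoint) auto
    also have "\<dots> = (\<Sum>w\<in>f ` T. (\<Sum>v\<in>B. a w v)\<^sup>2)"
    proof (intro sum.cong refl)
      fix w
      have "{u \<in> T. f u = w} = (\<Union>v\<in>B. {u \<in> T. f u = w \<and> h u = v})" using B by auto
      also have "card \<dots> = (\<Sum>v\<in>B. a w v)" unfolding a_def using T B by (intro card_UN_disjoint) auto
      finally show "card ({u \<in> T. f u = w} \<times> {u \<in> T. f u = w}) = (\<Sum>v\<in>B. a w v)\<^sup>2"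
        by (simp add: card_cartesian_product power2_eq_square)
    qed
    finally show ?thesis .
  qed
  have 2: "card {(u, u'). u \<in> T \<and> u' \<in> T \<and> f u = f u' \<and> h u = h u'} = (\<Sum>w\<in>f ` T. \<Sum>v\<in>B. (a w v)\<^sup>2)"
  proof -
    have "{(u, u'). u \<in> T \<and> u' \<in> T \<and> f u = f u' \<and> h u = h u'}
      = (\<Union>(w, v)\<in>f ` T \<times> B. {u \<in> T. f u = w \<and> h u = v} \<times> {u \<in> T. f u = w \<and> h u = v})"
      using B by fastforce
    also have "card \<dots> = (\<Sum>(w, v)\<in>f ` T \<times> B. card ({u \<in> T. f u = w \<and> h u = v} \<times> {u \<in> T. f u = w \<and> h u = v}))"
      unfolding case_prod_unfold using T B by (intro card_UN_disjoint) auto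
    also have "\<dots> = (\<Sum>w\<in>f ` T. \<Sum>v\<in>B. (a w v)\<^sup>2)"
      by (simp add: sum.cartesian_product a_def card_cartesian_product power2_eq_square)
    finally show ?thesis .
  qed
  have "real (card {(u, u'). u \<in> T \<and> u' \<in> T \<and> f u = f u'}) = (\<Sum>w\<in>f ` T. (\<Sum>v\<in>B. real (a w v))\<^sup>2)" by (simp add: 1)
  also have "\<dots> \<le> (\<Sum>w\<in>f ` T. (\<Sum>v\<in>B. (real (a w v))\<^sup>2) * real (card B))"
    by (intro sum_mono sum_squared_le_sum_of_squares)
  also have "\<dots> = real (card B) * real (card {(u, u'). u \<in> T \<and> u' \<in> T \<and> f u = f u' \<and> h u = h u'})"
    by (simp add: 2 sum_distrib_right[symmetric])
  finally show ?thesis .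
qed

definition tuples :: "nat \<Rightarrow> nat \<Rightarrow> (nat \<Rightarrow> nat) set" where
  "tuples s X = {..<s} \<rightarrow>\<^sub>E {1..X}"

definition psum :: "nat \<Rightarrow> (nat \<Rightarrow> nat) \<Rightarrow> nat \<Rightarrow> nat" where
  "psum s u j = (\<Sum>i<s. u i ^ j)"

lemma finite_tuples [simp]: "finite (tuples s X)"
  by (auto simp: tuples_def intro: finite_PiE)

lemma psum_le:
  assumes "u \<in> tuples s X"
  shows "psum s u j \<le> s * X ^ j"
proof -
  have "u i ^ j \<le> X ^ j" if "i < s" for i
    using assms that by (intro power_mono) (auto simp: tuples_def PiE_iff)
  then have "psum s u j \<le> (\<Sum>i<s. X ^ j)" unfolding psum_def by (intro sum_mono) auto
  then show ?thesis by simp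
qed

lemma power_sum_tuples:
  fixes f :: "nat \<Rightarrow> complex"
  shows "(\<Sum>n=1..X. f n) ^ s = (\<Sum>u\<in>tuples s X. \<Prod>i<s. f (u i))"
proof -
  have "(\<Sum>n=1..X. f n) ^ s = (\<Prod>i<s. \<Sum>n\<in>{1..X}. f n)" by simp
  also have "\<dots> = (\<Sum>u\<in>tuples s X. \<Prod>i<s. f (u i))" unfolding tuples_def by (rule prod_sum_PiE) auto
  finally show ?thesis .
qed

definition vinogradov :: "nat \<Rightarrow> nat \<Rightarrow> nat \<Rightarrow> nat" where
  "vinogradov k s X = card {(u, u'). u \<in> tuples s X \<and> u' \<in> tuples s X \<and> (\<forall>j\<in>{1..k}. psum s u j = psum s u' j)}"

lemma double_sum_indicator:
  assumes "finite T"
  shows "(\<Sum>u\<in>T. \<Sum>u'\<in>T. if P u u' then 1 * cnj 1 else 0) = complex_of_real (real (card {(u, u'). u \<in> T \<and> u' \<in> T \<and> P u u'}))"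
proof -
  have "(\<Sum>u\<in>T. \<Sum>u'\<in>T. if P u u' then 1 * cnj 1 else (0::complex)) = (\<Sum>z\<in>T \<times> T. if P (fst z) (snd z) then 1 else 0)"
    by (simp add: sum.cartesian_product case_prod_unfold cong: if_cong)
  also have "\<dots> = (\<Sum>z\<in>{z \<in> T \<times> T. P (fst z) (snd z)}. 1)"
    using assms by (intro sum.inter_filter[symmetric]) auto
  also have "{z \<in> T \<times> T. P (fst z) (snd z)} = {(u, u'). u \<in> T \<and> u' \<in> T \<and> P u u'}" by auto
  finally show ?thesis by simp
qed

lemma norm_power_double: "norm z ^ (2 * s) = (norm (z ^ s))\<^sup>2" for z :: complex
  by (simp add: norm_power power_mult[symmetric] mult.commute)

text \<open>By orthogonality the right side counts solutions of the system modulo q, among which are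
  all solutions in integers.\<close>

lemma vinogradov_le_grid_sum:
  assumes "q > 0"
  shows "real q ^ k * real (vinogradov k s X) \<le>
    (\<Sum>x\<in>grid k q. norm (\<Sum>n=1..X. unit_exp (of_int (mphase k x (int n)) / real q)) ^ (2 * s))"
proof -
  let ?T = "tuples s X"
  have "(\<Sum>n=1..X. unit_exp (of_int (mphase k x (int n)) / real q)) ^ s
    = (\<Sum>u\<in>?T. 1 * unit_exp (of_int (\<Sum>j=1..k. x j * int (psum s u j)) / real q))" for x
  proof -
    have "(\<Sum>i<s. of_int (mphase k x (int (u i))) / real q) = of_int (\<Sum>j=1..k. x j * int (psum s u j)) / real q" for u
    proof -
      have "(\<Sum>i<s. mphase k x (int (u i))) = (\<Sum>j=1..k. x j * int (psum s u j))"
        unfolding mphase_def psum_def of_nat_sum sum_distrib_left by (subst sum.swap) simp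
      then show ?thesis by (simp only: sum_divide_distrib[symmetric] of_int_sum[symmetric])
    qed
    then show ?thesis unfolding power_sum_tuples unit_exp_sum[symmetric] by simp
  qed
  then have s1: "(\<Sum>x\<in>grid k q. norm (\<Sum>n=1..X. unit_exp (of_int (mphase k x (int n)) / real q)) ^ (2 * s))
     = (\<Sum>x\<in>grid k q. (norm (\<Sum>u\<in>?T. 1 * unit_exp (of_int (\<Sum>j=1..k. x j * int (psum s u j)) / real q)))\<^sup>2)"
    by (simp only: norm_power_double)
  have "complex_of_real (\<Sum>x\<in>grid k q. (norm (\<Sum>u\<in>?T. 1 * unit_exp (of_int (\<Sum>j=1..k. x j * int (psum s u j)) / real q)))\<^sup>2) = complex_of_real (real q ^ k * real (card {(u, u'). u \<in> ?T \<and> u' \<in> ?T \<and> (\<forall>n\<in>{1..k}. int q dvd int (psum s u n) - int (psum s u' n))}))"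
    unfolding Parseval_grid[OF assms] double_sum_indicator[OF finite_tuples] by simp
  then have eq: "(\<Sum>x\<in>grid k q. norm (\<Sum>n=1..X. unit_exp (of_int (mphase k x (int n)) / real q)) ^ (2 * s))
     = real q ^ k * real (card {(u, u'). u \<in> ?T \<and> u' \<in> ?T \<and> (\<forall>n\<in>{1..k}. int q dvd int (psum s u n) - int (psum s u' n))})"
    unfolding s1 by (simp only: of_real_eq_iff)
  have "vinogradov k s X \<le> card {(u, u'). u \<in> ?T \<and> u' \<in> ?T \<and> (\<forall>n\<in>{1..k}. int q dvd int (psum s u n) - int (psum s u' n))}"
    unfolding vinogradov_def
  proof (rule card_mono)
    show "finite {(u, u'). u \<in> ?T \<and> u' \<in> ?T \<and> (\<forall>n\<in>{1..k}. int q dvd int (psum s u n) - int (psum s u' n))}"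
      by (rule finite_subset[of _ "?T \<times> ?T"]) auto
  qed auto
  then show ?thesis unfolding eq by (intro mult_left_mono) auto
qed

theorem vinogradov_mean_value:
  assumes k: "k \<ge> 1" and e: "e > 0"
  shows "\<exists>C\<ge>1. \<forall>X\<ge>1. real (vinogradov k (tri k) X) \<le> C * real X powr (real (tri k) + e)"
proof -
  obtain p where p: "prime p" "p > k" using bigger_prime by blast
  have p1: "real p > 1" "p > 1" using p prime_gt_1_nat by auto
  obtain C where C: "C \<ge> 1" "\<And>N. decoupling p k N (C * real p powr (e * real N))"
    using decoupling_all_exponents[OF p(1) k p(2) e] by (auto simp: decoupling_exponents_def)
  define s where "s = tri k"
  have s: "s > 0" using k by (simp add: s_def)
  show ?thesis
  proof (intro exI[of _ "C * real p powr e"] conjI allI impI)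
    have "1 * 1 \<le> C * real p powr e" using C(1) p1 e by (intro mult_mono ge_one_powr_ge_zero) auto
    then show "1 \<le> C * real p powr e" by simp
    fix X :: nat assume X: "1 \<le> X"
    \<comment> \<open>The first scale at which 1, ..., X lie in different classes modulo p^N. The
      decoupled pieces are then single terms of modulus 1, at most X of them nonzero, and p^N is
      still at most p X.\<close>
    define N where "N = (LEAST N. X \<le> p ^ N)"
    have "X \<le> p ^ X" using power_gt_expt[of p X] p1(2) by simp
    then have XN: "X \<le> p ^ N" unfolding N_def by (rule LeastI)
    have NX: "real p ^ N \<le> real p * real X"
    proof (cases N)
      case 0
      then show ?thesis using p1 X by (simp add: mult_ge1_I)
    next
      case (Suc n)
      have "\<not> X \<le> p ^ n" using not_less_Least[of n "\<lambda>N. X \<le> p ^ N"] Suc by (simp add: N_def)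
      then have "p ^ Suc n \<le> p * X" by simp
      then show ?thesis unfolding Suc by (metis of_nat_le_iff of_nat_mult of_nat_power)
    qed
    define q where "q = p ^ (k * N)"
    have q: "q > 0" using p1 by (simp add: q_def)
    define H where "H B x = (\<Sum>n\<in>B. 1 * unit_exp (of_int (mphase k x n) / of_nat q))" for B x
    have "real q ^ k * real (vinogradov k s X) \<le> (\<Sum>x\<in>grid k q. norm (\<Sum>n=1..X. unit_exp (of_int (mphase k x (int n)) / real q)) ^ (2 * s))"
      by (rule vinogradov_le_grid_sum[OF q])
    also have "\<dots> = (\<Sum>x\<in>grid k q. norm (H {1..int X} x) ^ (2 * s))"
    proof -
      have "(\<Sum>n=1..X. unit_exp (of_int (mphase k x (int n)) / real q)) = H {1..int X} x" for x
        unfolding H_def by (rule sum.reindex_bij_witness[of _ nat int]) auto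
      then show ?thesis by simp
    qed
    also have "\<dots> \<le> C * real p powr (e * real N) * (\<Sum>c\<in>{0..<int p ^ N}. (\<Sum>x\<in>grid k q. norm (H {n. n \<in> {1..int X} \<and> n mod int p ^ N = c} x) ^ (2 * s)) powr (1 / s)) ^ s"
      using C(2)[of N, unfolded decoupling_def, rule_format, of "{1..int X}" "\<lambda>_. 1"]
      unfolding H_def q_def s_def by simp
    also have "\<dots> \<le> C * real p powr (e * real N) * (real X * (real q ^ k) powr (1 / s)) ^ s"
    proof (intro mult_left_mono power_mono)
      define f where "f c = (\<Sum>x\<in>grid k q. norm (H {n. n \<in> {1..int X} \<and> n mod int p ^ N = c} x) ^ (2 * s)) powr (1 / s)" for c
      define R where "R = (\<lambda>n. n mod int p ^ N) ` {1..int X}"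
      have f0: "f c = 0" if "c \<notin> R" for c
      proof -
        have em: "{n. n \<in> {1..int X} \<and> n mod int p ^ N = c} = {}" using that by (auto simp: R_def)
        show ?thesis using s unfolding f_def em H_def by simp
      qed
      have f1: "f c \<le> (real q ^ k) powr (1 / s)" if "c \<in> R" for c
      proof -
        have "is_singleton {n. n \<in> {1..int X} \<and> n mod int p ^ N = c}"
        proof (rule is_singletonI')
          show "{n. n \<in> {1..int X} \<and> n mod int p ^ N = c} \<noteq> {}" using that by (auto simp: R_def)
          fix x y assume xy: "x \<in> {n. n \<in> {1..int X} \<and> n mod int p ^ N = c}" "y \<in> {n. n \<in> {1..int X} \<and> n mod int p ^ N = c}"
          then have "(x - 1) mod int p ^ N = (y - 1) mod int p ^ N" by (metis (mono_tags, lifting) mem_Collect_eq mod_diff_left_eq)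
          moreover have "int X \<le> int p ^ N" using XN by (metis of_nat_le_iff of_nat_power)
          then have "(x - 1) mod int p ^ N = x - 1" "(y - 1) mod int p ^ N = y - 1"
          proof -
            have "1 \<le> x" "x \<le> int X" "1 \<le> y" "y \<le> int X" using xy by auto
            then have "0 \<le> x - 1" "x - 1 < int p ^ N" "0 \<le> y - 1" "y - 1 < int p ^ N"
              using \<open>int X \<le> int p ^ N\<close> by linarith+
            then show "(x - 1) mod int p ^ N = x - 1" "(y - 1) mod int p ^ N = y - 1"
              by (auto intro!: mod_pos_pos_trivial)
          qed
          ultimately show "x = y" by simp
        qed
        then obtain n where n: "{n. n \<in> {1..int X} \<and> n mod int p ^ N = c} = {n}" by (auto simp: is_singleton_def)
        have "f c = (real (card (grid k q))) powr (1 / s)" unfolding f_def n by (simp add: H_def)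
        then show ?thesis by (simp add: card_grid)
      qed
      have "(\<Sum>c\<in>{0..<int p ^ N}. f c) \<le> (\<Sum>c\<in>R. f c)"
      proof -
        have "(\<Sum>c\<in>{0..<int p ^ N}. f c) = (\<Sum>c\<in>{0..<int p ^ N} \<inter> R. f c)"
          using f0 by (intro sum.mono_neutral_right) auto
        also have "\<dots> \<le> (\<Sum>c\<in>R. f c)" by (intro sum_mono2) (auto simp: f_def R_def)
        finally show ?thesis .
      qed
      also have "\<dots> \<le> real (card R) * (real q ^ k) powr (1 / s)" using sum_mono[OF f1, of R] by simp
      also have "\<dots> \<le> real X * (real q ^ k) powr (1 / s)"
      proof (intro mult_right_mono)
        have "card R \<le> card {1..int X}" unfolding R_def by (rule card_image_le) simp
        then show "real (card R) \<le> real X" by simp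
      qed simp
      finally show "(\<Sum>c\<in>{0..<int p ^ N}. (\<Sum>x\<in>grid k q. norm (H {n. n \<in> {1..int X} \<and> n mod int p ^ N = c} x) ^ (2 * s)) powr (1 / s))
         \<le> real X * (real q ^ k) powr (1 / s)" unfolding f_def .
    qed (use C in \<open>auto intro!: sum_nonneg\<close>)
    also have "\<dots> = real q ^ k * (C * real p powr (e * real N) * real X ^ s)"
      using s by (simp add: power_mult_distrib power_powr_inverse)
    finally have "real (vinogradov k s X) \<le> C * real p powr (e * real N) * real X ^ s" using q by simp
    also have "\<dots> \<le> C * (real p powr e * real X powr e) * real X ^ s"
    proof (intro mult_right_mono mult_left_mono)
      have "real p powr (e * real N) = (real p ^ N) powr e" using p1 by (simp add: powr_realpow[symmetric] powr_powr mult.commute)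
      also have "\<dots> \<le> (real p * real X) powr e" using NX e p1 by (intro powr_mono2) auto
      finally show "real p powr (e * real N) \<le> real p powr e * real X powr e" by (simp add: powr_mult)
    qed (use C in auto)
    also have "\<dots> = C * real p powr e * real X powr (real s + e)" using X by (simp add: powr_add powr_realpow)
    finally show "real (vinogradov k (tri k) X) \<le> C * real p powr e * real X powr (real (tri k) + e)" unfolding s_def .
  qed
qed

text \<open>As Q exceeds all power sums of degree k, the left side counts solutions of one equation.
  The lower power sums take O(X^(1 + ... + (k - 1))) values, and the fibre estimate passes to the
  full system at that cost.\<close>

lemma sum_power_le_vinogradov:
  assumes k: "k \<ge> 1" and Q: "Q > s * X ^ k" and X: "X \<ge> 1"
  shows "(\<Sum>r<Q. norm (\<Sum>n=1..X. unit_exp (real r * real n ^ k / real Q)) ^ (2 * s)) \<le>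
    real Q * ((real s + 1) ^ k * real X ^ (k * (k - 1) div 2) * real (vinogradov k s X))"
proof -
  let ?T = "tuples s X"
  have Q0: "Q > 0" using Q by simp
  have "(\<Sum>n=1..X. unit_exp (real r * real n ^ k / real Q)) ^ s = (\<Sum>u\<in>?T. 1 * unit_exp (real r * of_int (int (psum s u k)) / real Q))" for r
  proof -
    have "(\<Sum>i<s. real r * real (u i) ^ k / real Q) = real r * of_int (int (psum s u k)) / real Q" for u
      by (simp add: psum_def sum_distrib_left sum_divide_distrib)
    then show ?thesis unfolding power_sum_tuples unit_exp_sum[symmetric] by simp
  qed
  then have s1: "(\<Sum>r<Q. norm (\<Sum>n=1..X. unit_exp (real r * real n ^ k / real Q)) ^ (2 * s))
     = (\<Sum>r<Q. (norm (\<Sum>u\<in>?T. 1 * unit_exp (real r * of_int (int (psum s u k)) / real Q)))\<^sup>2)"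
    by (simp only: norm_power_double)
  have "complex_of_real (\<Sum>r<Q. (norm (\<Sum>u\<in>?T. 1 * unit_exp (real r * of_int (int (psum s u k)) / real Q)))\<^sup>2) = complex_of_real (real Q * real (card {(u, u'). u \<in> ?T \<and> u' \<in> ?T \<and> int Q dvd int (psum s u k) - int (psum s u' k)}))"
    unfolding Parseval_unit_exp[OF Q0] double_sum_indicator[OF finite_tuples] by simp
  then have eq: "(\<Sum>r<Q. norm (\<Sum>n=1..X. unit_exp (real r * real n ^ k / real Q)) ^ (2 * s))
     = real Q * real (card {(u, u'). u \<in> ?T \<and> u' \<in> ?T \<and> int Q dvd int (psum s u k) - int (psum s u' k)})"
    unfolding s1 by (simp only: of_real_eq_iff)
  have "{(u, u'). u \<in> ?T \<and> u' \<in> ?T \<and> int Q dvd int (psum s u k) - int (psum s u' k)} = {(u, u'). u \<in> ?T \<and> u' \<in> ?T \<and> psum s u k = psum s u' k}"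
  proof -
    have "psum s u k = psum s u' k" if "u \<in> ?T" "u' \<in> ?T" "int Q dvd int (psum s u k) - int (psum s u' k)" for u u'
    proof -
      have "psum s u k < Q" "psum s u' k < Q" using le_less_trans[OF psum_le Q] that(1,2) by blast+
      then have "\<bar>int (psum s u k) - int (psum s u' k)\<bar> < int Q" by linarith
      then show ?thesis using that(3) dvd_imp_le_int[of "int (psum s u k) - int (psum s u' k)" "int Q"] by (cases "psum s u k = psum s u' k") auto
    qed
    then show ?thesis by auto
  qed
  moreover have "real (card {(u, u'). u \<in> ?T \<and> u' \<in> ?T \<and> psum s u k = psum s u' k})
    \<le> real (card (\<Pi>\<^sub>E j\<in>{1..<k}. {0..s * X ^ j})) * real (card {(u, u'). u \<in> ?T \<and> u' \<in> ?T \<and> psum s u k = psum s u' k \<and>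
        restrict (psum s u) {1..<k} = restrict (psum s u') {1..<k}})"
    by (rule card_fibre_pairs_le) (auto intro!: finite_PiE psum_le)
  moreover have "{(u, u'). u \<in> ?T \<and> u' \<in> ?T \<and> psum s u k = psum s u' k \<and> restrict (psum s u) {1..<k} = restrict (psum s u') {1..<k}}
     = {(u, u'). u \<in> ?T \<and> u' \<in> ?T \<and> (\<forall>j\<in>{1..k}. psum s u j = psum s u' j)}"
  proof -
    have "{1..k} = insert k {1..<k}" using k by auto
    moreover have "restrict (psum s u) {1..<k} = restrict (psum s u') {1..<k} \<longleftrightarrow> (\<forall>j\<in>{1..<k}. psum s u j = psum s u' j)" for u u'
      by (metis (no_types, lifting) restrict_apply' restrict_ext)
    ultimately show ?thesis by simp
  qed
  ultimately have le: "real (card {(u, u'). u \<in> ?T \<and> u' \<in> ?T \<and> int Q dvd int (psum s u k) - int (psum s u' k)})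
     \<le> real (card (\<Pi>\<^sub>E j\<in>{1..<k}. {0..s * X ^ j})) * real (vinogradov k s X)"
    by (simp add: vinogradov_def)
  have "real (card (\<Pi>\<^sub>E j\<in>{1..<k}. {0..s * X ^ j})) = (\<Prod>j\<in>{1..<k}. real (s * X ^ j + 1))"
    by (simp add: card_PiE)
  also have "\<dots> \<le> (\<Prod>j\<in>{1..<k}. (real s + 1) * real X ^ j)"
    using X by (intro prod_mono) (auto simp: algebra_simps)
  also have "\<dots> = (real s + 1) ^ (k - 1) * real X ^ (\<Sum>j\<in>{1..<k}. j)"
    by (simp add: prod.distrib power_sum)
  also have "(\<Sum>j\<in>{1..<k}. j) = k * (k - 1) div 2"
  proof -
    have "{1..<k} = {0..<k} - {0}" by auto
    then have "(\<Sum>j\<in>{1..<k}. j) = (\<Sum>j\<in>{0..<k}. j)" by (simp add: sum_diff1_nat)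
    then show ?thesis by (simp add: Sum_Ico_nat)
  qed
  also have "(real s + 1) ^ (k - 1) * real X ^ (k * (k - 1) div 2) \<le> (real s + 1) ^ k * real X ^ (k * (k - 1) div 2)"
    by (intro mult_right_mono power_increasing) auto
  finally have cB: "real (card (\<Pi>\<^sub>E j\<in>{1..<k}. {0..s * X ^ j})) \<le> (real s + 1) ^ k * real X ^ (k * (k - 1) div 2)" .
  show ?thesis unfolding eq
    by (intro mult_left_mono order_trans[OF le] mult_right_mono cB) auto
qed

text \<open>The exponent k^2 is k (k + 1) - k, the number of variables minus the degree. This is the
  order contributed by the neighbourhood of 0 on the circle, so nothing but \<open>e\<close> is
  lost.\<close>

theorem power_mean_value:
  assumes k: "k \<ge> 1" and e: "e > 0"
  shows "\<exists>C\<ge>1. \<forall>X\<ge>1. \<forall>Q. Q > tri k * X ^ k \<longrightarrow>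
    (\<Sum>r<Q. norm (\<Sum>n=1..X. unit_exp (real r * real n ^ k / real Q)) ^ (k * (k + 1))) \<le> C * real Q * real X powr (real (k * k) + e)"
proof -
  obtain C where C: "C \<ge> 1" "\<And>X. X \<ge> 1 \<Longrightarrow> real (vinogradov k (tri k) X) \<le> C * real X powr (real (tri k) + e)"
    using vinogradov_mean_value[OF assms] by blast
  define s where "s = tri k"
  show ?thesis
  proof (intro exI[of _ "(real s + 1) ^ k * C"] conjI allI impI)
    have "1 * 1 \<le> (real s + 1) ^ k * C" using C(1) by (intro mult_mono one_le_power) auto
    then show "1 \<le> (real s + 1) ^ k * C" by simp
    fix X Q :: nat assume X: "1 \<le> X" and Q: "tri k * X ^ k < Q"
    have "(\<Sum>r<Q. norm (\<Sum>n=1..X. unit_exp (real r * real n ^ k / real Q)) ^ (k * (k + 1))) \<le>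
      real Q * ((real s + 1) ^ k * real X ^ (k * (k - 1) div 2) * real (vinogradov k s X))"
      using sum_power_le_vinogradov[OF k _ X, of s Q] Q by (simp only: s_def two_tri)
    also have "\<dots> \<le> real Q * ((real s + 1) ^ k * real X ^ (k * (k - 1) div 2) * (C * real X powr (real s + e)))"
      using C(2)[OF X] by (intro mult_left_mono) (auto simp: s_def)
    also have "\<dots> = (real s + 1) ^ k * C * real Q * (real X powr real (k * (k - 1) div 2) * real X powr (real s + e))"
      using X by (simp add: powr_realpow)
    also have "real X powr real (k * (k - 1) div 2) * real X powr (real s + e) = real X powr (real (k * k) + e)"
    proof -
      have "k * (k - 1) div 2 + s = k * k"
      proof -
        have "even (k * (k - 1))" by (cases k) auto
        then have "2 * (k * (k - 1) div 2) = k * (k - 1)" by simp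
        then have "2 * (k * (k - 1) div 2 + s) = k * (k - 1) + k * (k + 1)" using two_tri[of k] by (simp add: s_def)
        also have "\<dots> = 2 * (k * k)" using k by (cases k) (auto simp: algebra_simps)
        finally show ?thesis by simp
      qed
      then have "real (k * (k - 1) div 2) + (real s + e) = real (k * k) + e" by (metis add.assoc of_nat_add)
      then show ?thesis by (simp only: powr_add[symmetric])
    qed
    finally show "(\<Sum>r<Q. norm (\<Sum>n=1..X. unit_exp (real r * real n ^ k / real Q)) ^ (k * (k + 1))) \<le> (real s + 1) ^ k * C * real Q * real X powr (real (k * k) + e)" .
  qed
qed

section \<open>Weyl's inequality\<close>

lemma card_divisors_mult:
  fixes p m :: nat
  assumes "prime p" "m > 0"
  shows "card {d. d dvd p ^ a * m} \<le> (a + 1) * card {d. d dvd m}"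
proof -
  have "{d. d dvd p ^ a * m} \<subseteq> (\<lambda>(i, d). p ^ i * d) ` ({0..a} \<times> {d. d dvd m})"
  proof
    fix d assume "d \<in> {d. d dvd p ^ a * m}"
    then obtain b c where "d = b * c" "b dvd p ^ a" "c dvd m" using division_decomp[of d "p ^ a" m] by auto
    moreover obtain i where "i \<le> a" "b = p ^ i" using \<open>b dvd p ^ a\<close> assms(1) by (auto simp: divides_primepow_nat)
    ultimately show "d \<in> (\<lambda>(i, d). p ^ i * d) ` ({0..a} \<times> {d. d dvd m})" by force
  qed
  moreover have fin: "finite ({0..a} \<times> {d. d dvd m})" using assms(2) by (auto intro: finite_divisors_nat)
  ultimately have "card {d. d dvd p ^ a * m} \<le> card ((\<lambda>(i, d). p ^ i * d) ` ({0..a} \<times> {d. d dvd m}))"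
    by (intro card_mono finite_imageI)
  also have "\<dots> \<le> card ({0..a} \<times> {d. d dvd m})" by (rule card_image_le[OF fin])
  finally show ?thesis by (simp add: card_cartesian_product)
qed

text \<open>One prime is removed at a time. A prime p >= 2^(1 / e) satisfies a + 1 <= 2^a <= p^(e
  a), and each of the finitely many smaller primes costs a constant factor K.\<close>

lemma divisor_bound:
  fixes e :: real
  assumes e: "e > 0"
  shows "\<exists>C\<ge>1. \<forall>n\<ge>1. real (card {d. d dvd (n::nat)}) \<le> C * real n powr e"
proof -
  define p0 :: nat where "p0 = nat \<lceil>2 powr (1 / e)\<rceil>"
  define K where "K = 1 / min 1 (e * ln 2)"
  have K: "K \<ge> 1" using e by (auto simp: K_def min_def)
  have small: "real a + 1 \<le> K * real p powr (e * real a)" if "p \<ge> 2" for a p :: nat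
  proof -
    have m: "min 1 (e * ln 2) > 0" using e by auto
    have "min 1 (e * ln 2) * (real a + 1) \<le> 1 + e * ln 2 * real a"
    proof -
      have "min 1 (e * ln 2) * real a \<le> e * ln 2 * real a" by (intro mult_right_mono) auto
      moreover have "min 1 (e * ln 2) \<le> 1" by simp
      ultimately show ?thesis by (simp add: distrib_left)
    qed
    also have "\<dots> \<le> exp (e * ln 2 * real a)" by (rule exp_ge_add_one_self)
    also have "\<dots> = 2 powr (e * real a)" by (simp add: powr_def mult_ac)
    also have "\<dots> \<le> real p powr (e * real a)" using that e by (intro powr_mono2) auto
    finally show ?thesis using m by (simp add: K_def field_simps)
  qed
  have large: "real a + 1 \<le> real p powr (e * real a)" if "p \<ge> p0" for a p :: nat
  proof -
    have "2 powr (1 / e) \<le> real p" using that unfolding p0_def by linarith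
    then have "(2 powr (1 / e)) powr (e * real a) \<le> real p powr (e * real a)" using e by (intro powr_mono2) auto
    then have "2 ^ a \<le> real p powr (e * real a)" using e by (simp add: powr_powr powr_realpow)
    moreover have "real a + 1 \<le> 2 ^ a"
    proof -
      have "Suc a \<le> 2 ^ a" by (simp add: Suc_le_eq less_exp)
      then have "real (Suc a) \<le> real (2 ^ a)" by (simp only: of_nat_le_iff)
      then show ?thesis by simp
    qed
    ultimately show ?thesis by linarith
  qed
  have main: "n \<ge> 1 \<Longrightarrow> real (card {d. d dvd n}) \<le> K ^ card {p. prime p \<and> p < p0 \<and> p dvd n} * real n powr e" for n :: nat
  proof (induction n rule: less_induct)
    case (less n)
    show ?case
    proof (cases "n = 1")
      case True
      then show ?thesis using K by (simp add: one_le_power)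
    next
      case False
      then obtain p where p: "prime p" "p dvd n" using prime_factor_nat by blast
      obtain m where m: "n = p ^ multiplicity p n * m" "\<not> p dvd m"
        using multiplicity_decompose'[of n p] p less.prems False by (metis not_one_le_zero not_prime_unit)
      define a where "a = multiplicity p n"
      have na: "n = p ^ a * m" using m(1) by (simp add: a_def)
      have p2: "p \<ge> 2" using p(1) by (rule prime_ge_2_nat)
      have a1: "a \<ge> 1" using p less.prems by (simp add: a_def Suc_le_eq prime_multiplicity_gt_zero_iff)
      have m0: "m \<ge> 1" using less.prems na by (cases m) auto
      have mn: "m < n"
      proof -
        have "1 * m < p ^ a * m" using p2 a1 m0 by (intro mult_strict_right_mono one_less_power) auto
        then show ?thesis using na by simp
      qed
      define S where "S n = {p. prime p \<and> p < p0 \<and> p dvd n}" for n :: nat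
      have fS: "finite (S n)" for n by (rule finite_subset[of _ "{..<p0}"]) (auto simp: S_def)
      have Sm: "S m \<subseteq> S n" using na by (auto simp: S_def)
      have "real (card {d. d dvd n}) \<le> real ((a + 1) * card {d. d dvd m})"
        unfolding na using card_divisors_mult[OF p(1), of m a] m0 by (intro of_nat_mono) auto
      also have "\<dots> = (real a + 1) * real (card {d. d dvd m})" by (simp add: ring_distribs)
      also have "\<dots> \<le> (real a + 1) * (K ^ card (S m) * real m powr e)"
        unfolding S_def using less.IH[OF mn m0] by (intro mult_left_mono) auto
      also have "\<dots> \<le> K ^ card (S n) * (real p powr (e * real a) * real m powr e)"
      proof (cases "p < p0")
        case True
        have "p \<in> S n - S m" using True p m(2) by (auto simp: S_def)
        then have "card (S m) < card (S n)" using Sm fS by (intro psubset_card_mono) auto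
        have "(real a + 1) * (K ^ card (S m) * real m powr e) \<le> (K * real p powr (e * real a)) * (K ^ card (S m) * real m powr e)"
          using small[OF p2] K by (intro mult_right_mono) auto
        also have "\<dots> = K ^ Suc (card (S m)) * (real p powr (e * real a) * real m powr e)" by simp
        also have "\<dots> \<le> K ^ card (S n) * (real p powr (e * real a) * real m powr e)"
          using \<open>card (S m) < card (S n)\<close> K by (intro mult_right_mono power_increasing) auto
        finally show ?thesis .
      next
        case False
        have "(real a + 1) * (K ^ card (S m) * real m powr e) \<le> real p powr (e * real a) * (K ^ card (S m) * real m powr e)"
          using large[of p a] K False by (intro mult_right_mono) auto
        also have "\<dots> = K ^ card (S m) * (real p powr (e * real a) * real m powr e)" by simp
        also have "\<dots> \<le> K ^ card (S n) * (real p powr (e * real a) * real m powr e)"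
          using card_mono[OF fS Sm] K by (intro mult_right_mono power_increasing) auto
        finally show ?thesis .
      qed
      also have "real p powr (e * real a) * real m powr e = real n powr e"
      proof -
        have "real n = real p ^ a * real m" by (simp add: na)
        then show ?thesis using p2 by (simp add: powr_mult powr_powr mult.commute flip: powr_realpow)
      qed
      finally show ?thesis by (simp add: S_def)
    qed
  qed
  show ?thesis
  proof (intro exI[of _ "K ^ p0"] conjI allI impI)
    show "1 \<le> K ^ p0" using K by (rule one_le_power)
    fix n :: nat assume n: "1 \<le> n"
    have "card {p. prime p \<and> p < p0 \<and> p dvd n} \<le> card {..<p0}" by (intro card_mono) auto
    then have "K ^ card {p. prime p \<and> p < p0 \<and> p dvd n} \<le> K ^ p0" using K by (intro power_increasing) auto
    then show "real (card {d. d dvd n}) \<le> K ^ p0 * real n powr e"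
      using main[OF n] by (meson mult_right_mono order_trans powr_ge_zero)
  qed
qed

section \<open>Distance to the nearest integer and geometric sums\<close>

definition dist_int :: "real \<Rightarrow> real" where
  "dist_int x = \<bar>x - of_int (round x)\<bar>"

lemma dist_int_ge:
  assumes "x = of_int k + f" "d \<le> f" "f \<le> 1 - d"
  shows "d \<le> dist_int x"
proof (cases "k - round x \<ge> 0")
  case True
  then have "real_of_int (k - round x) \<ge> 0" by (simp only: of_int_0_le_iff)
  then show ?thesis using assms by (simp add: dist_int_def)
next
  case False
  then have "k - round x \<le> - 1" by simp
  then have "real_of_int (k - round x) \<le> - 1" by (metis of_int_le_iff of_int_minus of_int_1)
  then show ?thesis using assms by (simp add: dist_int_def)
qed

lemma dist_int_le: "dist_int x \<le> \<bar>x - of_int k\<bar>"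
  unfolding dist_int_def by (rule round_diff_minimal)

lemma dist_int_nonneg: "dist_int x \<ge> 0"
  by (simp add: dist_int_def)

lemma dist_int_minus_le: "dist_int (x - y) \<le> dist_int x + dist_int y"
proof -
  have "dist_int (x - y) \<le> \<bar>x - y - of_int (round x - round y)\<bar>" by (rule dist_int_le)
  also have "\<dots> \<le> dist_int x + dist_int y" by (simp add: dist_int_def)
  finally show ?thesis .
qed

text \<open>A weak form of Jordan's inequality. The factor pi in the argument makes it sufficient
  for the constant 2 in the bound below.\<close>

lemma sin_ge_half:
  assumes "0 \<le> y" "y \<le> pi / 2"
  shows "y / 2 \<le> sin y"
proof (cases "y \<le> pi / 3")
  case True
  show ?thesis
  proof (cases "y = 0")
    case False
    then have y: "0 < y" using assms by simp
    obtain z where z: "0 < z" "z < y" "sin y - sin 0 = (y - 0) * cos z"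
      using MVT2[OF y, of sin cos] DERIV_sin by blast
    have "cos (pi / 3) \<le> cos z" using z True pi_gt_zero by (intro cos_monotone_0_pi_le) auto
    then show ?thesis using z y by (simp add: cos_60)
  qed simp
next
  case False
  have "sin (pi / 3) \<le> sin y" using False assms by (intro sin_monotone_2pi_le) auto
  moreover have "sin (pi / 3) = sqrt 3 / 2" by (rule sin_60)
  moreover have "sqrt 3 \<ge> 17 / 10" by (rule real_le_rsqrt) (simp add: power2_eq_square)
  ultimately show ?thesis using assms pi_less_4 pi_approx by (simp add: field_simps)
qed

lemma norm_unit_exp_minus_1_ge: "2 * dist_int x \<le> norm (unit_exp x - 1)"
proof -
  define y where "y = x - of_int (round x)"
  have y: "\<bar>y\<bar> \<le> 1 / 2" using of_int_round_abs_le[of x] by (simp add: y_def abs_minus_commute)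
  have "unit_exp x = unit_exp y" by (rule unit_exp_cong) (simp add: y_def)
  also have "unit_exp y = cis (2 * pi * y)" by (simp add: unit_exp_def cis_conv_exp mult_ac)
  finally have "(norm (unit_exp x - 1))\<^sup>2 = (cos (2 * pi * y) - 1)\<^sup>2 + (sin (2 * pi * y))\<^sup>2"
    by (simp add: cmod_power2)
  also have "\<dots> = 2 - 2 * cos (2 * (pi * y))"
    using sin_cos_squared_add[of "2 * pi * y"] by (simp add: power2_eq_square algebra_simps)
  also have "\<dots> = (2 * sin (pi * \<bar>y\<bar>))\<^sup>2"
    unfolding cos_double_sin by (cases "y \<ge> 0") (auto simp: power2_eq_square)
  finally have "norm (unit_exp x - 1) = \<bar>2 * sin (pi * \<bar>y\<bar>)\<bar>"
    by (metis abs_norm_cancel power2_eq_iff_nonneg abs_ge_zero norm_ge_zero power2_abs)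
  moreover have "pi * \<bar>y\<bar> / 2 \<le> sin (pi * \<bar>y\<bar>)" using y by (intro sin_ge_half) auto
  moreover have "2 * \<bar>y\<bar> \<le> pi * \<bar>y\<bar>" using pi_ge_two by (intro mult_right_mono) auto
  ultimately show ?thesis by (simp add: dist_int_def y_def[symmetric])
qed

text \<open>The minimum of X and the reciprocal distance, written so that distance 0 gives X; the
  quotient alone would be 0 there.\<close>

definition mn :: "nat \<Rightarrow> real \<Rightarrow> real" where
  "mn X c = (if real X * dist_int c \<le> 1 then real X else 1 / dist_int c)"

lemma mn_le: "mn X c \<le> real X"
proof (cases "real X * dist_int c \<le> 1")
  case False
  then have "dist_int c > 0" using dist_int_nonneg[of c] by (cases "dist_int c = 0") auto
  then show ?thesis using False by (simp add: mn_def divide_le_eq)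
qed (simp add: mn_def)

lemma mn_nonneg: "mn X c \<ge> 0"
  using dist_int_nonneg[of c] by (auto simp: mn_def)

lemma mn_le_inverse:
  assumes "0 < d" "d \<le> dist_int c"
  shows "mn X c \<le> 1 / d"
proof -
  have "real X \<le> 1 / dist_int c" if "real X * dist_int c \<le> 1" using that assms by (simp add: field_simps)
  moreover have "1 / dist_int c \<le> 1 / d" using assms by (simp add: frac_le)
  ultimately show ?thesis unfolding mn_def by (auto intro: order_trans)
qed

lemma norm_linear_sum_le:
  assumes "v - u \<le> int X"
  shows "norm (\<Sum>n\<in>{u..<v}. unit_exp (c * of_int n + b)) \<le> mn X c"
proof (cases "v \<le> u")
  case True
  then show ?thesis by (simp add: mn_nonneg)
next
  case False
  define l where "l = nat (v - u)"
  have l: "v = u + int l" "l \<le> X" using False assms by (auto simp: l_def)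
  let ?z = "unit_exp c"
  have eq: "(\<Sum>n\<in>{u..<v}. unit_exp (c * of_int n + b)) = unit_exp (c * of_int u + b) * (\<Sum>i<l. ?z ^ i)"
  proof -
    have "(\<Sum>n\<in>{u..<v}. unit_exp (c * of_int n + b)) = (\<Sum>i<l. unit_exp (c * of_int (u + int i) + b))"
      by (rule sum.reindex_bij_witness[of _ "\<lambda>i. u + int i" "\<lambda>n. nat (n - u)"]) (auto simp: l)
    also have "\<dots> = (\<Sum>i<l. unit_exp (c * of_int u + b) * ?z ^ i)"
      by (intro sum.cong refl) (simp add: unit_exp_power unit_exp_add[symmetric] algebra_simps)
    finally show ?thesis by (simp add: sum_distrib_left)
  qed
  have triv: "norm (\<Sum>n\<in>{u..<v}. unit_exp (c * of_int n + b)) \<le> real X"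
  proof -
    have "norm (\<Sum>n\<in>{u..<v}. unit_exp (c * of_int n + b)) \<le> (\<Sum>n\<in>{u..<v}. 1)" by (rule sum_norm_le) simp
    also have "\<dots> \<le> real X" using l by simp
    finally show ?thesis .
  qed
  show ?thesis
  proof (cases "real X * dist_int c \<le> 1")
    case True
    then show ?thesis using triv by (simp add: mn_def)
  next
    case False
    then have d: "dist_int c > 0" using dist_int_nonneg[of c] by (cases "dist_int c = 0") auto
    then have nz: "norm (?z - 1) > 0" using norm_unit_exp_minus_1_ge[of c] by linarith
    then have "?z \<noteq> 1" by auto
    then have "norm (\<Sum>i<l. ?z ^ i) = norm (1 - ?z ^ l) / norm (?z - 1)"
      by (simp add: sum_gp_strict norm_divide norm_minus_commute)
    also have "\<dots> \<le> 2 / (2 * dist_int c)"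
    proof (intro frac_le)
      show "norm (1 - ?z ^ l) \<le> 2" using norm_triangle_ineq4[of 1 "?z ^ l"] by (simp add: unit_exp_power)
    qed (use d norm_unit_exp_minus_1_ge in auto)
    finally show ?thesis using False by (simp add: eq norm_mult mn_def)
  qed
qed

section \<open>Weyl differencing\<close>

lemma van_der_Corput_square:
  fixes \<phi> :: "int \<Rightarrow> real"
  assumes "v - u \<le> int X"
  shows "(norm (\<Sum>n\<in>{u..<v}. unit_exp (\<phi> n)))\<^sup>2 \<le> real X + 2 * (\<Sum>h=1..X. norm (\<Sum>n\<in>{u..<v - int h}. unit_exp (\<phi> (n + int h) - \<phi> n)))"
proof -
  define I where "I = {u..<v}"
  define c where "c n n' = unit_exp (\<phi> n - \<phi> n')" for n n'
  define A where "A = {(n, n'). n \<in> I \<and> n' \<in> I \<and> n' < n}"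
  have fin: "finite I" "finite A" by (auto simp: I_def A_def intro: finite_subset[of _ "{u..<v} \<times> {u..<v}"])
  have "complex_of_real ((norm (\<Sum>n\<in>I. unit_exp (\<phi> n)))\<^sup>2) = (\<Sum>(n, n')\<in>I \<times> I. c n n')"
    unfolding complex_norm_square c_def unit_exp_diff by (simp add: sum_product sum.cartesian_product)
  \<comment> \<open>Pairs with n' < n, their mirror images, which contribute the complex conjugate,
    and the diagonal.\<close>
  also have "I \<times> I = (A \<union> (\<lambda>(n, n'). (n', n)) ` A) \<union> (\<lambda>n. (n, n)) ` I" by (auto simp: A_def image_iff)
  also have "(\<Sum>(n, n')\<in>\<dots>. c n n') = (\<Sum>(n, n')\<in>A. c n n') + (\<Sum>(n, n')\<in>(\<lambda>(n, n'). (n', n)) ` A. c n n') + (\<Sum>(n, n')\<in>(\<lambda>n. (n, n)) ` I. c n n')"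
    using fin by (subst sum.union_disjoint, auto simp: A_def)+
  also have "(\<Sum>(n, n')\<in>(\<lambda>(n, n'). (n', n)) ` A. c n n') = cnj (\<Sum>(n, n')\<in>A. c n n')"
    by (subst sum.reindex) (auto simp: inj_on_def c_def unit_exp_diff case_prod_unfold mult.commute)
  also have "(\<Sum>(n, n')\<in>(\<lambda>n. (n, n)) ` I. c n n') = of_nat (card I)"
    by (subst sum.reindex) (auto simp: inj_on_def c_def)
  finally have eq: "complex_of_real ((norm (\<Sum>n\<in>I. unit_exp (\<phi> n)))\<^sup>2) = (\<Sum>(n, n')\<in>A. c n n') + cnj (\<Sum>(n, n')\<in>A. c n n') + of_nat (card I)" .
  have "(norm (\<Sum>n\<in>I. unit_exp (\<phi> n)))\<^sup>2 = norm (complex_of_real ((norm (\<Sum>n\<in>I. unit_exp (\<phi> n)))\<^sup>2))" by (subst norm_of_real) simp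
  also have "\<dots> \<le> norm (\<Sum>(n, n')\<in>A. c n n') + norm (\<Sum>(n, n')\<in>A. c n n') + real (card I)"
    unfolding eq by (metis (no_types, lifting) add_mono_thms_linordered_semiring(3) complex_mod_cnj norm_of_nat norm_triangle_ineq norm_triangle_le order_refl)
  finally have le: "(norm (\<Sum>n\<in>I. unit_exp (\<phi> n)))\<^sup>2 \<le> 2 * norm (\<Sum>(n, n')\<in>A. c n n') + real (card I)" by simp
  have "(\<Sum>(n, n')\<in>A. c n n') = (\<Sum>(h, n)\<in>Sigma {1..X} (\<lambda>h. {u..<v - int h}). c (n + int h) n)"
    by (rule sum.reindex_bij_witness[of _ "\<lambda>(h, n). (n + int h, n)" "\<lambda>(n, n'). (nat (n - n'), n')"])
       (use assms in \<open>auto simp: A_def I_def\<close>)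
  also have "\<dots> = (\<Sum>h=1..X. \<Sum>n\<in>{u..<v - int h}. c (n + int h) n)" by (simp add: sum.Sigma)
  finally have "norm (\<Sum>(n, n')\<in>A. c n n') \<le> (\<Sum>h=1..X. norm (\<Sum>n\<in>{u..<v - int h}. c (n + int h) n))"
    by (simp add: norm_sum)
  moreover have "real (card I) \<le> real X" using assms by (simp add: I_def)
  ultimately show ?thesis using le by (simp add: I_def c_def)
qed

lemma power_mean_two_power:
  fixes y :: "'a \<Rightarrow> real"
  assumes "\<And>i. i \<in> S \<Longrightarrow> y i \<ge> 0"
  shows "(\<Sum>i\<in>S. y i) ^ (2 ^ j) \<le> real (card S) ^ (2 ^ j - 1) * (\<Sum>i\<in>S. y i ^ (2 ^ j))"
proof (induction j)
  case (Suc j)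
  have "(\<Sum>i\<in>S. y i) ^ (2 ^ Suc j) = ((\<Sum>i\<in>S. y i) ^ (2 ^ j))\<^sup>2"
    by (simp add: power_mult[symmetric] mult.commute)
  also have "\<dots> \<le> (real (card S) ^ (2 ^ j - 1) * (\<Sum>i\<in>S. y i ^ (2 ^ j)))\<^sup>2"
    using Suc assms by (intro power_mono zero_le_power sum_nonneg) auto
  also have "\<dots> \<le> (real (card S) ^ (2 ^ j - 1))\<^sup>2 * ((\<Sum>i\<in>S. (y i ^ (2 ^ j))\<^sup>2) * real (card S))"
    unfolding power_mult_distrib by (intro mult_left_mono sum_squared_le_sum_of_squares) auto
  also have "\<dots> = (real (card S) ^ (2 ^ j - 1 + (2 ^ j - 1) + 1)) * (\<Sum>i\<in>S. y i ^ (2 ^ Suc j))"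
  proof -
    have yy: "(y i ^ (2 ^ j))\<^sup>2 = y i ^ (2 ^ Suc j)" for i by (simp add: power_mult[symmetric] mult.commute)
    show ?thesis unfolding yy by (simp only: power_add power2_eq_square power_one_right mult_ac)
  qed
  also have "(2 ^ j - 1 + (2 ^ j - 1) + 1 :: nat) = 2 ^ Suc j - 1"
  proof -
    have "y - 1 + (y - 1) + 1 = 2 * y - 1" if "y \<ge> 1" for y :: nat using that by linarith
    from this[of "2 ^ j"] show ?thesis by (simp only: power_Suc) simp
  qed
  finally show ?case .
qed simp

text \<open>\<open>weyl_sum j X c\<close> is what remains of a Weyl sum of degree \<open>j\<close> with leading coefficient \<open>c\<close> after
  \<open>j - 1\<close> differencing steps; the index is shifted by one.\<close>

fun weyl_sum :: "nat \<Rightarrow> nat \<Rightarrow> real \<Rightarrow> real" where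
  "weyl_sum 0 X c = mn X c"
| "weyl_sum (Suc j) X c = real X ^ Suc j + (\<Sum>h=1..X. weyl_sum j X (real (j + 2) * real h * c))"

lemma weyl_sum_nonneg: "weyl_sum j X c \<ge> 0"
  by (induction j arbitrary: c) (auto intro!: add_nonneg_nonneg sum_nonneg simp: mn_nonneg)

lemma polynomial_difference:
  fixes a :: "nat \<Rightarrow> real" and n h :: real
  shows "(\<Sum>i\<le>Suc j. a i * (n + h) ^ i) - (\<Sum>i\<le>Suc j. a i * n ^ i)
    = (\<Sum>t\<le>j. (\<Sum>i=Suc t..Suc j. a i * real (i choose t) * h ^ (i - t)) * n ^ t)"
proof -
  have "(\<Sum>i\<le>Suc j. a i * (n + h) ^ i) - (\<Sum>i\<le>Suc j. a i * n ^ i) = (\<Sum>i\<le>Suc j. \<Sum>t<i. a i * real (i choose t) * h ^ (i - t) * n ^ t)"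
    unfolding sum_subtractf[symmetric]
  proof (intro sum.cong refl)
    fix i
    have "(n + h) ^ i = (\<Sum>t\<le>i. real (i choose t) * n ^ t * h ^ (i - t))" by (simp add: binomial_ring)
    also have "\<dots> = (\<Sum>t<i. real (i choose t) * n ^ t * h ^ (i - t)) + n ^ i"
      by (simp add: lessThan_Suc_atMost[symmetric])
    finally show "a i * (n + h) ^ i - a i * n ^ i = (\<Sum>t<i. a i * real (i choose t) * h ^ (i - t) * n ^ t)"
      by (simp add: sum_distrib_left algebra_simps)
  qed
  also have "\<dots> = (\<Sum>(i, t)\<in>Sigma {..Suc j} (\<lambda>i. {..<i}). a i * real (i choose t) * h ^ (i - t) * n ^ t)" by (rule sum.Sigma) auto
  also have "\<dots> = (\<Sum>(t, i)\<in>Sigma {..j} (\<lambda>t. {Suc t..Suc j}). a i * real (i choose t) * h ^ (i - t) * n ^ t)"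
    by (rule sum.reindex_bij_witness[of _ "\<lambda>(t, i). (i, t)" "\<lambda>(i, t). (t, i)"]) auto
  also have "\<dots> = (\<Sum>t\<le>j. \<Sum>i=Suc t..Suc j. a i * real (i choose t) * h ^ (i - t) * n ^ t)" by (rule sum.Sigma[symmetric]) auto
  finally show ?thesis by (simp only: sum_distrib_right)
qed

text \<open>Each squaring replaces a polynomial of degree j + 2 with leading coefficient c by its
  differences with step h, of degree j + 1 and leading coefficient (j + 2) h c. The interval only
  becomes shorter, and the power mean inequality moves the remaining power inside the sum over
  h.\<close>

lemma weyl_differencing:
  assumes X: "X \<ge> 1"
  shows "v - u \<le> int X \<Longrightarrow> norm (\<Sum>n\<in>{u..<v}. unit_exp (\<Sum>i\<le>Suc j. a i * real_of_int n ^ i)) ^ (2 ^ j)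
    \<le> 4 ^ (2 ^ j) * real X ^ (2 ^ j - Suc j) * weyl_sum j X (a (Suc j))"
proof (induction j arbitrary: u v a)
  case 0
  have "norm (\<Sum>n\<in>{u..<v}. unit_exp (a (Suc 0) * real_of_int n + a 0)) \<le> mn X (a (Suc 0))" by (rule norm_linear_sum_le[OF 0])
  also have "\<dots> \<le> 4 * mn X (a (Suc 0))" using mn_nonneg[of X "a (Suc 0)"] by simp
  finally show ?case by (simp add: add.commute)
next
  case (Suc j)
  define K :: nat where "K = 2 ^ j"
  define \<phi> where "\<phi> n = (\<Sum>i\<le>Suc (Suc j). a i * real_of_int n ^ i)" for n
  define T where "T h = norm (\<Sum>n\<in>{u..<v - int h}. unit_exp (\<phi> (n + int h) - \<phi> n))" for h
  have K: "K \<ge> Suc j" "K \<ge> 1" unfolding K_def by (auto simp: Suc_le_eq less_exp)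
  have T: "T h ^ K \<le> 4 ^ K * real X ^ (K - Suc j) * weyl_sum j X (real (j + 2) * real h * a (Suc (Suc j)))" for h
  proof -
    define b where "b t = (\<Sum>i=Suc t..Suc (Suc j). a i * real (i choose t) * real h ^ (i - t))" for t
    have "\<phi> (n + int h) - \<phi> n = (\<Sum>t\<le>Suc j. b t * real_of_int n ^ t)" for n
      using polynomial_difference[of a "real_of_int n" "real h" "Suc j"] by (simp add: \<phi>_def b_def)
    then have "T h ^ K \<le> 4 ^ K * real X ^ (K - Suc j) * weyl_sum j X (b (Suc j))"
      unfolding T_def K_def using Suc.IH[of "v - int h" u b] Suc.prems by simp
    moreover have "b (Suc j) = real (j + 2) * real h * a (Suc (Suc j))" by (simp add: b_def)
    ultimately show ?thesis by simp
  qed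
  have "norm (\<Sum>n\<in>{u..<v}. unit_exp (\<phi> n)) ^ (2 ^ Suc j) = ((norm (\<Sum>n\<in>{u..<v}. unit_exp (\<phi> n)))\<^sup>2) ^ K"
    by (simp add: K_def power_mult[symmetric])
  also have "\<dots> \<le> (real X + 2 * (\<Sum>h=1..X. T h)) ^ K"
    unfolding T_def by (intro power_mono van_der_Corput_square Suc.prems) auto
  \<comment> \<open>The diagonal is entered as the term h = 0, so that one power mean inequality
    over X + 1 <= 2 X terms covers everything.\<close>
  also have "real X + 2 * (\<Sum>h=1..X. T h) = (\<Sum>h\<in>{0..X}. if h = 0 then real X else 2 * T h)"
    by (simp add: sum.atLeast_Suc_atMost sum_distrib_left)
  finally have "norm (\<Sum>n\<in>{u..<v}. unit_exp (\<phi> n)) ^ (2 ^ Suc j) \<le> (\<Sum>h\<in>{0..X}. if h = 0 then real X else 2 * T h) ^ K" .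
  also have "\<dots> \<le> real (card {0..X}) ^ (K - 1) * (\<Sum>h\<in>{0..X}. (if h = 0 then real X else 2 * T h) ^ K)"
    unfolding K_def by (rule power_mean_two_power) (auto simp: T_def)
  also have "(\<Sum>h\<in>{0..X}. (if h = 0 then real X else 2 * T h) ^ K) = real X ^ K + (\<Sum>h=1..X. 2 ^ K * T h ^ K)"
    by (simp add: sum.atLeast_Suc_atMost power_mult_distrib)
  also have "real (card {0..X}) ^ (K - 1) * (real X ^ K + (\<Sum>h=1..X. 2 ^ K * T h ^ K)) \<le> (2 * real X) ^ (K - 1) * (8 ^ K * (real X ^ (K - Suc j) * weyl_sum (Suc j) X (a (Suc (Suc j)))))"
  proof (intro mult_mono power_mono)
    have "real X ^ K = real X ^ (K - Suc j) * real X ^ Suc j"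
      using K by (simp only: power_add[symmetric] le_add_diff_inverse2)
    then have "1 * real X ^ K \<le> 8 ^ K * (real X ^ (K - Suc j) * real X ^ Suc j)" by (intro mult_mono) auto
    moreover have "(\<Sum>h=1..X. 2 ^ K * T h ^ K) \<le> (\<Sum>h=1..X. 2 ^ K * (4 ^ K * real X ^ (K - Suc j) * weyl_sum j X (real (j + 2) * real h * a (Suc (Suc j)))))"
      by (intro sum_mono mult_left_mono T) auto
    moreover have "(\<Sum>h=1..X. 2 ^ K * (4 ^ K * real X ^ (K - Suc j) * weyl_sum j X (real (j + 2) * real h * a (Suc (Suc j)))))
       = 8 ^ K * (real X ^ (K - Suc j) * (\<Sum>h=1..X. weyl_sum j X (real (j + 2) * real h * a (Suc (Suc j)))))"
    proof -
      have "(8::real) ^ K = 2 ^ K * 4 ^ K" by (simp flip: power_mult_distrib)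
      then show ?thesis by (simp only: sum_distrib_left mult_ac)
    qed
    ultimately show "real X ^ K + (\<Sum>h=1..X. 2 ^ K * T h ^ K) \<le> 8 ^ K * (real X ^ (K - Suc j) * weyl_sum (Suc j) X (a (Suc (Suc j))))"
      by (simp only: weyl_sum.simps distrib_left mult_1_left)
  qed (use X in \<open>auto simp: T_def intro!: sum_nonneg add_nonneg_nonneg\<close>)
  also have "\<dots> = 2 ^ (K - 1) * 8 ^ K * (real X ^ (K - 1) * real X ^ (K - Suc j)) * weyl_sum (Suc j) X (a (Suc (Suc j)))"
    by (simp add: power_mult_distrib)
  also have "real X ^ (K - 1) * real X ^ (K - Suc j) = real X ^ (2 ^ Suc j - Suc (Suc j))"
  proof -
    have "K - 1 + (K - Suc j) = 2 ^ Suc j - Suc (Suc j)" using K by (simp add: K_def)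
    then show ?thesis by (simp only: power_add[symmetric])
  qed
  also have "2 ^ (K - 1) * 8 ^ K * real X ^ (2 ^ Suc j - Suc (Suc j)) * weyl_sum (Suc j) X (a (Suc (Suc j)))
     \<le> 4 ^ (2 ^ Suc j) * real X ^ (2 ^ Suc j - Suc (Suc j)) * weyl_sum (Suc j) X (a (Suc (Suc j)))"
  proof (intro mult_right_mono weyl_sum_nonneg)
    have "(2::real) ^ (K - 1) * 8 ^ K \<le> 2 ^ K * 8 ^ K" by (intro mult_right_mono power_increasing) auto
    also have "\<dots> = 4 ^ (2 ^ Suc j)" by (simp add: K_def power_mult power2_eq_square flip: power_mult_distrib)
    finally show "(2::real) ^ (K - 1) * 8 ^ K \<le> 4 ^ (2 ^ Suc j)" .
  qed simp
  finally show ?case by (simp add: \<phi>_def)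
qed

lemma double_sum_products_le:
  fixes G :: "nat \<Rightarrow> real"
  assumes G: "\<And>s. G s \<ge> 0" and D: "\<And>s. s \<in> {1..X * Y} \<Longrightarrow> real (card {d. d dvd s}) \<le> D"
  shows "(\<Sum>h=1..X. \<Sum>t=1..Y. G (h * t)) \<le> D * (\<Sum>s=1..X * Y. G s)"
proof -
  let ?S = "{1..X} \<times> {1..Y}"
  have "(\<Sum>h=1..X. \<Sum>t=1..Y. G (h * t)) = (\<Sum>z\<in>?S. G (fst z * snd z))"
    by (simp add: sum.cartesian_product case_prod_unfold)
  also have "\<dots> = (\<Sum>s=1..X * Y. \<Sum>z\<in>{z \<in> ?S. fst z * snd z = s}. G (fst z * snd z))"
    by (rule sum.group[symmetric]) (auto intro: mult_le_mono)
  also have "\<dots> \<le> (\<Sum>s=1..X * Y. D * G s)"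
  proof (rule sum_mono)
    fix s assume s: "s \<in> {1..X * Y}"
    have "card {z \<in> ?S. fst z * snd z = s} \<le> card {d. d dvd s}"
    proof (rule card_inj_on_le[where f = fst])
      show "inj_on fst {z \<in> ?S. fst z * snd z = s}"
      proof (rule inj_onI)
        fix x y assume xy: "x \<in> {z \<in> ?S. fst z * snd z = s}" "y \<in> {z \<in> ?S. fst z * snd z = s}" "fst x = fst y"
        then have "fst x * snd x = fst x * snd y" "fst x \<noteq> 0" by auto
        then have "snd x = snd y" by simp
        then show "x = y" using xy(3) by (simp add: prod_eq_iff)
      qed
      show "finite {d. d dvd s}" using s by (intro finite_divisors_nat) auto
    qed auto
    then have "real (card {z \<in> ?S. fst z * snd z = s}) \<le> D" using D[OF s] by linarith
    moreover have "(\<Sum>z\<in>{z \<in> ?S. fst z * snd z = s}. G (fst z * snd z)) = real (card {z \<in> ?S. fst z * snd z = s}) * G s" by simp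
    ultimately show "(\<Sum>z\<in>{z \<in> ?S. fst z * snd z = s}. G (fst z * snd z)) \<le> D * G s"
      using G[of s] by (simp only: mult_right_mono)
  qed
  finally show ?thesis by (simp add: sum_distrib_left)
qed

text \<open>The differencing parameters matter only through their product. Each merging of a
  parameter into the product costs a divisor bound \<open>D\<close>, and the degrees of the
  successive polynomials leave the factor \<open>fact (Suc j)\<close>.\<close>

lemma weyl_sum_le:
  assumes X: "X \<ge> 1" and D: "D \<ge> 1"
  shows "(\<And>s. s \<in> {1..X ^ j} \<Longrightarrow> real (card {d. d dvd s}) \<le> D) \<Longrightarrow>
    weyl_sum j X c \<le> (2 * D) ^ j * (real X ^ j + (\<Sum>t=1..X ^ j. mn X (fact (Suc j) * real t * c)))"
proof (induction j arbitrary: c)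
  case 0
  then show ?case by simp
next
  case (Suc j)
  define B where "B = (2 * D) ^ j"
  have B: "B \<ge> 1" unfolding B_def using D by (intro one_le_power) simp
  have sub: "{1..X ^ j} \<subseteq> {1..X ^ Suc j}" using X by auto
  have Dj: "\<And>s. s \<in> {1..X ^ j} \<Longrightarrow> real (card {d. d dvd s}) \<le> D" using Suc.prems sub by blast
  have f2: "fact (Suc (Suc j)) = real (j + 2) * fact (Suc j)" by (simp add: algebra_simps)
  have "weyl_sum (Suc j) X c \<le> real X ^ Suc j + (\<Sum>h=1..X. B * (real X ^ j + (\<Sum>t=1..X ^ j. mn X (fact (Suc j) * real t * (real (j + 2) * real h * c)))))"
    unfolding weyl_sum.simps B_def by (intro add_left_mono sum_mono Suc.IH[OF Dj])
  also have "\<dots> = real X ^ Suc j + B * real X ^ Suc j + B * (\<Sum>h=1..X. \<Sum>t=1..X ^ j. mn X (fact (Suc (Suc j)) * real (h * t) * c))"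
  proof -
    have "fact (Suc j) * real t * (real (j + 2) * real h * c) = fact (Suc (Suc j)) * real (h * t) * c" for h t
      unfolding f2 by (simp only: of_nat_mult mult_ac)
    then show ?thesis by (simp only: sum_distrib_left[symmetric] distrib_left sum.distrib) simp
  qed
  also have "\<dots> \<le> real X ^ Suc j + B * real X ^ Suc j + B * (D * (\<Sum>s=1..X ^ Suc j. mn X (fact (Suc (Suc j)) * real s * c)))"
  proof -
    have "(\<Sum>h=1..X. \<Sum>t=1..X ^ j. mn X (fact (Suc (Suc j)) * real (h * t) * c)) \<le> D * (\<Sum>s=1..X * X ^ j. mn X (fact (Suc (Suc j)) * real s * c))"
      using Suc.prems by (intro double_sum_products_le) (auto simp: mn_nonneg)
    then show ?thesis using B by (intro add_left_mono mult_left_mono) auto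
  qed
  also have "\<dots> \<le> (2 * D) ^ Suc j * (real X ^ Suc j + (\<Sum>s=1..X ^ Suc j. mn X (fact (Suc (Suc j)) * real s * c)))"
  proof -
    define S where "S = (\<Sum>s=1..X ^ Suc j. mn X (fact (Suc (Suc j)) * real s * c))"
    have S: "S \<ge> 0" by (auto simp: S_def intro: sum_nonneg mn_nonneg)
    have "1 * 1 \<le> B * D" using B D by (intro mult_mono) auto
    moreover have "B * 1 \<le> B * D" using B D by (intro mult_left_mono) auto
    ultimately have "1 + B \<le> 2 * D * B" by (simp add: mult.commute)
    then have "(1 + B) * real X ^ Suc j \<le> 2 * D * B * real X ^ Suc j" by (intro mult_right_mono) auto
    moreover have "B * (D * S) \<le> 2 * D * B * S" using B D S by (simp add: mult_ac)
    ultimately show ?thesis unfolding S_def[symmetric] by (simp add: B_def algebra_simps)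
  qed
  finally show ?case .
qed

lemma harmonic_sum_le: "q \<ge> 1 \<Longrightarrow> (\<Sum>i=1..q. 1 / real i) \<le> 1 + ln (real q)"
proof -
  assume q: "q \<ge> 1"
  have "harm (Suc (q - 1)) - ln (real (Suc (q - 1))) \<le> harm (Suc 0) - ln (real (Suc 0))"
    by (rule decseqD[OF decseq_harm_diff_ln]) simp
  then have "harm q - ln (real q) \<le> 1" using q by (simp add: harm_def)
  then show ?thesis by (simp add: harm_def inverse_eq_divide)
qed

text \<open>Modulo 1 the point \<gamma> + r \<alpha> is (y r + \<eta>) / q, where y permutes the
  residues and \<eta> lies between -1 and 2. The residues 0, 1, q - 2, q - 1 get the trivial bound
  X; the others are dominated by two harmonic sums. The shift \<gamma> permits blocks starting
  anywhere and, later on, the points r / Q seen from a fixed fraction.\<close>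

lemma shifted_block_sum_mn_le:
  fixes a :: int
  assumes q: "q \<ge> 1" and cop: "coprime a (int q)" and \<alpha>: "\<bar>\<alpha> - of_int a / real q\<bar> \<le> 1 / (real q)\<^sup>2"
  shows "(\<Sum>r<q. mn X (\<gamma> + real r * \<alpha>)) \<le> 4 * real X + 2 * real q * (1 + ln (real q))"
proof -
  define k where "k = \<lfloor>\<gamma> * real q\<rfloor>"
  define \<theta> where "\<theta> = \<alpha> - of_int a / real q"
  define y where "y r = (k + r * a) mod int q" for r
  define g where "g y = (if y \<le> 1 \<or> y \<ge> int q - 2 then real X else real q * (1 / of_int (y - 1)) + real q * (1 / of_int (int q - y - 2)))" for y
  have q0: "real q > 0" using q by simp
  have pt: "mn X (\<gamma> + of_int r * \<alpha>) \<le> g (y r)" if r: "r \<in> {0..<int q}" for r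
  proof (cases "y r \<le> 1 \<or> y r \<ge> int q - 2")
    case True
    then show ?thesis by (auto simp: g_def mn_le)
  next
    case False
    define \<phi> where "\<phi> = \<gamma> * real q - of_int k"
    have \<phi>: "0 \<le> \<phi>" "\<phi> < 1" unfolding \<phi>_def k_def by linarith+
    define \<eta> where "\<eta> = \<phi> + real q * (of_int r * \<theta>)"
    have "\<bar>real q * (of_int r * \<theta>)\<bar> \<le> 1"
    proof -
      have "\<bar>real q * (of_int r * \<theta>)\<bar> = real q * of_int r * \<bar>\<theta>\<bar>" using r by (simp add: abs_mult)
      also have "\<dots> \<le> real q * real q * (1 / (real q)\<^sup>2)" using r \<alpha> by (intro mult_mono) (auto simp: \<theta>_def)
      finally show ?thesis using q0 by (simp add: power2_eq_square)
    qed
    then have \<eta>: "- 1 \<le> \<eta>" "\<eta> < 2" using \<phi> unfolding \<eta>_def by linarith+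
    have dec: "k + r * a = int q * ((k + r * a) div int q) + y r" by (simp add: y_def)
    have "\<gamma> + of_int r * \<alpha> = of_int ((k + r * a) div int q) + (of_int (y r) + \<eta>) / real q"
    proof -
      have "(\<gamma> + of_int r * \<alpha>) * real q = \<gamma> * real q + of_int r * (of_int a + real q * \<theta>)"
        using r q0 by (simp add: \<theta>_def algebra_simps)
      also have "\<dots> = of_int (k + r * a) + \<eta>" by (simp add: \<eta>_def \<phi>_def algebra_simps)
      also have "\<dots> = of_int (int q * ((k + r * a) div int q) + y r) + \<eta>" using dec by presburger
      finally show ?thesis using q0 by (simp add: field_simps)
    qed
    moreover define d where "d = min (of_int (y r - 1) / real q) (of_int (int q - y r - 2) / real q)"
    have d: "d > 0" using False q0 by (auto simp: d_def)
    have f1: "d \<le> (of_int (y r) + \<eta>) / real q"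
    proof -
      have "d \<le> of_int (y r - 1) / real q" by (simp add: d_def)
      also have "\<dots> \<le> (of_int (y r) + \<eta>) / real q" using \<eta> q0 by (intro divide_right_mono) auto
      finally show ?thesis .
    qed
    have f2: "(of_int (y r) + \<eta>) / real q \<le> 1 - d"
    proof -
      have "(of_int (y r) + \<eta>) / real q \<le> (real q - of_int (int q - y r - 2)) / real q" using \<eta> q0 by (intro divide_right_mono) auto
      also have "\<dots> = 1 - of_int (int q - y r - 2) / real q" using q0 by (simp only: diff_divide_distrib) simp
      also have "\<dots> \<le> 1 - d" by (simp add: d_def)
      finally show ?thesis .
    qed
    ultimately have "d \<le> dist_int (\<gamma> + of_int r * \<alpha>)" using f1 f2 by (intro dist_int_ge)
    then have "mn X (\<gamma> + of_int r * \<alpha>) \<le> 1 / d" by (rule mn_le_inverse[OF d])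
    also have "1 / d \<le> real q * (1 / of_int (y r - 1)) + real q * (1 / of_int (int q - y r - 2))"
      using False q0 unfolding d_def min_def by auto
    finally show ?thesis using False by (simp add: g_def)
  qed
  have bij: "bij_betw y {0..<int q} {0..<int q}"
  proof -
    have inj: "inj_on y {0..<int q}"
    proof (rule inj_onI)
      fix r r' assume r: "r \<in> {0..<int q}" "r' \<in> {0..<int q}" "y r = y r'"
      then have "int q dvd (k + r * a) - (k + r' * a)" unfolding y_def by (simp only: mod_eq_dvd_iff)
      then have "int q dvd (r - r') * a" by (simp add: algebra_simps)
      then have "int q dvd r - r'" using cop by (simp add: coprime_dvd_mult_left_iff coprime_commute)
      then have "r mod int q = r' mod int q" by (simp add: mod_eq_dvd_iff)
      then show "r = r'" using r by simp
    qed
    moreover have "y ` {0..<int q} \<subseteq> {0..<int q}" using q by (auto simp: y_def)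
    ultimately show ?thesis using endo_inj_surj[OF _ _ inj] by (simp add: bij_betw_def)
  qed
  have H: "(\<Sum>i=1..q. 1 / real i) \<le> 1 + ln (real q)" by (rule harmonic_sum_le[OF q])
  have Hi: "(\<Sum>i\<in>{1..int q}. 1 / real_of_int i) = (\<Sum>i=1..q. 1 / real i)"
    by (rule sum.reindex_bij_witness[of _ int nat]) auto
  have "(\<Sum>r<q. mn X (\<gamma> + real r * \<alpha>)) = (\<Sum>r\<in>{0..<int q}. mn X (\<gamma> + of_int r * \<alpha>))"
    by (rule sum.reindex_bij_witness[of _ nat int]) auto
  also have "\<dots> \<le> (\<Sum>r\<in>{0..<int q}. g (y r))" by (intro sum_mono pt)
  also have "\<dots> = (\<Sum>r\<in>{0..<int q}. g r)" by (rule sum.reindex_bij_betw[OF bij])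
  also have "\<dots> \<le> (\<Sum>r\<in>{0, 1, int q - 2, int q - 1} \<union> {2..int q - 3}. g r)"
  proof (rule sum_mono2)
    show "0 \<le> g b" for b unfolding g_def by auto
  qed auto
  also have "\<dots> \<le> (\<Sum>r\<in>{0, 1, int q - 2, int q - 1}. g r) + (\<Sum>r\<in>{2..int q - 3}. g r)"
  proof -
    have "g b \<ge> 0" for b unfolding g_def by auto
    then have "0 \<le> (\<Sum>r\<in>{0, 1, int q - 2, int q - 1} \<inter> {2..int q - 3}. g r)" by (intro sum_nonneg) auto
    then show ?thesis using sum.union_inter[of "{0, 1, int q - 2, int q - 1}" "{2..int q - 3}" g] by simp
  qed
  also have "\<dots> \<le> 4 * real X + (real q * (1 + ln (real q)) + real q * (1 + ln (real q)))"
  proof (rule add_mono)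
    have "(\<Sum>r\<in>{0, 1, int q - 2, int q - 1}. g r) = real (card {0, 1, int q - 2, int q - 1}) * real X"
    proof -
      have "g r = real X" if "r \<in> {0, 1, int q - 2, int q - 1}" for r using that by (auto simp: g_def)
      then show ?thesis by simp
    qed
    also have "\<dots> \<le> real 4 * real X"
    proof (intro mult_right_mono)
      have "card {0, 1, int q - 2, int q - 1} = card (set [0, 1, int q - 2, int q - 1])" by simp
      also have "\<dots> \<le> length [0, 1, int q - 2, int q - 1]" by (rule card_length)
      finally show "real (card {0, 1, int q - 2, int q - 1}) \<le> real 4" by simp
    qed simp
    finally show "(\<Sum>r\<in>{0, 1, int q - 2, int q - 1}. g r) \<le> 4 * real X" by simp
    have "(\<Sum>r\<in>{2..int q - 3}. g r) = real q * (\<Sum>r\<in>{2..int q - 3}. 1 / real_of_int (r - 1)) + real q * (\<Sum>r\<in>{2..int q - 3}. 1 / real_of_int (int q - r - 2))"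
      unfolding sum_distrib_left sum.distrib[symmetric] by (intro sum.cong refl) (simp add: g_def)
    also have "(\<Sum>r\<in>{2..int q - 3}. 1 / real_of_int (r - 1)) = (\<Sum>i\<in>{1..int q - 4}. 1 / real_of_int i)"
      by (rule sum.reindex_bij_witness[of _ "\<lambda>i. i + 1" "\<lambda>r. r - 1"]) auto
    also have "(\<Sum>r\<in>{2..int q - 3}. 1 / real_of_int (int q - r - 2)) = (\<Sum>i\<in>{1..int q - 4}. 1 / real_of_int i)"
      by (rule sum.reindex_bij_witness[of _ "\<lambda>i. int q - i - 2" "\<lambda>r. int q - r - 2"]) auto
    finally have eq: "(\<Sum>r\<in>{2..int q - 3}. g r) = real q * (\<Sum>i\<in>{1..int q - 4}. 1 / real_of_int i) + real q * (\<Sum>i\<in>{1..int q - 4}. 1 / real_of_int i)" .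
    have "(\<Sum>i\<in>{1..int q - 4}. 1 / real_of_int i) \<le> (\<Sum>i\<in>{1..int q}. 1 / real_of_int i)" by (intro sum_mono2) auto
    then have "(\<Sum>i\<in>{1..int q - 4}. 1 / real_of_int i) \<le> 1 + ln (real q)" using H Hi by linarith
    then show "(\<Sum>r\<in>{2..int q - 3}. g r) \<le> real q * (1 + ln (real q)) + real q * (1 + ln (real q))"
      unfolding eq using q0 by (intro add_mono mult_left_mono) auto
  qed
  finally show ?thesis by simp
qed

lemma block_sum_mn_le:
  fixes a :: int
  assumes "q \<ge> 1" "coprime a (int q)" "\<bar>\<alpha> - of_int a / real q\<bar> \<le> 1 / (real q)\<^sup>2"
  shows "(\<Sum>s\<in>{u..<u + q}. mn X (real s * \<alpha>)) \<le> 4 * real X + 2 * real q * (1 + ln (real q))"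
proof -
  have "(\<Sum>s\<in>{u..<u + q}. mn X (real s * \<alpha>)) = (\<Sum>r<q. mn X (real u * \<alpha> + real r * \<alpha>))"
    by (rule sum.reindex_bij_witness[of _ "\<lambda>r. u + r" "\<lambda>s. s - u"]) (auto simp: algebra_simps of_nat_diff)
  then show ?thesis using shifted_block_sum_mn_le[OF assms] by simp
qed

lemma sum_mn_le:
  fixes a :: int
  assumes q: "q \<ge> 1" and cop: "coprime a (int q)" and \<alpha>: "\<bar>\<alpha> - of_int a / real q\<bar> \<le> 1 / (real q)\<^sup>2"
  shows "(\<Sum>s=1..Y. mn X (real s * \<alpha>)) \<le> (real Y / real q + 1) * (4 * real X + 2 * real q * (1 + ln (real q)))"
proof -
  define B where "B = Y div q + 1"
  have YB: "Y < B * q"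
  proof -
    have "Y = (Y div q) * q + Y mod q" by simp
    moreover have "Y mod q < q" using q by simp
    ultimately have "Y < (Y div q) * q + q" by linarith
    then show ?thesis by (simp add: B_def)
  qed
  have "(\<Sum>s=1..Y. mn X (real s * \<alpha>)) \<le> (\<Sum>s<B * q. mn X (real s * \<alpha>))"
    using YB by (intro sum_mono2) (auto simp: mn_nonneg)
  also have "\<dots> = (\<Sum>b<B. \<Sum>s\<in>{b * q..<b * q + q}. mn X (real s * \<alpha>))" by (rule sum.nat_group[symmetric])
  also have "\<dots> \<le> (\<Sum>b<B. 4 * real X + 2 * real q * (1 + ln (real q)))"
    by (intro sum_mono block_sum_mn_le[OF q cop \<alpha>])
  also have "\<dots> = real B * (4 * real X + 2 * real q * (1 + ln (real q)))" by simp
  also have "\<dots> \<le> (real Y / real q + 1) * (4 * real X + 2 * real q * (1 + ln (real q)))"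
  proof (intro mult_right_mono)
    have "(Y div q) * q \<le> Y" by simp
    then have "real (Y div q) * real q \<le> real Y" by (simp only: of_nat_mult[symmetric] of_nat_le_iff)
    then have "real (Y div q) \<le> real Y / real q" using q by (simp add: le_divide_eq)
    then show "real B \<le> real Y / real q + 1" by (simp add: B_def)
  qed (use q in auto)
  finally show ?thesis .
qed

theorem Weyl_inequality:
  assumes m: "m \<ge> 2" and d: "0 < \<delta>" "\<delta> \<le> 1"
  shows "\<exists>l>0. \<exists>C\<ge>1. \<forall>X q a \<alpha>. X \<ge> 1 \<longrightarrow> q \<ge> 1 \<longrightarrow> coprime a (int q) \<longrightarrow> \<bar>\<alpha> - of_int a / real q\<bar> \<le> 1 / (real q)\<^sup>2 \<longrightarrow>
     real X powr \<delta> \<le> real q \<longrightarrow> real q \<le> real X powr (real m - \<delta>) \<longrightarrow>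
     norm (\<Sum>n=1..X. unit_exp (\<alpha> * real n ^ m)) \<le> C * real X powr (1 - l)"
proof -
  define j where "j = m - 1"
  have j: "m = Suc j" "j \<ge> 1" using m by (auto simp: j_def)
  define K :: nat where "K = 2 ^ j"
  have K: "K \<ge> m" "K \<ge> 1" unfolding K_def j(1) by (auto simp: Suc_le_eq less_exp)
  \<comment> \<open>The divisor bound is applied to integers up to X^j and then raised to the power
    j, so with this e1 it costs X^(\<delta> / 4). The logarithm costs the same again, and half of
    the saving X^\<delta> remains.\<close>
  define e1 where "e1 = \<delta> / (4 * real j * real j)"
  have e1: "e1 > 0" "real j * real j * e1 = \<delta> / 4" using d j by (auto simp: e1_def)
  obtain Cd where Cd: "Cd \<ge> 1" "\<And>n. n \<ge> 1 \<Longrightarrow> real (card {d. d dvd (n::nat)}) \<le> Cd * real n powr e1"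
    using divisor_bound[OF e1(1)] by blast
  define Lc where "Lc = 1 + real m * (4 / \<delta>)"
  have Lc: "Lc \<ge> 1" using d by (simp add: Lc_def)
  define C0 where "C0 = (2 * Cd) ^ j * (1 + 4 * fact m + 4 + 2 * fact m * Lc + 2 * Lc)"
  have "(1::real) \<le> fact m" by (simp add: fact_ge_1)
  then have C0: "C0 \<ge> 0" using Cd Lc by (auto simp: C0_def)
  define C where "C = 4 ^ K * C0 + 1"
  have C: "C \<ge> 1" using C0 by (simp add: C_def)
  have main: "norm (\<Sum>n=1..X. unit_exp (\<alpha> * real n ^ m)) \<le> C * real X powr (1 - \<delta> / (2 * real K))"
    if X: "X \<ge> 1" and q: "q \<ge> 1" and cop: "coprime a (int q)" and \<alpha>: "\<bar>\<alpha> - of_int a / real q\<bar> \<le> 1 / (real q)\<^sup>2"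
      and q1: "real X powr \<delta> \<le> real q" and q2: "real q \<le> real X powr (real m - \<delta>)" for X q a \<alpha>
  proof -
    have X1: "real X \<ge> 1" using X by simp
    have q0: "real q > 0" using q by simp
    \<comment> \<open>A common bound for X^m / q, X, X^(m - 1) and q, the terms of the summation
      estimate: each saves X^\<delta> over X^m.\<close>
    define U where "U = real X powr (real m - \<delta>)"
    have XU: "real X ^ j \<le> U"
    proof -
      have "real X ^ j = real X powr real j" using X1 by (simp add: powr_realpow)
      also have "\<dots> \<le> U" unfolding U_def using X1 d j by (intro powr_mono) auto
      finally show ?thesis .
    qed
    have X1U: "real X \<le> U"
    proof -
      have "real X ^ 1 \<le> real X ^ j" using X1 j by (intro power_increasing) auto
      also note XU
      finally show ?thesis by simp
    qed
    have Xq: "real X ^ m / real q \<le> U"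
    proof -
      have "real X ^ m / real q \<le> real X powr real m / real X powr \<delta>" using q1 q0 X1 by (intro frac_le) (auto simp: powr_realpow)
      then show ?thesis by (simp add: U_def powr_diff)
    qed
    define D where "D = Cd * real X powr (real j * e1)"
    have D1: "D \<ge> 1"
    proof -
      have "1 * 1 \<le> D" unfolding D_def using Cd X1 e1 by (intro mult_mono ge_one_powr_ge_zero) auto
      then show ?thesis by simp
    qed
    have Dd: "real (card {d. d dvd s}) \<le> D" if s: "s \<in> {1..X ^ j}" for s
    proof -
      have "real (card {d. d dvd s}) \<le> Cd * real s powr e1" using s Cd by auto
      also have "\<dots> \<le> Cd * (real X ^ j) powr e1"
        using s Cd e1 by (intro mult_left_mono powr_mono2) (auto simp flip: of_nat_power)
      also have "(real X ^ j) powr e1 = real X powr (real j * e1)" using X1 by (simp add: powr_realpow[symmetric] powr_powr)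
      finally show ?thesis by (simp add: D_def)
    qed
    define L where "L = Lc * real X powr (\<delta> / 4)"
    have X4: "real X powr (\<delta> / 4) \<ge> 1" using X1 d by (intro ge_one_powr_ge_zero) auto
    have lnq: "1 + ln (real q) \<le> L"
    proof -
      have "ln (real q) \<le> ln (real X powr (real m - \<delta>))" using q2 q0 by (intro ln_mono) auto
      also have "\<dots> = (real m - \<delta>) * ln (real X)" using X1 by (simp add: ln_powr)
      also have "\<dots> \<le> real m * ln (real X)" using X1 d by (intro mult_right_mono) auto
      also have "\<dots> \<le> real m * (real X powr (\<delta> / 4) / (\<delta> / 4))" using X1 d by (intro mult_left_mono ln_powr_bound) auto
      finally show ?thesis using X4 by (simp add: L_def Lc_def algebra_simps)
    qed
    have L1: "L \<ge> 1"
    proof -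
      have "1 * 1 \<le> L" unfolding L_def using Lc X4 by (intro mult_mono) auto
      then show ?thesis by simp
    qed
    define f where "f = (fact m :: real)"
    have f1: "f \<ge> 1" by (simp add: f_def fact_ge_1)
    have S: "(\<Sum>t=1..X ^ j. mn X (fact (Suc j) * real t * \<alpha>)) \<le> (4 * f + 4 + 2 * f * Lc + 2 * Lc) * real X powr (\<delta> / 4) * U"
    proof -
      have "(\<Sum>t=1..X ^ j. mn X (fact (Suc j) * real t * \<alpha>)) = (\<Sum>s\<in>(\<lambda>t. fact m * t) ` {1..X ^ j}. mn X (real s * \<alpha>))"
        unfolding j(1)[symmetric] by (subst sum.reindex) (auto simp: inj_on_def)
      also have "\<dots> \<le> (\<Sum>s=1..fact m * X ^ j. mn X (real s * \<alpha>))"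
      proof (rule sum_mono2)
        show "(*) (fact m) ` {1..X ^ j} \<subseteq> {1..fact m * X ^ j}" by auto
      qed (auto simp: mn_nonneg)
      also have "\<dots> \<le> (real (fact m * X ^ j) / real q + 1) * (4 * real X + 2 * real q * (1 + ln (real q)))"
        by (rule sum_mn_le[OF q cop \<alpha>])
      also have "\<dots> \<le> (real (fact m * X ^ j) / real q + 1) * (4 * real X + 2 * real q * L)"
        using lnq q0 by (intro mult_left_mono add_left_mono) auto
      also have "\<dots> = 4 * f * (real X ^ m / real q) + 4 * real X + 2 * f * L * real X ^ j + 2 * L * real q"
        using q0 by (simp add: f_def field_simps j)
      also have "\<dots> \<le> 4 * f * U + 4 * U + 2 * f * L * U + 2 * L * U"
        using f1 L1 Xq X1U XU q2 by (intro add_mono mult_left_mono) (auto simp: U_def)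
      also have "\<dots> \<le> 4 * f * (real X powr (\<delta> / 4) * U) + 4 * (real X powr (\<delta> / 4) * U) + 2 * f * L * U + 2 * L * U"
      proof -
        have "1 * U \<le> real X powr (\<delta> / 4) * U" using X4 by (intro mult_right_mono) (auto simp: U_def)
        then show ?thesis using f1 L1 by (intro add_mono mult_left_mono mult_nonneg_nonneg order_refl) auto
      qed
      also have "\<dots> = (4 * f + 4 + 2 * f * Lc + 2 * Lc) * real X powr (\<delta> / 4) * U"
        by (simp add: L_def algebra_simps)
      finally show ?thesis .
    qed
    have W: "weyl_sum j X \<alpha> \<le> C0 * real X powr (\<delta> / 2) * U"
    proof -
      have "weyl_sum j X \<alpha> \<le> (2 * D) ^ j * (real X ^ j + (\<Sum>t=1..X ^ j. mn X (fact (Suc j) * real t * \<alpha>)))"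
        by (rule weyl_sum_le[OF X D1 Dd])
      also have "\<dots> \<le> (2 * D) ^ j * (1 * (real X powr (\<delta> / 4) * U) + (4 * f + 4 + 2 * f * Lc + 2 * Lc) * real X powr (\<delta> / 4) * U)"
      proof (intro mult_left_mono add_mono S)
        have "1 * U \<le> real X powr (\<delta> / 4) * U" using X4 by (intro mult_right_mono) (auto simp: U_def)
        then show "real X ^ j \<le> 1 * (real X powr (\<delta> / 4) * U)" using XU by simp
      qed (use D1 in auto)
      also have "(2 * D) ^ j = (2 * Cd) ^ j * real X powr (\<delta> / 4)"
      proof -
        have "(real X powr (real j * e1)) ^ j = real X powr (real j * e1 * real j)" using X1 by (simp add: powr_powr flip: powr_realpow)
        also have "real j * e1 * real j = \<delta> / 4" using e1(2) by (simp add: mult_ac)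
        finally show ?thesis by (simp add: D_def power_mult_distrib)
      qed
      also have "(2 * Cd) ^ j * real X powr (\<delta> / 4) * (1 * (real X powr (\<delta> / 4) * U) + (4 * f + 4 + 2 * f * Lc + 2 * Lc) * real X powr (\<delta> / 4) * U)
        = C0 * (real X powr (\<delta> / 4) * real X powr (\<delta> / 4)) * U"
        by (simp add: C0_def f_def algebra_simps)
      also have "real X powr (\<delta> / 4) * real X powr (\<delta> / 4) = real X powr (\<delta> / 2)" by (simp flip: powr_add)
      finally show ?thesis .
    qed
    have eqs: "(\<Sum>n=1..X. unit_exp (\<alpha> * real n ^ m)) = (\<Sum>n\<in>{1..<int X + 1}. unit_exp (\<Sum>i\<le>Suc j. (if i = m then \<alpha> else 0) * real_of_int n ^ i))"
    proof -
      have "(\<Sum>i\<le>Suc j. (if i = m then \<alpha> else 0) * x ^ i) = \<alpha> * x ^ m" for x :: real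
        by (simp add: j if_distrib[of "\<lambda>c. c * _"] sum.delta cong: if_cong)
      then show ?thesis by (simp only:) (rule sum.reindex_bij_witness[of _ nat int], auto)
    qed
    have "norm (\<Sum>n=1..X. unit_exp (\<alpha> * real n ^ m)) ^ K \<le> 4 ^ K * real X ^ (K - m) * weyl_sum j X \<alpha>"
      unfolding eqs using weyl_differencing[OF X, where v = "int X + 1" and u = 1 and j = j and a = "\<lambda>i. if i = m then \<alpha> else 0"] by (simp add: K_def j)
    also have "\<dots> \<le> 4 ^ K * real X ^ (K - m) * (C0 * real X powr (\<delta> / 2) * U)"
      using W by (intro mult_left_mono) auto
    also have "\<dots> = 4 ^ K * C0 * (real X powr real (K - m) * real X powr (\<delta> / 2) * real X powr (real m - \<delta>))"
      using X1 by (simp add: powr_realpow U_def)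
    also have "real X powr real (K - m) * real X powr (\<delta> / 2) * real X powr (real m - \<delta>) = real X powr (real K - \<delta> / 2)"
      using K by (simp add: powr_add[symmetric] of_nat_diff)
    also have "4 ^ K * C0 * real X powr (real K - \<delta> / 2) \<le> C ^ K * (real X powr (1 - \<delta> / (2 * real K))) ^ K"
    proof (intro mult_mono)
      have "C ^ 1 \<le> C ^ K" using C K by (intro power_increasing) auto
      then show "4 ^ K * C0 \<le> C ^ K" by (simp add: C_def)
      have "real K * (1 - \<delta> / (2 * real K)) = real K - \<delta> / 2" using K by (simp add: field_simps)
      then show "real X powr (real K - \<delta> / 2) \<le> (real X powr (1 - \<delta> / (2 * real K))) ^ K"
        using X1 by (simp add: powr_powr mult.commute flip: powr_realpow)
    qed (use C in auto)
    finally have "norm (\<Sum>n=1..X. unit_exp (\<alpha> * real n ^ m)) ^ K \<le> (C * real X powr (1 - \<delta> / (2 * real K))) ^ K"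
      by (simp add: power_mult_distrib)
    then show ?thesis using K C by (subst (asm) power_mono_iff) auto
  qed
  show ?thesis
    by (rule exI[of _ "\<delta> / (2 * real K)"], intro conjI exI[of _ C] C allI impI) (use d K main in auto)
qed

section \<open>Approximation on the major arcs\<close>

text \<open>The coefficients of \<open>(1 - z)\<^sup>-\<^sup>a\<close>. They behave like \<open>t\<^sup>a\<^sup>-\<^sup>1 / Gamma a\<close>, but convolve exactly.\<close>

definition wcoef :: "real \<Rightarrow> nat \<Rightarrow> real" where
  "wcoef a t = pochhammer a t / fact t"

lemma wcoef_pos: "a > 0 \<Longrightarrow> wcoef a t > 0"
  by (simp add: wcoef_def pochhammer_pos)

lemma wcoef_0 [simp]: "wcoef a 0 = 1"
  by (simp add: wcoef_def)

lemma wcoef_Suc: "wcoef a (Suc t) = wcoef a t * (a + real t) / (real t + 1)"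
  by (simp add: wcoef_def pochhammer_Suc algebra_simps)

text \<open>In generating functions: (1 - z)^(-a) multiplied by 1 / (1 - z).\<close>

lemma sum_wcoef: "(\<Sum>t\<le>u. wcoef a t) = wcoef (a + 1) u"
proof (induction u)
  case (Suc u)
  have "wcoef a (Suc u) = a * pochhammer (a + 1) u / fact (Suc u)"
    unfolding wcoef_def pochhammer_rec by simp
  moreover have "wcoef (a + 1) u = (real u + 1) * pochhammer (a + 1) u / fact (Suc u)"
  proof -
    have "(real u + 1) * pochhammer (a + 1) u / ((real u + 1) * fact u) = pochhammer (a + 1) u / fact u"
      by (rule nonzero_mult_divide_mult_cancel_left) simp
    moreover have "fact (Suc u) = (real u + 1) * fact u" by simp
    ultimately show ?thesis by (simp only: wcoef_def)
  qed
  ultimately have "wcoef (a + 1) u + wcoef a (Suc u) = (a + 1 + real u) * pochhammer (a + 1) u / fact (Suc u)"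
    by (simp add: add_divide_distrib[symmetric] algebra_simps)
  also have "\<dots> = wcoef (a + 1) (Suc u)" by (simp add: wcoef_def pochhammer_Suc mult.commute)
  finally show ?case using Suc by simp
qed simp

text \<open>Comparison of coefficients in a product of two powers of 1 - z, which is Vandermonde's
  identity for Pochhammer symbols.\<close>

lemma wcoef_convolution: "(\<Sum>t\<le>n. wcoef a t * wcoef b (n - t)) = wcoef (a + b) n"
proof -
  have "wcoef (a + b) n = (\<Sum>t\<le>n. real (n choose t) * pochhammer a t * pochhammer b (n - t)) / fact n"
    unfolding wcoef_def by (simp add: pochhammer_binomial_sum)
  also have "\<dots> = (\<Sum>t\<le>n. wcoef a t * wcoef b (n - t))"
    unfolding sum_divide_distrib by (intro sum.cong refl) (simp add: wcoef_def binomial_fact field_simps)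
  finally show ?thesis by simp
qed

lemma wcoef_decreasing:
  assumes "0 < a" "a \<le> 1"
  shows "wcoef a (Suc t) \<le> wcoef a t"
proof -
  have "wcoef a t * ((a + real t) / (real t + 1)) \<le> wcoef a t * 1"
    using assms wcoef_pos[OF assms(1), of t] by (intro mult_left_mono) auto
  then show ?thesis by (simp add: wcoef_Suc)
qed

text \<open>The logarithmic error \<open>G\<close> tends to -ln (Gamma a) by the limit formula for
  Gamma. Its increments are O(1 / (t (t + 1))), which telescopes to a relative error O(1 / t), hence
  one full power of t.\<close>

lemma wcoef_asymptotic:
  assumes a: "a > 0"
  shows "\<exists>C\<ge>0. \<forall>t\<ge>1. \<bar>wcoef a t - real t powr (a - 1) / Gamma a\<bar> \<le> C * real t powr (a - 2)"
proof -
  define G where "G t = ln (wcoef a t) - (a - 1) * ln (real t)" for t :: nat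
  have Gam: "Gamma a > 0" using a by (rule Gamma_real_pos)
  have expG: "wcoef a t = real t powr (a - 1) * exp (G t)" if "t \<ge> 1" for t
    using that wcoef_pos[OF a, of t] by (simp add: G_def exp_diff powr_def)
  have lim: "G \<longlonglongrightarrow> - ln (Gamma a)"
  proof -
    have "(\<lambda>t. - ln (Gamma_series' a t)) \<longlonglongrightarrow> - ln (Gamma a)"
      using Gam by (intro tendsto_intros Gamma_series'_LIMSEQ) auto
    moreover have "eventually (\<lambda>t. - ln (Gamma_series' a t) = G t) sequentially"
    proof (rule eventually_sequentiallyI[of 1])
      fix t :: nat assume t: "1 \<le> t"
      have "fact t = real t * fact (t - 1)" using t by (simp add: fact_reduce)
      then have "Gamma_series' a t = exp (a * ln (real t)) / (real t * wcoef a t)"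
        using t by (simp add: Gamma_series'_def wcoef_def)
      then have "ln (Gamma_series' a t) = a * ln (real t) - (ln (real t) + ln (wcoef a t))"
        using t wcoef_pos[OF a, of t] by (simp add: ln_div ln_mult)
      then show "- ln (Gamma_series' a t) = G t" by (simp add: G_def algebra_simps)
    qed
    ultimately show ?thesis by (rule Lim_transform_eventually)
  qed
  have "(\<lambda>t. ln ((a + real t) / (real t + 1)) - (a - 1) * ln ((real t + 1) / real t)) \<in> O(\<lambda>t. 1 / (real t * (real t + 1)))"
    by real_asymp
  then obtain c where c: "c > 0" "eventually (\<lambda>t. norm (ln ((a + real t) / (real t + 1)) - (a - 1) * ln ((real t + 1) / real t)) \<le> c * norm (1 / (real t * (real t + 1)))) sequentially"
    by (elim landau_o.bigE)
  then obtain t0 where t0: "\<And>t. t \<ge> t0 \<Longrightarrow> norm (ln ((a + real t) / (real t + 1)) - (a - 1) * ln ((real t + 1) / real t)) \<le> c * norm (1 / (real t * (real t + 1)))"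
    by (auto simp: eventually_sequentially)
  define t1 where "t1 = max 1 t0"
  have diff: "\<bar>G (Suc t) - G t\<bar> \<le> c * (1 / real t - 1 / real (Suc t))" if t: "t \<ge> t1" for t
  proof -
    have t': "t \<ge> 1" "t \<ge> t0" using t by (auto simp: t1_def)
    have "G (Suc t) - G t = ln ((a + real t) / (real t + 1)) - (a - 1) * ln ((real t + 1) / real t)"
    proof -
      have w: "wcoef a t > 0" by (rule wcoef_pos[OF a])
      have "ln (wcoef a (Suc t)) = ln (wcoef a t * ((a + real t) / (real t + 1)))" by (simp add: wcoef_Suc)
      also have "\<dots> = ln (wcoef a t) + ln ((a + real t) / (real t + 1))"
      proof -
        have "(a + real t) / (real t + 1) > 0" "a + real t \<noteq> 0" using a by auto
        then show ?thesis using ln_mult[of "wcoef a t" "(a + real t) / (real t + 1)"] w by simp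
      qed
      finally have "G (Suc t) - G t = ln ((a + real t) / (real t + 1)) - (a - 1) * (ln (real t + 1) - ln (real t))"
        by (simp add: G_def algebra_simps)
      also have "ln (real t + 1) - ln (real t) = ln ((real t + 1) / real t)" using t' by (simp add: ln_div)
      finally show ?thesis .
    qed
    then have "\<bar>G (Suc t) - G t\<bar> \<le> c * norm (1 / (real t * (real t + 1)))" using t0[OF t'(2)] by simp
    also have "norm (1 / (real t * (real t + 1))) = 1 / real t - 1 / real (Suc t)" using t' by (simp add: field_simps)
    finally show ?thesis .
  qed
  have tele: "\<bar>G (t + n) - G t\<bar> \<le> c * (1 / real t - 1 / real (t + n))" if t: "t \<ge> t1" for t n
  proof (induction n)
    case (Suc n)
    have "\<bar>G (t + Suc n) - G t\<bar> \<le> \<bar>G (Suc (t + n)) - G (t + n)\<bar> + \<bar>G (t + n) - G t\<bar>" by simp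
    also have "\<dots> \<le> c * (1 / real (t + n) - 1 / real (Suc (t + n))) + c * (1 / real t - 1 / real (t + n))"
      using t by (intro add_mono diff Suc) auto
    also have "\<dots> = c * (1 / real t - 1 / real (t + Suc n))" by (simp add: algebra_simps)
    finally show ?case .
  qed simp
  have near: "\<bar>- ln (Gamma a) - G t\<bar> \<le> c / real t" if t: "t \<ge> t1" for t
  proof -
    have "(\<lambda>n. \<bar>G (n + t) - G t\<bar>) \<longlonglongrightarrow> \<bar>- ln (Gamma a) - G t\<bar>"
      by (intro tendsto_intros LIMSEQ_ignore_initial_segment lim)
    moreover have "\<bar>G (n + t) - G t\<bar> \<le> c / real t" for n
    proof -
      have "\<bar>G (n + t) - G t\<bar> \<le> c * (1 / real t - 1 / real (t + n))" using tele[OF t, of n] by (simp add: add.commute)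
      also have "\<dots> \<le> c * (1 / real t)" using c(1) by (intro mult_left_mono) auto
      finally show ?thesis by simp
    qed
    ultimately show ?thesis by (intro LIMSEQ_le_const2[where X = "\<lambda>n. \<bar>G (n + t) - G t\<bar>"]) auto
  qed
  define A where "A = exp c * c / Gamma a"
  have A0: "A \<ge> 0" using c Gam by (simp add: A_def)
  have big: "\<bar>wcoef a t - real t powr (a - 1) / Gamma a\<bar> \<le> A * real t powr (a - 2)" if t: "t \<ge> t1" for t
  proof -
    have t': "t \<ge> 1" using t by (simp add: t1_def)
    define x where "x = G t + ln (Gamma a)"
    have x: "\<bar>x\<bar> \<le> c / real t" using near[OF t] by (simp add: x_def)
    have "c / real t \<le> c" using t' c(1) by (simp add: divide_le_eq)
    then have xc: "\<bar>x\<bar> \<le> c" using x by simp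
    have ex: "\<bar>exp x - 1\<bar> \<le> exp c * \<bar>x\<bar>"
    proof (cases "x \<ge> 0")
      case True
      have "exp x * (1 - x) \<le> exp x * exp (- x)" using exp_ge_add_one_self[of "- x"] by (intro mult_left_mono) auto
      then have "exp x - 1 \<le> exp x * x" by (simp add: exp_minus algebra_simps)
      also have "\<dots> \<le> exp c * x" using True xc by (intro mult_right_mono) auto
      finally show ?thesis using True by simp
    next
      case False
      have "1 - exp x \<le> - x" using exp_ge_add_one_self[of x] by linarith
      also have "\<dots> \<le> exp c * \<bar>x\<bar>" using False c(1) by (simp add: mult_le_cancel_right1)
      finally show ?thesis using False by simp
    qed
    have "exp (G t) = exp x / Gamma a" using Gam by (simp add: x_def exp_add)
    then have "wcoef a t - real t powr (a - 1) / Gamma a = real t powr (a - 1) / Gamma a * (exp x - 1)"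
      using expG[OF t'] by (simp add: right_diff_distrib diff_divide_distrib)
    then have "\<bar>wcoef a t - real t powr (a - 1) / Gamma a\<bar> = real t powr (a - 1) / Gamma a * \<bar>exp x - 1\<bar>"
      using Gam by (simp add: abs_mult)
    also have "\<dots> \<le> real t powr (a - 1) / Gamma a * (exp c * (c / real t))"
    proof (intro mult_left_mono)
      have "exp c * \<bar>x\<bar> \<le> exp c * (c / real t)" using x by (intro mult_left_mono) auto
      then show "\<bar>exp x - 1\<bar> \<le> exp c * (c / real t)" using ex by simp
    qed (use Gam in auto)
    also have "\<dots> = A * (real t powr (a - 1) / real t powr 1)" using t' by (simp add: A_def)
    also have "real t powr (a - 1) / real t powr 1 = real t powr (a - 2)" unfolding powr_diff[symmetric] by simp
    finally show ?thesis .
  qed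
  \<comment> \<open>The estimate is available from t1 on; the finitely many smaller t enter through
    their quotients.\<close>
  define B where "B = A + (\<Sum>t=1..<t1. \<bar>wcoef a t - real t powr (a - 1) / Gamma a\<bar> / real t powr (a - 2))"
  have BA: "A \<le> B" unfolding B_def by (intro le_add_same_cancel1[THEN iffD2] sum_nonneg) auto
  show ?thesis
  proof (intro exI[of _ B] conjI allI impI)
    show "0 \<le> B" using A0 BA by simp
    fix t :: nat assume t: "1 \<le> t"
    show "\<bar>wcoef a t - real t powr (a - 1) / Gamma a\<bar> \<le> B * real t powr (a - 2)"
    proof (cases "t \<ge> t1")
      case True
      then show ?thesis using big[OF True] BA by (meson mult_right_mono order_trans powr_ge_zero)
    next
      case False
      have "\<bar>wcoef a t - real t powr (a - 1) / Gamma a\<bar> / real t powr (a - 2) \<le> (\<Sum>t=1..<t1. \<bar>wcoef a t - real t powr (a - 1) / Gamma a\<bar> / real t powr (a - 2))"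
        using False t by (intro member_le_sum) auto
      then have "\<bar>wcoef a t - real t powr (a - 1) / Gamma a\<bar> / real t powr (a - 2) \<le> B" using A0 by (simp add: B_def)
      then show ?thesis using t by (simp add: divide_le_eq)
    qed
  qed
qed

lemma wcoef_le_powr:
  assumes a: "a > 0"
  shows "\<exists>C\<ge>1. \<forall>t\<ge>1. wcoef a t \<le> C * real t powr (a - 1)"
proof -
  obtain C where C: "C \<ge> 0" "\<And>t. t \<ge> 1 \<Longrightarrow> \<bar>wcoef a t - real t powr (a - 1) / Gamma a\<bar> \<le> C * real t powr (a - 2)"
    using wcoef_asymptotic[OF a] by blast
  have G: "Gamma a > 0" using a by (rule Gamma_real_pos)
  show ?thesis
  proof (intro exI[of _ "1 + C + 1 / Gamma a"] conjI allI impI)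
    show "1 \<le> 1 + C + 1 / Gamma a" using C G by simp
    fix t :: nat assume t: "1 \<le> t"
    have "wcoef a t \<le> C * real t powr (a - 2) + real t powr (a - 1) / Gamma a" using C(2)[OF t] by linarith
    also have "\<dots> \<le> C * real t powr (a - 1) + real t powr (a - 1) / Gamma a"
      using t C by (intro add_right_mono mult_left_mono powr_mono) auto
    also have "\<dots> \<le> (1 + C + 1 / Gamma a) * real t powr (a - 1)" by (simp add: algebra_simps)
    finally show "wcoef a t \<le> (1 + C + 1 / Gamma a) * real t powr (a - 1)" .
  qed
qed

section \<open>Partial summation\<close>

lemma Abel_summation:
  fixes c z :: "nat \<Rightarrow> 'a :: comm_ring_1"
  shows "(\<Sum>t\<le>n. c t * z t) = (\<Sum>s\<le>n. c s) * z n + (\<Sum>t<n. (\<Sum>s\<le>t. c s) * (z t - z (Suc t)))"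
proof (induction n)
  case (Suc n)
  have "(\<Sum>t\<le>Suc n. c t * z t) = (\<Sum>s\<le>n. c s) * z n + (\<Sum>t<n. (\<Sum>s\<le>t. c s) * (z t - z (Suc t))) + c (Suc n) * z (Suc n)"
    using Suc by simp
  then show ?case by (simp add: algebra_simps)
qed simp

lemma norm_unit_exp_minus_1_le: "norm (unit_exp x - 1) \<le> 2 * pi * \<bar>x\<bar>"
proof -
  have "unit_exp x = cis (2 * (pi * x))" by (simp add: unit_exp_def cis_conv_exp mult_ac)
  then have "(norm (unit_exp x - 1))\<^sup>2 = (cos (2 * (pi * x)) - 1)\<^sup>2 + (sin (2 * (pi * x)))\<^sup>2"
    by (simp add: cmod_power2)
  also have "\<dots> = 2 - 2 * cos (2 * (pi * x))"
    using sin_cos_squared_add[of "2 * (pi * x)"] by (simp add: power2_eq_square algebra_simps)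
  also have "\<dots> = (2 * sin (pi * x))\<^sup>2"
    unfolding cos_double_sin by (simp add: power2_eq_square)
  finally have "norm (unit_exp x - 1) = \<bar>2 * sin (pi * x)\<bar>"
    by (metis abs_norm_cancel power2_eq_iff_nonneg abs_ge_zero norm_ge_zero power2_abs)
  also have "\<dots> \<le> 2 * \<bar>pi * x\<bar>" using abs_sin_x_le_abs_x[of "pi * x"] by (simp add: abs_mult)
  finally show ?thesis by (simp add: abs_mult)
qed

text \<open>Under partial summation the character changes by at most 2 pi |\<beta>| from one term to
  the next, so a bound for the untwisted partial sums survives with a factor 1 + O(|\<beta>|
  n).\<close>

lemma norm_twisted_sum_le:
  fixes c :: "nat \<Rightarrow> complex"
  assumes "\<And>u. u \<le> n \<Longrightarrow> norm (\<Sum>t\<le>u. c t) \<le> M"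
  shows "norm (\<Sum>t\<le>n. c t * unit_exp (\<beta> * real t)) \<le> M * (1 + 2 * pi * \<bar>\<beta>\<bar> * real n)"
proof -
  have M: "M \<ge> 0" using assms[of 0] norm_ge_zero order_trans by blast
  have d: "norm (unit_exp (\<beta> * real t) - unit_exp (\<beta> * real (Suc t))) \<le> 2 * pi * \<bar>\<beta>\<bar>" for t
  proof -
    have "unit_exp (\<beta> * real t) - unit_exp (\<beta> * real (Suc t)) = - (unit_exp (\<beta> * real t) * (unit_exp \<beta> - 1))"
      by (simp add: unit_exp_add[symmetric] algebra_simps)
    then show ?thesis using norm_unit_exp_minus_1_le[of \<beta>] by (simp add: norm_mult)
  qed
  have "norm (\<Sum>t\<le>n. c t * unit_exp (\<beta> * real t)) \<le> norm ((\<Sum>s\<le>n. c s) * unit_exp (\<beta> * real n))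
     + norm (\<Sum>t<n. (\<Sum>s\<le>t. c s) * (unit_exp (\<beta> * real t) - unit_exp (\<beta> * real (Suc t))))"
    unfolding Abel_summation by (rule norm_triangle_ineq)
  also have "\<dots> \<le> M + (\<Sum>t<n. M * (2 * pi * \<bar>\<beta>\<bar>))"
  proof (rule add_mono)
    show "norm ((\<Sum>s\<le>n. c s) * unit_exp (\<beta> * real n)) \<le> M" using assms[of n] by (simp add: norm_mult)
    show "norm (\<Sum>t<n. (\<Sum>s\<le>t. c s) * (unit_exp (\<beta> * real t) - unit_exp (\<beta> * real (Suc t)))) \<le> (\<Sum>t<n. M * (2 * pi * \<bar>\<beta>\<bar>))"
      unfolding norm_mult using assms d M by (intro sum_norm_le) (auto simp: norm_mult intro!: mult_mono)
  qed
  finally show ?thesis by (simp add: algebra_simps)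
qed

lemma norm_decreasing_twisted_sum_le:
  fixes c :: "nat \<Rightarrow> real"
  assumes c: "\<And>t. c (Suc t) \<le> c t" "\<And>t. c t \<ge> 0" and d: "dist_int \<beta> > 0"
  shows "norm (\<Sum>t\<le>n. complex_of_real (c t) * unit_exp (\<beta> * real t)) \<le> c 0 / dist_int \<beta>"
proof -
  let ?z = "unit_exp \<beta>"
  have nz: "norm (?z - 1) \<ge> 2 * dist_int \<beta>" by (rule norm_unit_exp_minus_1_ge)
  then have z1: "?z \<noteq> 1" using d by auto
  have S: "norm (\<Sum>s\<le>t. unit_exp (\<beta> * real s)) \<le> 1 / dist_int \<beta>" for t
  proof -
    have "(\<Sum>s\<le>t. unit_exp (\<beta> * real s)) = (\<Sum>s<Suc t. ?z ^ s)"
      by (intro sum.cong) (auto simp: unit_exp_power mult.commute)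
    also have "norm \<dots> = norm (1 - ?z ^ Suc t) / norm (?z - 1)"
      using z1 by (simp only: sum_gp_strict norm_divide norm_minus_commute[of "1" ?z] if_False)
    also have "\<dots> \<le> 2 / (2 * dist_int \<beta>)"
    proof (intro frac_le)
      show "norm (1 - ?z ^ Suc t) \<le> 2" using norm_triangle_ineq4[of 1 "?z ^ Suc t"] by (simp only: unit_exp_power norm_unit_exp norm_one)
    qed (use d nz in auto)
    finally show ?thesis by simp
  qed
  have "(\<Sum>t\<le>n. complex_of_real (c t) * unit_exp (\<beta> * real t)) = (\<Sum>s\<le>n. unit_exp (\<beta> * real s)) * of_real (c n)
     + (\<Sum>t<n. (\<Sum>s\<le>t. unit_exp (\<beta> * real s)) * of_real (c t - c (Suc t)))"
    using Abel_summation[of "\<lambda>t. unit_exp (\<beta> * real t)" "\<lambda>t. complex_of_real (c t)" n] by (simp add: mult.commute)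
  also have "norm \<dots> \<le> 1 / dist_int \<beta> * c n + (\<Sum>t<n. 1 / dist_int \<beta> * (c t - c (Suc t)))"
  proof (intro norm_triangle_le add_mono)
    show "norm ((\<Sum>s\<le>n. unit_exp (\<beta> * real s)) * of_real (c n)) \<le> 1 / dist_int \<beta> * c n"
      unfolding norm_mult using S[of n] c d by (intro mult_mono) auto
    show "norm (\<Sum>t<n. (\<Sum>s\<le>t. unit_exp (\<beta> * real s)) * of_real (c t - c (Suc t))) \<le> (\<Sum>t<n. 1 / dist_int \<beta> * (c t - c (Suc t)))"
    proof (rule sum_norm_le)
      fix t
      have "norm (complex_of_real (c t - c (Suc t))) = c t - c (Suc t)" using c(1)[of t] by (simp only: norm_of_real)
      then show "norm ((\<Sum>s\<le>t. unit_exp (\<beta> * real s)) * of_real (c t - c (Suc t))) \<le> 1 / dist_int \<beta> * (c t - c (Suc t))"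
        unfolding norm_mult by (metis S diff_ge_0_iff_ge c(1) mult_right_mono)
    qed
  qed
  also have "\<dots> = c 0 / dist_int \<beta>"
    unfolding sum_distrib_left[symmetric] sum_lessThan_telescope' by (simp add: algebra_simps diff_divide_distrib)
  finally show ?thesis .
qed

text \<open>Since Gamma (1 + 1 / m) = Gamma (1 / m) / m, the coefficients behave like t^(1 / m - 1)
  / m, the density of the m-th powers.\<close>

definition vsum :: "nat \<Rightarrow> nat \<Rightarrow> real \<Rightarrow> complex" where
  "vsum m N \<beta> = of_real (Gamma (1 + 1 / real m)) * (\<Sum>t\<le>N. of_real (wcoef (1 / real m) t) * unit_exp (\<beta> * real t))"

text \<open>The sum is cut at T about 1 / dist_int \<beta>. Up to T the trivial bound gives T^a.
  Beyond T the coefficients decrease, and the bounded geometric sums give wcoef a T / dist_int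
  \<beta>, which has the same order.\<close>

lemma norm_wcoef_sum_le:
  assumes a: "0 < a" "a \<le> 1"
  shows "\<exists>C\<ge>1. \<forall>N \<beta>. dist_int \<beta> > 0 \<longrightarrow> norm (\<Sum>t\<le>N. complex_of_real (wcoef a t) * unit_exp (\<beta> * real t)) \<le> C * dist_int \<beta> powr (- a)"
proof -
  obtain C1 where C1: "C1 \<ge> 1" "\<And>t. t \<ge> 1 \<Longrightarrow> wcoef a t \<le> C1 * real t powr (a - 1)" using wcoef_le_powr[OF a(1)] by blast
  obtain C2 where C2: "C2 \<ge> 1" "\<And>t. t \<ge> 1 \<Longrightarrow> wcoef (a + 1) t \<le> C2 * real t powr (a + 1 - 1)" using wcoef_le_powr[of "a + 1"] a by auto
  have main: "norm (\<Sum>t\<le>N. complex_of_real (wcoef a t) * unit_exp (\<beta> * real t)) \<le> (C2 + 2 * C1) * d powr (- a)"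
    if d: "d > 0" "d = dist_int \<beta>" for N \<beta> d
  proof -
    have d2: "d \<le> 1 / 2" using of_int_round_abs_le[of \<beta>] by (simp add: d(2) dist_int_def abs_minus_commute)
    define T where "T = nat \<lfloor>1 / d\<rfloor>"
    have Tle: "real T \<le> 1 / d" using d by (simp add: T_def)
    have Tge: "real T \<ge> 1 / (2 * d)"
    proof -
      have "real T \<ge> 1 / d - 1" using d by (simp add: T_def)
      moreover have "1 / d - 1 \<ge> 1 / (2 * d)" using d d2 by (simp add: field_simps)
      ultimately show ?thesis by linarith
    qed
    have T1: "T \<ge> 1"
    proof -
      have "1 / (2 * d) \<ge> 1" using d(1) d2 by (simp add: field_simps)
      then show ?thesis using Tge by simp
    qed
    have head: "norm (\<Sum>t\<le>n. complex_of_real (wcoef a t) * unit_exp (\<beta> * real t)) \<le> C2 * d powr (- a)" if n: "n \<le> T" for n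
    proof -
      have "norm (\<Sum>t\<le>n. complex_of_real (wcoef a t) * unit_exp (\<beta> * real t)) \<le> (\<Sum>t\<le>n. wcoef a t)"
        using wcoef_pos[OF a(1)] by (intro sum_norm_le) (simp add: norm_mult less_imp_le)
      also have "\<dots> \<le> (\<Sum>t\<le>T. wcoef a t)" using n wcoef_pos[OF a(1)] by (intro sum_mono2) (auto simp: less_imp_le)
      also have "\<dots> = wcoef (a + 1) T" by (rule sum_wcoef)
      also have "\<dots> \<le> C2 * real T powr a" using C2(2)[OF T1] by simp
      also have "\<dots> \<le> C2 * (1 / d) powr a" using C2 Tle a by (intro mult_left_mono powr_mono2) auto
      also have "(1 / d) powr a = d powr (- a)" by (simp only: powr_divide powr_minus_divide powr_one_eq_one)
      finally show ?thesis .
    qed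
    show ?thesis
    proof (cases "N \<le> T")
      case True
      have "C2 * d powr (- a) \<le> (C2 + 2 * C1) * d powr (- a)" using C1 by (intro mult_right_mono) auto
      then show ?thesis using head[OF True] by linarith
    next
      case False
      define n where "n = N - Suc T"
      have N: "N = Suc T + n" using False by (simp add: n_def)
      have "(\<Sum>t\<le>N. complex_of_real (wcoef a t) * unit_exp (\<beta> * real t)) = (\<Sum>t\<le>T. complex_of_real (wcoef a t) * unit_exp (\<beta> * real t))
         + (\<Sum>t\<in>{Suc T..N}. complex_of_real (wcoef a t) * unit_exp (\<beta> * real t))"
      proof -
        have "{..N} = {..T} \<union> {Suc T..N}" using False by auto
        then show ?thesis by (simp add: sum.union_disjoint)
      qed
      also have "(\<Sum>t\<in>{Suc T..N}. complex_of_real (wcoef a t) * unit_exp (\<beta> * real t))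
         = unit_exp (\<beta> * real (Suc T)) * (\<Sum>i\<le>n. complex_of_real (wcoef a (Suc T + i)) * unit_exp (\<beta> * real i))"
      proof -
        have "(\<Sum>t\<in>{Suc T..N}. complex_of_real (wcoef a t) * unit_exp (\<beta> * real t)) = (\<Sum>i\<le>n. complex_of_real (wcoef a (Suc T + i)) * unit_exp (\<beta> * real (Suc T + i)))"
          by (rule sum.reindex_bij_witness[of _ "\<lambda>i. Suc T + i" "\<lambda>t. t - Suc T"]) (auto simp: N)
        moreover have "unit_exp (\<beta> * real (Suc T + i)) = unit_exp (\<beta> * real (Suc T)) * unit_exp (\<beta> * real i)" for i
          by (simp only: unit_exp_add[symmetric] of_nat_add distrib_left)
        ultimately show ?thesis by (simp only: sum_distrib_left mult_ac)
      qed
      also have "norm ((\<Sum>t\<le>T. complex_of_real (wcoef a t) * unit_exp (\<beta> * real t)) + unit_exp (\<beta> * real (Suc T)) * (\<Sum>i\<le>n. complex_of_real (wcoef a (Suc T + i)) * unit_exp (\<beta> * real i)))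
         \<le> C2 * d powr (- a) + wcoef a (Suc T + 0) / d"
        unfolding d(2)
        by (intro norm_triangle_le add_mono head[unfolded d(2)] order_refl, simp only: norm_mult norm_unit_exp mult_1_left,
            rule norm_decreasing_twisted_sum_le) (use a d wcoef_decreasing wcoef_pos[OF a(1)] in \<open>auto simp: less_imp_le\<close>)
      finally have le: "norm (\<Sum>t\<le>N. complex_of_real (wcoef a t) * unit_exp (\<beta> * real t)) \<le> C2 * d powr (- a) + wcoef a (Suc T + 0) / d" .
      have "wcoef a (Suc T + 0) \<le> wcoef a T" using wcoef_decreasing[OF a, of T] by simp
      also have "\<dots> \<le> C1 * real T powr (a - 1)" by (rule C1(2)[OF T1])
      also have "\<dots> \<le> C1 * (2 * d powr (1 - a))"
      proof (intro mult_left_mono)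
        have "real T powr (a - 1) \<le> (1 / (2 * d)) powr (a - 1)" using Tge d a by (intro powr_mono2') auto
        also have "\<dots> = (2 * d) powr (- (a - 1))" by (simp only: powr_divide powr_minus_divide powr_one_eq_one)
        also have "\<dots> = 2 powr (1 - a) * d powr (1 - a)" by (simp add: powr_mult)
        also have "\<dots> \<le> 2 powr 1 * d powr (1 - a)" using a by (intro mult_right_mono powr_mono) auto
        finally show "real T powr (a - 1) \<le> 2 * d powr (1 - a)" by simp
      qed (use C1 in auto)
      finally have "wcoef a (Suc T + 0) / d \<le> C1 * (2 * d powr (1 - a)) / d" using d by (intro divide_right_mono) auto
      then have "norm (\<Sum>t\<le>N. complex_of_real (wcoef a t) * unit_exp (\<beta> * real t)) \<le> C2 * d powr (- a) + C1 * (2 * d powr (1 - a)) / d"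
        using le by linarith
      also have "\<dots> = (C2 + 2 * C1) * d powr (- a)"
      proof -
        have "d powr (1 - a) / d = d powr (- a)" using d by (simp add: powr_diff powr_minus_divide)
        then show ?thesis by (simp add: algebra_simps flip: times_divide_eq_right)
      qed
      finally show ?thesis .
    qed
  qed
  show ?thesis
    by (rule exI[of _ "C2 + 2 * C1"]) (use C1 C2 main in auto)
qed

section \<open>Power sums near a fraction and their models\<close>

definition csum :: "nat \<Rightarrow> nat \<Rightarrow> int \<Rightarrow> complex" where
  "csum m q a = (\<Sum>k<q. unit_exp (of_int a * real k ^ m / real q))"

definition rt :: "nat \<Rightarrow> nat \<Rightarrow> nat" where
  "rt m N = nat \<lfloor>real N powr (1 / real m)\<rfloor>"

definition psumexp :: "nat \<Rightarrow> nat \<Rightarrow> real \<Rightarrow> complex" where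
  "psumexp m N \<alpha> = (\<Sum>x=1..rt m N. unit_exp (\<alpha> * real x ^ m))"

lemma norm_csum_le: "norm (csum m q a) \<le> real q"
proof -
  have "norm (csum m q a) \<le> (\<Sum>k<q. 1)" unfolding csum_def by (rule sum_norm_le) simp
  then show ?thesis by simp
qed

lemma norm_csum_div_le: "norm (csum m q a / of_nat q) \<le> 1"
  using norm_csum_le[of m q a] by (cases "q = 0") (auto simp: norm_divide divide_le_eq)

lemma unit_exp_frac_cong:
  assumes "q > 0" "[u = v] (mod int q)"
  shows "unit_exp (of_int u / real q) = unit_exp (of_int v / real q)"
proof -
  obtain w where "u = v + int q * w" using assms(2) by (metis cong_iff_lin cong_sym)
  then have "of_int u / real q - of_int v / real q = of_int w" using assms(1) by (simp add: field_simps)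
  then show ?thesis by (intro unit_exp_cong) simp
qed

lemma csum_cong:
  assumes "q > 0" "[a = b] (mod int q)"
  shows "csum m q a = csum m q b"
  unfolding csum_def
proof (intro sum.cong refl)
  fix k
  have "[a * int k ^ m = b * int k ^ m] (mod int q)" using assms(2) by (intro cong_mult cong_refl)
  from unit_exp_frac_cong[OF assms(1) this] show "unit_exp (of_int a * real k ^ m / real q) = unit_exp (of_int b * real k ^ m / real q)"
    by simp
qed

lemma rt_iff:
  assumes m: "m \<ge> 1"
  shows "x ^ m \<le> u \<longleftrightarrow> x \<le> rt m u"
proof -
  have "x ^ m \<le> u \<longleftrightarrow> real x \<le> real u powr (1 / real m)"
  proof (cases "x = 0")
    case True
    then show ?thesis using m by (simp add: power_0_left)
  next
    case False
    have "x ^ m \<le> u \<longleftrightarrow> real x ^ m \<le> real u" by (metis of_nat_le_iff of_nat_power)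
    also have "\<dots> \<longleftrightarrow> real x powr real m \<le> real u" using False by (simp add: powr_realpow)
    also have "\<dots> \<longleftrightarrow> real x \<le> real u powr (1 / real m)"
    proof
      assume "real x powr real m \<le> real u"
      then have "(real x powr real m) powr (1 / real m) \<le> real u powr (1 / real m)" by (intro powr_mono2) auto
      then show "real x \<le> real u powr (1 / real m)" using False m by (simp add: powr_powr)
    next
      assume "real x \<le> real u powr (1 / real m)"
      then have "real x powr real m \<le> (real u powr (1 / real m)) powr real m" by (intro powr_mono2) auto
      then show "real x powr real m \<le> real u" using False m by (cases "u = 0") (auto simp: powr_powr)
    qed
    finally show ?thesis .
  qed
  also have "\<dots> \<longleftrightarrow> x \<le> rt m u" unfolding rt_def by (simp add: le_nat_iff le_floor_iff)
  finally show ?thesis .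
qed

lemma rt_le: "real (rt m u) \<le> real u powr (1 / real m)"
  unfolding rt_def by simp

lemma rt_gt: "real u powr (1 / real m) < real (rt m u) + 1"
  unfolding rt_def by (simp add: of_nat_nat)

lemma rt_pos: "N \<ge> 1 \<Longrightarrow> m \<ge> 1 \<Longrightarrow> rt m N \<ge> 1"
  using rt_iff[of m 1 N] by simp

lemma norm_psumexp_le: "norm (psumexp m N \<alpha>) \<le> real N powr (1 / real m)"
proof -
  have "norm (psumexp m N \<alpha>) \<le> (\<Sum>x=1..rt m N. 1)" unfolding psumexp_def by (rule sum_norm_le) simp
  also have "\<dots> \<le> real N powr (1 / real m)" using rt_le[of m N] by simp
  finally show ?thesis .
qed

lemma periodic_exp_sum:
  assumes q: "q \<ge> 1" and m: "m \<ge> 1"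
  shows "norm ((\<Sum>x=1..Y. unit_exp (of_int a * real x ^ m / real q)) - of_real (real Y / real q) * csum m q a) \<le> 4 * real q"
proof -
  define h where "h x = unit_exp (of_int a * real x ^ m / real q)" for x :: nat
  have hn: "norm (h x) = 1" for x by (simp add: h_def)
  have per: "h (b * q + x) = h x" for b x
  proof -
    have "[int (b * q + x) = int x] (mod int q)" by (simp add: cong_def)
    then have "[a * int (b * q + x) ^ m = a * int x ^ m] (mod int q)" by (intro cong_mult cong_pow cong_refl)
    from unit_exp_frac_cong[OF _ this] show ?thesis using q by (simp add: h_def)
  qed
  define b where "b = Y div q"
  define r where "r = Y mod q"
  have Y: "Y = b * q + r" "r < q" using q by (auto simp: b_def r_def)
  have 1: "(\<Sum>x=1..Y. h x) = (\<Sum>x<Y. h x) + h Y - h 0"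
  proof -
    have "(\<Sum>x\<le>Y. h x) = h 0 + (\<Sum>x=1..Y. h x)" by (simp add: atLeast0AtMost[symmetric] sum.atLeast_Suc_atMost)
    moreover have "(\<Sum>x\<le>Y. h x) = (\<Sum>x<Y. h x) + h Y" by (simp add: lessThan_Suc_atMost[symmetric])
    ultimately show ?thesis by (simp add: algebra_simps)
  qed
  have 2: "(\<Sum>x<Y. h x) = of_nat b * csum m q a + (\<Sum>x\<in>{b * q..<Y}. h x)"
  proof -
    have "(\<Sum>x<Y. h x) = (\<Sum>x<b * q. h x) + (\<Sum>x\<in>{b * q..<Y}. h x)"
      using Y by (subst sum.union_disjoint[symmetric]) (auto intro!: sum.cong)
    also have "(\<Sum>x<b * q. h x) = (\<Sum>i<b. \<Sum>x\<in>{i * q..<i * q + q}. h x)" by (rule sum.nat_group[symmetric])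
    also have "\<dots> = (\<Sum>i<b. csum m q a)"
    proof (intro sum.cong refl)
      fix i
      have "(\<Sum>x\<in>{i * q..<i * q + q}. h x) = (\<Sum>k<q. h (i * q + k))"
        by (rule sum.reindex_bij_witness[of _ "\<lambda>k. i * q + k" "\<lambda>x. x - i * q"]) auto
      then show "(\<Sum>x\<in>{i * q..<i * q + q}. h x) = csum m q a" by (simp only: per) (simp only: csum_def h_def)
    qed
    finally show ?thesis by simp
  qed
  have eq: "(\<Sum>x=1..Y. h x) - of_real (real Y / real q) * csum m q a = h Y - h 0 + (\<Sum>x\<in>{b * q..<Y}. h x) - of_real (real r / real q) * csum m q a"
  proof -
    have "real Y / real q = real b + real r / real q" using Y q by (simp add: field_simps)
    then show ?thesis unfolding 1 unfolding 2 by (simp add: algebra_simps)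
  qed
  have n1: "norm (h Y - h 0) \<le> 2" using norm_triangle_ineq4[of "h Y" "h 0"] by (simp add: hn)
  have n2: "norm (\<Sum>x\<in>{b * q..<Y}. h x) \<le> real q"
  proof -
    have "norm (\<Sum>x\<in>{b * q..<Y}. h x) \<le> (\<Sum>x\<in>{b * q..<Y}. 1)" by (rule sum_norm_le) (simp add: hn)
    then show ?thesis using Y by simp
  qed
  have n3: "norm (of_real (real r / real q) * csum m q a) \<le> real q"
  proof -
    have "norm (of_real (real r / real q) * csum m q a) \<le> 1 * real q"
      unfolding norm_mult norm_of_real using Y norm_csum_le[of m q a] by (intro mult_mono) auto
    then show ?thesis by simp
  qed
  have "norm ((h Y - h 0) + (\<Sum>x\<in>{b * q..<Y}. h x) - of_real (real r / real q) * csum m q a) \<le> 2 + real q + real q"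
    by (rule order_trans[OF norm_triangle_ineq4 add_mono[OF order_trans[OF norm_triangle_ineq add_mono[OF n1 n2]] n3]])
  also have "\<dots> \<le> 4 * real q" using q by simp
  finally show ?thesis using eq by (simp only: h_def)
qed

text \<open>Both quantities are u^(1 / m) + O(1): the secondary term of the coefficient asymptotics
  has exponent 1 / m - 1 <= 0. So the model counts m-th powers up to a bounded error.\<close>

lemma Gamma_wcoef_near_root:
  assumes m: "m \<ge> 1"
  shows "\<exists>C\<ge>1. \<forall>u. \<bar>Gamma (1 + 1 / real m) * wcoef (1 / real m + 1) u - real (rt m u)\<bar> \<le> C"
proof -
  define a where "a = 1 / real m + 1"
  have a: "a > 0" "a - 2 \<le> 0" using m by (auto simp: a_def intro: add_nonneg_pos)
  have Gp: "Gamma a > 0" by (rule Gamma_real_pos[OF a(1)])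
  obtain C where C: "C \<ge> 0" "\<And>t. t \<ge> 1 \<Longrightarrow> \<bar>wcoef a t - real t powr (a - 1) / Gamma a\<bar> \<le> C * real t powr (a - 2)"
    using wcoef_asymptotic[OF a(1)] by blast
  have main: "\<bar>Gamma a * wcoef a u - real (rt m u)\<bar> \<le> Gamma a * C + 1 + Gamma a" for u
  proof (cases "u = 0")
    case True
    then have "rt m u = 0" by (simp add: rt_def)
    then show ?thesis using True C(1) Gp by simp
  next
    case False
    have "\<bar>Gamma a * wcoef a u - real u powr (a - 1)\<bar> = Gamma a * \<bar>wcoef a u - real u powr (a - 1) / Gamma a\<bar>"
    proof -
      have "Gamma a * wcoef a u - real u powr (a - 1) = Gamma a * (wcoef a u - real u powr (a - 1) / Gamma a)"
        using Gp by (simp add: right_diff_distrib)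
      then show ?thesis using Gp by (simp add: abs_mult)
    qed
    also have "\<dots> \<le> Gamma a * C"
    proof (intro mult_left_mono)
      have "real u powr (a - 2) \<le> real u powr 0" using False a by (intro powr_mono) auto
      then have "C * real u powr (a - 2) \<le> C * 1" using False C(1) by (intro mult_left_mono) auto
      then show "\<bar>wcoef a u - real u powr (a - 1) / Gamma a\<bar> \<le> C" using C(2)[of u] False by simp
    qed (use Gp in auto)
    finally have 1: "\<bar>Gamma a * wcoef a u - real u powr (a - 1)\<bar> \<le> Gamma a * C" .
    have 2: "\<bar>real u powr (a - 1) - real (rt m u)\<bar> \<le> 1"
      using rt_le[of m u] rt_gt[of u m] by (simp add: a_def)
    have "\<bar>Gamma a * wcoef a u - real (rt m u)\<bar> \<le> Gamma a * C + 1" using 1 2 by linarith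
    then show ?thesis using Gp by linarith
  qed
  show ?thesis
    by (rule exI[of _ "Gamma a * C + 1 + Gamma a"]) (use main C(1) Gp in \<open>auto simp: a_def add.commute\<close>)
qed

text \<open>The difference is one sum over t twisted by \<beta>. Its untwisted partial sums are
  O(q), by periodicity modulo q and the bounded counting error, and partial summation brings \<beta>
  back.\<close>

lemma psumexp_approx_aux:
  assumes m: "m \<ge> 1"
  shows "\<exists>C\<ge>1. \<forall>N q a \<beta>. q \<ge> 1 \<longrightarrow>
    norm (psumexp m N (of_int a / real q + \<beta>) - csum m q a / of_nat q * vsum m N \<beta>) \<le> C * real q * (1 + 2 * pi * \<bar>\<beta>\<bar> * real N)"
proof -
  define G where "G = Gamma (1 + 1 / real m)"
  obtain C where C: "C \<ge> 1" "\<And>u. \<bar>G * wcoef (1 / real m + 1) u - real (rt m u)\<bar> \<le> C"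
    using Gamma_wcoef_near_root[OF m] unfolding G_def by blast
  have main: "norm (psumexp m N (of_int a / real q + \<beta>) - csum m q a / of_nat q * vsum m N \<beta>) \<le> ((4 + C) * real q) * (1 + 2 * pi * \<bar>\<beta>\<bar> * real N)"
    if q: "q \<ge> 1" for N q a \<beta>
  proof -
    define s where "s = csum m q a / of_nat q"
    define h where "h x = unit_exp (of_int a * real x ^ m / real q)" for x :: nat
    define c where "c t = (\<Sum>x | x \<in> {1..rt m N} \<and> x ^ m = t. h x) - s * of_real (G * wcoef (1 / real m) t)" for t
    have s1: "norm s \<le> 1" by (simp add: s_def norm_csum_div_le)
    have part: "norm (\<Sum>t\<le>u. c t) \<le> (4 + C) * real q" if u: "u \<le> N" for u
    proof -
      have "(\<Sum>t\<le>u. \<Sum>x | x \<in> {1..rt m N} \<and> x ^ m = t. h x) = (\<Sum>x=1..rt m u. h x)"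
      proof -
        have A: "{x. x \<in> {1..rt m N} \<and> x ^ m = t} = {x \<in> {1..rt m u}. x ^ m = t}" if "t \<in> {..u}" for t
        proof -
          have "x \<le> rt m u" "x \<le> rt m N" if "x ^ m = t" for x
            using that \<open>t \<in> {..u}\<close> u rt_iff[OF m, of x u] rt_iff[OF m, of x N] by auto
          then show ?thesis by auto
        qed
        have "(\<Sum>t\<le>u. \<Sum>x | x \<in> {1..rt m N} \<and> x ^ m = t. h x) = (\<Sum>t\<le>u. \<Sum>x\<in>{x \<in> {1..rt m u}. x ^ m = t}. h x)"
          by (intro sum.cong refl) (simp only: A)
        also have "\<dots> = (\<Sum>x=1..rt m u. h x)"
          by (rule sum.group) (use rt_iff[OF m] in auto)
        finally show ?thesis .
      qed
      then have "(\<Sum>t\<le>u. c t) = (\<Sum>x=1..rt m u. h x) - s * of_real (G * wcoef (1 / real m + 1) u)"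
        by (simp add: c_def sum_subtractf sum_distrib_left[symmetric] flip: sum_wcoef of_real_sum of_real_mult)
      also have "\<dots> = ((\<Sum>x=1..rt m u. h x) - of_real (real (rt m u) / real q) * csum m q a) - s * of_real (G * wcoef (1 / real m + 1) u - real (rt m u))"
        using q by (simp add: s_def algebra_simps)
      also have "norm \<dots> \<le> 4 * real q + 1 * C"
      proof (rule order_trans[OF norm_triangle_ineq4 add_mono])
        show "norm ((\<Sum>x=1..rt m u. h x) - of_real (real (rt m u) / real q) * csum m q a) \<le> 4 * real q"
          unfolding h_def by (rule periodic_exp_sum[OF q m])
        show "norm (s * of_real (G * wcoef (1 / real m + 1) u - real (rt m u))) \<le> 1 * C"
          unfolding norm_mult norm_of_real using s1 C(2)[of u] by (intro mult_mono) auto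
      qed
      also have "\<dots> \<le> (4 + C) * real q"
      proof -
        have "C * 1 \<le> C * real q" using C(1) q by (intro mult_left_mono) auto
        then show ?thesis by (simp add: algebra_simps)
      qed
      finally show ?thesis .
    qed
    have "(\<Sum>t\<le>N. c t * unit_exp (\<beta> * real t)) = psumexp m N (of_int a / real q + \<beta>) - s * vsum m N \<beta>"
    proof -
      have "(\<Sum>t\<le>N. (\<Sum>x | x \<in> {1..rt m N} \<and> x ^ m = t. h x) * unit_exp (\<beta> * real t)) = psumexp m N (of_int a / real q + \<beta>)"
      proof -
        have "(\<Sum>t\<le>N. (\<Sum>x | x \<in> {1..rt m N} \<and> x ^ m = t. h x) * unit_exp (\<beta> * real t))
          = (\<Sum>t\<le>N. \<Sum>x | x \<in> {1..rt m N} \<and> x ^ m = t. unit_exp ((of_int a / real q + \<beta>) * real x ^ m))"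
          unfolding sum_distrib_right by (intro sum.cong refl) (auto simp: h_def unit_exp_add[symmetric] algebra_simps)
        also have "\<dots> = (\<Sum>x=1..rt m N. unit_exp ((of_int a / real q + \<beta>) * real x ^ m))"
          by (rule sum.group[where g = "\<lambda>x. x ^ m" and S = "{1..rt m N}" and T = "{..N}"]) (use rt_iff[OF m] in auto)
        finally show ?thesis by (simp add: psumexp_def)
      qed
      moreover have "(\<Sum>t\<le>N. s * of_real (G * wcoef (1 / real m) t) * unit_exp (\<beta> * real t)) = s * vsum m N \<beta>"
        unfolding vsum_def sum_distrib_left by (intro sum.cong refl) (simp add: G_def mult_ac)
      ultimately show ?thesis unfolding c_def left_diff_distrib sum_subtractf by (simp only:)
    qed
    moreover have "norm (\<Sum>t\<le>N. c t * unit_exp (\<beta> * real t)) \<le> ((4 + C) * real q) * (1 + 2 * pi * \<bar>\<beta>\<bar> * real N)"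
      by (rule norm_twisted_sum_le) (rule part)
    ultimately show ?thesis by (simp only: s_def)
  qed
  show ?thesis by (rule exI[of _ "4 + C"]) (use main C(1) in auto)
qed

lemma vsum_add_int: "vsum m N (\<beta> + of_int k) = vsum m N \<beta>"
proof -
  have "unit_exp ((\<beta> + of_int k) * real t) = unit_exp (\<beta> * real t)" for t
    by (rule unit_exp_cong) (simp add: algebra_simps)
  then show ?thesis by (simp add: vsum_def)
qed

text \<open>All terms are periodic once \<open>a\<close> is shifted by a multiple of q, so the
  absolute value of the offset may be replaced by its distance to the nearest integer.\<close>

lemma psumexp_approx:
  assumes m: "m \<ge> 1"
  shows "\<exists>C\<ge>1. \<forall>N q a \<alpha>. q \<ge> 1 \<longrightarrow>
    norm (psumexp m N \<alpha> - csum m q a / of_nat q * vsum m N (\<alpha> - of_int a / real q)) \<le> C * real q * (1 + 2 * pi * dist_int (\<alpha> - of_int a / real q) * real N)"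
proof -
  obtain C where C: "C \<ge> 1" "\<And>N q a \<beta>. q \<ge> 1 \<Longrightarrow> norm (psumexp m N (of_int a / real q + \<beta>) - csum m q a / of_nat q * vsum m N \<beta>) \<le> C * real q * (1 + 2 * pi * \<bar>\<beta>\<bar> * real N)"
    using psumexp_approx_aux[OF m] by blast
  have main: "norm (psumexp m N \<alpha> - csum m q a / of_nat q * vsum m N (\<alpha> - of_int a / real q)) \<le> C * real q * (1 + 2 * pi * dist_int (\<alpha> - of_int a / real q) * real N)"
    if q: "q \<ge> 1" for N q a \<alpha>
  proof -
    define k where "k = round (\<alpha> - of_int a / real q)"
    define b where "b = \<alpha> - of_int a / real q - of_int k"
    have b: "\<bar>b\<bar> = dist_int (\<alpha> - of_int a / real q)" by (simp add: b_def k_def dist_int_def)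
    have 1: "\<alpha> = of_int (a + int q * k) / real q + b" using q by (simp add: b_def add_divide_distrib)
    have 2: "csum m q (a + int q * k) = csum m q a" using q by (intro csum_cong) (auto simp: cong_def)
    have 3: "vsum m N b = vsum m N (\<alpha> - of_int a / real q)" using vsum_add_int[of m N b k] by (simp add: b_def)
    show ?thesis using C(2)[OF q, of N "a + int q * k" b] unfolding 1[symmetric] 2 3 b .
  qed
  show ?thesis by (rule exI[of _ C]) (use main C in auto)
qed

lemma norm_vsum_le_inverse:
  assumes m: "m \<ge> 1"
  shows "\<exists>C\<ge>1. \<forall>N \<beta>. dist_int \<beta> > 0 \<longrightarrow> norm (vsum m N \<beta>) \<le> C * dist_int \<beta> powr (- (1 / real m))"
proof -
  have a: "0 < 1 / real m" "1 / real m \<le> 1" using m by auto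
  obtain C where C: "C \<ge> 1" "\<And>N \<beta>. dist_int \<beta> > 0 \<Longrightarrow> norm (\<Sum>t\<le>N. complex_of_real (wcoef (1 / real m) t) * unit_exp (\<beta> * real t)) \<le> C * dist_int \<beta> powr (- (1 / real m))"
    using norm_wcoef_sum_le[OF a] by blast
  have G: "Gamma (1 + 1 / real m) > 0" using a by (intro Gamma_real_pos add_pos_pos) auto
  have "norm (vsum m N \<beta>) \<le> (Gamma (1 + 1 / real m) * C + 1) * dist_int \<beta> powr (- (1 / real m))" if d: "dist_int \<beta> > 0" for N \<beta>
  proof -
    have "norm (vsum m N \<beta>) \<le> Gamma (1 + 1 / real m) * (C * dist_int \<beta> powr (- (1 / real m)))"
      unfolding vsum_def norm_mult using C(2)[OF d, of N] G by (simp add: mult_left_mono)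
    also have "\<dots> \<le> \<dots> + dist_int \<beta> powr (- (1 / real m))" by simp
    finally show ?thesis by (simp add: algebra_simps)
  qed
  moreover have "Gamma (1 + 1 / real m) * C + 1 \<ge> 1" using G C(1) by simp
  ultimately show ?thesis by blast
qed

lemma norm_vsum_le:
  assumes m: "m \<ge> 1"
  shows "\<exists>C\<ge>1. \<forall>N\<ge>1. \<forall>\<beta>. norm (vsum m N \<beta>) \<le> C * real N powr (1 / real m)"
proof -
  have a: "0 < 1 / real m" using m by auto
  have G: "Gamma (1 + 1 / real m) > 0" using a by (intro Gamma_real_pos add_pos_pos) auto
  obtain C where C: "C \<ge> 1" "\<And>u. \<bar>Gamma (1 + 1 / real m) * wcoef (1 / real m + 1) u - real (rt m u)\<bar> \<le> C"
    using Gamma_wcoef_near_root[OF m] by blast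
  have "norm (vsum m N \<beta>) \<le> (1 + C) * real N powr (1 / real m)" if N: "N \<ge> 1" for N \<beta>
  proof -
    have "norm (vsum m N \<beta>) \<le> Gamma (1 + 1 / real m) * (\<Sum>t\<le>N. wcoef (1 / real m) t)"
      unfolding vsum_def norm_mult using G wcoef_pos[OF a]
      by (auto intro!: mult_left_mono sum_norm_le simp: norm_mult less_imp_le)
    also have "\<dots> = Gamma (1 + 1 / real m) * wcoef (1 / real m + 1) N" by (simp add: sum_wcoef)
    also have "\<dots> \<le> real (rt m N) + C" using C(2)[of N] by linarith
    also have "\<dots> \<le> real N powr (1 / real m) + C * real N powr (1 / real m)"
    proof (rule add_mono[OF rt_le])
      have "1 \<le> real N powr (1 / real m)" using N a by (intro ge_one_powr_ge_zero) auto
      then show "C \<le> C * real N powr (1 / real m)" using C(1) by simp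
    qed
    finally show ?thesis by (simp add: algebra_simps)
  qed
  then show ?thesis using C(1) by (intro exI[of _ "1 + C"]) auto
qed

text \<open>For |\<beta>| N <= 1 / 8 all angles stay within pi / 4, so no cancellation occurs. This
  lower bound is what converts mean values of power sums into moments of complete sums.\<close>

lemma norm_vsum_ge:
  assumes m: "m \<ge> 1"
  shows "\<exists>c>0. \<exists>N0. \<forall>N\<ge>N0. \<forall>\<beta>. \<bar>\<beta>\<bar> * real N \<le> 1 / 8 \<longrightarrow> norm (vsum m N \<beta>) \<ge> c * real N powr (1 / real m)"
proof -
  have a: "0 < 1 / real m" using m by auto
  have G: "Gamma (1 + 1 / real m) > 0" using a by (intro Gamma_real_pos add_pos_pos) auto
  obtain C where C: "C \<ge> 1" "\<And>u. \<bar>Gamma (1 + 1 / real m) * wcoef (1 / real m + 1) u - real (rt m u)\<bar> \<le> C"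
    using Gamma_wcoef_near_root[OF m] by blast
  define N0 where "N0 = nat \<lceil>(4 * (C + 1)) powr real m\<rceil> + 1"
  have main: "norm (vsum m N \<beta>) \<ge> 1 / 4 * real N powr (1 / real m)" if N: "N \<ge> N0" and b: "\<bar>\<beta>\<bar> * real N \<le> 1 / 8" for N \<beta>
  proof -
    have cosge: "1 / 2 \<le> Re (unit_exp (\<beta> * real t))" if t: "t \<le> N" for t
    proof -
      have "\<bar>\<beta>\<bar> * real t \<le> 1 / 8"
      proof -
        have "\<bar>\<beta>\<bar> * real t \<le> \<bar>\<beta>\<bar> * real N" using t by (intro mult_left_mono) auto
        then show ?thesis using b by linarith
      qed
      then have "2 * pi * (\<bar>\<beta>\<bar> * real t) \<le> 2 * pi * (1 / 8)" by (intro mult_left_mono) auto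
      then have "cos (pi / 3) \<le> cos \<bar>2 * pi * (\<beta> * real t)\<bar>"
        by (intro cos_monotone_0_pi_le) (auto simp: abs_mult)
      moreover have "Re (unit_exp (\<beta> * real t)) = cos (2 * pi * (\<beta> * real t))"
        by (simp add: unit_exp_def Re_exp)
      ultimately show ?thesis by (simp add: cos_60)
    qed
    have "1 / 2 * (\<Sum>t\<le>N. wcoef (1 / real m) t) \<le> Re (\<Sum>t\<le>N. of_real (wcoef (1 / real m) t) * unit_exp (\<beta> * real t))"
      unfolding Re_sum sum_distrib_left
    proof (rule sum_mono)
      fix t assume "t \<in> {..N}"
      then have "wcoef (1 / real m) t * (1 / 2) \<le> wcoef (1 / real m) t * Re (unit_exp (\<beta> * real t))"
        using cosge wcoef_pos[OF a, of t] by (intro mult_left_mono) auto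
      then show "1 / 2 * wcoef (1 / real m) t \<le> Re (of_real (wcoef (1 / real m) t) * unit_exp (\<beta> * real t))" by simp
    qed
    also have "\<dots> \<le> norm (\<Sum>t\<le>N. of_real (wcoef (1 / real m) t) * unit_exp (\<beta> * real t))" by (rule complex_Re_le_cmod)
    finally have "Gamma (1 + 1 / real m) * (1 / 2 * (\<Sum>t\<le>N. wcoef (1 / real m) t)) \<le> norm (vsum m N \<beta>)"
      unfolding vsum_def norm_mult using G by (simp add: mult_left_mono)
    define V0 where "V0 = Gamma (1 + 1 / real m) * wcoef (1 / real m + 1) N"
    have "Gamma (1 + 1 / real m) * (1 / 2 * (\<Sum>t\<le>N. wcoef (1 / real m) t)) = 1 / 2 * V0"
      by (simp add: sum_wcoef V0_def)
    then have "1 / 2 * V0 \<le> norm (vsum m N \<beta>)"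
      using \<open>Gamma (1 + 1 / real m) * (1 / 2 * (\<Sum>t\<le>N. wcoef (1 / real m) t)) \<le> norm (vsum m N \<beta>)\<close> by simp
    moreover have "real (rt m N) - C \<le> V0" using C(2)[of N] unfolding V0_def by linarith
    moreover have "real N powr (1 / real m) - 1 \<le> real (rt m N)" using rt_gt[of N m] by linarith
    moreover have "2 * (C + 1) \<le> 1 / 2 * real N powr (1 / real m)"
    proof -
      have "(4 * (C + 1)) powr real m \<le> real N" using N unfolding N0_def by linarith
      then have "((4 * (C + 1)) powr real m) powr (1 / real m) \<le> real N powr (1 / real m)" by (intro powr_mono2) auto
      then show ?thesis using m C(1) by (simp add: powr_powr)
    qed
    moreover have gen: "P \<le> 4 * V" if "V0 \<le> 2 * V" "R - D \<le> V0" "P - 1 \<le> R" "4 * (D + 1) \<le> P" "1 \<le> D" for P V V0 R D :: real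
    proof -
      have "P - 1 - D \<le> 2 * V" using that(1,2,3) by linarith
      then show ?thesis using that(4,5) by argo
    qed
    ultimately have "real N powr (1 / real m) \<le> 4 * norm (vsum m N \<beta>)"
      using C(1) by (intro gen[of V0 _ "real (rt m N)" C]) auto
    then show ?thesis by simp
  qed
  show ?thesis by (rule exI[of _ "1 / 4"], intro conjI exI[of _ N0]) (use main in auto)
qed

lemma psumexp_mean_value:
  assumes m: "m \<ge> 1" and e: "e > 0"
  shows "\<exists>C\<ge>1. \<forall>N\<ge>1. \<forall>Q. Q > tri m * N \<longrightarrow>
    (\<Sum>r<Q. norm (psumexp m N (real r / real Q)) ^ (m * (m + 1))) \<le> C * real Q * real N powr (real m + e)"
proof -
  obtain C where C: "C \<ge> 1" "\<And>X Q. X \<ge> 1 \<Longrightarrow> Q > tri m * X ^ m \<Longrightarrow>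
    (\<Sum>r<Q. norm (\<Sum>n=1..X. unit_exp (real r * real n ^ m / real Q)) ^ (m * (m + 1))) \<le> C * real Q * real X powr (real (m * m) + e)"
    using power_mean_value[OF m e] by blast
  have "(\<Sum>r<Q. norm (psumexp m N (real r / real Q)) ^ (m * (m + 1))) \<le> C * real Q * real N powr (real m + e)"
    if N: "N \<ge> 1" and Q: "Q > tri m * N" for N Q
  proof -
    have X: "rt m N \<ge> 1" by (rule rt_pos[OF N m])
    have "rt m N ^ m \<le> N" using rt_iff[OF m, of "rt m N" N] by simp
    then have "tri m * rt m N ^ m \<le> tri m * N" by (rule mult_left_mono) simp
    then have Q': "Q > tri m * rt m N ^ m" using Q by linarith
    have "(\<Sum>r<Q. norm (psumexp m N (real r / real Q)) ^ (m * (m + 1))) \<le> C * real Q * real (rt m N) powr (real (m * m) + e)"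
      using C(2)[OF X Q'] by (simp add: psumexp_def)
    also have "\<dots> \<le> C * real Q * real N powr (real m + e)"
    proof (intro mult_left_mono)
      have "real (rt m N) powr (real (m * m) + e) \<le> (real N powr (1 / real m)) powr (real (m * m) + e)"
        using rt_le[of m N] e by (intro powr_mono2) auto
      also have "\<dots> = real N powr (real m + e / real m)" using m by (simp add: powr_powr add_divide_distrib)
      also have "\<dots> \<le> real N powr (real m + e)" using N m e by (intro powr_mono) (auto simp: divide_le_eq)
      finally show "real (rt m N) powr (real (m * m) + e) \<le> real N powr (real m + e)" .
    qed (use C in auto)
    finally show ?thesis .
  qed
  then show ?thesis using C(1) by blast
qed

section \<open>The singular series\<close>

lemma power_powr:
  fixes x :: real
  assumes "x > 0"
  shows "(x ^ k) powr a = x powr (real k * a)"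
  unfolding powr_realpow[OF assms, symmetric] by (rule powr_powr)

lemma le_power_powr:
  fixes y w :: real
  assumes "0 \<le> y" "y \<le> 1" "real e * w \<le> 1"
  shows "y \<le> (y ^ e) powr w"
proof (cases "y = 0")
  case False
  then have y: "y > 0" using assms by simp
  have "y powr 1 \<le> y powr (real e * w)" using y assms by (intro powr_mono') auto
  then show ?thesis using y by (simp add: powr_powr flip: powr_realpow)
qed simp

text \<open>Hoelder's inequality calls for moments of order 1 / w i, which is at least
  \<open>e i\<close>. Since all values are at most 1, the moments of order \<open>e i\<close>
  dominate them.\<close>

lemma Hoelder_moments:
  fixes y :: "'i \<Rightarrow> 'x \<Rightarrow> real"
  assumes fin: "finite I" "finite X" and w: "(\<Sum>i\<in>I. w i) = 1" "\<And>i. i \<in> I \<Longrightarrow> w i > 0" "\<And>i. i \<in> I \<Longrightarrow> real (e i) * w i \<le> 1"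
    and y: "\<And>i x. i \<in> I \<Longrightarrow> x \<in> X \<Longrightarrow> 0 \<le> y i x \<and> y i x \<le> 1"
    and M: "\<And>i. i \<in> I \<Longrightarrow> (\<Sum>x\<in>X. y i x ^ e i) \<le> M" "M > 0"
  shows "(\<Sum>x\<in>X. \<Prod>i\<in>I. y i x) \<le> M"
proof -
  have "(\<Sum>x\<in>X. \<Prod>i\<in>I. y i x) \<le> (\<Sum>x\<in>X. \<Prod>i\<in>I. (y i x ^ e i) powr w i)"
    using y w by (intro sum_mono prod_mono conjI le_power_powr) auto
  also have "\<dots> \<le> (\<Prod>i\<in>I. (\<Sum>x\<in>X. y i x ^ e i) powr w i)"
    using y by (intro Hoelder_sum_prod fin w) auto
  also have "\<dots> \<le> (\<Prod>i\<in>I. M powr w i)"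
    using M w y by (intro prod_mono conjI powr_mono2 sum_nonneg) (auto simp: less_imp_le)
  also have "\<dots> = M powr (\<Sum>i\<in>I. w i)" using fin M(2) by (simp add: powr_sum)
  also have "\<dots> = M" using w M(2) by simp
  finally show ?thesis .
qed

section \<open>Well-spaced fractions and moments of complete sums\<close>

definition farey :: "nat \<Rightarrow> (nat \<times> nat) set" where
  "farey W = Sigma {1..W} (\<lambda>q. {a. a < q \<and> gcd a q = 1})"

lemma finite_farey [simp]: "finite (farey W)"
  unfolding farey_def by (intro finite_SigmaI) auto

lemma card_farey: "card (farey W) \<le> W ^ 2"
proof -
  have "farey W \<subseteq> {1..W} \<times> {..<W}" by (auto simp: farey_def)
  then have "card (farey W) \<le> card ({1..W} \<times> {..<W})" by (intro card_mono) auto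
  then show ?thesis by (simp add: card_cartesian_product power2_eq_square)
qed

lemma farey_distinct:
  assumes "(q, a) \<in> farey W" "(q', a') \<in> farey W" "a * q' = a' * q"
  shows "(q, a) = (q', a')"
proof -
  have c: "coprime a q" "coprime a' q'" "q \<ge> 1" "q' \<ge> 1" using assms by (auto simp: farey_def coprime_iff_gcd_eq_1)
  have "q dvd a * q'" using assms(3) by simp
  then have 1: "q dvd q'" using c(1) by (simp add: coprime_dvd_mult_right_iff coprime_commute)
  have "q' dvd a' * q" using assms(3) by (metis dvd_triv_right)
  then have "q' dvd q" using c(2) by (simp add: coprime_dvd_mult_right_iff coprime_commute)
  then have "q = q'" using 1 by (simp add: dvd_antisym)
  then show ?thesis using assms(3) c by simp
qed

lemma div_mult_bounds:
  fixes x q :: nat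
  assumes "q \<ge> 1"
  shows "(x div q) * q \<le> x" "x < (x div q + 1) * q"
proof -
  show "(x div q) * q \<le> x" by simp
  have "x mod q < q" using assms by simp
  moreover have "(x div q) * q + x mod q = x" by simp
  ultimately have "x < (x div q) * q + q" by linarith
  then show "x < (x div q + 1) * q" by (simp add: algebra_simps)
qed

text \<open>Fractions with equal floors lie in one half-open interval of length 1 / Q, whereas
  distinct ones differ by at least 1 / (q q') >= 1 / Q.\<close>

lemma farey_floor_inj:
  assumes "W ^ 2 \<le> Q"
  shows "inj_on (\<lambda>(q, a). (a * Q) div q) (farey W)"
proof (rule inj_onI, clarify)
  fix q a q' a' assume f: "(q, a) \<in> farey W" "(q', a') \<in> farey W" and eq: "(a * Q) div q = (a' * Q) div q'"
  have q: "q \<ge> 1" "q' \<ge> 1" "q \<le> W" "q' \<le> W" using f by (auto simp: farey_def)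
  define r where "r = (a * Q) div q"
  have 1: "r * q \<le> a * Q" "a * Q < (r + 1) * q"
    unfolding r_def by (rule div_mult_bounds[OF q(1)])+
  have 2: "r * q' \<le> a' * Q" "a' * Q < (r + 1) * q'"
    unfolding r_def eq by (rule div_mult_bounds[OF q(2)])+
  have W: "q * q' \<le> Q"
  proof -
    have "q * q' \<le> W * W" using q by (intro mult_mono) auto
    then show ?thesis using assms by (simp add: power2_eq_square)
  qed
  have "a * q' = a' * q"
  proof (rule ccontr)
    assume "a * q' \<noteq> a' * q"
    then consider "a * q' + 1 \<le> a' * q" | "a' * q + 1 \<le> a * q'" by linarith
    then show False
    proof cases
      case 1
      have "(a * q' + 1) * Q \<le> a' * q * Q" by (rule mult_right_mono[OF 1]) simp
      also have "\<dots> = a' * Q * q" by simp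
      also have "\<dots> < (r + 1) * q' * q" using 2(2) q by (intro mult_strict_right_mono) auto
      also have "\<dots> = r * q * q' + q * q'" by (simp add: algebra_simps)
      also have "\<dots> \<le> a * Q * q' + Q" using \<open>r * q \<le> a * Q\<close> W by (intro add_mono mult_right_mono) auto
      finally show False by (simp add: algebra_simps)
    next
      case 2
      have "(a' * q + 1) * Q \<le> a * q' * Q" by (rule mult_right_mono[OF 2]) simp
      also have "\<dots> = a * Q * q'" by simp
      also have "\<dots> < (r + 1) * q * q'" using 1(2) q by (intro mult_strict_right_mono) auto
      also have "\<dots> = r * q' * q + q * q'" by (simp add: algebra_simps)
      also have "\<dots> \<le> a' * Q * q + Q" using \<open>r * q' \<le> a' * Q\<close> W by (intro add_mono mult_right_mono) auto
      finally show False by (simp add: algebra_simps)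
    qed
  qed
  then show "q = q' \<and> a = a'" using farey_distinct[OF f] by simp
qed

text \<open>The approximation error W / P is at most 1 / W. Raised to a power E >= 2 it is O(1 /
  W^2), which just balances the number of fractions, at most W^2.\<close>

lemma complete_sum_moment_pointwise:
  fixes c Ca P W :: real
  assumes "c > 0" "P \<ge> W\<^sup>2" "W \<ge> 1" "Ca \<ge> 1" "E \<ge> 2" "s \<ge> 0" "F \<ge> 0"
    and le: "s * (c * P) \<le> F + 2 * Ca * W"
  shows "s ^ E \<le> (2 / c) ^ E * (F ^ E / P ^ E) + (2 / c) ^ E * (2 * Ca) ^ E / W\<^sup>2"
proof -
  have "W\<^sup>2 \<ge> 1" using assms(3) by (simp add: one_le_power)
  then have P: "P > 0" using assms(2) by linarith
  have "s \<le> (F + 2 * Ca * W) / (c * P)" using le P assms(1) by (simp add: le_divide_eq)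
  also have "\<dots> = (F / P + 2 * Ca * W / P) / c" by (simp add: add_divide_distrib mult.commute)
  also have "\<dots> \<le> (F / P + 2 * Ca / W) / c"
  proof (intro divide_right_mono add_left_mono)
    have "2 * Ca * W / P \<le> 2 * Ca * W / W\<^sup>2" using assms P by (intro divide_left_mono) auto
    then show "2 * Ca * W / P \<le> 2 * Ca / W" using assms by (simp add: power2_eq_square)
  qed (use assms in auto)
  finally have "s ^ E \<le> ((F / P + 2 * Ca / W) / c) ^ E" using assms(6) by (intro power_mono)
  also have "\<dots> \<le> (2 * max (F / P) (2 * Ca / W) / c) ^ E"
    using assms P by (intro power_mono divide_right_mono) auto
  also have "\<dots> = (2 / c) ^ E * max (F / P) (2 * Ca / W) ^ E" by (simp add: power_divide power_mult_distrib)
  also have "\<dots> \<le> (2 / c) ^ E * ((F / P) ^ E + (2 * Ca / W) ^ E)"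
    using assms P by (intro mult_left_mono) (auto simp: max_def)
  also have "\<dots> \<le> (2 / c) ^ E * ((F / P) ^ E + (2 * Ca) ^ E / W\<^sup>2)"
  proof (intro mult_left_mono add_left_mono)
    have "(2 * Ca / W) ^ E = (2 * Ca) ^ E / W ^ E" by (simp add: power_divide)
    also have "\<dots> \<le> (2 * Ca) ^ E / W\<^sup>2" using assms by (intro divide_left_mono power_increasing mult_pos_pos) auto
    finally show "(2 * Ca / W) ^ E \<le> (2 * Ca) ^ E / W\<^sup>2" .
  qed (use assms in auto)
  finally show ?thesis by (simp add: power_divide algebra_simps)
qed

text \<open>The fractions \<open>a / q\<close> are well spaced, and near each of them the power sum of length \<open>W\<^sup>2\<close> is
  essentially its full length times \<open>csum m q a / q\<close>; hence the mean value of power sums over \<open>r / Q\<close>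
  dominates the moments of complete sums.\<close>

lemma complete_sum_moments:
  assumes m: "m \<ge> 1" and e: "e > 0"
  shows "\<exists>C\<ge>1. \<forall>W\<ge>1. (\<Sum>(q, a)\<in>farey W. norm (csum m q (int a) / of_nat q) ^ (m * (m + 1))) \<le> C * real W powr e"
proof -
  define E where "E = m * (m + 1)"
  have E2: "E \<ge> 2" using m by (cases m) (auto simp: E_def)
  \<comment> \<open>N will grow like W^(2 m), so N^e1 is W^e up to a constant.\<close>
  define e1 where "e1 = e / (2 * real m)"
  have e1: "e1 > 0" using e m by (simp add: e1_def)
  obtain Cm where Cm: "Cm \<ge> 1" "\<And>N Q. N \<ge> 1 \<Longrightarrow> Q > tri m * N \<Longrightarrow> (\<Sum>r<Q. norm (psumexp m N (real r / real Q)) ^ E) \<le> Cm * real Q * real N powr (real m + e1)"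
    using psumexp_mean_value[OF m e1] unfolding E_def by blast
  obtain Ca where Ca: "Ca \<ge> 1" "\<And>N q a \<alpha>. q \<ge> 1 \<Longrightarrow>
    norm (psumexp m N \<alpha> - csum m q a / of_nat q * vsum m N (\<alpha> - of_int a / real q)) \<le> Ca * real q * (1 + 2 * pi * dist_int (\<alpha> - of_int a / real q) * real N)"
    using psumexp_approx[OF m] by blast
  obtain c N0 where c: "c > 0" "\<And>N \<beta>. N \<ge> N0 \<Longrightarrow> \<bar>\<beta>\<bar> * real N \<le> 1 / 8 \<Longrightarrow> norm (vsum m N \<beta>) \<ge> c * real N powr (1 / real m)"
    using norm_vsum_ge[OF m] by blast
  \<comment> \<open>Q = K N must exceed tri m * N for the mean value, and must be at least 8 N so
    that points within 1 / Q of a fraction lie in the range of the lower bound for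
    \<open>vsum\<close>.\<close>
  define K where "K = tri m + 8"
  define C where "C = (2 / c) ^ E * (Cm * real K * real (N0 + 1) powr e1) + (2 / c) ^ E * (2 * Ca) ^ E + 1"
  have C: "C \<ge> 1" using c(1) Ca(1) Cm(1) by (simp add: C_def)
  have main: "(\<Sum>(q, a)\<in>farey W. norm (csum m q (int a) / of_nat q) ^ E) \<le> C * real W powr e" if W: "W \<ge> 1" for W
  proof -
    \<comment> \<open>The exponent 2 m makes the length N^(1 / m) at least W^2; the factor N0 + 1
      passes the threshold of the lower bound.\<close>
    define N where "N = (N0 + 1) * W ^ (2 * m)"
    define Q where "Q = K * N"
    define P where "P = real N powr (1 / real m)"
    define F where "F r = norm (psumexp m N (real r / real Q))" for r
    have W1: "real W \<ge> 1" using W by simp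
    have NW: "W ^ (2 * m) \<le> N" by (simp add: N_def)
    have Wm: "1 \<le> W ^ (2 * m)" using W by simp
    have N1: "N \<ge> 1" "N \<ge> N0" using NW Wm
    proof -
      have "(N0 + 1) * 1 \<le> N" unfolding N_def by (intro mult_left_mono Wm) simp
      then show "N \<ge> N0" "N \<ge> 1" by auto
    qed
    have W2N: "W ^ 2 \<le> N"
    proof -
      have "W ^ 2 \<le> W ^ (2 * m)" using W m by (intro power_increasing) auto
      then show ?thesis using NW by linarith
    qed
    have Q8: "8 * N \<le> Q" "Q > tri m * N" "Q \<ge> 1" using N1 by (auto simp: Q_def K_def algebra_simps)
    have W2Q: "W ^ 2 \<le> Q" using W2N Q8 by linarith
    have PW: "P \<ge> (real W)\<^sup>2"
    proof -
      have "(real W ^ (2 * m)) powr (1 / real m) \<le> P" unfolding P_def using NW by (intro powr_mono2) (auto simp flip: of_nat_power)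
      moreover have "(real W ^ (2 * m)) powr (1 / real m) = real W ^ 2"
        using W1 m power_powr[of "real W" "2 * m" "1 / real m"] by simp
      ultimately show ?thesis by simp
    qed
    have Ppos: "P > 0" using N1 by (simp add: P_def)
    have PE: "P ^ E = real N powr (real m + 1)"
    proof -
      have "real E * (1 / real m) = real m + 1" using m by (simp add: E_def field_simps)
      moreover have "P ^ E = P powr real E" by (rule powr_realpow[OF Ppos, symmetric])
      ultimately show ?thesis unfolding P_def powr_powr by (simp add: mult.commute)
    qed
    have pt: "norm (csum m q (int a) / of_nat q) ^ E \<le> (2 / c) ^ E * (F ((a * Q) div q) ^ E / P ^ E) + (2 / c) ^ E * (2 * Ca) ^ E / (real W)\<^sup>2"
      if qa: "(q, a) \<in> farey W" for q a
    proof (rule complete_sum_moment_pointwise[OF c(1) PW W1 Ca(1) E2])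
      have q: "q \<ge> 1" "q \<le> W" "a < q" using qa by (auto simp: farey_def)
      define r where "r = (a * Q) div q"
      define b where "b = real r / real Q - of_int (int a) / real q"
      have b: "\<bar>b\<bar> \<le> 1 / real Q"
      proof -
        have h: "r * q \<le> a * Q" "a * Q < (r + 1) * q"
          unfolding r_def by (rule div_mult_bounds[OF q(1)])+
        have "real (r * q) \<le> real (a * Q)" "real (a * Q) \<le> real ((r + 1) * q)" using h by (simp_all only: of_nat_le_iff less_imp_le)
        then have "real r / real Q \<le> real a / real q" "real a / real q \<le> (real r + 1) / real Q"
          using q Q8 by (simp_all add: divide_le_eq le_divide_eq field_simps)
        then show ?thesis by (simp add: b_def add_divide_distrib)
      qed
      have bN: "\<bar>b\<bar> * real N \<le> 1 / 8"
      proof -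
        have "\<bar>b\<bar> * real N \<le> 1 / real Q * real N" using b by (intro mult_right_mono) auto
        also have "\<dots> \<le> 1 / 8"
        proof -
          have "8 * real N \<le> real Q" using Q8(1) by (simp flip: of_nat_mult)
          then show ?thesis using Q8 by (simp add: divide_le_eq)
        qed
        finally show ?thesis .
      qed
      have "2 * pi * dist_int b * real N \<le> 1"
      proof -
        have "dist_int b \<le> \<bar>b\<bar>" using dist_int_le[of b 0] by simp
        then have "dist_int b * real N \<le> 1 / 8" using bN by (meson mult_right_mono of_nat_0_le_iff order_trans)
        then have "2 * pi * (dist_int b * real N) \<le> 2 * pi * (1 / 8)" by (intro mult_left_mono) auto
        also have "\<dots> \<le> 1" using pi_less_4 by simp
        finally show ?thesis by (simp add: mult.assoc)
      qed
      then have "Ca * real q * (1 + 2 * pi * dist_int b * real N) \<le> Ca * real W * 2"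
        using Ca(1) q dist_int_nonneg[of b] by (intro mult_mono) auto
      then have d: "norm (psumexp m N (real r / real Q) - csum m q (int a) / of_nat q * vsum m N b) \<le> 2 * Ca * real W"
        using Ca(2)[OF q(1), of N "real r / real Q" "int a"] unfolding b_def by (simp add: mult_ac)
      have "norm (csum m q (int a) / of_nat q) * (c * P) \<le> norm (csum m q (int a) / of_nat q) * norm (vsum m N b)"
        unfolding P_def by (intro mult_left_mono c(2) N1 bN) auto
      also have "\<dots> = norm (csum m q (int a) / of_nat q * vsum m N b)" by (simp only: norm_mult)
      also have "\<dots> \<le> norm (psumexp m N (real r / real Q)) + norm (psumexp m N (real r / real Q) - csum m q (int a) / of_nat q * vsum m N b)"
        by (metis norm_minus_commute norm_triangle_sub)
      finally show "norm (csum m q (int a) / of_nat q) * (c * P) \<le> F ((a * Q) div q) + 2 * Ca * real W"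
        using d by (simp add: F_def r_def)
    qed (auto simp: F_def)
    have S1: "(\<Sum>(q, a)\<in>farey W. F ((a * Q) div q) ^ E) \<le> Cm * real Q * real N powr (real m + e1)"
    proof -
      have "(\<Sum>(q, a)\<in>farey W. F ((a * Q) div q) ^ E) = (\<Sum>r\<in>(\<lambda>(q, a). (a * Q) div q) ` farey W. F r ^ E)"
        by (subst sum.reindex[OF farey_floor_inj[OF W2Q]]) (auto simp: case_prod_unfold intro!: sum.cong)
      also have "\<dots> \<le> (\<Sum>r<Q. F r ^ E)"
      proof (rule sum_mono2)
        show "(\<lambda>(q, a). (a * Q) div q) ` farey W \<subseteq> {..<Q}"
          using Q8 by (auto simp: farey_def div_less_iff_less_mult mult.commute)
      qed (auto simp: F_def)
      also have "\<dots> \<le> Cm * real Q * real N powr (real m + e1)" unfolding F_def by (rule Cm(2)[OF N1(1) Q8(2)])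
      finally show ?thesis .
    qed
    have "(\<Sum>(q, a)\<in>farey W. norm (csum m q (int a) / of_nat q) ^ E) \<le>
       (\<Sum>(q, a)\<in>farey W. (2 / c) ^ E * (F ((a * Q) div q) ^ E / P ^ E) + (2 / c) ^ E * (2 * Ca) ^ E / (real W)\<^sup>2)"
      using pt by (intro sum_mono) auto
    also have "\<dots> = (2 / c) ^ E / P ^ E * (\<Sum>(q, a)\<in>farey W. F ((a * Q) div q) ^ E) + real (card (farey W)) * ((2 / c) ^ E * (2 * Ca) ^ E / (real W)\<^sup>2)"
      by (simp add: case_prod_unfold sum.distrib sum_distrib_left)
    also have "\<dots> \<le> (2 / c) ^ E / P ^ E * (Cm * real Q * real N powr (real m + e1)) + (real W)\<^sup>2 * ((2 / c) ^ E * (2 * Ca) ^ E / (real W)\<^sup>2)"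
    proof (intro add_mono mult_left_mono mult_right_mono S1)
      show "real (card (farey W)) \<le> (real W)\<^sup>2" using card_farey[of W] by (metis of_nat_le_iff of_nat_power)
    qed (use c(1) Ca(1) Ppos in auto)
    also have "\<dots> = (2 / c) ^ E * (Cm * real K * real N powr e1) + (2 / c) ^ E * (2 * Ca) ^ E"
    proof -
      have "real Q * real N powr (real m + e1) = real K * (real N powr (real m + 1) * real N powr e1)"
        using N1 by (simp add: Q_def powr_add)
      then have "Cm * real Q * real N powr (real m + e1) = P ^ E * (Cm * real K * real N powr e1)"
        unfolding PE by (simp only: mult_ac)
      note eq = this
      have "k / p * (p * z) + v * (d / v) = k * z + d" if "p > 0" "v > 0" for k p z v d :: real
        using that by simp
      note this[of "P ^ E" "(real W)\<^sup>2" "(2 / c) ^ E" "Cm * real K * real N powr e1" "(2 / c) ^ E * (2 * Ca) ^ E"]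
      moreover have "P ^ E > 0" "(real W)\<^sup>2 > 0" using Ppos W1 by simp_all
      ultimately show ?thesis unfolding eq by (simp only: mult.assoc)
    qed
    also have "\<dots> \<le> (2 / c) ^ E * (Cm * real K * real (N0 + 1) powr e1) * real W powr e + ((2 / c) ^ E * (2 * Ca) ^ E + 1) * real W powr e"
    proof (rule add_mono)
      have "real N powr e1 = real (N0 + 1) powr e1 * real W powr e"
      proof -
        have "(real W ^ (2 * m)) powr e1 = real W powr e" using W1 m power_powr[of "real W" "2 * m" e1] by (simp add: e1_def)
        moreover have "real N = real (N0 + 1) * real W ^ (2 * m)" by (simp add: N_def algebra_simps)
        ultimately show ?thesis by (simp add: powr_mult)
      qed
      then show "(2 / c) ^ E * (Cm * real K * real N powr e1) \<le> (2 / c) ^ E * (Cm * real K * real (N0 + 1) powr e1) * real W powr e"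
        by (simp add: mult_ac)
      have "real W powr e \<ge> 1" using W1 e by (intro ge_one_powr_ge_zero) auto
      then have "((2 / c) ^ E * (2 * Ca) ^ E + 1) * 1 \<le> ((2 / c) ^ E * (2 * Ca) ^ E + 1) * real W powr e"
        using c(1) Ca(1) by (intro mult_left_mono) auto
      then show "(2 / c) ^ E * (2 * Ca) ^ E \<le> ((2 / c) ^ E * (2 * Ca) ^ E + 1) * real W powr e" by simp
    qed
    also have "\<dots> = C * real W powr e" by (simp add: C_def algebra_simps)
    finally show ?thesis .
  qed
  show ?thesis using main C unfolding E_def by blast
qed

lemma complete_sum_shift:
  assumes "m \<ge> 1" "q \<ge> 1"
  shows "(\<Sum>x=1..q. unit_exp (of_int a / real q * real x ^ m)) = csum m q a"
proof -
  define h where "h x = unit_exp (of_int a * real x ^ m / real q)" for x :: nat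
  have "h q = 1"
  proof -
    obtain m' where "m = Suc m'" using assms(1) by (cases m) auto
    then have "of_int a * real q ^ m / real q = of_int (a * int q ^ m')" using assms(2) by simp
    then show ?thesis unfolding h_def by (simp only: unit_exp_of_int)
  qed
  moreover have "h 0 = 1" using assms(1) by (simp add: h_def power_0_left)
  moreover have "(\<Sum>x\<le>q. h x) = h 0 + (\<Sum>x=1..q. h x)" by (simp add: atLeast0AtMost[symmetric] sum.atLeast_Suc_atMost)
  moreover have "(\<Sum>x\<le>q. h x) = (\<Sum>x<q. h x) + h q" by (simp add: lessThan_Suc_atMost[symmetric])
  ultimately have "(\<Sum>x=1..q. h x) = (\<Sum>x<q. h x)" by (simp add: algebra_simps)
  then show ?thesis by (simp add: h_def csum_def)
qed

text \<open>Weyl's inequality with X = q and \<alpha> equal to a / q. Its range condition holds with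
  \<delta> = 1 / 2 because m >= 2.\<close>

lemma complete_sum_bound:
  assumes m: "m \<ge> 2"
  shows "\<exists>l>0. \<exists>C\<ge>1. \<forall>q\<ge>1. \<forall>a. coprime a (int q) \<longrightarrow> norm (csum m q a / of_nat q) \<le> C * real q powr (- l)"
proof -
  obtain l C where l: "l > 0" and C: "C \<ge> 1" and W: "\<And>X q a \<alpha>. X \<ge> 1 \<Longrightarrow> q \<ge> 1 \<Longrightarrow> coprime a (int q) \<Longrightarrow> \<bar>\<alpha> - of_int a / real q\<bar> \<le> 1 / (real q)\<^sup>2 \<Longrightarrow>
     real X powr (1 / 2) \<le> real q \<Longrightarrow> real q \<le> real X powr (real m - 1 / 2) \<Longrightarrow>
     norm (\<Sum>n=1..X. unit_exp (\<alpha> * real n ^ m)) \<le> C * real X powr (1 - l)"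
    using Weyl_inequality[OF m, of "1 / 2"] by auto
  have "norm (csum m q a / of_nat q) \<le> C * real q powr (- l)" if q: "q \<ge> 1" and cop: "coprime a (int q)" for q a
  proof -
    have q1: "real q \<ge> 1" using q by simp
    have "norm (\<Sum>n=1..q. unit_exp (of_int a / real q * real n ^ m)) \<le> C * real q powr (1 - l)"
    proof (rule W[OF q q cop])
      have "real q powr (1 / 2) \<le> real q powr 1" using q1 by (intro powr_mono) auto
      then show "real q powr (1 / 2) \<le> real q" using q1 by simp
      have "real q powr 1 \<le> real q powr (real m - 1 / 2)" using q1 m by (intro powr_mono) auto
      then show "real q \<le> real q powr (real m - 1 / 2)" using q1 by simp
    qed simp
    then have "norm (csum m q a) \<le> C * real q powr (1 - l)" using complete_sum_shift[of m q a] m q by simp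
    then have "norm (csum m q a / of_nat q) \<le> C * real q powr (1 - l) / real q"
      using q1 by (simp add: norm_divide divide_right_mono)
    also have "\<dots> = C * (real q powr (1 - l) / real q powr 1)" using q1 by simp
    also have "real q powr (1 - l) / real q powr 1 = real q powr (- l)" unfolding powr_diff[symmetric] by simp
    finally show ?thesis .
  qed
  then show ?thesis using l C by blast
qed

lemma powr_split_half: "(x::real) powr (- l) = x powr (- (l / 2)) * x powr (- (l / 2))"
  by (rule trans[OF _ powr_add]) (rule arg_cong[where f="\<lambda>t. x powr t"], linarith)

lemma powr_half_cancel: "(x::real) > 0 \<Longrightarrow> x powr (l / 2) * x powr (- (l / 2)) = 1"
  by (simp only: powr_minus, simp)

lemma Abel_step:
  fixes D x y S b c v :: real
  assumes "D \<le> x * x * S + c * (v - x)" "(x + y) * S \<le> c" "y \<le> x"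
  shows "D + y * y * b \<le> y * y * (S + b) + c * (v - y)"
proof -
  have "(x - y) * ((x + y) * S) \<le> (x - y) * c" using assms by (intro mult_left_mono) auto
  then show ?thesis using assms(1) by (simp add: algebra_simps)
qed

lemma Abel_final:
  fixes A x S B v :: real
  assumes "A \<le> x * x * S + 2 * B * (v - x)" "S * x \<le> B" "x \<ge> 0" "B \<ge> 0"
  shows "A \<le> 2 * B * v"
proof -
  have "(S * x) * x \<le> B * x" using assms by (intro mult_right_mono)
  moreover have "B * x \<ge> 0" using assms by simp
  ultimately show ?thesis using assms(1) by (simp add: algebra_simps)
qed

text \<open>Partial summation with q^(-l) written as the square of x = q^(-l / 2). The invariant
  combines x^2 S, with S the partial sum of \<open>b\<close>, and a telescoping multiple of x; the
  bound S x <= B0 controls both.\<close>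

lemma weighted_tail_sum_le:
  fixes b :: "nat \<Rightarrow> real"
  assumes b: "\<And>q. b q \<ge> 0" and l: "l > 0" and B0: "B0 \<ge> 0"
    and B: "\<And>W. W \<ge> 1 \<Longrightarrow> (\<Sum>q=1..W. b q) \<le> B0 * real W powr (l / 2)"
    and V: "1 \<le> V" "V \<le> W"
  shows "(\<Sum>q=Suc V..W. real q powr (- l) * b q) \<le> 2 * B0 * real V powr (- (l / 2))"
proof -
  define S where "S W = (\<Sum>q=1..W. b q)" for W
  define x where "x w = real w powr (- (l / 2))" for w :: nat
  have xx: "real w powr (- l) = x w * x w" for w unfolding x_def by (rule powr_split_half)
  have x0: "x w \<ge> 0" for w by (simp add: x_def)
  have xm: "x (Suc w) \<le> x w" if "w \<ge> 1" for w unfolding x_def using that l by (intro powr_mono2') auto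
  have Sx: "S w * x w \<le> B0" if "w \<ge> 1" for w
  proof -
    have "S w * x w \<le> B0 * real w powr (l / 2) * x w" unfolding S_def using B[OF that] x0 by (intro mult_right_mono)
    also have "\<dots> = B0 * (real w powr (l / 2) * x w)" by (rule mult.assoc)
    also have "\<dots> = B0" using that unfolding x_def by (subst powr_half_cancel) auto
    finally show ?thesis .
  qed
  have S0: "S w \<ge> 0" for w unfolding S_def using b by (intro sum_nonneg) auto
  have ind: "(\<Sum>q=Suc V..V + i. real q powr (- l) * b q) \<le> x (V + i) * x (V + i) * S (V + i) + 2 * B0 * (x V - x (V + i))" for i
  proof (induction i)
    case 0
    then show ?case using x0 S0 by simp
  next
    case (Suc i)
    define w where "w = V + i"
    have w: "w \<ge> 1" using V by (simp add: w_def)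
    define D where "D = (\<Sum>q=Suc V..w. real q powr (- l) * b q)"
    have D: "D \<le> x w * x w * S w + 2 * B0 * (x V - x w)" unfolding D_def w_def by (rule Suc.IH)
    have S: "S (Suc w) = S w + b (Suc w)" by (simp add: S_def)
    have "(x w + x (Suc w)) * S w \<le> 2 * B0"
    proof -
      have "(x w + x (Suc w)) * S w \<le> (2 * x w) * S w" using xm[OF w] S0 by (intro mult_right_mono) auto
      also have "\<dots> = 2 * (S w * x w)" by simp
      also have "\<dots> \<le> 2 * B0" using Sx[OF w] by simp
      finally show ?thesis .
    qed
    then have "D + x (Suc w) * x (Suc w) * b (Suc w) \<le> x (Suc w) * x (Suc w) * S (Suc w) + 2 * B0 * (x V - x (Suc w))"
      unfolding S using D xm[OF w] by (intro Abel_step)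
    moreover have "(\<Sum>q=Suc V..V + Suc i. real q powr (- l) * b q) = D + x (Suc w) * x (Suc w) * b (Suc w)"
    proof -
      have "(\<Sum>q=Suc V..Suc w. real q powr (- l) * b q) = D + real (Suc w) powr (- l) * b (Suc w)"
        unfolding D_def by (rule sum.nat_ivl_Suc'[THEN trans, OF _ add.commute]) (use V in \<open>simp add: w_def\<close>)
      then show ?thesis by (simp only: xx w_def add_Suc_right)
    qed
    ultimately show ?case by (simp only: w_def add_Suc_right)
  qed
  obtain i where i: "W = V + i" using le_Suc_ex[OF V(2)] by (elim exE) (rule that)
  have W1: "W \<ge> 1" using V by (rule order_trans)
  have "(\<Sum>q=Suc V..W. real q powr (- l) * b q) \<le> 2 * B0 * x V"
    by (rule Abel_final[OF _ Sx[OF W1] x0 B0]) (rule ind[of i, folded i])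
  then show ?thesis unfolding x_def .
qed

section \<open>The singular series for mixed exponents\<close>

locale mixed_powers =
  fixes n :: nat and m :: "nat \<Rightarrow> nat" and j :: nat
  assumes exponents: "\<And>i. i \<le> n \<Longrightarrow> m i \<ge> 2" and j: "j \<le> n"
    and large: "(\<Sum>i\<in>{..n} - {j}. 1 / (real (m i) * (real (m i) + 1))) \<ge> 1"
begin

text \<open>Dividing the weights by their sum \<open>S \<ge> 1\<close> does no harm: weight times
  moment order becomes 1 / S <= 1, as the moment form of Hoelder's inequality requires.\<close>

lemma Hoelder_off_j:
  fixes y :: "nat \<Rightarrow> 'x \<Rightarrow> real"
  assumes "finite X" and y: "\<And>i x. i \<le> n \<Longrightarrow> x \<in> X \<Longrightarrow> 0 \<le> y i x \<and> y i x \<le> 1"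
    and M: "\<And>i. i \<le> n \<Longrightarrow> (\<Sum>x\<in>X. y i x ^ (m i * (m i + 1))) \<le> M" "M > 0"
  shows "(\<Sum>x\<in>X. \<Prod>i\<in>{..n} - {j}. y i x) \<le> M"
proof -
  define S where "S = (\<Sum>i\<in>{..n} - {j}. 1 / (real (m i) * (real (m i) + 1)))"
  have S: "S \<ge> 1" using large by (simp add: S_def)
  have mp: "real (m i) * (real (m i) + 1) > 0" if "i \<le> n" for i using exponents[OF that] by simp
  show ?thesis
  proof (rule Hoelder_moments[where w = "\<lambda>i. 1 / (real (m i) * (real (m i) + 1)) / S" and e = "\<lambda>i. m i * (m i + 1)"])
    show "(\<Sum>i\<in>{..n} - {j}. 1 / (real (m i) * (real (m i) + 1)) / S) = 1"
      using S unfolding sum_divide_distrib[symmetric] S_def[symmetric] by simp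
    show "0 < 1 / (real (m i) * (real (m i) + 1)) / S" if "i \<in> {..n} - {j}" for i using mp[of i] S that by simp
    show "real (m i * (m i + 1)) * (1 / (real (m i) * (real (m i) + 1)) / S) \<le> 1" if "i \<in> {..n} - {j}" for i
    proof -
      have "real (m i * (m i + 1)) = real (m i) * (real (m i) + 1)" by (simp add: algebra_simps)
      moreover have "x * (1 / x / S) = 1 / S" if "x > 0" for x :: real using that by simp
      note this[OF mp[of i]]
      ultimately have "real (m i * (m i + 1)) * (1 / (real (m i) * (real (m i) + 1)) / S) = 1 / S" using that by (simp only:) auto
      then show ?thesis using S by simp
    qed
  qed (use assms in auto)
qed

definition complete_prod :: "nat \<Rightarrow> nat \<Rightarrow> complex" where
  "complete_prod q a = (\<Prod>i\<le>n. csum (m i) q (int a) / of_nat q)"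

lemma singular_term_eq:
  "singular_term n m N q = (\<Sum>a | a < q \<and> gcd a q = 1. unit_exp (- (real a * real N / real q)) * complete_prod q a)"
proof -
  have "1 / of_nat q ^ (n + 1) * (unit_exp (- (real a * real N / real q)) * (\<Prod>j\<le>n. \<Sum>k<q. unit_exp (real a * real k ^ m j / real q)))
     = unit_exp (- (real a * real N / real q)) * complete_prod q a" for a
    by (simp add: complete_prod_def csum_def prod_dividef)
  then show ?thesis unfolding singular_term_def sum_distrib_left by (simp only:)
qed

lemma norm_complete_prod: "norm (complete_prod q a) = norm (csum (m j) q (int a) / of_nat q) * (\<Prod>i\<in>{..n} - {j}. norm (csum (m i) q (int a) / of_nat q))"
  unfolding complete_prod_def prod_norm[symmetric] using j by (subst prod.remove[of _ j]) auto

lemma norm_complete_prod_le: "q \<ge> 1 \<Longrightarrow> norm (complete_prod q a) \<le> 1"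
  unfolding complete_prod_def prod_norm[symmetric] by (intro prod_le_1 conjI norm_ge_zero norm_csum_div_le)

text \<open>The factor \<open>j\<close> gives q^(-l) for each fraction. The other factors, summed
  over all fractions with denominator up to W, give O(W^(l / 2)) by Hoelder's inequality and the
  moments of complete sums. Partial summation leaves V^(-l / 2) for the tail.\<close>

lemma singular_term_bounds:
  "\<exists>l>0. \<exists>C\<ge>1. (\<forall>N V W. 1 \<le> V \<longrightarrow> V \<le> W \<longrightarrow> (\<Sum>q=Suc V..W. norm (singular_term n m N q)) \<le> C * real V powr (- l))
     \<and> (\<forall>N W. (\<Sum>q=1..W. norm (singular_term n m N q)) \<le> C)"
proof -
  obtain l Cj where l: "l > 0" and Cj: "Cj \<ge> 1" "\<And>q a. q \<ge> 1 \<Longrightarrow> coprime a (int q) \<Longrightarrow> norm (csum (m j) q a / of_nat q) \<le> Cj * real q powr (- l)"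
    using complete_sum_bound[OF exponents[OF j]] by blast
  have "\<forall>i\<in>{..n}. \<exists>C\<ge>1. \<forall>W\<ge>1. (\<Sum>(q, a)\<in>farey W. norm (csum (m i) q (int a) / of_nat q) ^ (m i * (m i + 1))) \<le> C * real W powr (l / 2)"
  proof
    fix i assume "i \<in> {..n}"
    then have "m i \<ge> 1" using exponents[of i] by simp
    then show "\<exists>C\<ge>1. \<forall>W\<ge>1. (\<Sum>(q, a)\<in>farey W. norm (csum (m i) q (int a) / of_nat q) ^ (m i * (m i + 1))) \<le> C * real W powr (l / 2)"
      using l by (intro complete_sum_moments) auto
  qed
  then obtain D where D: "\<forall>i\<in>{..n}. D i \<ge> (1::real) \<and> (\<forall>W\<ge>1. (\<Sum>(q, a)\<in>farey W. norm (csum (m i) q (int a) / of_nat q) ^ (m i * (m i + 1))) \<le> D i * real W powr (l / 2))"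
    unfolding Bex_def by (elim bchoice[THEN exE]) (rule that)
  define B0 where "B0 = (\<Sum>i\<le>n. D i)"
  have DB: "D i \<le> B0" if "i \<le> n" for i unfolding B0_def using D that by (intro member_le_sum) (auto intro: order_trans[of 0 1])
  have B0: "B0 \<ge> 1" using DB[of 0] D by force
  define b where "b q = (\<Sum>a | a < q \<and> gcd a q = 1. \<Prod>i\<in>{..n} - {j}. norm (csum (m i) q (int a) / of_nat q))" for q
  have b0: "b q \<ge> 0" for q unfolding b_def by (intro sum_nonneg prod_nonneg) auto
  have B: "(\<Sum>q=1..W. b q) \<le> B0 * real W powr (l / 2)" if W: "W \<ge> 1" for W
  proof -
    have "(\<Sum>q=1..W. b q) = (\<Sum>(q, a)\<in>farey W. \<Prod>i\<in>{..n} - {j}. norm (csum (m i) q (int a) / of_nat q))"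
      unfolding b_def farey_def by (rule sum.Sigma) auto
    also have "\<dots> = (\<Sum>x\<in>farey W. \<Prod>i\<in>{..n} - {j}. norm (csum (m i) (fst x) (int (snd x)) / of_nat (fst x)))"
      by (simp only: case_prod_unfold)
    also have "\<dots> \<le> B0 * real W powr (l / 2)"
    proof (rule Hoelder_off_j)
      show "(\<Sum>x\<in>farey W. norm (csum (m i) (fst x) (int (snd x)) / of_nat (fst x)) ^ (m i * (m i + 1))) \<le> B0 * real W powr (l / 2)" if "i \<le> n" for i
      proof -
        have "(\<Sum>x\<in>farey W. norm (csum (m i) (fst x) (int (snd x)) / of_nat (fst x)) ^ (m i * (m i + 1))) \<le> D i * real W powr (l / 2)"
          using D[THEN bspec, of i] that W unfolding case_prod_unfold by simp
        also have "\<dots> \<le> B0 * real W powr (l / 2)" using DB[OF that] by (intro mult_right_mono) auto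
        finally show ?thesis .
      qed
      show "0 < B0 * real W powr (l / 2)" using B0 W by simp
      show "0 \<le> norm (csum (m i) (fst x) (int (snd x)) / of_nat (fst x)) \<and> norm (csum (m i) (fst x) (int (snd x)) / of_nat (fst x)) \<le> 1"
        if "x \<in> farey W" for i x
      proof -
        have "fst x \<ge> 1" using that by (auto simp: farey_def)
        then show ?thesis by (intro conjI norm_ge_zero norm_csum_div_le)
      qed
    qed simp
    finally show ?thesis .
  qed
  have t: "norm (singular_term n m N q) \<le> Cj * (real q powr (- l) * b q)" if q: "q \<ge> 1" for N q
  proof -
    have "norm (singular_term n m N q) \<le> (\<Sum>a | a < q \<and> gcd a q = 1. norm (complete_prod q a))"
      unfolding singular_term_eq by (rule sum_norm_le) (simp add: norm_mult)
    also have "\<dots> \<le> (\<Sum>a | a < q \<and> gcd a q = 1. Cj * real q powr (- l) * (\<Prod>i\<in>{..n} - {j}. norm (csum (m i) q (int a) / of_nat q)))"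
      unfolding norm_complete_prod
      by (intro sum_mono mult_right_mono prod_nonneg Cj(2) q) (auto simp: coprime_iff_gcd_eq_1)
    also have "\<dots> = Cj * (real q powr (- l) * b q)" unfolding b_def by (simp add: sum_distrib_left mult.assoc)
    finally show ?thesis .
  qed
  have tail: "(\<Sum>q=Suc V..W. norm (singular_term n m N q)) \<le> 3 * Cj * B0 * real V powr (- (l / 2))" if V: "1 \<le> V" "V \<le> W" for N V W
  proof -
    have "(\<Sum>q=Suc V..W. norm (singular_term n m N q)) \<le> (\<Sum>q=Suc V..W. Cj * (real q powr (- l) * b q))"
      using t by (intro sum_mono) auto
    also have "\<dots> = Cj * (\<Sum>q=Suc V..W. real q powr (- l) * b q)" by (simp only: sum_distrib_left)
    also have "\<dots> \<le> Cj * (2 * B0 * real V powr (- (l / 2)))"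
      using Cj(1) B0 by (intro mult_left_mono weighted_tail_sum_le[OF b0 l _ B V]) auto
    also have "\<dots> \<le> 3 * Cj * B0 * real V powr (- (l / 2))" using Cj(1) B0 by simp
    finally show ?thesis .
  qed
  have part: "(\<Sum>q=1..W. norm (singular_term n m N q)) \<le> 3 * Cj * B0" for N W
  proof (cases "W \<ge> 1")
    case True
    have p1: "norm (singular_term n m N 1) \<le> Cj * B0"
    proof -
      have "norm (singular_term n m N 1) \<le> Cj * b 1" using t[of 1 N] by simp
      also have "\<dots> \<le> Cj * B0" using B[of 1] Cj(1) by (intro mult_left_mono) auto
      finally show ?thesis .
    qed
    have "(\<Sum>q=Suc 1..W. norm (singular_term n m N q)) \<le> (\<Sum>q=Suc 1..W. Cj * (real q powr (- l) * b q))"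
      using t by (intro sum_mono) auto
    also have "\<dots> = Cj * (\<Sum>q=Suc 1..W. real q powr (- l) * b q)" by (simp only: sum_distrib_left)
    also have "\<dots> \<le> Cj * (2 * B0 * real 1 powr (- (l / 2)))"
      using Cj(1) B0 by (intro mult_left_mono weighted_tail_sum_le[OF b0 l _ B _ True]) auto
    also have "\<dots> = 2 * Cj * B0" by simp
    finally have p2: "(\<Sum>q=Suc 1..W. norm (singular_term n m N q)) \<le> 2 * Cj * B0" .
    have "(\<Sum>q=1..W. norm (singular_term n m N q)) = norm (singular_term n m N 1) + (\<Sum>q=Suc 1..W. norm (singular_term n m N q))"
      by (rule sum.atLeast_Suc_atMost[OF True])
    then show ?thesis using p1 p2 by linarith
  qed (use Cj(1) B0 in simp)
  have "3 * Cj * B0 \<ge> 1" using mult_mono[of 1 Cj 1 B0] Cj(1) B0 by simp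
  then show ?thesis using tail part l by (intro exI[of _ "l / 2"] conjI exI[of _ "3 * Cj * B0"]) auto
qed

lemma summable_singular_term: "summable (\<lambda>q. norm (singular_term n m N (Suc q)))"
proof -
  obtain C where C: "\<And>W. (\<Sum>q=1..W. norm (singular_term n m N q)) \<le> C" using singular_term_bounds by blast
  show ?thesis
  proof (rule summableI_nonneg_bounded)
    show "(\<Sum>q<k. norm (singular_term n m N (Suc q))) \<le> C" for k using C[of k] by (simp add: sum.atLeast1_atMost_eq)
  qed simp
qed

lemma singular_series_truncation:
  "\<exists>l>0. \<exists>C\<ge>1. \<forall>N. \<forall>V\<ge>1. norm (singular_series n m N - (\<Sum>q=1..V. singular_term n m N q)) \<le> C * real V powr (- l)
     \<and> norm (\<Sum>q=1..V. singular_term n m N q) \<le> C"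
proof -
  obtain l C where l: "l > 0" and C: "C \<ge> 1" and tail: "\<And>N V W. 1 \<le> V \<Longrightarrow> V \<le> W \<Longrightarrow> (\<Sum>q=Suc V..W. norm (singular_term n m N q)) \<le> C * real V powr (- l)"
    and part: "\<And>N W. (\<Sum>q=1..W. norm (singular_term n m N q)) \<le> C"
    using singular_term_bounds by blast
  have "norm (singular_series n m N - (\<Sum>q=1..V. singular_term n m N q)) \<le> C * real V powr (- l)" if V: "V \<ge> 1" for N V
  proof -
    let ?t = "\<lambda>q. singular_term n m N (Suc q)"
    have sn: "summable (\<lambda>i. norm (?t (i + V)))" using summable_singular_term[of N] by (rule summable_ignore_initial_segment)
    have "singular_series n m N - (\<Sum>q=1..V. singular_term n m N q) = (\<Sum>i. ?t (i + V))"
      unfolding singular_series_def suminf_minus_initial_segment[OF summable_norm_cancel[OF summable_singular_term]] by (simp add: sum.atLeast1_atMost_eq)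
    also have "norm \<dots> \<le> (\<Sum>i. norm (?t (i + V)))" by (rule summable_norm[OF sn])
    also have "\<dots> \<le> C * real V powr (- l)"
    proof (rule suminf_le_const[OF sn])
      fix k
      have "(\<Sum>i<k. norm (?t (i + V))) = (\<Sum>q=Suc V..V + k. norm (singular_term n m N q))"
        by (rule sum.reindex_bij_witness[of _ "\<lambda>q. q - Suc V" "\<lambda>i. Suc (i + V)"]) auto
      then show "(\<Sum>i<k. norm (?t (i + V))) \<le> C * real V powr (- l)" using tail[OF V, of "V + k" N] by simp
    qed
    finally show ?thesis .
  qed
  moreover have "norm (\<Sum>q=1..V. singular_term n m N q) \<le> C" for N V using part[of N V] norm_sum order_trans by blast
  ultimately show ?thesis using l C by blast
qed

end

section \<open>The circle method\<close>

text \<open>A displacement \<gamma> of the points r / Q cancels in the only surviving terms, those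
  with s f = N; the sizes of s f and N make the congruence modulo Q an equality. The displacement 0
  counts representations, a / q evaluates the model at a fraction.\<close>

lemma circle_extraction:
  fixes s :: "'f \<Rightarrow> nat" and c :: "'f \<Rightarrow> complex"
  assumes Q: "Q > 0" and fin: "finite F" and s: "\<And>f. f \<in> F \<Longrightarrow> s f < Q" and N: "N < Q"
  shows "(\<Sum>r<Q. (\<Sum>f\<in>F. c f * unit_exp ((real r / real Q - \<gamma>) * real (s f))) * unit_exp (- ((real r / real Q - \<gamma>) * real N)))
    = of_nat Q * (\<Sum>f | f \<in> F \<and> s f = N. c f)"
proof -
  have one: "(\<Sum>r<Q. unit_exp ((real r / real Q - \<gamma>) * real (s f)) * unit_exp (- ((real r / real Q - \<gamma>) * real N))) = (if s f = N then of_nat Q else 0)"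
    if f: "f \<in> F" for f
  proof -
    have "unit_exp ((real r / real Q - \<gamma>) * real (s f)) * unit_exp (- ((real r / real Q - \<gamma>) * real N))
      = unit_exp (- \<gamma> * of_int (int (s f) - int N)) * unit_exp (of_nat r * of_int (int (s f) - int N) / of_nat Q)" for r
      unfolding unit_exp_add[symmetric] by (rule arg_cong[where f=unit_exp]) (simp add: algebra_simps add_divide_distrib diff_divide_distrib)
    then have "(\<Sum>r<Q. unit_exp ((real r / real Q - \<gamma>) * real (s f)) * unit_exp (- ((real r / real Q - \<gamma>) * real N)))
      = unit_exp (- \<gamma> * of_int (int (s f) - int N)) * (if int Q dvd (int (s f) - int N) then of_nat Q else 0)"
      using sum_unit_exp[OF Q, of "int (s f) - int N"] by (simp only: sum_distrib_left[symmetric])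
    moreover have "int Q dvd (int (s f) - int N) \<longleftrightarrow> s f = N"
    proof
      assume d: "int Q dvd (int (s f) - int N)"
      have "\<bar>int (s f) - int N\<bar> < int Q" using s[OF f] N by linarith
      then have "int (s f) - int N = 0" using d zdvd_imp_le[of "int Q" "\<bar>int (s f) - int N\<bar>"] by fastforce
      then show "s f = N" by simp
    qed simp
    ultimately show ?thesis by simp
  qed
  have "(\<Sum>r<Q. (\<Sum>f\<in>F. c f * unit_exp ((real r / real Q - \<gamma>) * real (s f))) * unit_exp (- ((real r / real Q - \<gamma>) * real N)))
    = (\<Sum>r<Q. \<Sum>f\<in>F. c f * (unit_exp ((real r / real Q - \<gamma>) * real (s f)) * unit_exp (- ((real r / real Q - \<gamma>) * real N))))"
    by (simp only: sum_distrib_right mult.assoc)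
  also have "\<dots> = (\<Sum>f\<in>F. c f * (\<Sum>r<Q. unit_exp ((real r / real Q - \<gamma>) * real (s f)) * unit_exp (- ((real r / real Q - \<gamma>) * real N))))"
    by (subst sum.swap) (simp only: sum_distrib_left)
  also have "\<dots> = (\<Sum>f\<in>F. if s f = N then c f * of_nat Q else 0)"
    by (intro sum.cong refl) (simp only: one, simp)
  also have "\<dots> = (\<Sum>f | f \<in> F \<and> s f = N. c f * of_nat Q)" using fin by (simp add: sum.inter_filter)
  also have "\<dots> = of_nat Q * (\<Sum>f | f \<in> F \<and> s f = N. c f)" by (simp add: sum_distrib_left mult.commute)
  finally show ?thesis .
qed

text \<open>The truncation of (1 - z)^(-a) at degree N. A product of such truncations has the
  coefficients of the full product series in all degrees up to N, and the coefficient of degree N is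
  the one needed.\<close>

definition wcoef_poly :: "nat \<Rightarrow> real \<Rightarrow> complex poly" where
  "wcoef_poly N a = (\<Sum>t\<le>N. monom (of_real (wcoef a t)) t)"

lemma poly_wcoef_poly: "poly (wcoef_poly N a) z = (\<Sum>t\<le>N. of_real (wcoef a t) * z ^ t)"
  by (simp add: wcoef_poly_def poly_sum poly_monom)

lemma coeff_wcoef_poly: "t \<le> N \<Longrightarrow> poly.coeff (wcoef_poly N a) t = of_real (wcoef a t)"
  by (simp add: wcoef_poly_def coeff_sum)

lemma degree_wcoef_poly: "degree (wcoef_poly N a) \<le> N"
  unfolding wcoef_poly_def by (intro degree_sum_le) (auto intro: order_trans[OF degree_monom_le])

lemma degree_prod_wcoef_poly: "degree (\<Prod>i\<le>(k::nat). wcoef_poly N (a i)) \<le> (k + 1) * N"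
proof (induction k)
  case (Suc k)
  have "degree (\<Prod>i\<le>Suc k. wcoef_poly N (a i)) \<le> degree (\<Prod>i\<le>k. wcoef_poly N (a i)) + degree (wcoef_poly N (a (Suc k)))"
    by (simp add: degree_mult_le)
  then show ?case using Suc degree_wcoef_poly[of N "a (Suc k)"] by simp
qed (simp add: degree_wcoef_poly)

lemma poly_eq_sum_le:
  fixes p :: "complex poly"
  assumes "degree p \<le> M"
  shows "poly p z = (\<Sum>t\<le>M. poly.coeff p t * z ^ t)"
  unfolding poly_altdef using assms by (intro sum.mono_neutral_left) (auto simp: coeff_eq_0)

lemma coeff_prod_wcoef_poly: "t \<le> N \<Longrightarrow> poly.coeff (\<Prod>i\<le>(k::nat). wcoef_poly N (a i)) t = of_real (wcoef (\<Sum>i\<le>k. a i) t)"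
proof (induction k arbitrary: t)
  case (Suc k)
  have "poly.coeff (\<Prod>i\<le>Suc k. wcoef_poly N (a i)) t = (\<Sum>s\<le>t. poly.coeff (\<Prod>i\<le>k. wcoef_poly N (a i)) s * poly.coeff (wcoef_poly N (a (Suc k))) (t - s))"
    by (simp add: coeff_mult)
  also have "\<dots> = (\<Sum>s\<le>t. of_real (wcoef (\<Sum>i\<le>k. a i) s * wcoef (a (Suc k)) (t - s)))"
    using Suc by (intro sum.cong refl) (simp add: coeff_wcoef_poly)
  also have "\<dots> = of_real (wcoef (\<Sum>i\<le>Suc k. a i) t)"
    unfolding of_real_sum[symmetric] wcoef_convolution by simp
  finally show ?case .
qed (simp add: coeff_wcoef_poly)

context mixed_powers
begin

definition exponent_sum :: real where "exponent_sum = (\<Sum>i\<le>n. 1 / real (m i))"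

definition gamma_prod :: real where "gamma_prod = (\<Prod>i\<le>n. Gamma (1 + 1 / real (m i)))"

text \<open>The factor of N makes the modulus larger than \<open>tri (m i) * N\<close>, as the mean
  values require, and larger than \<open>(n + 1) * N\<close>, the largest frequency in the
  generating functions and their models.\<close>

definition modulus :: "nat \<Rightarrow> nat" where "modulus N = ((\<Sum>i\<le>n. tri (m i)) + n + 2) * N"

definition full_prod :: "nat \<Rightarrow> nat \<Rightarrow> complex" where
  "full_prod N r = (\<Prod>i\<le>n. psumexp (m i) N (real r / real (modulus N)))"

definition offset :: "nat \<Rightarrow> nat \<Rightarrow> nat \<Rightarrow> nat \<Rightarrow> real" where
  "offset N q a r = real r / real (modulus N) - real a / real q"

definition model_prod :: "nat \<Rightarrow> nat \<Rightarrow> nat \<Rightarrow> nat \<Rightarrow> complex" where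
  "model_prod N q a r = complete_prod q a * (\<Prod>i\<le>n. vsum (m i) N (offset N q a r))"

lemma modulus_bounds:
  assumes "N \<ge> 1"
  shows "modulus N > 0" "(n + 1) * N < modulus N" "N < modulus N" "\<And>i. i \<le> n \<Longrightarrow> tri (m i) * N < modulus N"
proof -
  have eq: "modulus N = (\<Sum>i\<le>n. tri (m i)) * N + (n + 1) * N + N" by (simp add: modulus_def algebra_simps)
  show "modulus N > 0" "(n + 1) * N < modulus N" "N < modulus N" unfolding eq using assms by simp_all
  show "tri (m i) * N < modulus N" if "i \<le> n" for i
  proof -
    have "tri (m i) \<le> (\<Sum>i\<le>n. tri (m i))" using that by (intro member_le_sum) auto
    then have "tri (m i) * N \<le> (\<Sum>i\<le>n. tri (m i)) * N" by (rule mult_right_mono) simp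
    then show ?thesis unfolding eq using assms by linarith
  qed
qed

lemma rep_count_eq:
  assumes N: "N \<ge> 1"
  shows "(\<Sum>r<modulus N. full_prod N r * unit_exp (- (real r / real (modulus N) * real N))) = of_nat (modulus N) * of_nat (rep_count n m N)"
proof -
  define F where "F = (\<Pi>\<^sub>E i\<in>{..n}. {1..rt (m i) N})"
  have m1: "m i \<ge> 1" if "i \<le> n" for i using exponents[OF that] by simp
  have prod: "full_prod N r = (\<Sum>f\<in>F. 1 * unit_exp ((real r / real (modulus N) - 0) * real (\<Sum>i\<le>n. f i ^ m i)))" for r
  proof -
    have "full_prod N r = (\<Sum>f\<in>F. \<Prod>i\<le>n. unit_exp (real r / real (modulus N) * real (f i) ^ m i))"
      unfolding full_prod_def psumexp_def F_def by (rule prod_sum_PiE) auto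
    also have "\<dots> = (\<Sum>f\<in>F. 1 * unit_exp ((real r / real (modulus N) - 0) * real (\<Sum>i\<le>n. f i ^ m i)))"
    proof (rule sum.cong[OF refl])
      fix f assume "f \<in> F"
      have "(\<Prod>i\<le>n. unit_exp (x * real (f i) ^ m i)) = unit_exp (x * real (\<Sum>i\<le>n. f i ^ m i))" for x
        by (simp add: sum_distrib_left unit_exp_sum)
      then show "(\<Prod>i\<le>n. unit_exp (real r / real (modulus N) * real (f i) ^ m i)) = 1 * unit_exp ((real r / real (modulus N) - 0) * real (\<Sum>i\<le>n. f i ^ m i))"
        by (simp only: mult_1_left diff_zero)
    qed
    finally show ?thesis .
  qed
  have small: "(\<Sum>i\<le>n. f i ^ m i) < modulus N" if "f \<in> F" for f
  proof -
    have "(\<Sum>i\<le>n. f i ^ m i) \<le> (\<Sum>i\<le>n. N)"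
      using that m1 by (intro sum_mono) (auto simp: F_def rt_iff dest!: PiE_mem)
    then show ?thesis using modulus_bounds(2)[OF N] by simp
  qed
  have set: "{f. f \<in> F \<and> (\<Sum>i\<le>n. f i ^ m i) = N} = {x \<in> {..n} \<rightarrow>\<^sub>E {1..}. N = (\<Sum>i\<le>n. x i ^ m i)}"
  proof (intro set_eqI iffI)
    fix x assume x: "x \<in> {x \<in> {..n} \<rightarrow>\<^sub>E {1..}. N = (\<Sum>i\<le>n. x i ^ m i)}"
    have "x i \<le> rt (m i) N" if i: "i \<le> n" for i
    proof -
      have "x i ^ m i \<le> (\<Sum>i\<le>n. x i ^ m i)" using i by (intro member_le_sum) auto
      then show ?thesis using x rt_iff[OF m1[OF i]] by simp
    qed
    then show "x \<in> {f. f \<in> F \<and> (\<Sum>i\<le>n. f i ^ m i) = N}" using x by (auto simp: F_def PiE_iff)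
  qed (auto simp: F_def PiE_iff)
  have "finite F" unfolding F_def by (intro finite_PiE) auto
  from circle_extraction[where c="\<lambda>_. 1" and \<gamma>=0 and s="\<lambda>f. \<Sum>i\<le>n. f i ^ m i", OF modulus_bounds(1)[OF N] this small modulus_bounds(3)[OF N]]
  show ?thesis unfolding prod[symmetric] set rep_count_def by (simp only: diff_zero sum_constant mult_1_right)
qed

text \<open>The model is summed over the whole circle and not over an arc. The sum is then the
  coefficient of degree N of a polynomial, and the singular integral comes out exactly; the part
  outside the arc is estimated separately as \<open>far_sum\<close>.\<close>

lemma model_prod_sum:
  assumes N: "N \<ge> 1"
  shows "(\<Sum>r<modulus N. model_prod N q a r * unit_exp (- (real r / real (modulus N) * real N)))
    = of_nat (modulus N) * (unit_exp (- (real a * real N / real q)) * complete_prod q a * of_real (gamma_prod * wcoef exponent_sum N))"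
proof -
  define p where "p = (\<Prod>i\<le>n. wcoef_poly N (1 / real (m i)))"
  have poly_p: "poly p z = (\<Sum>t\<le>(n + 1) * N. poly.coeff p t * z ^ t)" for z
    unfolding p_def by (rule poly_eq_sum_le[OF degree_prod_wcoef_poly])
  have v: "(\<Prod>i\<le>n. vsum (m i) N b) = of_real gamma_prod * (\<Sum>t\<le>(n + 1) * N. poly.coeff p t * unit_exp (b * real t))" for b
  proof -
    have e: "unit_exp (b * real t) = unit_exp b ^ t" for t by (simp add: unit_exp_power mult.commute)
    have "(\<Prod>i\<le>n. vsum (m i) N b) = (\<Prod>i\<le>n. of_real (Gamma (1 + 1 / real (m i))) * poly (wcoef_poly N (1 / real (m i))) (unit_exp b))"
      unfolding vsum_def poly_wcoef_poly e ..
    also have "\<dots> = of_real gamma_prod * poly p (unit_exp b)" by (simp add: gamma_prod_def p_def prod.distrib poly_prod)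
    finally show ?thesis unfolding poly_p e .
  qed
  have "model_prod N q a r * unit_exp (- (real r / real (modulus N) * real N)) = unit_exp (- (real a * real N / real q)) * complete_prod q a * of_real gamma_prod *
      ((\<Sum>t\<le>(n + 1) * N. poly.coeff p t * unit_exp ((real r / real (modulus N) - real a / real q) * real t)) * unit_exp (- ((real r / real (modulus N) - real a / real q) * real N)))" for r
  proof -
    have "unit_exp (- (real r / real (modulus N) * real N)) = unit_exp (- (real a * real N / real q)) * unit_exp (- ((real r / real (modulus N) - real a / real q) * real N))"
      unfolding unit_exp_add[symmetric] by (rule arg_cong[where f=unit_exp]) (simp add: algebra_simps)
    then show ?thesis unfolding model_prod_def v offset_def by (simp only: mult_ac)
  qed
  then have "(\<Sum>r<modulus N. model_prod N q a r * unit_exp (- (real r / real (modulus N) * real N))) = unit_exp (- (real a * real N / real q)) * complete_prod q a * of_real gamma_prod *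
      (\<Sum>r<modulus N. (\<Sum>t\<le>(n + 1) * N. poly.coeff p t * unit_exp ((real r / real (modulus N) - real a / real q) * real t)) * unit_exp (- ((real r / real (modulus N) - real a / real q) * real N)))"
    by (simp only: sum_distrib_left)
  also have "(\<Sum>r<modulus N. (\<Sum>t\<le>(n + 1) * N. poly.coeff p t * unit_exp ((real r / real (modulus N) - real a / real q) * real t)) * unit_exp (- ((real r / real (modulus N) - real a / real q) * real N)))
      = of_nat (modulus N) * (\<Sum>t | t \<in> {..(n + 1) * N} \<and> t = N. poly.coeff p t)"
    using modulus_bounds[OF N] by (intro circle_extraction[where s="\<lambda>t. t"]) auto
  also have "{t. t \<in> {..(n + 1) * N} \<and> t = N} = {N}" by auto
  also have "(\<Sum>t\<in>{N}. poly.coeff p t) = of_real (wcoef exponent_sum N)" by (simp add: p_def coeff_prod_wcoef_poly exponent_sum_def)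
  finally show ?thesis by (simp add: mult_ac)
qed

section \<open>Dissection of the circle\<close>

definition near :: "nat \<Rightarrow> real \<Rightarrow> nat \<Rightarrow> nat \<Rightarrow> nat \<Rightarrow> bool" where
  "near N k q a r \<longleftrightarrow> dist_int (offset N q a r) \<le> k"

text \<open>Two fractions near the same point are within 2 k of each other modulo 1, while distinct
  ones are at least 1 / (q q') >= 1 / W^2 apart modulo 1.\<close>

lemma near_unique:
  assumes W: "2 * k * (real W)\<^sup>2 < 1" and f: "(q, a) \<in> farey W" "(q', a') \<in> farey W" and "near N k q a r" "near N k q' a' r"
  shows "(q, a) = (q', a')"
proof (rule ccontr)
  assume ne: "(q, a) \<noteq> (q', a')"
  have q: "q \<ge> 1" "q' \<ge> 1" "q \<le> W" "q' \<le> W" "a < q" "a' < q'" using f by (auto simp: farey_def)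
  define x where "x = real a' / real q' - real a / real q"
  have x: "x = of_int (int a' * int q - int a * int q') / real (q * q')" using q by (simp add: x_def field_simps)
  have "x = offset N q a r - offset N q' a' r" by (simp add: x_def offset_def)
  then have "dist_int x \<le> dist_int (offset N q a r) + dist_int (offset N q' a' r)" using dist_int_minus_le by simp
  then have dx: "dist_int x \<le> 2 * k" using assms(4,5) by (simp add: near_def)
  have "\<bar>int a' * int q - int a * int q'\<bar> \<ge> 1"
  proof -
    have "int (a * q') \<noteq> int (a' * q)" using ne farey_distinct[OF f] by (metis of_nat_eq_iff)
    then show ?thesis by simp
  qed
  have qq: "real (q * q') \<ge> 1" "real (q * q') \<le> (real W)\<^sup>2"
  proof -
    show "real (q * q') \<ge> 1" using q mult_mono[of 1 "real q" 1 "real q'"] by simp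
    show "real (q * q') \<le> (real W)\<^sup>2" unfolding power2_eq_square of_nat_mult using q by (intro mult_mono) auto
  qed
  have "1 / real (q * q') \<le> dist_int x"
  proof -
    define c where "c = int a' * int q - int a * int q' - round x * int (q * q')"
    have "of_int c / real (q * q') = of_int (int a' * int q - int a * int q') / real (q * q') - of_int (round x)"
      unfolding c_def using qq(1) q by (simp add: diff_divide_distrib)
    then have e: "x - of_int (round x) = of_int c / real (q * q')" by (simp only: x[symmetric])
    \<comment> \<open>Both fractions lie in [0, 1), so their difference is an integer only if it is
      0.\<close>
    have "c \<noteq> 0"
    proof
      assume "c = 0"
      then have xi: "x = of_int (round x)" using e by simp
      have "real a' / real q' < 1" "real a / real q < 1" "real a' / real q' \<ge> 0" "real a / real q \<ge> 0" using q by simp_all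
      then have "x < 1" "- 1 < x" unfolding x_def by linarith+
      then have "round x = 0" using xi by linarith
      then have "x = 0" using xi by simp
      then have "real_of_int (int a' * int q - int a * int q') = 0" using qq(1) unfolding x divide_eq_0_iff by linarith
      then have "int a' * int q - int a * int q' = 0" by (simp only: of_int_eq_0_iff)
      then show False using \<open>\<bar>int a' * int q - int a * int q'\<bar> \<ge> 1\<close> by simp
    qed
    then have "(1::real) \<le> \<bar>of_int c\<bar>" by linarith
    then show ?thesis unfolding dist_int_def e using qq by (simp add: divide_right_mono)
  qed
  then have "1 / real (q * q') \<le> 2 * k" using dx by linarith
  then have "1 \<le> 2 * k * real (q * q')" using qq(1) by (simp add: divide_le_eq)
  also have "\<dots> \<le> 2 * k * (real W)\<^sup>2"
    using qq(2) dist_int_nonneg[of x] dx by (intro mult_left_mono) auto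
  finally show False using W by simp
qed

definition minor_sum where
  "minor_sum N k W = (\<Sum>r | r < modulus N \<and> (\<forall>(q, a)\<in>farey W. \<not> near N k q a r). norm (full_prod N r))"
definition major_sum where
  "major_sum N k W = (\<Sum>(q, a)\<in>farey W. \<Sum>r | r < modulus N \<and> near N k q a r. norm (full_prod N r - model_prod N q a r))"
definition far_sum where
  "far_sum N k W = (\<Sum>(q, a)\<in>farey W. \<Sum>r | r < modulus N \<and> \<not> near N k q a r. norm (model_prod N q a r))"

text \<open>At most one fraction is near r. If there is one, its model is compared with the product
  and all other models count as far; if there is none, the product itself is estimated and every
  model is far.\<close>

lemma dissection_pointwise:
  assumes W: "2 * k * (real W)\<^sup>2 < 1"
  shows "norm (full_prod N r - (\<Sum>(q, a)\<in>farey W. model_prod N q a r)) \<le>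
    (if \<forall>(q, a)\<in>farey W. \<not> near N k q a r then norm (full_prod N r) else 0)
    + (\<Sum>(q, a)\<in>farey W. if near N k q a r then norm (full_prod N r - model_prod N q a r) else 0)
    + (\<Sum>(q, a)\<in>farey W. if \<not> near N k q a r then norm (model_prod N q a r) else 0)"
proof (cases "\<forall>(q, a)\<in>farey W. \<not> near N k q a r")
  case True
  have "norm (full_prod N r - (\<Sum>(q, a)\<in>farey W. model_prod N q a r)) \<le> norm (full_prod N r) + norm (\<Sum>(q, a)\<in>farey W. model_prod N q a r)"
    by (rule norm_triangle_ineq4)
  also have "\<dots> \<le> norm (full_prod N r) + (\<Sum>(q, a)\<in>farey W. if \<not> near N k q a r then norm (model_prod N q a r) else 0)"
    using True by (intro add_left_mono sum_norm_le) auto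
  finally show ?thesis using True by (simp add: case_prod_unfold sum_nonneg)
next
  case False
  then obtain q a where qa: "(q, a) \<in> farey W" "near N k q a r" by auto
  have oth: "\<not> near N k (fst x) (snd x) r" if "x \<in> farey W - {(q, a)}" for x
    using near_unique[OF W, of "fst x" "snd x" q a] that qa by auto
  have sp: "(\<Sum>(q, a)\<in>farey W. g q a) = g q a + (\<Sum>(q, a)\<in>farey W - {(q, a)}. g q a)" for g :: "nat \<Rightarrow> nat \<Rightarrow> 'b :: comm_monoid_add"
    using sum.remove[OF finite_farey qa(1), of "\<lambda>(q, a). g q a"] by simp
  have "norm (full_prod N r - (\<Sum>(q, a)\<in>farey W. model_prod N q a r)) = norm ((full_prod N r - model_prod N q a r) - (\<Sum>(q, a)\<in>farey W - {(q, a)}. model_prod N q a r))"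
    unfolding sp by (simp add: algebra_simps)
  also have "\<dots> \<le> norm (full_prod N r - model_prod N q a r) + norm (\<Sum>(q, a)\<in>farey W - {(q, a)}. model_prod N q a r)"
    by (rule norm_triangle_ineq4)
  also have "norm (\<Sum>(q, a)\<in>farey W - {(q, a)}. model_prod N q a r) \<le> (\<Sum>(q, a)\<in>farey W - {(q, a)}. if \<not> near N k q a r then norm (model_prod N q a r) else 0)"
    using oth by (intro sum_norm_le) (auto simp: case_prod_unfold)
  finally have m: "norm (full_prod N r - (\<Sum>(q, a)\<in>farey W. model_prod N q a r)) \<le> norm (full_prod N r - model_prod N q a r)
     + (\<Sum>(q, a)\<in>farey W - {(q, a)}. if \<not> near N k q a r then norm (model_prod N q a r) else 0)" by simp
  have "norm (full_prod N r - model_prod N q a r) \<le> (\<Sum>(q, a)\<in>farey W. if near N k q a r then norm (full_prod N r - model_prod N q a r) else 0)"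
    unfolding sp using qa(2) by (simp add: case_prod_unfold sum_nonneg)
  moreover have "(\<Sum>(q, a)\<in>farey W - {(q, a)}. if \<not> near N k q a r then norm (model_prod N q a r) else 0)
     \<le> (\<Sum>(q, a)\<in>farey W. if \<not> near N k q a r then norm (model_prod N q a r) else 0)"
    by (rule sum_mono2) auto
  ultimately show ?thesis unfolding if_not_P[OF False] using m by linarith
qed

lemma dissection:
  assumes W: "2 * k * (real W)\<^sup>2 < 1" and N: "N \<ge> 1"
  shows "real (modulus N) * norm (of_nat (rep_count n m N) - (\<Sum>q=1..W. singular_term n m N q) * of_real (gamma_prod * wcoef exponent_sum N))
    \<le> minor_sum N k W + major_sum N k W + far_sum N k W"
proof -
  let ?e = "\<lambda>r. unit_exp (- (real r / real (modulus N) * real N))"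
  have "(\<Sum>q=1..W. singular_term n m N q) = (\<Sum>(q, a)\<in>farey W. unit_exp (- (real a * real N / real q)) * complete_prod q a)"
    unfolding singular_term_eq farey_def by (rule sum.Sigma) auto
  then have "of_nat (modulus N) * ((\<Sum>q=1..W. singular_term n m N q) * of_real (gamma_prod * wcoef exponent_sum N))
     = (\<Sum>(q, a)\<in>farey W. of_nat (modulus N) * (unit_exp (- (real a * real N / real q)) * complete_prod q a * of_real (gamma_prod * wcoef exponent_sum N)))"
    by (simp only: sum_distrib_left sum_distrib_right case_prod_unfold)
  also have "\<dots> = (\<Sum>(q, a)\<in>farey W. \<Sum>r<modulus N. model_prod N q a r * ?e r)"
    by (simp only: model_prod_sum[OF N])
  also have "\<dots> = (\<Sum>r<modulus N. (\<Sum>(q, a)\<in>farey W. model_prod N q a r) * ?e r)"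
    unfolding case_prod_unfold sum_distrib_right by (rule sum.swap)
  finally have "of_nat (modulus N) * (of_nat (rep_count n m N) - (\<Sum>q=1..W. singular_term n m N q) * of_real (gamma_prod * wcoef exponent_sum N))
     = (\<Sum>r<modulus N. full_prod N r * ?e r) - (\<Sum>r<modulus N. (\<Sum>(q, a)\<in>farey W. model_prod N q a r) * ?e r)"
    unfolding rep_count_eq[OF N] right_diff_distrib by simp
  also have "\<dots> = (\<Sum>r<modulus N. (full_prod N r - (\<Sum>(q, a)\<in>farey W. model_prod N q a r)) * ?e r)"
    by (simp only: sum_subtractf left_diff_distrib)
  finally have E: "of_nat (modulus N) * (of_nat (rep_count n m N) - (\<Sum>q=1..W. singular_term n m N q) * of_real (gamma_prod * wcoef exponent_sum N))
     = (\<Sum>r<modulus N. (full_prod N r - (\<Sum>(q, a)\<in>farey W. model_prod N q a r)) * ?e r)" .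
  have "real (modulus N) * norm (of_nat (rep_count n m N) - (\<Sum>q=1..W. singular_term n m N q) * of_real (gamma_prod * wcoef exponent_sum N))
     = norm (\<Sum>r<modulus N. (full_prod N r - (\<Sum>(q, a)\<in>farey W. model_prod N q a r)) * ?e r)"
    using arg_cong[OF E, of norm] by (simp only: norm_mult norm_of_nat)
  also have "\<dots> \<le> (\<Sum>r<modulus N. norm (full_prod N r - (\<Sum>(q, a)\<in>farey W. model_prod N q a r)))"
    by (rule sum_norm_le) (simp add: norm_mult)
  also have "\<dots> \<le> (\<Sum>r<modulus N. (if \<forall>(q, a)\<in>farey W. \<not> near N k q a r then norm (full_prod N r) else 0)
    + (\<Sum>(q, a)\<in>farey W. if near N k q a r then norm (full_prod N r - model_prod N q a r) else 0)
    + (\<Sum>(q, a)\<in>farey W. if \<not> near N k q a r then norm (model_prod N q a r) else 0))"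
    by (intro sum_mono dissection_pointwise W)
  also have "\<dots> = minor_sum N k W + major_sum N k W + far_sum N k W"
  proof -
    have f: "(\<Sum>r<M. if P r then g r else 0) = (\<Sum>r | r < M \<and> P r. g r)" for M :: nat and P and g :: "nat \<Rightarrow> real"
      by (simp add: sum.inter_filter[symmetric])
    have s: "(\<Sum>r<M. \<Sum>(q, a)\<in>farey W. if P q a r then g q a r else 0) = (\<Sum>(q, a)\<in>farey W. \<Sum>r | r < M \<and> P q a r. g q a r)"
      for M :: nat and P and g :: "nat \<Rightarrow> nat \<Rightarrow> nat \<Rightarrow> real"
      unfolding f[symmetric] case_prod_unfold by (rule sum.swap)
    show ?thesis unfolding sum.distrib f s minor_sum_def major_sum_def far_sum_def ..
  qed
  finally show ?thesis .
qed

end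

section \<open>Choice of parameters and the major arcs\<close>

lemma powr_mult_eq: "a + b = c \<Longrightarrow> (x::real) powr a * x powr b = x powr c"
  using powr_add[of x a b] by simp

lemma uniform_constant:
  fixes P :: "nat \<Rightarrow> real \<Rightarrow> bool"
  assumes ex: "\<And>i. i \<le> n \<Longrightarrow> \<exists>C\<ge>1. P i C" and mono: "\<And>i C D. P i C \<Longrightarrow> C \<le> D \<Longrightarrow> P i D"
  shows "\<exists>C\<ge>1. \<forall>i\<le>n. P i C"
proof -
  have "\<forall>i\<in>{..n}. \<exists>C. C \<ge> 1 \<and> P i C" using ex by auto
  then obtain D where D: "\<forall>i\<in>{..n}. D i \<ge> (1::real) \<and> P i (D i)" by (elim bchoice[THEN exE]) (rule that)
  have DB: "D i \<le> (\<Sum>i\<le>n. D i)" if "i \<le> n" for i using D that by (intro member_le_sum) (auto intro: order_trans[of 0 1])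
  show ?thesis
  proof (intro exI[of _ "\<Sum>i\<le>n. D i"] conjI allI impI)
    show "(\<Sum>i\<le>n. D i) \<ge> 1" using DB[of 0] D by force
    show "P i (\<Sum>i\<le>n. D i)" if "i \<le> n" for i using mono[of i "D i"] D DB[OF that] that by auto
  qed
qed

text \<open>Division by \<open>D i\<close> brings all factors into the unit disc, where a difference
  of products is at most the sum of the differences of the factors.\<close>

lemma norm_prod_diff_scaled:
  fixes f g :: "'i \<Rightarrow> complex"
  assumes D: "\<And>i. i \<in> I \<Longrightarrow> D i > 0" "\<And>i. i \<in> I \<Longrightarrow> norm (f i) \<le> D i" "\<And>i. i \<in> I \<Longrightarrow> norm (g i) \<le> D i"
    and e: "\<And>i. i \<in> I \<Longrightarrow> norm (f i - g i) \<le> e * D i"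
  shows "norm ((\<Prod>i\<in>I. f i) - (\<Prod>i\<in>I. g i)) \<le> (\<Prod>i\<in>I. D i) * (real (card I) * e)"
proof -
  have dec: "(\<Prod>i\<in>I. h i) = of_real (\<Prod>i\<in>I. D i) * (\<Prod>i\<in>I. h i / of_real (D i))" for h :: "'i \<Rightarrow> complex"
    unfolding of_real_prod prod.distrib[symmetric]
  proof (rule prod.cong[OF refl])
    fix i assume "i \<in> I"
    then show "h i = of_real (D i) * (h i / of_real (D i))" using D(1)[of i] by simp
  qed
  have n1: "norm (h i / of_real (D i)) \<le> 1" if "i \<in> I" "norm (h i) \<le> D i" for h :: "'i \<Rightarrow> complex" and i
    using D(1)[OF that(1)] that(2) by (simp add: norm_divide)
  have "norm ((\<Prod>i\<in>I. f i / of_real (D i)) - (\<Prod>i\<in>I. g i / of_real (D i))) \<le> (\<Sum>i\<in>I. norm (f i / of_real (D i) - g i / of_real (D i)))"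
    by (rule norm_prod_diff) (auto intro!: n1 D)
  also have "\<dots> \<le> (\<Sum>i\<in>I. e)"
  proof (rule sum_mono)
    fix i assume i: "i \<in> I"
    have "norm (f i / of_real (D i) - g i / of_real (D i)) = norm (f i - g i) / D i"
      using D(1)[OF i] by (simp add: norm_divide flip: diff_divide_distrib)
    also have "\<dots> \<le> e" using D(1)[OF i] e[OF i] by (simp add: divide_le_eq)
    finally show "norm (f i / of_real (D i) - g i / of_real (D i)) \<le> e" .
  qed
  finally have "norm ((\<Prod>i\<in>I. f i / of_real (D i)) - (\<Prod>i\<in>I. g i / of_real (D i))) \<le> real (card I) * e" by simp
  moreover have "(\<Prod>i\<in>I. f i) - (\<Prod>i\<in>I. g i) = of_real (\<Prod>i\<in>I. D i) * ((\<Prod>i\<in>I. f i / of_real (D i)) - (\<Prod>i\<in>I. g i / of_real (D i)))"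
    unfolding right_diff_distrib dec[symmetric] ..
  moreover have "(\<Prod>i\<in>I. D i) \<ge> 0" using D(1) by (intro prod_nonneg) (auto intro: less_imp_le)
  ultimately show ?thesis by (simp add: norm_mult mult_left_mono flip: of_real_prod)
qed

context mixed_powers
begin

text \<open>Every occurrence of \<open>delta\<close> in the major arc error adds up to \<open>6 * delta\<close>, which must stay below all
  \<open>1 / m i\<close>.\<close>

definition delta :: real where "delta = 1 / (10 * real (\<Sum>i\<le>n. m i))"
definition width :: "nat \<Rightarrow> real" where "width N = real N powr (delta - 1)"
definition cutoff :: "nat \<Rightarrow> nat" where "cutoff N = nat \<lfloor>real N powr delta\<rfloor>"
text \<open>At least the reciprocal of the arc width, so that off the arc
  \<open>mn (scale N)\<close> is the reciprocal distance. It also bounds the denominators in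
  Dirichlet's approximation on the minor arcs.\<close>

definition scale :: "nat \<Rightarrow> nat" where "scale N = nat \<lceil>real N powr (1 - delta)\<rceil>"

lemma m_pos: "i \<le> n \<Longrightarrow> m i \<ge> 1"
  using exponents[of i] by simp

lemma delta_bounds: "delta > 0" "delta \<le> 1 / 20" "\<And>i. i \<le> n \<Longrightarrow> 10 * delta \<le> 1 / real (m i)"
proof -
  have le: "m i \<le> (\<Sum>i\<le>n. m i)" if "i \<le> n" for i using that by (intro member_le_sum) auto
  have s2: "(\<Sum>i\<le>n. m i) \<ge> 2" using le[OF j] exponents[OF j] by linarith
  then have s2': "real (\<Sum>i\<le>n. m i) \<ge> 2" by (metis of_nat_le_iff of_nat_numeral)
  show "delta > 0" unfolding delta_def using s2' by (intro divide_pos_pos) auto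
  have "1 / (10 * real (\<Sum>i\<le>n. m i)) \<le> 1 / 20" using s2' by (intro divide_left_mono mult_pos_pos) auto
  then show "delta \<le> 1 / 20" unfolding delta_def .
  show "10 * delta \<le> 1 / real (m i)" if "i \<le> n" for i
  proof -
    have "10 * delta = 1 / real (\<Sum>i\<le>n. m i)" unfolding delta_def using s2' by simp
    also have "\<dots> \<le> 1 / real (m i)"
      using le[OF that] m_pos[OF that] s2' by (intro divide_left_mono mult_pos_pos) (simp_all only: of_nat_le_iff of_nat_0_less_iff)
    finally show ?thesis .
  qed
qed

lemma exponent_sum_split: "exponent_sum = 1 / real (m j) + (\<Sum>i\<in>{..n} - {j}. 1 / real (m i))"
  unfolding exponent_sum_def using j by (subst sum.remove[of _ j]) auto

text \<open>As m i + 1 >= 3, each term of the hypothesis is at most a third of 1 / m i. The index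
  \<open>j\<close> makes the inequality strict.\<close>

lemma exponent_sum_gt: "exponent_sum > 3"
proof -
  have "3 * (1 / (real (m i) * (real (m i) + 1))) \<le> 1 / real (m i)" if "i \<in> {..n} - {j}" for i
  proof -
    have m2: "real (m i) \<ge> 2" using exponents[of i] that by simp
    have "3 * (1 / (x * (x + 1))) \<le> 1 / x" if "x \<ge> 2" for x :: real
      using that by (simp add: divide_simps)
    then show ?thesis using m2 .
  qed
  then have "(\<Sum>i\<in>{..n} - {j}. 3 * (1 / (real (m i) * (real (m i) + 1)))) \<le> (\<Sum>i\<in>{..n} - {j}. 1 / real (m i))" by (rule sum_mono)
  then have "3 * (\<Sum>i\<in>{..n} - {j}. 1 / (real (m i) * (real (m i) + 1))) \<le> (\<Sum>i\<in>{..n} - {j}. 1 / real (m i))"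
    by (simp only: sum_distrib_left)
  then have "(\<Sum>i\<in>{..n} - {j}. 1 / real (m i)) \<ge> 3" using large by linarith
  moreover have "1 / real (m j) > 0" using m_pos[OF j] by simp
  ultimately show ?thesis unfolding exponent_sum_split by linarith
qed

lemma prod_powr_exponents:
  assumes "N \<ge> 1"
  shows "(\<Prod>i\<le>n. real N powr (1 / real (m i))) = real N powr exponent_sum"
  using assms unfolding exponent_sum_def by (simp add: powr_sum)

lemma width_pos: "N \<ge> 1 \<Longrightarrow> width N > 0"
  by (simp add: width_def)

lemma cutoff_bounds:
  assumes "N \<ge> 1"
  shows "cutoff N \<ge> 1" "real (cutoff N) \<le> real N powr delta" "real N powr delta < real (cutoff N) + 1"
proof -
  have g: "real N powr delta \<ge> 1" using assms delta_bounds(1) by (intro ge_one_powr_ge_zero) auto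
  then show "cutoff N \<ge> 1" "real (cutoff N) \<le> real N powr delta" "real N powr delta < real (cutoff N) + 1"
    unfolding cutoff_def by (simp_all add: le_nat_floor of_nat_nat)
qed

lemma scale_bounds:
  assumes "N \<ge> 1"
  shows "1 / width N \<le> real (scale N)" "real (scale N) \<le> 2 * real N powr (1 - delta)" "scale N \<ge> 1" "real (scale N) \<le> 2 * real (modulus N)"
proof -
  have g: "real N powr (1 - delta) \<ge> 1" using assms delta_bounds(2) by (intro ge_one_powr_ge_zero) auto
  have "1 / width N = real N powr (1 - delta)" unfolding width_def powr_minus_divide[symmetric] by simp
  moreover have c: "real N powr (1 - delta) \<le> real (scale N)" unfolding scale_def using g by (simp add: of_nat_nat)
  ultimately show "1 / width N \<le> real (scale N)" by simp
  have "real (scale N) < real N powr (1 - delta) + 1" unfolding scale_def using g by (subst of_nat_nat) linarith+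
  then show u: "real (scale N) \<le> 2 * real N powr (1 - delta)" using g by linarith
  have "real (scale N) \<ge> 1" using c g by linarith
  then show "scale N \<ge> 1" by simp
  have "real N powr (1 - delta) \<le> real N powr 1" using assms delta_bounds(1) by (intro powr_mono) auto
  then have "real N powr (1 - delta) \<le> real N" using assms by simp
  also have "real N \<le> real (modulus N)" using modulus_bounds(3)[OF assms] by simp
  finally show "real (scale N) \<le> 2 * real (modulus N)" using u by linarith
qed

lemma width_cutoff:
  assumes N: "N \<ge> 5"
  shows "2 * width N * (real (cutoff N))\<^sup>2 < 1"
proof -
  have "(real (cutoff N))\<^sup>2 \<le> (real N powr delta)\<^sup>2" using cutoff_bounds(2)[of N] N by (intro power_mono) auto
  also have "\<dots> = real N powr (2 * delta)" unfolding power2_eq_square by (rule powr_mult_eq) simp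
  finally have "2 * width N * (real (cutoff N))\<^sup>2 \<le> 2 * width N * real N powr (2 * delta)"
    using width_pos[of N] N by (intro mult_left_mono) auto
  also have "\<dots> = 2 * real N powr (3 * delta - 1)" unfolding width_def mult.assoc by (subst powr_mult_eq[where c = "3 * delta - 1"]) auto
  also have "\<dots> \<le> 2 * real N powr (- (1 / 2))" using delta_bounds N by (intro mult_left_mono powr_mono) auto
  also have "\<dots> = 2 / sqrt (real N)" using N by (simp add: powr_minus_divide powr_half_sqrt)
  also have "\<dots> < 1"
  proof -
    have "sqrt 4 < sqrt (real N)" using N by (intro real_sqrt_less_mono) auto
    then have "2 < sqrt (real N)" by simp
    then show ?thesis by (simp add: divide_less_eq)
  qed
  finally show ?thesis .
qed

lemma card_farey_cutoff:
  assumes "N \<ge> 1"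
  shows "real (card (farey (cutoff N))) \<le> real N powr (2 * delta)"
proof -
  have "real (card (farey (cutoff N))) \<le> (real (cutoff N))\<^sup>2" using card_farey[of "cutoff N"] by (metis of_nat_le_iff of_nat_power)
  also have "\<dots> \<le> (real N powr delta)\<^sup>2" using cutoff_bounds(2)[OF assms] by (intro power_mono) auto
  also have "\<dots> = real N powr (2 * delta)" unfolding power2_eq_square by (rule powr_mult_eq) simp
  finally show ?thesis .
qed

text \<open>Seen from a fraction, the points r / Q form a progression with difference 1 / Q, so the
  block estimate applies with q = Q and a = 1. The bound serves twice: near the fraction
  \<open>width N * mn\<close> is at least 1 and counts points, far from it \<open>mn\<close> is the
  reciprocal distance.\<close>

lemma mn_total:
  assumes e: "e > 0"
  shows "\<exists>C\<ge>1. \<forall>N\<ge>1. \<forall>q a. (\<Sum>r<modulus N. mn (scale N) (offset N q a r)) \<le> C * real (modulus N) * real N powr e"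
proof -
  define K where "K = (\<Sum>i\<le>n. tri (m i)) + n + 2"
  have "K \<ge> 1" by (simp add: K_def)
  then have K: "real K \<ge> 1" by simp
  define C where "C = 10 + 2 * ln (real K) + 2 / e"
  have C: "C \<ge> 1" unfolding C_def using K e by (simp add: add_nonneg_nonneg)
  have "(\<Sum>r<modulus N. mn (scale N) (offset N q a r)) \<le> C * real (modulus N) * real N powr e" if N: "N \<ge> 1" for N q a
  proof -
    define Q where "Q = modulus N"
    have Q: "Q \<ge> 1" using modulus_bounds(1)[OF N] by (simp add: Q_def)
    have QK: "real Q = real K * real N" unfolding Q_def modulus_def K_def by (simp only: of_nat_mult)
    have "(\<Sum>r<Q. mn (scale N) (- (real a / real q) + real r * (1 / real Q))) \<le> 4 * real (scale N) + 2 * real Q * (1 + ln (real Q))"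
      by (rule shifted_block_sum_mn_le[where a = 1, OF Q]) auto
    then have s: "(\<Sum>r<Q. mn (scale N) (offset N q a r)) \<le> 4 * real (scale N) + 2 * real Q * (1 + ln (real Q))"
      unfolding offset_def Q_def by (simp add: algebra_simps)
    have "ln (real Q) = ln (real K) + ln (real N)" unfolding QK using K N by (intro ln_mult_pos) auto
    also have "\<dots> \<le> ln (real K) + real N powr e / e" using ln_powr_bound[of "real N" e] N e by simp
    finally have lnQ: "ln (real Q) \<le> ln (real K) + real N powr e / e" .
    have Ne: "real N powr e \<ge> 1" using N e by (intro ge_one_powr_ge_zero) auto
    have lK: "ln (real K) \<le> ln (real K) * real N powr e" using Ne K by (simp add: mult_le_cancel_left1)
    have "4 * real (scale N) + 2 * real Q * (1 + ln (real Q)) \<le> 4 * (2 * real Q) + 2 * real Q * (1 + ln (real Q))"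
      using scale_bounds(4)[OF N] by (simp add: Q_def)
    also have "\<dots> = real Q * (10 + 2 * ln (real Q))" by algebra
    also have "\<dots> \<le> real Q * (C * real N powr e)"
    proof (rule mult_left_mono)
      have "C * real N powr e = 10 * real N powr e + 2 * (ln (real K) * real N powr e) + 2 * (real N powr e / e)"
        by (simp add: C_def algebra_simps)
      then show "10 + 2 * ln (real Q) \<le> C * real N powr e" using lnQ Ne lK by linarith
    qed simp
    also have "\<dots> = C * real Q * real N powr e" by simp
    finally show ?thesis using s unfolding Q_def by linarith
  qed
  then show ?thesis using C by blast
qed

lemma mn_near:
  assumes N: "N \<ge> 1" and "near N (width N) q a r"
  shows "1 / width N \<le> mn (scale N) (offset N q a r)"
proof (cases "real (scale N) * dist_int (offset N q a r) \<le> 1")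
  case True
  then show ?thesis using scale_bounds(1)[OF N] by (simp add: mn_def)
next
  case False
  then have "dist_int (offset N q a r) > 0" using dist_int_nonneg[of "offset N q a r"] by (cases "dist_int (offset N q a r) = 0") auto
  then show ?thesis using False assms(2) width_pos[OF N] by (auto simp: mn_def near_def intro!: divide_left_mono)
qed

lemma mn_far:
  assumes N: "N \<ge> 1" and "\<not> near N (width N) q a r"
  shows "mn (scale N) (offset N q a r) = 1 / dist_int (offset N q a r)"
proof -
  have "1 = 1 / width N * width N" using width_pos[OF N] by simp
  also have "\<dots> < 1 / width N * dist_int (offset N q a r)"
    using assms width_pos[OF N] by (intro mult_strict_left_mono) (auto simp: near_def)
  also have "\<dots> \<le> real (scale N) * dist_int (offset N q a r)"
    using scale_bounds(1)[OF N] dist_int_nonneg by (rule mult_right_mono)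
  finally show ?thesis by (simp add: mn_def)
qed

text \<open>A single factor is approximated up to q (1 + |\<beta>| N), which is O(N^(2 delta)) here.
  Relative to N^(1 / m i) >= N^(10 delta) this is an error N^(-8 delta), and the relative errors of
  the factors add up.\<close>

lemma norm_full_model_le:
  "\<exists>C\<ge>1. \<forall>N\<ge>1. \<forall>q\<ge>1. \<forall>a r. real q \<le> real N powr delta \<longrightarrow> near N (width N) q a r \<longrightarrow>
    norm (full_prod N r - model_prod N q a r) \<le> C * real N powr (exponent_sum - 8 * delta)"
proof -
  have "\<exists>C\<ge>1. \<forall>i\<le>n. \<forall>N q a \<alpha>. q \<ge> 1 \<longrightarrow>
    norm (psumexp (m i) N \<alpha> - csum (m i) q a / of_nat q * vsum (m i) N (\<alpha> - of_int a / real q)) \<le> C * (real q * (1 + 2 * pi * dist_int (\<alpha> - of_int a / real q) * real N))"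
    (is "\<exists>C\<ge>1. \<forall>i\<le>n. ?P i C")
  proof (rule uniform_constant)
    show "\<exists>C\<ge>1. ?P i C" if "i \<le> n" for i using psumexp_approx[OF m_pos[OF that]] by (simp only: mult.assoc)
    show "?P i D" if "?P i C" "C \<le> D" for i C D
    proof (intro allI impI)
      fix N q a \<alpha> assume h: "q \<ge> (1::nat)"
      show "norm (psumexp (m i) N \<alpha> - csum (m i) q a / of_nat q * vsum (m i) N (\<alpha> - of_int a / real q)) \<le> D * (real q * (1 + 2 * pi * dist_int (\<alpha> - of_int a / real q) * real N))"
        by (rule order_trans[OF that(1)[rule_format, OF h] mult_right_mono[OF that(2)]]) (simp add: dist_int_nonneg)
    qed
  qed
  then obtain A where A: "A \<ge> 1" "\<And>i N q a \<alpha>. i \<le> n \<Longrightarrow> q \<ge> 1 \<Longrightarrow>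
    norm (psumexp (m i) N \<alpha> - csum (m i) q a / of_nat q * vsum (m i) N (\<alpha> - of_int a / real q)) \<le> A * (real q * (1 + 2 * pi * dist_int (\<alpha> - of_int a / real q) * real N))"
    by blast
  have "\<exists>C\<ge>1. \<forall>i\<le>n. \<forall>N\<ge>1. \<forall>\<beta>. norm (vsum (m i) N \<beta>) \<le> C * real N powr (1 / real (m i))" (is "\<exists>C\<ge>1. \<forall>i\<le>n. ?R i C")
  proof (rule uniform_constant)
    show "\<exists>C\<ge>1. ?R i C" if "i \<le> n" for i by (rule norm_vsum_le[OF m_pos[OF that]])
    show "?R i D" if "?R i C" "C \<le> D" for i C D
    proof (intro allI impI)
      fix N \<beta> assume h: "N \<ge> (1::nat)"
      show "norm (vsum (m i) N \<beta>) \<le> D * real N powr (1 / real (m i))"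
        by (rule order_trans[OF that(1)[rule_format, OF h] mult_right_mono[OF that(2)]]) simp
    qed
  qed
  then obtain V where V: "V \<ge> 1" "\<And>i N \<beta>. i \<le> n \<Longrightarrow> N \<ge> 1 \<Longrightarrow> norm (vsum (m i) N \<beta>) \<le> V * real N powr (1 / real (m i))" by blast
  define C where "C = V ^ (n + 1) * (real (n + 1) * (8 * A))"
  have C1: "C \<ge> 1"
  proof -
    have "V ^ (n + 1) \<ge> 1" using V(1) by (rule one_le_power)
    moreover have "real (n + 1) * (8 * A) \<ge> 1" using mult_mono[of 1 "real (n + 1)" 1 "8 * A"] A(1) by simp
    ultimately show ?thesis unfolding C_def using mult_mono[of 1 "V ^ (n + 1)" 1 "real (n + 1) * (8 * A)"] by simp
  qed
  have "norm (full_prod N r - model_prod N q a r) \<le> C * real N powr (exponent_sum - 8 * delta)"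
    if N: "N \<ge> 1" and q: "q \<ge> 1" "real q \<le> real N powr delta" and near: "near N (width N) q a r" for N q a r
  proof -
    let ?b = "offset N q a r"
    have b: "?b = real r / real (modulus N) - of_int (int a) / real q" by (simp add: offset_def)
    have d: "norm (psumexp (m i) N (real r / real (modulus N)) - csum (m i) q (int a) / of_nat q * vsum (m i) N ?b) \<le> 8 * A * real N powr (2 * delta)"
      if i: "i \<le> n" for i
    proof -
      have Nd: "real N powr delta \<ge> 1" using N delta_bounds(1) by (intro ge_one_powr_ge_zero) auto
      have "dist_int ?b * real N \<le> width N * real N" using near by (intro mult_right_mono) (auto simp: near_def)
      also have "width N * real N = real N powr delta" using N powr_mult_eq[of "delta - 1" 1 delta "real N"] by (simp add: width_def)
      finally have "2 * pi * (dist_int ?b * real N) \<le> 7 * real N powr delta"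
        using pi_less_4 pi_approx dist_int_nonneg[of ?b] by (intro mult_mono) auto
      then have "1 + 2 * pi * dist_int ?b * real N \<le> 8 * real N powr delta" using Nd by (simp add: mult.assoc)
      then have "real q * (1 + 2 * pi * dist_int ?b * real N) \<le> real N powr delta * (8 * real N powr delta)"
        using q dist_int_nonneg[of ?b] by (intro mult_mono) auto
      also have "\<dots> = 8 * (real N powr delta * real N powr delta)" by simp
      also have "\<dots> = 8 * real N powr (2 * delta)" by (subst powr_mult_eq[where c = "2 * delta"]) auto
      finally have "A * (real q * (1 + 2 * pi * dist_int ?b * real N)) \<le> A * (8 * real N powr (2 * delta))"
        using A(1) by (intro mult_left_mono) auto
      then show ?thesis using A(2)[OF i q(1), of N "real r / real (modulus N)" "int a"] unfolding b by simp
    qed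
    have "norm (full_prod N r - model_prod N q a r) = norm ((\<Prod>i\<le>n. psumexp (m i) N (real r / real (modulus N))) - (\<Prod>i\<le>n. csum (m i) q (int a) / of_nat q * vsum (m i) N ?b))"
      unfolding full_prod_def model_prod_def complete_prod_def prod.distrib ..
    also have "\<dots> \<le> (\<Prod>i\<le>n. V * real N powr (1 / real (m i))) * (real (card {..n}) * (8 * A * real N powr (- (8 * delta))))"
    proof (rule norm_prod_diff_scaled)
      fix i assume "i \<in> {..n}"
      then have i: "i \<le> n" by simp
      show "0 < V * real N powr (1 / real (m i))" using V(1) N by simp
      have "1 * real N powr (1 / real (m i)) \<le> V * real N powr (1 / real (m i))" using V(1) by (intro mult_right_mono) auto
      then show "norm (psumexp (m i) N (real r / real (modulus N))) \<le> V * real N powr (1 / real (m i))"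
        using norm_psumexp_le[of "m i" N "real r / real (modulus N)"] by simp
      have "norm (csum (m i) q (int a) / of_nat q * vsum (m i) N ?b) \<le> 1 * norm (vsum (m i) N ?b)"
        unfolding norm_mult by (intro mult_right_mono norm_csum_div_le) auto
      then show "norm (csum (m i) q (int a) / of_nat q * vsum (m i) N ?b) \<le> V * real N powr (1 / real (m i))"
        using V(2)[OF i N, of ?b] by simp
      have "real N powr (2 * delta) = real N powr (- (8 * delta)) * real N powr (10 * delta)" by (rule powr_mult_eq[symmetric]) simp
      also have "\<dots> \<le> real N powr (- (8 * delta)) * real N powr (1 / real (m i))"
        using delta_bounds(3)[OF i] N by (intro mult_left_mono powr_mono) auto
      also have "\<dots> \<le> real N powr (- (8 * delta)) * (V * real N powr (1 / real (m i)))"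
        using mult_right_mono[OF V(1), of "real N powr (1 / real (m i))"] by (intro mult_left_mono) auto
      finally have "8 * A * real N powr (2 * delta) \<le> 8 * A * (real N powr (- (8 * delta)) * (V * real N powr (1 / real (m i))))"
        using A(1) by (intro mult_left_mono) auto
      then show "norm (psumexp (m i) N (real r / real (modulus N)) - csum (m i) q (int a) / of_nat q * vsum (m i) N ?b) \<le> 8 * A * real N powr (- (8 * delta)) * (V * real N powr (1 / real (m i)))"
        using d[OF i] by (simp add: mult.assoc)
    qed
    also have "\<dots> = C * (real N powr exponent_sum * real N powr (- (8 * delta)))"
      unfolding prod.distrib prod_powr_exponents[OF N] C_def by simp
    also have "\<dots> = C * real N powr (exponent_sum - 8 * delta)" by (subst powr_mult_eq[where c = "exponent_sum - 8 * delta"]) auto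
    finally show ?thesis .
  qed
  then show ?thesis using C1 by blast
qed

text \<open>At most N^(2 delta) fractions with O(width * Q * N^delta) points each make Q N^(4 delta
  - 1), against the pointwise saving N^(-8 delta).\<close>

lemma major_sum_bound:
  "\<exists>l>0. \<exists>C. \<forall>N\<ge>1. major_sum N (width N) (cutoff N) \<le> C * real (modulus N) * real N powr (exponent_sum - 1 - l)"
proof -
  obtain C where C: "C \<ge> 1" "\<And>N q a r. N \<ge> 1 \<Longrightarrow> q \<ge> 1 \<Longrightarrow> real q \<le> real N powr delta \<Longrightarrow> near N (width N) q a r \<Longrightarrow>
    norm (full_prod N r - model_prod N q a r) \<le> C * real N powr (exponent_sum - 8 * delta)"
    using norm_full_model_le by blast
  obtain B where B: "B \<ge> 1" "\<And>N q a. N \<ge> 1 \<Longrightarrow> (\<Sum>r<modulus N. mn (scale N) (offset N q a r)) \<le> B * real (modulus N) * real N powr delta"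
    using mn_total[OF delta_bounds(1)] by blast
  have "major_sum N (width N) (cutoff N) \<le> C * B * real (modulus N) * real N powr (exponent_sum - 1 - 4 * delta)" if N: "N \<ge> 1" for N
  proof -
    define T where "T = width N * (B * real (modulus N) * real N powr delta) * (C * real N powr (exponent_sum - 8 * delta))"
    have T0: "T \<ge> 0" unfolding T_def using width_pos[OF N] B(1) C(1) by simp
    have in1: "(\<Sum>r | r < modulus N \<and> near N (width N) q a r. norm (full_prod N r - model_prod N q a r)) \<le> T"
      if qa: "(q, a) \<in> farey (cutoff N)" for q a
    proof -
      have q: "q \<ge> 1" "q \<le> cutoff N" using qa by (auto simp: farey_def)
      then have qd: "real q \<le> real N powr delta" using cutoff_bounds(2)[OF N] by linarith
      have "(\<Sum>r | r < modulus N \<and> near N (width N) q a r. norm (full_prod N r - model_prod N q a r))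
        \<le> (\<Sum>r | r < modulus N \<and> near N (width N) q a r. width N * mn (scale N) (offset N q a r) * (C * real N powr (exponent_sum - 8 * delta)))"
      proof (rule sum_mono)
        fix r assume "r \<in> {r. r < modulus N \<and> near N (width N) q a r}"
        then have nr: "near N (width N) q a r" by simp
        have "width N * (1 / width N) \<le> width N * mn (scale N) (offset N q a r)"
          using mn_near[OF N nr] width_pos[OF N] by (intro mult_left_mono) auto
        then have "1 \<le> width N * mn (scale N) (offset N q a r)" using width_pos[OF N] by simp
        then have "1 * (C * real N powr (exponent_sum - 8 * delta)) \<le> width N * mn (scale N) (offset N q a r) * (C * real N powr (exponent_sum - 8 * delta))"
          using C(1) by (intro mult_right_mono) auto
        then show "norm (full_prod N r - model_prod N q a r) \<le> width N * mn (scale N) (offset N q a r) * (C * real N powr (exponent_sum - 8 * delta))"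
          using C(2)[OF N q(1) qd nr] by simp
      qed
      also have "\<dots> \<le> (\<Sum>r<modulus N. width N * mn (scale N) (offset N q a r) * (C * real N powr (exponent_sum - 8 * delta)))"
        using width_pos[OF N] C(1) mn_nonneg by (intro sum_mono2) (auto intro!: mult_nonneg_nonneg)
      also have "\<dots> = width N * (\<Sum>r<modulus N. mn (scale N) (offset N q a r)) * (C * real N powr (exponent_sum - 8 * delta))"
        by (simp only: sum_distrib_left sum_distrib_right)
      also have "\<dots> \<le> T" unfolding T_def using B(2)[OF N] width_pos[OF N] C(1)
        by (intro mult_right_mono mult_left_mono) auto
      finally show ?thesis .
    qed
    have "major_sum N (width N) (cutoff N) \<le> (\<Sum>(q, a)\<in>farey (cutoff N). T)"
      unfolding major_sum_def using in1 by (intro sum_mono) auto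
    also have "\<dots> = real (card (farey (cutoff N))) * T" by (simp add: case_prod_unfold)
    also have "\<dots> \<le> real N powr (2 * delta) * T" using card_farey_cutoff[OF N] T0 by (rule mult_right_mono)
    also have "\<dots> = C * B * real (modulus N) * (real N powr (2 * delta) * real N powr (delta - 1) * real N powr delta * real N powr (exponent_sum - 8 * delta))"
      unfolding T_def width_def by simp
    also have "\<dots> = C * B * real (modulus N) * real N powr (exponent_sum - 1 - 4 * delta)"
      unfolding powr_add[symmetric] by (simp add: algebra_simps)
    finally show ?thesis .
  qed
  then show ?thesis using delta_bounds(1) by (intro exI[of _ "4 * delta"] conjI exI[of _ "C * B"]) auto
qed

text \<open>At distance d the model is O(d^(-\<sigma>)) with \<sigma> = exponent_sum. One factor 1 /
  d is summed by \<open>mn_total\<close>, the rest is at most the width to the power 1 - \<sigma>,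
  which saves delta (\<sigma> - 1). The number of fractions costs 2 delta, so delta (\<sigma> - 3) >
  0 remains, and \<open>e\<close> is half of it.\<close>

lemma far_sum_bound:
  "\<exists>l>0. \<exists>C. \<forall>N\<ge>1. far_sum N (width N) (cutoff N) \<le> C * real (modulus N) * real N powr (exponent_sum - 1 - l)"
proof -
  have "\<exists>C\<ge>1. \<forall>i\<le>n. \<forall>N \<beta>. dist_int \<beta> > 0 \<longrightarrow> norm (vsum (m i) N \<beta>) \<le> C * dist_int \<beta> powr (- (1 / real (m i)))" (is "\<exists>C\<ge>1. \<forall>i\<le>n. ?R i C")
  proof (rule uniform_constant)
    show "\<exists>C\<ge>1. ?R i C" if "i \<le> n" for i by (rule norm_vsum_le_inverse[OF m_pos[OF that]])
    show "?R i D" if "?R i C" "C \<le> D" for i C D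
    proof (intro allI impI)
      fix N \<beta> assume h: "dist_int \<beta> > 0"
      show "norm (vsum (m i) N \<beta>) \<le> D * dist_int \<beta> powr (- (1 / real (m i)))"
        by (rule order_trans[OF that(1)[rule_format, OF h] mult_right_mono[OF that(2)]]) simp
    qed
  qed
  then obtain V where V: "V \<ge> 1" "\<And>i N \<beta>. i \<le> n \<Longrightarrow> dist_int \<beta> > 0 \<Longrightarrow> norm (vsum (m i) N \<beta>) \<le> V * dist_int \<beta> powr (- (1 / real (m i)))" by blast
  define e where "e = delta * (exponent_sum - 3) / 2"
  have e: "e > 0" unfolding e_def using delta_bounds(1) exponent_sum_gt by simp
  obtain B where B: "B \<ge> 1" "\<And>N q a. N \<ge> 1 \<Longrightarrow> (\<Sum>r<modulus N. mn (scale N) (offset N q a r)) \<le> B * real (modulus N) * real N powr e"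
    using mn_total[OF e] by blast
  have "far_sum N (width N) (cutoff N) \<le> V ^ (n + 1) * B * real (modulus N) * real N powr (exponent_sum - 1 - e)" if N: "N \<ge> 1" for N
  proof -
    define D where "D = V ^ (n + 1) * width N powr (- (exponent_sum - 1))"
    have D0: "D \<ge> 0" unfolding D_def using V(1) by simp
    define T where "T = D * (B * real (modulus N) * real N powr e)"
    have T0: "T \<ge> 0" unfolding T_def using D0 B(1) by simp
    have in1: "(\<Sum>r | r < modulus N \<and> \<not> near N (width N) q a r. norm (model_prod N q a r)) \<le> T"
      if qa: "(q, a) \<in> farey (cutoff N)" for q a
    proof -
      have q: "q \<ge> 1" using qa by (auto simp: farey_def)
      have "(\<Sum>r | r < modulus N \<and> \<not> near N (width N) q a r. norm (model_prod N q a r))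
        \<le> (\<Sum>r | r < modulus N \<and> \<not> near N (width N) q a r. D * mn (scale N) (offset N q a r))"
      proof (rule sum_mono)
        fix r assume "r \<in> {r. r < modulus N \<and> \<not> near N (width N) q a r}"
        then have nr: "\<not> near N (width N) q a r" by simp
        define d where "d = dist_int (offset N q a r)"
        have wd: "width N < d" using nr by (simp add: near_def d_def)
        then have d: "d > 0" using width_pos[OF N] by linarith
        have "norm (model_prod N q a r) \<le> 1 * norm (\<Prod>i\<le>n. vsum (m i) N (offset N q a r))"
          unfolding model_prod_def norm_mult by (intro mult_right_mono norm_complete_prod_le q) auto
        also have "\<dots> = (\<Prod>i\<le>n. norm (vsum (m i) N (offset N q a r)))" by (simp add: prod_norm)
        also have "\<dots> \<le> (\<Prod>i\<le>n. V * d powr (- (1 / real (m i))))"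
          using V(2) d unfolding d_def by (intro prod_mono conjI norm_ge_zero) auto
        also have "\<dots> = V ^ (n + 1) * d powr (- exponent_sum)"
        proof -
          have "(\<Prod>i\<le>n. d powr (- (1 / real (m i)))) = d powr (\<Sum>i\<le>n. - (1 / real (m i)))" using d by (simp add: powr_sum)
          also have "(\<Sum>i\<le>n. - (1 / real (m i))) = - exponent_sum" unfolding exponent_sum_def by (rule sum_negf)
          finally show ?thesis by (simp add: prod.distrib)
        qed
        also have "d powr (- exponent_sum) = d powr (- (exponent_sum - 1)) * d powr (- 1)" by (rule powr_mult_eq[symmetric]) simp
        also have "V ^ (n + 1) * (d powr (- (exponent_sum - 1)) * d powr (- 1)) \<le> V ^ (n + 1) * (width N powr (- (exponent_sum - 1)) * d powr (- 1))"
          using V(1) wd width_pos[OF N] exponent_sum_gt by (intro mult_left_mono mult_right_mono powr_mono2') auto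
        also have "\<dots> = D * mn (scale N) (offset N q a r)"
          unfolding mn_far[OF N nr] D_def d_def[symmetric] using d by (simp add: powr_minus_divide)
        finally show "norm (model_prod N q a r) \<le> D * mn (scale N) (offset N q a r)" .
      qed
      also have "\<dots> \<le> (\<Sum>r<modulus N. D * mn (scale N) (offset N q a r))"
        using D0 mn_nonneg by (intro sum_mono2) auto
      also have "\<dots> = D * (\<Sum>r<modulus N. mn (scale N) (offset N q a r))" by (simp only: sum_distrib_left)
      also have "\<dots> \<le> T" unfolding T_def using B(2)[OF N] D0 by (intro mult_left_mono) auto
      finally show ?thesis .
    qed
    have "far_sum N (width N) (cutoff N) \<le> (\<Sum>(q, a)\<in>farey (cutoff N). T)"
      unfolding far_sum_def using in1 by (intro sum_mono) auto
    also have "\<dots> = real (card (farey (cutoff N))) * T" by (simp add: case_prod_unfold)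
    also have "\<dots> \<le> real N powr (2 * delta) * T" using card_farey_cutoff[OF N] T0 by (rule mult_right_mono)
    also have "\<dots> = V ^ (n + 1) * B * real (modulus N) * (real N powr (2 * delta) * real N powr ((delta - 1) * - (exponent_sum - 1)) * real N powr e)"
      unfolding T_def D_def width_def powr_powr by simp
    also have "\<dots> = V ^ (n + 1) * B * real (modulus N) * real N powr (exponent_sum - 1 - e)"
    proof -
      have "2 * delta + (delta - 1) * - (exponent_sum - 1) + e = exponent_sum - 1 - e" unfolding e_def by (simp add: field_simps)
      then show ?thesis unfolding powr_add[symmetric] by (simp only:)
    qed
    finally show ?thesis .
  qed
  then show ?thesis using e by blast
qed

end

section \<open>The minor arcs\<close>

lemma powr_eventually_ge:
  fixes e B :: real
  assumes "e > 0"
  shows "\<exists>N0\<ge>1. \<forall>N\<ge>N0. real N powr e \<ge> B"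
proof -
  have "filterlim (\<lambda>N. real N powr e) at_top sequentially" using assms by real_asymp
  then have "eventually (\<lambda>N. real N powr e \<ge> B) sequentially" by (simp add: filterlim_at_top)
  then obtain N0 where N0: "\<And>N. N \<ge> N0 \<Longrightarrow> real N powr e \<ge> B" unfolding eventually_sequentially by blast
  show ?thesis by (rule exI[of _ "max 1 N0"]) (auto intro: N0)
qed

context mixed_powers
begin

text \<open>Dirichlet's theorem with denominators up to \<open>scale N\<close> approximates within 1
  / (q * scale N), hence within the arc width. A denominator up to \<open>cutoff N\<close> would
  therefore put r near a fraction.\<close>

lemma minor_arc_approx:
  assumes N: "N \<ge> 1" and minor: "\<forall>(q, a)\<in>farey (cutoff N). \<not> near N (width N) q a r"
  shows "\<exists>q\<ge>1. \<exists>h. coprime h (int q) \<and> \<bar>real r / real (modulus N) - of_int h / real q\<bar> \<le> 1 / (real q)\<^sup>2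
    \<and> real N powr delta \<le> real q \<and> real q \<le> 2 * real N powr (1 - delta)"
proof -
  define \<theta> where "\<theta> = real r / real (modulus N)"
  have X: "scale N > 0" using scale_bounds(3)[OF N] by simp
  obtain h k where hk: "coprime h k" "0 < k" "k \<le> int (scale N)" "\<bar>of_int k * \<theta> - of_int h\<bar> < 1 / scale N"
    using Dirichlet_approx_coprime[OF X] by metis
  define q where "q = nat k"
  have kq: "k = int q" and q1: "q \<ge> 1" using hk(2) by (auto simp: q_def)
  have qX: "real q \<le> real (scale N)" using hk(3) unfolding kq by simp
  have rq: "real q \<ge> 1" using q1 by simp
  have lt: "\<bar>\<theta> - of_int h / real q\<bar> * real q < 1 / real (scale N)"
  proof -
    have "of_int k * \<theta> - of_int h = (\<theta> - of_int h / real q) * real q" unfolding kq using rq by (simp add: field_simps)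
    then show ?thesis using hk(4) rq by (simp add: abs_mult)
  qed
  have le2: "\<bar>\<theta> - of_int h / real q\<bar> \<le> 1 / (real q)\<^sup>2"
  proof -
    have "1 / real (scale N) \<le> 1 / real q" using qX rq by (intro divide_left_mono) auto
    then have "\<bar>\<theta> - of_int h / real q\<bar> * real q \<le> 1 / real q" using lt by linarith
    then show ?thesis using rq by (simp add: le_divide_eq power2_eq_square mult.assoc)
  qed
  have "\<not> q \<le> cutoff N"
  proof
    assume qW: "q \<le> cutoff N"
    define a where "a = nat (h mod int q)"
    have a: "int a = h mod int q" "a < q" using q1 by (auto simp: a_def nat_less_iff)
    have "coprime (int a) (int q)" using hk(1) q1 unfolding a(1) kq by (simp add: coprime_mod_left_iff)
    then have "(q, a) \<in> farey (cutoff N)" using a(2) q1 qW by (simp add: farey_def coprime_iff_gcd_eq_1)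
    then have "\<not> near N (width N) q a r" using minor by auto
    moreover have "dist_int (offset N q a r) \<le> width N"
    proof -
      have "h = (h div int q) * int q + int a" unfolding a(1) by simp
      then have "real_of_int h = of_int (h div int q) * real q + real a" by (metis of_int_add of_int_mult of_int_of_nat_eq)
      then have "offset N q a r - of_int (h div int q) = \<theta> - of_int h / real q"
        unfolding offset_def \<theta>_def using rq by (simp add: add_divide_distrib)
      then have "dist_int (offset N q a r) \<le> \<bar>\<theta> - of_int h / real q\<bar>" using dist_int_le[of "offset N q a r" "h div int q"] by simp
      also have "\<dots> * 1 \<le> \<bar>\<theta> - of_int h / real q\<bar> * real q" using rq by (intro mult_left_mono) auto
      finally have "dist_int (offset N q a r) \<le> 1 / real (scale N)" using lt by simp
      also have "\<dots> \<le> width N"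
        using scale_bounds(1)[OF N] width_pos[OF N] X by (simp add: field_simps)
      finally show ?thesis .
    qed
    ultimately show False by (simp add: near_def)
  qed
  then have "real (cutoff N) + 1 \<le> real q" by linarith
  then have "real N powr delta \<le> real q" using cutoff_bounds(3)[OF N] by linarith
  moreover have "real q \<le> 2 * real N powr (1 - delta)" using qX scale_bounds(2)[OF N] by linarith
  ultimately show ?thesis using le2 q1 hk(1) unfolding kq \<theta>_def by blast
qed

text \<open>Weyl's inequality needs the range of q in terms of the length x, about N^(1 / m j). The
  lower end follows from x <= N. At the upper end delta / m j <= delta / 2 leaves N^(delta / 2) to
  absorb the constants, which is why N has to be large.\<close>

lemma minor_arc_Weyl:
  "\<exists>l>0. \<exists>C\<ge>1. \<exists>N0\<ge>1. \<forall>N\<ge>N0. \<forall>r. (\<forall>(q, a)\<in>farey (cutoff N). \<not> near N (width N) q a r) \<longrightarrow>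
    norm (psumexp (m j) N (real r / real (modulus N))) \<le> C * real N powr (1 / real (m j) - l)"
proof -
  define M where "M = m j"
  have M: "M \<ge> 2" using exponents[OF j] by (simp add: M_def)
  obtain l0 C where l0: "l0 > 0" and C: "C \<ge> 1" and W: "\<And>X q a \<alpha>. X \<ge> 1 \<Longrightarrow> q \<ge> 1 \<Longrightarrow> coprime a (int q) \<Longrightarrow> \<bar>\<alpha> - of_int a / real q\<bar> \<le> 1 / (real q)\<^sup>2 \<Longrightarrow>
     real X powr delta \<le> real q \<Longrightarrow> real q \<le> real X powr (real M - delta) \<Longrightarrow>
     norm (\<Sum>n=1..X. unit_exp (\<alpha> * real n ^ M)) \<le> C * real X powr (1 - l0)"
    using Weyl_inequality[OF M delta_bounds(1)] delta_bounds(2) by auto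
  \<comment> \<open>Capping at 1 keeps the exponent 1 - l1 nonnegative, so that x may be replaced by
    its upper bound.\<close>
  define l1 where "l1 = min l0 1"
  have l1: "l1 > 0" "l1 \<le> l0" "l1 \<le> 1" using l0 by (auto simp: l1_def)
  obtain N0 where N0: "N0 \<ge> 1" "\<And>N. N \<ge> N0 \<Longrightarrow> real N powr (delta / 2) \<ge> 2 * 2 powr real M"
    using powr_eventually_ge[of "delta / 2" "2 * 2 powr real M"] delta_bounds(1) by auto
  have "norm (psumexp M N (real r / real (modulus N))) \<le> C * real N powr (1 / real M - l1 / real M)"
    if NN: "N \<ge> N0" and minor: "\<forall>(q, a)\<in>farey (cutoff N). \<not> near N (width N) q a r" for N r
  proof -
    have N: "N \<ge> 1" using NN N0(1) by linarith
    have rN: "real N \<ge> 1" using N by simp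
    obtain q h where q: "q \<ge> 1" "coprime h (int q)" "\<bar>real r / real (modulus N) - of_int h / real q\<bar> \<le> 1 / (real q)\<^sup>2"
      "real N powr delta \<le> real q" "real q \<le> 2 * real N powr (1 - delta)"
      using minor_arc_approx[OF N minor] by blast
    define x where "x = rt M N"
    have x1: "x \<ge> 1" using rt_pos[OF N, of M] M by (simp add: x_def)
    have rx: "real x \<ge> 1" using x1 by simp
    have xle: "real x \<le> real N powr (1 / real M)" unfolding x_def by (rule rt_le)
    have xge: "real N powr (1 / real M) / 2 \<le> real x" using rt_gt[of N M] rx unfolding x_def by linarith
    have d: "0 < delta" "delta \<le> 1" using delta_bounds(1,2) by auto
    have lo: "real x powr delta \<le> real q"
    proof -
      have "real N powr (1 / real M) \<le> real N powr 1" using rN M by (intro powr_mono) auto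
      then have "real x \<le> real N" using xle rN by simp
      then have "real x powr delta \<le> real N powr delta" using d rx by (intro powr_mono2) auto
      then show ?thesis using q(4) by linarith
    qed
    have hi: "real q \<le> real x powr (real M - delta)"
    proof -
      have "real N powr (1 - delta) * (2 * 2 powr real M) \<le> real N powr (1 - delta) * real N powr (delta / 2)"
        using N0(2)[OF NN] by (intro mult_left_mono) auto
      also have "\<dots> = real N powr (1 - delta / 2)" by (rule powr_mult_eq) simp
      also have "\<dots> \<le> real N powr ((1 / real M) * (real M - delta))"
      proof -
        have "delta / real M \<le> delta / 2" using d M by (intro divide_left_mono) auto
        moreover have "(1 / real M) * (real M - delta) = 1 - delta / real M" using M by (simp add: diff_divide_distrib)
        ultimately show ?thesis using rN by (intro powr_mono) linarith+
      qed
      also have "\<dots> = (real N powr (1 / real M)) powr (real M - delta)" by (rule powr_powr[symmetric])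
      also have "\<dots> \<le> (2 * real x) powr (real M - delta)"
        using xge M d by (intro powr_mono2) auto
      also have "\<dots> = 2 powr (real M - delta) * real x powr (real M - delta)" by (rule powr_mult)
      also have "\<dots> \<le> 2 powr real M * real x powr (real M - delta)" using d by (intro mult_right_mono powr_mono) auto
      finally have "2 powr real M * (2 * real N powr (1 - delta)) \<le> 2 powr real M * real x powr (real M - delta)" by (simp add: mult_ac)
      then have "2 * real N powr (1 - delta) \<le> real x powr (real M - delta)" by simp
      then show ?thesis using q(5) by linarith
    qed
    have "norm (psumexp M N (real r / real (modulus N))) \<le> C * real x powr (1 - l0)"
      unfolding psumexp_def x_def[symmetric] by (rule W[OF x1 q(1-3) lo hi])
    also have "\<dots> \<le> C * real x powr (1 - l1)" using C l1 rx by (intro mult_left_mono powr_mono) auto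
    also have "\<dots> \<le> C * (real N powr (1 / real M)) powr (1 - l1)" using C l1 rx xle by (intro mult_left_mono powr_mono2) auto
    also have "\<dots> = C * real N powr (1 / real M - l1 / real M)" unfolding powr_powr by (simp add: diff_divide_distrib)
    finally show ?thesis .
  qed
  moreover have "l1 / real M > 0" using l1 M by simp
  ultimately show ?thesis using C N0(1) unfolding M_def by blast
qed

text \<open>Divided by their trivial bounds, the factors other than \<open>j\<close> have average
  product O(N^(l / 2 - 1)) by Hoelder's inequality. The loss N^(l / 2) of the mean values is chosen
  as half of Weyl's saving in the factor \<open>j\<close>.\<close>

lemma minor_sum_bound:
  "\<exists>l>0. \<exists>C. \<exists>N0\<ge>1. \<forall>N\<ge>N0. minor_sum N (width N) (cutoff N) \<le> C * real (modulus N) * real N powr (exponent_sum - 1 - l)"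
proof -
  obtain l C N0 where l: "l > 0" and C: "C \<ge> 1" and N0: "N0 \<ge> 1" and Wy: "\<And>N r. N \<ge> N0 \<Longrightarrow> (\<forall>(q, a)\<in>farey (cutoff N). \<not> near N (width N) q a r) \<Longrightarrow>
    norm (psumexp (m j) N (real r / real (modulus N))) \<le> C * real N powr (1 / real (m j) - l)"
    using minor_arc_Weyl by blast
  have "\<exists>C\<ge>1. \<forall>i\<le>n. \<forall>N\<ge>1. \<forall>Q. Q > tri (m i) * N \<longrightarrow>
    (\<Sum>r<Q. norm (psumexp (m i) N (real r / real Q)) ^ (m i * (m i + 1))) \<le> C * (real Q * real N powr (real (m i) + l / 2))" (is "\<exists>C\<ge>1. \<forall>i\<le>n. ?R i C")
  proof (rule uniform_constant)
    show "\<exists>C\<ge>1. ?R i C" if "i \<le> n" for i using psumexp_mean_value[OF m_pos[OF that], of "l / 2"] l by (simp only: mult.assoc half_gt_zero)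
    show "?R i D" if "?R i C" "C \<le> D" for i C D
    proof (intro allI impI)
      fix N Q assume h: "N \<ge> (1::nat)" "tri (m i) * N < Q"
      show "(\<Sum>r<Q. norm (psumexp (m i) N (real r / real Q)) ^ (m i * (m i + 1))) \<le> D * (real Q * real N powr (real (m i) + l / 2))"
        by (rule order_trans[OF that(1)[rule_format, OF h] mult_right_mono[OF that(2)]]) simp
    qed
  qed
  then obtain B where B: "B \<ge> 1" "\<And>i N Q. i \<le> n \<Longrightarrow> N \<ge> 1 \<Longrightarrow> Q > tri (m i) * N \<Longrightarrow>
    (\<Sum>r<Q. norm (psumexp (m i) N (real r / real Q)) ^ (m i * (m i + 1))) \<le> B * (real Q * real N powr (real (m i) + l / 2))" by blast
  have "minor_sum N (width N) (cutoff N) \<le> C * B * real (modulus N) * real N powr (exponent_sum - 1 - l / 2)" if NN: "N \<ge> N0" for N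
  proof -
    have N: "N \<ge> 1" using NN N0 by linarith
    define Q where "Q = modulus N"
    have Q: "Q > 0" using modulus_bounds(1)[OF N] by (simp add: Q_def)
    define y where "y i r = norm (psumexp (m i) N (real r / real Q)) / real N powr (1 / real (m i))" for i r
    have Np: "real N powr (1 / real (m i)) > 0" for i using N by simp
    define P where "P = (\<Prod>i\<in>{..n} - {j}. real N powr (1 / real (m i)))"
    have P0: "P \<ge> 0" unfolding P_def by (intro prod_nonneg) auto
    define L where "L = C * real N powr (1 / real (m j) - l)"
    have L0: "L \<ge> 0" unfolding L_def using C by simp
    have yH: "(\<Sum>r<Q. \<Prod>i\<in>{..n} - {j}. y i r) \<le> B * real Q * real N powr (l / 2 - 1)"
    proof (rule Hoelder_off_j)
      show "0 \<le> y i r \<and> y i r \<le> 1" for i r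
        using Np[of i] norm_psumexp_le[of "m i" N "real r / real Q"] by (simp add: y_def divide_le_eq)
      show "0 < B * real Q * real N powr (l / 2 - 1)" using B(1) Q N by simp
      show "(\<Sum>r<Q. y i r ^ (m i * (m i + 1))) \<le> B * real Q * real N powr (l / 2 - 1)" if i: "i \<le> n" for i
      proof -
        have D: "(real N powr (1 / real (m i))) ^ (m i * (m i + 1)) = real N powr (real (m i) + 1)"
        proof -
          have "real (m i * (m i + 1)) * (1 / real (m i)) = real (m i) + 1" using m_pos[OF i] by (simp add: field_simps)
          moreover have "(real N powr (1 / real (m i))) ^ (m i * (m i + 1)) = (real N powr (1 / real (m i))) powr real (m i * (m i + 1))"
            by (rule powr_realpow[OF Np, symmetric])
          ultimately show ?thesis unfolding powr_powr by (simp only: mult.commute)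
        qed
        have "(\<Sum>r<Q. y i r ^ (m i * (m i + 1))) = (\<Sum>r<Q. norm (psumexp (m i) N (real r / real Q)) ^ (m i * (m i + 1))) / real N powr (real (m i) + 1)"
          unfolding y_def power_divide D by (rule sum_divide_distrib[symmetric])
        also have "\<dots> \<le> B * (real Q * real N powr (real (m i) + l / 2)) / real N powr (real (m i) + 1)"
          using B(2)[OF i N, of Q] modulus_bounds(4)[OF N i] unfolding Q_def by (intro divide_right_mono) auto
        also have "\<dots> = B * real Q * (real N powr (real (m i) + l / 2) / real N powr (real (m i) + 1))" by simp
        also have "real N powr (real (m i) + l / 2) / real N powr (real (m i) + 1) = real N powr (l / 2 - 1)"
          unfolding powr_diff[symmetric] by simp
        finally show ?thesis .
      qed
    qed simp
    have pt: "norm (full_prod N r) \<le> L * (P * (\<Prod>i\<in>{..n} - {j}. y i r))"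
      if "\<forall>(q, a)\<in>farey (cutoff N). \<not> near N (width N) q a r" for r
    proof -
      have "norm (full_prod N r) = norm (psumexp (m j) N (real r / real Q)) * (\<Prod>i\<in>{..n} - {j}. norm (psumexp (m i) N (real r / real Q)))"
        unfolding full_prod_def prod_norm[symmetric] Q_def using j by (subst prod.remove[of _ j]) auto
      also have "(\<Prod>i\<in>{..n} - {j}. norm (psumexp (m i) N (real r / real Q))) = P * (\<Prod>i\<in>{..n} - {j}. y i r)"
        unfolding P_def y_def prod.distrib[symmetric] using N by (intro prod.cong) auto
      also have "norm (psumexp (m j) N (real r / real Q)) * (P * (\<Prod>i\<in>{..n} - {j}. y i r)) \<le> L * (P * (\<Prod>i\<in>{..n} - {j}. y i r))"
        unfolding L_def Q_def using Wy[OF NN that] P0 by (intro mult_right_mono mult_nonneg_nonneg prod_nonneg) (auto simp: y_def)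
      finally show ?thesis .
    qed
    have "minor_sum N (width N) (cutoff N) \<le> (\<Sum>r | r < Q \<and> (\<forall>(q, a)\<in>farey (cutoff N). \<not> near N (width N) q a r). L * (P * (\<Prod>i\<in>{..n} - {j}. y i r)))"
      unfolding minor_sum_def Q_def[symmetric] by (intro sum_mono pt) simp
    also have "\<dots> \<le> (\<Sum>r<Q. L * (P * (\<Prod>i\<in>{..n} - {j}. y i r)))"
      using L0 P0 by (intro sum_mono2) (auto intro!: mult_nonneg_nonneg prod_nonneg simp: y_def)
    also have "\<dots> = L * (P * (\<Sum>r<Q. \<Prod>i\<in>{..n} - {j}. y i r))" by (simp only: sum_distrib_left)
    also have "\<dots> \<le> L * (P * (B * real Q * real N powr (l / 2 - 1)))" using yH L0 P0 by (intro mult_left_mono)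
    also have "\<dots> = C * B * real Q * (real N powr (1 / real (m j) - l) * P * real N powr (l / 2 - 1))" unfolding L_def by simp
    also have "P = real N powr (\<Sum>i\<in>{..n} - {j}. 1 / real (m i))" unfolding P_def using N by (simp add: powr_sum)
    also have "real N powr (1 / real (m j) - l) * real N powr (\<Sum>i\<in>{..n} - {j}. 1 / real (m i)) * real N powr (l / 2 - 1)
       = real N powr (exponent_sum - 1 - l / 2)"
    proof -
      have "1 / real (m j) - l + (\<Sum>i\<in>{..n} - {j}. 1 / real (m i)) + (l / 2 - 1) = exponent_sum - 1 - l / 2"
        unfolding exponent_sum_split by (simp add: field_simps)
      then show ?thesis unfolding powr_add[symmetric] by (simp only:)
    qed
    finally show ?thesis unfolding Q_def .
  qed
  then show ?thesis using l N0 half_gt_zero[OF l] by blast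
qed

text \<open>Three errors are added: that of the dissection; the replacement of \<open>wcoef\<close>
  by its asymptotic value, which saves one power of N and so limits \<eta> to 1; and the completion
  of the singular series beyond \<open>cutoff N\<close>, which saves N^(delta * l4).\<close>

lemma rep_count_asymptotic:
  "\<exists>\<eta>>0. \<eta> \<le> 1 \<and> (\<exists>C\<ge>0. \<exists>N0\<ge>1. \<forall>N\<ge>N0. norm (of_nat (rep_count n m N) - of_real (gamma_prod / Gamma exponent_sum) * singular_series n m N * of_real (real N powr (exponent_sum - 1)))
    \<le> C * real N powr (exponent_sum - 1 - \<eta>))"
proof -
  obtain l1 C1 where l1: "l1 > 0" and C1: "\<And>N. N \<ge> 1 \<Longrightarrow> major_sum N (width N) (cutoff N) \<le> C1 * real (modulus N) * real N powr (exponent_sum - 1 - l1)"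
    using major_sum_bound by blast
  obtain l2 C2 where l2: "l2 > 0" and C2: "\<And>N. N \<ge> 1 \<Longrightarrow> far_sum N (width N) (cutoff N) \<le> C2 * real (modulus N) * real N powr (exponent_sum - 1 - l2)"
    using far_sum_bound by blast
  obtain l3 C3 N3 where l3: "l3 > 0" and C3: "\<And>N. N \<ge> N3 \<Longrightarrow> minor_sum N (width N) (cutoff N) \<le> C3 * real (modulus N) * real N powr (exponent_sum - 1 - l3)"
    using minor_sum_bound by blast
  obtain l4 C4 where l4: "l4 > 0" and C4: "C4 \<ge> 1" "\<And>N V. V \<ge> 1 \<Longrightarrow> norm (singular_series n m N - (\<Sum>q=1..V. singular_term n m N q)) \<le> C4 * real V powr (- l4)"
    "\<And>N V. V \<ge> 1 \<Longrightarrow> norm (\<Sum>q=1..V. singular_term n m N q) \<le> C4"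
    using singular_series_truncation by blast
  obtain C5 where C5: "C5 \<ge> 0" "\<And>t. t \<ge> 1 \<Longrightarrow> \<bar>wcoef exponent_sum t - real t powr (exponent_sum - 1) / Gamma exponent_sum\<bar> \<le> C5 * real t powr (exponent_sum - 2)"
    using wcoef_asymptotic[of exponent_sum] exponent_sum_gt by auto
  define \<eta> where "\<eta> = min (min l1 l2) (min l3 (min 1 (delta * l4)))"
  have dl: "delta * l4 > 0" using delta_bounds(1) l4 by simp
  have \<eta>: "\<eta> > 0" "\<eta> \<le> 1" "\<eta> \<le> l1" "\<eta> \<le> l2" "\<eta> \<le> l3" "\<eta> \<le> delta * l4" using l1 l2 l3 dl by (auto simp: \<eta>_def)
  define G where "G = gamma_prod / Gamma exponent_sum"
  define C where "C = \<bar>C1\<bar> + \<bar>C2\<bar> + \<bar>C3\<bar> + C4 * (\<bar>gamma_prod\<bar> * C5) + C4 * 2 powr l4 * \<bar>G\<bar>"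
  have "norm (of_nat (rep_count n m N) - of_real G * singular_series n m N * of_real (real N powr (exponent_sum - 1))) \<le> C * real N powr (exponent_sum - 1 - \<eta>)"
    if N: "N \<ge> max 5 N3" for N
  proof -
    have N1: "N \<ge> 1" "N \<ge> 5" "N \<ge> N3" and rN: "real N \<ge> 1" using N by auto
    define S where "S = (\<Sum>q=1..cutoff N. singular_term n m N q)"
    define w where "w = wcoef exponent_sum N"
    define E where "E = real N powr (exponent_sum - 1 - \<eta>)"
    define Q where "Q = real (modulus N)"
    have Q: "Q > 0" using modulus_bounds(1)[OF N1(1)] by (simp add: Q_def)
    have pE: "real N powr (exponent_sum - 1 - l) \<le> E" if "\<eta> \<le> l" for l unfolding E_def using rN that by (intro powr_mono) auto
    have step: "x \<le> \<bar>K\<bar> * Q * E" if "x \<le> K * Q * real N powr (exponent_sum - 1 - l)" "\<eta> \<le> l" for x K l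
    proof -
      have "K * Q * real N powr (exponent_sum - 1 - l) \<le> \<bar>K\<bar> * Q * real N powr (exponent_sum - 1 - l)"
        using Q by (intro mult_right_mono) auto
      also have "\<dots> \<le> \<bar>K\<bar> * Q * E" using Q pE[OF that(2)] by (intro mult_left_mono) auto
      finally show ?thesis using that(1) by linarith
    qed
    have "Q * norm (of_nat (rep_count n m N) - S * of_real (gamma_prod * w)) \<le> minor_sum N (width N) (cutoff N) + major_sum N (width N) (cutoff N) + far_sum N (width N) (cutoff N)"
      unfolding Q_def S_def w_def by (rule dissection[OF width_cutoff[OF N1(2)] N1(1)])
    also have "\<dots> \<le> \<bar>C3\<bar> * Q * E + \<bar>C1\<bar> * Q * E + \<bar>C2\<bar> * Q * E"
      by (intro add_mono step[OF C3[OF N1(3), folded Q_def] \<eta>(5)] step[OF C1[OF N1(1), folded Q_def] \<eta>(3)] step[OF C2[OF N1(1), folded Q_def] \<eta>(4)])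
    also have "\<dots> = Q * ((\<bar>C1\<bar> + \<bar>C2\<bar> + \<bar>C3\<bar>) * E)" by (simp add: algebra_simps)
    finally have a: "norm (of_nat (rep_count n m N) - S * of_real (gamma_prod * w)) \<le> (\<bar>C1\<bar> + \<bar>C2\<bar> + \<bar>C3\<bar>) * E" using Q by simp
    have b: "norm (S * of_real (gamma_prod * w) - S * of_real (G * real N powr (exponent_sum - 1))) \<le> C4 * (\<bar>gamma_prod\<bar> * C5) * E"
    proof -
      have "S * of_real (gamma_prod * w) - S * of_real (G * real N powr (exponent_sum - 1)) = S * of_real (gamma_prod * (w - real N powr (exponent_sum - 1) / Gamma exponent_sum))"
        unfolding right_diff_distrib[symmetric] of_real_diff[symmetric] by (simp add: G_def right_diff_distrib)
      then have "norm (S * of_real (gamma_prod * w) - S * of_real (G * real N powr (exponent_sum - 1))) = norm S * (\<bar>gamma_prod\<bar> * \<bar>w - real N powr (exponent_sum - 1) / Gamma exponent_sum\<bar>)"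
        by (simp only: norm_mult norm_of_real abs_mult)
      also have "\<dots> \<le> C4 * (\<bar>gamma_prod\<bar> * (C5 * real N powr (exponent_sum - 2)))"
        unfolding S_def w_def using C4(1) C4(3)[OF cutoff_bounds(1)[OF N1(1)], of N] C5(2)[OF N1(1)]
        by (intro mult_mono mult_left_mono) auto
      also have "\<dots> \<le> C4 * (\<bar>gamma_prod\<bar> * (C5 * E))"
        using C4(1) C5(1) pE[OF \<eta>(2)] by (intro mult_left_mono) auto
      finally show ?thesis by (simp only: mult.assoc)
    qed
    have c: "norm (S * of_real (G * real N powr (exponent_sum - 1)) - of_real G * singular_series n m N * of_real (real N powr (exponent_sum - 1))) \<le> C4 * 2 powr l4 * \<bar>G\<bar> * E"
    proof -
      have W: "real N powr delta / 2 \<le> real (cutoff N)" "real (cutoff N) > 0" using cutoff_bounds(1,3)[OF N1(1)] by linarith+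
      have "real (cutoff N) powr (- l4) \<le> (real N powr delta / 2) powr (- l4)" using W l4 rN by (intro powr_mono2') auto
      also have "\<dots> = 2 powr l4 * real N powr (- (delta * l4))" by (simp add: powr_divide powr_powr powr_minus field_simps)
      finally have cut: "real (cutoff N) powr (- l4) \<le> 2 powr l4 * real N powr (- (delta * l4))" .
      have "S * of_real (G * real N powr (exponent_sum - 1)) - of_real G * singular_series n m N * of_real (real N powr (exponent_sum - 1))
         = - ((singular_series n m N - S) * of_real (G * real N powr (exponent_sum - 1)))" by (simp add: algebra_simps)
      then have "norm (S * of_real (G * real N powr (exponent_sum - 1)) - of_real G * singular_series n m N * of_real (real N powr (exponent_sum - 1)))
         = norm (singular_series n m N - S) * (\<bar>G\<bar> * real N powr (exponent_sum - 1))"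
        by (simp only: norm_minus_cancel norm_mult norm_of_real abs_mult) simp
      also have "\<dots> \<le> C4 * (2 powr l4 * real N powr (- (delta * l4))) * (\<bar>G\<bar> * real N powr (exponent_sum - 1))"
      proof (rule mult_right_mono)
        have "norm (singular_series n m N - S) \<le> C4 * real (cutoff N) powr (- l4)" unfolding S_def by (rule C4(2)[OF cutoff_bounds(1)[OF N1(1)]])
        also have "\<dots> \<le> C4 * (2 powr l4 * real N powr (- (delta * l4)))" using cut C4(1) by (intro mult_left_mono) auto
        finally show "norm (singular_series n m N - S) \<le> C4 * (2 powr l4 * real N powr (- (delta * l4)))" .
      qed simp
      also have "\<dots> = C4 * 2 powr l4 * \<bar>G\<bar> * (real N powr (- (delta * l4)) * real N powr (exponent_sum - 1))" by simp
      also have "\<dots> = C4 * 2 powr l4 * \<bar>G\<bar> * real N powr (exponent_sum - 1 - delta * l4)" by (subst powr_mult_eq[where c = "exponent_sum - 1 - delta * l4"]) auto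
      also have "\<dots> \<le> C4 * 2 powr l4 * \<bar>G\<bar> * E" using C4(1) pE[OF \<eta>(6)] by (intro mult_left_mono) auto
      finally show ?thesis .
    qed
    have tri3: "norm (x - v) \<le> A + B + D" if "norm (x - y) \<le> A" "norm (y - z) \<le> B" "norm (z - v) \<le> D" for x y z v :: complex and A B D
      using that norm_triangle_ineq[of "x - y" "y - z"] norm_triangle_ineq[of "x - z" "z - v"] by simp
    have "norm (of_nat (rep_count n m N) - of_real G * singular_series n m N * of_real (real N powr (exponent_sum - 1)))
       \<le> (\<bar>C1\<bar> + \<bar>C2\<bar> + \<bar>C3\<bar>) * E + C4 * (\<bar>gamma_prod\<bar> * C5) * E + C4 * 2 powr l4 * \<bar>G\<bar> * E"
      by (rule tri3[OF a b c])
    also have "\<dots> = C * E" unfolding C_def by (simp add: algebra_simps)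
    finally show ?thesis unfolding E_def .
  qed
  moreover have "C \<ge> 0" unfolding C_def using C4(1) C5(1) by (intro add_nonneg_nonneg mult_nonneg_nonneg) auto
  ultimately show ?thesis using \<eta>(1,2) unfolding G_def
    by (intro exI[of _ \<eta>] conjI exI[of _ C] exI[of _ "max 5 N3"]) auto
qed

end

text \<open>Convergence of the singular series is stated as well, because \<open>suminf\<close> of a
  divergent series would be an unspecified number.\<close>

theorem theorem1p4:
  fixes n :: nat and m :: "nat \<Rightarrow> nat"
  assumes "n \<ge> 1"
    and "\<And>i. i \<le> n \<Longrightarrow> m i \<ge> 2"
    and "\<exists>j\<le>n. (\<Sum>i\<in>{..n} - {j}. 1 / (real (m i) * (real (m i) + 1))) \<ge> 1"
  shows "(\<forall>N\<ge>1. summable (\<lambda>q. singular_term n m N (Suc q))) \<and>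
    (\<exists>\<eta>>0. \<exists>C. \<forall>N\<ge>1.
       norm (of_nat (rep_count n m N) -
             of_real ((\<Prod>i\<le>n. Gamma (1 + 1 / real (m i))) / Gamma (\<Sum>i\<le>n. 1 / real (m i))) *
             singular_series n m N *
             of_real (real N powr ((\<Sum>i\<le>n. 1 / real (m i)) - 1)))
       \<le> C * real N powr ((\<Sum>i\<le>n. 1 / real (m i)) - 1 - \<eta>))"
proof -
  obtain j where j: "j \<le> n" "(\<Sum>i\<in>{..n} - {j}. 1 / (real (m i) * (real (m i) + 1))) \<ge> 1" using assms(3) by blast
  interpret mixed_powers n m j using assms(2) j by unfold_locales
  define err where "err N = norm (of_nat (rep_count n m N) - of_real (gamma_prod / Gamma exponent_sum) * singular_series n m N * of_real (real N powr (exponent_sum - 1)))" for N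
  obtain \<eta> C N0 where \<eta>: "\<eta> > 0" "\<eta> \<le> 1" and C: "C \<ge> 0" and err: "\<And>N. N \<ge> N0 \<Longrightarrow> err N \<le> C * real N powr (exponent_sum - 1 - \<eta>)"
    using rep_count_asymptotic unfolding err_def by blast
  have err0: "err N \<ge> 0" for N by (simp add: err_def)
  \<comment> \<open>The errors below N0 are absorbed by their sum: exponent_sum > 3 and \<eta> <= 1
    make the exponent of N positive, so the power of N is at least 1.\<close>
  have "err N \<le> (C + (\<Sum>k<N0. err k)) * real N powr (exponent_sum - 1 - \<eta>)" if N: "N \<ge> 1" for N
  proof -
    have S0: "(\<Sum>k<N0. err k) \<ge> 0" using err0 by (intro sum_nonneg)
    show ?thesis
    proof (cases "N \<ge> N0")
      case True
      have "C * real N powr (exponent_sum - 1 - \<eta>) \<le> (C + (\<Sum>k<N0. err k)) * real N powr (exponent_sum - 1 - \<eta>)"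
        using S0 by (intro mult_right_mono) auto
      then show ?thesis using err[OF True] by linarith
    next
      case False
      then have "err N \<le> (\<Sum>k<N0. err k)" using err0 by (intro member_le_sum) auto
      then have "err N \<le> (C + (\<Sum>k<N0. err k)) * 1" using C by simp
      also have "\<dots> \<le> (C + (\<Sum>k<N0. err k)) * real N powr (exponent_sum - 1 - \<eta>)"
        using C S0 N exponent_sum_gt \<eta>(2) by (intro mult_left_mono ge_one_powr_ge_zero) auto
      finally show ?thesis .
    qed
  qed
  then have "\<exists>\<eta>>0. \<exists>C. \<forall>N\<ge>1. err N \<le> C * real N powr (exponent_sum - 1 - \<eta>)" using \<eta>(1) by blast
  moreover have "summable (\<lambda>q. singular_term n m N (Suc q))" for N by (rule summable_norm_cancel[OF summable_singular_term])
  ultimately show ?thesis unfolding err_def gamma_prod_def exponent_sum_def by blast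
qed

end
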